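(* Let $a,b,A,q$ satisfy the coefficient assumptions stated in the context, let $I=(0,T)$, $\alpha\ge0$ and $\mu\in\mathcal D$. Then, in $[0,\infty]$, $$K_{\alpha,\mathrm{init}}(I)=\sup_{\mathbf T\in\mathfrak T(\mu)}\|\mathcal T_{\alpha,\mathbf T}\|,$$ where, for a heat tuple $\mathbf T=(\theta,a,A,q)$ (here $a,A,q$ denote its constant matrices) and $Q=(0,\infty)\times\mathbb R^d$, the operator $\mathcal T_{\alpha,\mathbf T}$ is defined on $g\in C_c^\infty(Q)$ by $$(\mathcal T_{\alpha,\mathbf T}g)(s,z)=\int_s^\infty\int_{\mathbb R^d}\Bigl(\frac st\Bigr)^{\alpha/2}\sqrt{\frac{F_{\mathbf T}(s,z)}{F_{\mathbf T}(t,y)}}\,\frac{\gamma_{2(t-s)A}(z-y)}{2(t-s)}\,q^{1/2}\Bigl(\frac{A^{-1}(z-y)(z-y)^{\mathsf T}A^{-1}}{2(t-s)}-A^{-1}\Bigr)q^{1/2}g(t,y)\,dy\,dt,$$ the spatial integral being taken first. The norm is from scalar $L^2(Q)$ to matrix-valued $L^2(Q)$ with the Frobenius norm, and equals $+\infty$ if there is no bounded extension. For every heat tuple $\mathbf T$, the same operator satisfies $$\|\mathcal T_{\alpha,\mathbf T}\|=\mathfrak P_\alpha(\mathbf T).$$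
   Context: Conventions. Vector norms are Euclidean, matrix norms Frobenius, $C:D=\operatorname{tr}(C^{\mathsf T}D)$, $B(x,r)$ is the open ball, $\gamma_C$ is the centered Gaussian density on $\mathbb R^d$ with covariance $C$, $0/0=0$, positive$/0=+\infty$. Coefficient assumptions. Fix $d\ge1$, $T>0$ and functions $a,b,A,q$ on $[0,T]\times\mathbb R^d$; $a,A,q$ take values in symmetric $d\times d$ matrices, $b$ in $\mathbb R^d$; $a,b$ are Borel. There are positive constants with $\lambda_aI_d\preceq a\preceq\Lambda_aI_d$, $|b|\le B_b$, $|a(t,x)-a(t,y)|\le L_a|x-y|$; a nondecreasing continuous $\omega_a$ with $\omega_a(0)=0$ and $h_*>0$ with $\sup_x|a(t,x)-a(v,x)|\le\omega_a(|t-v|)$ and $\int_0^{h_*}h^{-1}\sqrt{\omega_a(h)}\,dh<\infty$; $\lambda_AI_d\preceq A\preceq\Lambda_AI_d$, $\lambda_qI_d\preceq q\preceq\Lambda_qI_d$; and for a nondecreasing continuous $\omega_{A,q}$ with $\omega_{A,q}(0)=0$, $|A(t,x)-A(v,y)|+|q(t,x)-q(v,y)|\le\omega_{A,q}(|t-v|^{1/2}+|x-y|)$. Class $\mathcal D$: probability measures $\mu$ on $\mathbb R^d$ with nonempty compact support $S$ and some $C_D<\infty$ with $\mu(B(y,2r))\le C_D\mu(B(y,r))$ for all $y\in S$, $r>0$. Interval constants. For constant positive definite matrices $A,q$: $P_Au=-u_s-A:D^2u$, $\mathcal H_qu=q^{1/2}D^2u\,q^{1/2}$. For $J=(c,B)$,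 $0\le c<B<\infty$, and a positive continuous $F$ on $(c,B]\times\mathbb R^d$: $\|f\|_{\alpha,J;F}^2=\int_J\int s^\alpha F|f|^2\,dz\,ds$; $\mathcal W_{\alpha,0}(J;F)$ is the space of $u$ with $u,u_s,Du,D^2u$ (distributional derivatives) of finite $\|\cdot\|_{\alpha,J;F}$ norm and zero $H^1_{\mathrm{loc}}$ trace at $s=B$; $k_\alpha(J;F,A,q)=\sup_{u\in\mathcal W_{\alpha,0}(J;F)}\|\mathcal H_qu\|_{\alpha,J;F}/\|P_Au\|_{\alpha,J;F}$. Heat tuples. A heat tuple is $\mathbf T=(\theta,a_*,A_*,q_* )$ with $a_*,A_*,q_*$ constant positive definite symmetric matrices and $\theta$ a nonzero nonnegative Radon measure with $\int e^{-c|z|^2}\theta(dz)<\infty$ for all $c>0$; $F_{\mathbf T}(\tau,z)=\int\gamma_{\tau a_*}(z-y)\,\theta(dy)$, $\tau>0$; $\mathfrak P_\alpha(\mathbf T)=\sup_{0<c<B<\infty}k_\alpha((c,B);F_{\mathbf T},A_*,q_* )$. $\mathfrak T(\mu)$ is the set of tuples $(\theta,a(0,x_* ),A(0,x_* ),q(0,x_* ))$ for which there are $x_j\in S$, $r_j\downarrow0$ with $x_j\to x_*\in S$ and $\theta_j(E)=\mu(x_j+r_jE)/\mu(B(x_j,r_j))$ converging vaguely to $\theta$. $K_{\alpha,\mathrm{init}}(I)=\sup_{\mathbf T\in\mathfrak T(\mu)}\mathfrak P_\alpha(\mathbf T)$. *)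

theory Defs
  imports "HOL-Probability.Probability"
begin

section \<open>Matrices and Gaussian densities\<close>

text \<open>The norm on \<^typ>\<open>real^'n^'n\<close> provided by HOL-Analysis is the Frobenius norm.\<close>

type_synonym 'n mat = "real^'n^'n"

definition loewner_le :: "'n::finite mat \<Rightarrow> 'n mat \<Rightarrow> bool" (infix \<open>\<preceq>\<^sub>L\<close> 50) where
  "M \<preceq>\<^sub>L N \<longleftrightarrow> (\<forall>\<xi>. \<xi> \<bullet> (M *v \<xi>) \<le> \<xi> \<bullet> (N *v \<xi>))"

definition symmetric_mat :: "'n::finite mat \<Rightarrow> bool" where
  "symmetric_mat M \<longleftrightarrow> transpose M = M"

definition posdef :: "'n::finite mat \<Rightarrow> bool" where
  "posdef M \<longleftrightarrow> symmetric_mat M \<and> (\<forall>\<xi>. \<xi> \<noteq> 0 \<longrightarrow> 0 < \<xi> \<bullet> (M *v \<xi>))"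

definition matrix_sqrt :: "'n::finite mat \<Rightarrow> 'n mat" where
  "matrix_sqrt M = (THE R. symmetric_mat R \<and> mat 0 \<preceq>\<^sub>L R \<and> R ** R = M)"

definition frob_inner :: "'n::finite mat \<Rightarrow> 'n mat \<Rightarrow> real" where
  "frob_inner C D = trace (transpose C ** D)"

definition outer :: "real^'n::finite \<Rightarrow> 'n mat" where
  "outer x = (\<chi> i j. x $ i * x $ j)"

definition gauss :: "'n::finite mat \<Rightarrow> real^'n \<Rightarrow> real" where
  "gauss C x = exp (- (x \<bullet> (matrix_inv C *v x)) / 2) / sqrt ((2 * pi) ^ CARD('n) * det C)"


section \<open>Coefficients and measures\<close>

definition coefficient_assumptions ::
    "real \<Rightarrow> (real \<Rightarrow> real^'n::finite \<Rightarrow> 'n mat) \<Rightarrow> (real \<Rightarrow> real^'n \<Rightarrow> real^'n) \<Rightarrow>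
     (real \<Rightarrow> real^'n \<Rightarrow> 'n mat) \<Rightarrow> (real \<Rightarrow> real^'n \<Rightarrow> 'n mat) \<Rightarrow> bool" where
  "coefficient_assumptions T a b A q \<longleftrightarrow>
     (\<forall>t\<in>{0..T}. \<forall>x. symmetric_mat (a t x) \<and> symmetric_mat (A t x) \<and> symmetric_mat (q t x)) \<and>
     set_borel_measurable borel ({0..T} \<times> UNIV) (\<lambda>(t, x). a t x) \<and>
     set_borel_measurable borel ({0..T} \<times> UNIV) (\<lambda>(t, x). b t x) \<and>
     (\<exists>la>0. \<exists>Ua>0. \<forall>t\<in>{0..T}. \<forall>x. la *\<^sub>R mat 1 \<preceq>\<^sub>L a t x \<and> a t x \<preceq>\<^sub>L Ua *\<^sub>R mat 1) \<and>
     (\<exists>Bb>0. \<forall>t\<in>{0..T}. \<forall>x. norm (b t x) \<le> Bb) \<and>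
     (\<exists>La>0. \<forall>t\<in>{0..T}. \<forall>x y. norm (a t x - a t y) \<le> La * norm (x - y)) \<and>
     (\<exists>\<omega>::real \<Rightarrow> real. \<exists>h0>0.
        mono_on {0..} \<omega> \<and> continuous_on {0..} \<omega> \<and> \<omega> 0 = 0 \<and>
        (\<forall>t\<in>{0..T}. \<forall>v\<in>{0..T}. \<forall>x. norm (a t x - a v x) \<le> \<omega> \<bar>t - v\<bar>) \<and>
        (\<integral>\<^sup>+h\<in>{0<..<h0}. ennreal (sqrt (\<omega> h) / h) \<partial>lborel) < \<infinity>) \<and>
     (\<exists>lA>0. \<exists>UA>0. \<forall>t\<in>{0..T}. \<forall>x. lA *\<^sub>R mat 1 \<preceq>\<^sub>L A t x \<and> A t x \<preceq>\<^sub>L UA *\<^sub>R mat 1) \<and>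
     (\<exists>lq>0. \<exists>Uq>0. \<forall>t\<in>{0..T}. \<forall>x. lq *\<^sub>R mat 1 \<preceq>\<^sub>L q t x \<and> q t x \<preceq>\<^sub>L Uq *\<^sub>R mat 1) \<and>
     (\<exists>\<omega>::real \<Rightarrow> real.
        mono_on {0..} \<omega> \<and> continuous_on {0..} \<omega> \<and> \<omega> 0 = 0 \<and>
        (\<forall>t\<in>{0..T}. \<forall>v\<in>{0..T}. \<forall>x y.
           norm (A t x - A v y) + norm (q t x - q v y) \<le> \<omega> (sqrt \<bar>t - v\<bar> + norm (x - y))))"

definition msupport :: "'x::metric_space measure \<Rightarrow> 'x set" where
  "msupport \<mu> = {x. \<forall>r>0. emeasure \<mu> (ball x r) > 0}"

definition class_D :: "(real^'n::finite) measure set" where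
  "class_D = {\<mu>. prob_space \<mu> \<and> sets \<mu> = sets borel \<and>
     msupport \<mu> \<noteq> {} \<and> compact (msupport \<mu>) \<and>
     (\<exists>C. \<forall>y\<in>msupport \<mu>. \<forall>r>0. measure \<mu> (ball y (2 * r)) \<le> C * measure \<mu> (ball y r))}"

text \<open>On \<open>\<real>\<^sup>d\<close>, a Borel measure that is finite on compact sets is automatically regular.\<close>

definition radon :: "(real^'n::finite) measure \<Rightarrow> bool" where
  "radon \<theta> \<longleftrightarrow> sets \<theta> = sets borel \<and> (\<forall>K. compact K \<longrightarrow> emeasure \<theta> K < \<infinity>)"

definition blowup :: "(real^'n::finite) measure \<Rightarrow> real^'n \<Rightarrow> real \<Rightarrow> (real^'n) measure" where
  "blowup \<mu> x r =
     scale_measure (1 / emeasure \<mu> (ball x r)) (distr \<mu> borel (\<lambda>y. (1 / r) *\<^sub>R (y - x)))"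

lemma emeasure_blowup:
  assumes "sets \<mu> = sets borel" "r > 0" "E \<in> sets borel"
  shows "emeasure (blowup \<mu> x r) E =
    emeasure \<mu> ((\<lambda>z. x + r *\<^sub>R z) ` E) / emeasure \<mu> (ball x r)"
proof -
  have meas: "(\<lambda>y. (1 / r) *\<^sub>R (y - x)) \<in> measurable \<mu> borel"
    unfolding measurable_cong_sets[OF assms(1) refl] by measurable
  have "(\<lambda>y. (1 / r) *\<^sub>R (y - x)) -` E = (\<lambda>z. x + r *\<^sub>R z) ` E"
  proof (intro set_eqI iffI)
    fix y assume "y \<in> (\<lambda>y. (1 / r) *\<^sub>R (y - x)) -` E"
    moreover have "y = x + r *\<^sub>R ((1 / r) *\<^sub>R (y - x))"
      using assms(2) by simp
    ultimately show "y \<in> (\<lambda>z. x + r *\<^sub>R z) ` E" by blast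
  qed (use assms(2) in auto)
  moreover have "space \<mu> = UNIV"
    using assms(1) sets_eq_imp_space_eq by fastforce
  ultimately show ?thesis
    using meas assms(3) by (simp add: blowup_def emeasure_distr divide_ennreal_def mult.commute)
qed

definition vague_conv :: "(nat \<Rightarrow> (real^'n::finite) measure) \<Rightarrow> (real^'n) measure \<Rightarrow> bool" where
  "vague_conv \<theta>s \<theta> \<longleftrightarrow>
     (\<forall>f :: real^'n \<Rightarrow> real. continuous_on UNIV f \<and> compact (closure {x. f x \<noteq> 0}) \<longrightarrow>
        (\<lambda>j. integral\<^sup>L (\<theta>s j) f) \<longlonglongrightarrow> integral\<^sup>L \<theta> f)"


section \<open>Test functions and weak derivatives\<close>

definition dderiv :: "'x::euclidean_space \<Rightarrow> ('x \<Rightarrow> real) \<Rightarrow> 'x \<Rightarrow> real" where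
  "dderiv e f x = frechet_derivative f (at x) e"

primrec Ck :: "nat \<Rightarrow> ('x::euclidean_space \<Rightarrow> real) \<Rightarrow> bool" where
  "Ck 0 f \<longleftrightarrow> continuous_on UNIV f"
| "Ck (Suc k) f \<longleftrightarrow> (\<forall>x. f differentiable at x) \<and> (\<forall>e. Ck k (dderiv e f))"

definition smooth :: "('x::euclidean_space \<Rightarrow> real) \<Rightarrow> bool" where
  "smooth f \<longleftrightarrow> (\<forall>k. Ck k f)"

definition test_functions :: "'x::euclidean_space set \<Rightarrow> ('x \<Rightarrow> real) set" where
  "test_functions \<Omega> =
     {\<phi>. smooth \<phi> \<and> compact (closure {x. \<phi> x \<noteq> 0}) \<and> closure {x. \<phi> x \<noteq> 0} \<subseteq> \<Omega>}"

definition locally_integrable :: "'x::euclidean_space set \<Rightarrow> ('x \<Rightarrow> real) \<Rightarrow> bool" where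
  "locally_integrable \<Omega> u \<longleftrightarrow> (\<forall>K. compact K \<and> K \<subseteq> \<Omega> \<longrightarrow> set_integrable lborel K u)"

definition weak_deriv ::
    "'x::euclidean_space set \<Rightarrow> 'x \<Rightarrow> ('x \<Rightarrow> real) \<Rightarrow> ('x \<Rightarrow> real) \<Rightarrow> bool" where
  "weak_deriv \<Omega> e u v \<longleftrightarrow> locally_integrable \<Omega> u \<and> locally_integrable \<Omega> v \<and>
     (\<forall>\<phi>\<in>test_functions \<Omega>.
        (LINT x:\<Omega>|lborel. u x * dderiv e \<phi> x) = - (LINT x:\<Omega>|lborel. v x * \<phi> x))"


section \<open>Weighted norms and interval constants\<close>

text \<open>Time comes first.  The parentheses matter: \<open>^\<close> binds weaker than \<open>\<times>\<close> in types.\<close>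

type_synonym 'n spacetime = "real \<times> (real^'n)"

abbreviation e_time :: "'n::finite spacetime" where
  "e_time \<equiv> (1, 0)"

abbreviation e_space :: "'n::finite \<Rightarrow> 'n spacetime" where
  "e_space i \<equiv> (0, axis i 1)"

definition ennsqrt :: "ennreal \<Rightarrow> ennreal" where
  "ennsqrt x = (if x = \<infinity> then \<infinity> else ennreal (sqrt (enn2real x)))"

definition L2norm ::
    "'x::euclidean_space set \<Rightarrow> ('x \<Rightarrow> real) \<Rightarrow> ('x \<Rightarrow> 'b::real_normed_vector) \<Rightarrow> ennreal" where
  "L2norm \<Omega> w f = ennsqrt (\<integral>\<^sup>+x\<in>\<Omega>. ennreal (w x * (norm (f x))\<^sup>2) \<partial>lborel)"

definition L2space ::
    "'x::euclidean_space set \<Rightarrow> ('x \<Rightarrow> real) \<Rightarrow> ('x \<Rightarrow> 'b::real_normed_vector) set" where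
  "L2space \<Omega> w = {f. set_borel_measurable lborel \<Omega> f \<and> L2norm \<Omega> w f < \<infinity>}"

definition tweight :: "real \<Rightarrow> ('n::finite spacetime \<Rightarrow> real) \<Rightarrow> 'n spacetime \<Rightarrow> real" where
  "tweight \<alpha> F = (\<lambda>(s, z). s powr \<alpha> * F (s, z))"

text \<open>\<open>g\<close> is the trace at \<open>s = B\<close> of a function \<open>u\<close> on \<open>(c, B) \<times> \<real>\<^sup>d\<close> with weak
  derivatives \<open>us\<close>, \<open>Du\<close>.  On each cylinder \<open>(c', B) \<times> B(0, R)\<close> the trace operator is the
  continuous extension to \<open>H\<^sup>1\<close> of the restriction map on functions smooth up to the boundary.\<close>

definition has_H1loc_trace ::
    "real \<Rightarrow> real \<Rightarrow> ('n::finite spacetime \<Rightarrow> real) \<Rightarrow> ('n spacetime \<Rightarrow> real) \<Rightarrow>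
     ('n spacetime \<Rightarrow> real^'n) \<Rightarrow> (real^'n \<Rightarrow> real) \<Rightarrow> bool" where
  "has_H1loc_trace c B u us Du g \<longleftrightarrow>
     (\<forall>c'\<in>{c<..<B}. \<forall>R>0. \<exists>\<phi> :: nat \<Rightarrow> 'n spacetime \<Rightarrow> real.
        let Z = {c'<..<B} \<times> ball 0 R in
        (\<forall>k. smooth (\<phi> k)) \<and>
        (\<lambda>k. L2norm Z (\<lambda>_. 1) (\<lambda>p. \<phi> k p - u p)) \<longlonglongrightarrow> 0 \<and>
        (\<lambda>k. L2norm Z (\<lambda>_. 1) (\<lambda>p. dderiv e_time (\<phi> k) p - us p)) \<longlonglongrightarrow> 0 \<and>
        (\<forall>i. (\<lambda>k. L2norm Z (\<lambda>_. 1) (\<lambda>p. dderiv (e_space i) (\<phi> k) p - Du p $ i)) \<longlonglongrightarrow> 0) \<and>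
        (\<lambda>k. L2norm (ball 0 R) (\<lambda>_. 1) (\<lambda>z. \<phi> k (B, z) - g z)) \<longlonglongrightarrow> 0)"

text \<open>The space \<open>\<W>\<^sub>\<alpha>\<^sub>,\<^sub>0((c, B); F)\<close>.  Its elements \<open>u\<close> are listed together with their
  distributional derivatives \<open>(u\<^sub>s, Du, D\<^sup>2u)\<close>, which \<open>u\<close> determines almost everywhere.\<close>

definition W0 ::
    "real \<Rightarrow> real \<Rightarrow> real \<Rightarrow> ('n::finite spacetime \<Rightarrow> real) \<Rightarrow>
     (('n spacetime \<Rightarrow> real) \<times> ('n spacetime \<Rightarrow> real) \<times>
      ('n spacetime \<Rightarrow> real^'n) \<times> ('n spacetime \<Rightarrow> 'n mat)) set" where
  "W0 \<alpha> c B F = {(u, us, Du, D2u). let \<Omega> = {c<..<B} \<times> UNIV in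
     weak_deriv \<Omega> e_time u us \<and>
     (\<forall>i. weak_deriv \<Omega> (e_space i) u (\<lambda>p. Du p $ i)) \<and>
     (\<forall>i j. weak_deriv \<Omega> (e_space i) (\<lambda>p. Du p $ j) (\<lambda>p. D2u p $ i $ j)) \<and>
     u \<in> L2space \<Omega> (tweight \<alpha> F) \<and> us \<in> L2space \<Omega> (tweight \<alpha> F) \<and>
     Du \<in> L2space \<Omega> (tweight \<alpha> F) \<and> D2u \<in> L2space \<Omega> (tweight \<alpha> F) \<and>
     has_H1loc_trace c B u us Du (\<lambda>_. 0)}"

text \<open>Division on \<^typ>\<open>ennreal\<close> satisfies \<open>0 / 0 = 0\<close> and \<open>x / 0 = \<infinity>\<close> for \<open>x > 0\<close>.\<close>

definition k_const ::
    "real \<Rightarrow> real \<Rightarrow> real \<Rightarrow> ('n::finite spacetime \<Rightarrow> real) \<Rightarrow> 'n mat \<Rightarrow> 'n mat \<Rightarrow> ennreal" where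
  "k_const \<alpha> c B F A q = (SUP (u, us, Du, D2u)\<in>W0 \<alpha> c B F.
     L2norm ({c<..<B} \<times> UNIV) (tweight \<alpha> F) (\<lambda>p. matrix_sqrt q ** D2u p ** matrix_sqrt q) /
     L2norm ({c<..<B} \<times> UNIV) (tweight \<alpha> F) (\<lambda>p. - us p - frob_inner A (D2u p)))"


section \<open>Heat tuples\<close>

text \<open>A tuple \<open>(\<theta>, a\<^sub>*, A\<^sub>*, q\<^sub>*)\<close>.\<close>

type_synonym 'n tuple = "(real^'n) measure \<times> 'n mat \<times> 'n mat \<times> 'n mat"

definition heat_tuple :: "'n::finite tuple \<Rightarrow> bool" where
  "heat_tuple = (\<lambda>(\<theta>, a, A, q). posdef a \<and> posdef A \<and> posdef q \<and>
     radon \<theta> \<and> emeasure \<theta> UNIV \<noteq> 0 \<and>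
     (\<forall>c>0. (\<integral>\<^sup>+z. ennreal (exp (- c * (norm z)\<^sup>2)) \<partial>\<theta>) < \<infinity>))"

definition heat_F :: "'n::finite tuple \<Rightarrow> 'n spacetime \<Rightarrow> real" where
  "heat_F = (\<lambda>(\<theta>, a, A, q) (\<tau>, z). LINT y|\<theta>. gauss (\<tau> *\<^sub>R a) (z - y))"

definition heat_const :: "real \<Rightarrow> 'n::finite tuple \<Rightarrow> ennreal" where
  "heat_const \<alpha> = (\<lambda>(\<theta>, a, A, q).
     SUP (c, B)\<in>{(c, B). 0 < c \<and> c < B}. k_const \<alpha> c B (heat_F (\<theta>, a, A, q)) A q)"

definition tangent_tuples ::
    "(real \<Rightarrow> real^'n::finite \<Rightarrow> 'n mat) \<Rightarrow> (real \<Rightarrow> real^'n \<Rightarrow> 'n mat) \<Rightarrow>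
     (real \<Rightarrow> real^'n \<Rightarrow> 'n mat) \<Rightarrow> (real^'n) measure \<Rightarrow> 'n tuple set" where
  "tangent_tuples a A q \<mu> = {(\<theta>, a 0 x, A 0 x, q 0 x) | \<theta> x.
     radon \<theta> \<and> x \<in> msupport \<mu> \<and>
     (\<exists>xs rs. (\<forall>j. xs j \<in> msupport \<mu>) \<and> xs \<longlonglongrightarrow> x \<and>
        (\<forall>j. 0 < rs j) \<and> decseq rs \<and> rs \<longlonglongrightarrow> 0 \<and>
        vague_conv (\<lambda>j. blowup \<mu> (xs j) (rs j)) \<theta>)}"

text \<open>\<open>K\<^sub>\<alpha>\<^sub>,\<^sub>i\<^sub>n\<^sub>i\<^sub>t(I)\<close> for \<open>I = (0, T)\<close>; only the initial time \<open>0\<close> of \<open>I\<close> enters.\<close>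

definition K_init ::
    "real \<Rightarrow> (real \<Rightarrow> real^'n::finite \<Rightarrow> 'n mat) \<Rightarrow> (real \<Rightarrow> real^'n \<Rightarrow> 'n mat) \<Rightarrow>
     (real \<Rightarrow> real^'n \<Rightarrow> 'n mat) \<Rightarrow> (real^'n) measure \<Rightarrow> ennreal" where
  "K_init \<alpha> a A q \<mu> = (SUP H\<in>tangent_tuples a A q \<mu>. heat_const \<alpha> H)"


section \<open>The integral operator\<close>

abbreviation Qdom :: "('n::finite spacetime) set" where
  "Qdom \<equiv> {0<..} \<times> UNIV"

definition heat_op ::
    "real \<Rightarrow> 'n::finite tuple \<Rightarrow> ('n spacetime \<Rightarrow> real) \<Rightarrow> 'n spacetime \<Rightarrow> 'n mat" where
  "heat_op \<alpha> = (\<lambda>(\<theta>, a, A, q) g (s, z).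
     LINT t:{s<..}|lborel. LINT y|lborel.
       ((s / t) powr (\<alpha> / 2) *
        sqrt (heat_F (\<theta>, a, A, q) (s, z) / heat_F (\<theta>, a, A, q) (t, y)) *
        (gauss ((2 * (t - s)) *\<^sub>R A) (z - y) / (2 * (t - s))) * g (t, y)) *\<^sub>R
       (matrix_sqrt q **
        ((1 / (2 * (t - s))) *\<^sub>R (matrix_inv A ** outer (z - y) ** matrix_inv A) - matrix_inv A) **
        matrix_sqrt q))"

definition L2_op_norm ::
    "(('n::finite spacetime \<Rightarrow> real) \<Rightarrow> 'n spacetime \<Rightarrow> 'n mat) \<Rightarrow> ennreal" where
  "L2_op_norm E = (SUP f\<in>L2space Qdom (\<lambda>_. 1). L2norm Qdom (\<lambda>_. 1) (E f) / L2norm Qdom (\<lambda>_. 1) f)"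

text \<open>\<open>E\<close> is a bounded linear operator from scalar to matrix-valued \<open>L\<^sup>2(Q)\<close> extending \<open>U\<close>,
  which is only considered on \<open>C\<^sub>c\<^sup>\<infinity>(Q)\<close>.  Elements of \<open>L\<^sup>2(Q)\<close> are represented by functions, so
  identities hold almost everywhere.\<close>

definition bounded_extension ::
    "(('n::finite spacetime \<Rightarrow> real) \<Rightarrow> 'n spacetime \<Rightarrow> 'n mat) \<Rightarrow>
     (('n spacetime \<Rightarrow> real) \<Rightarrow> 'n spacetime \<Rightarrow> 'n mat) \<Rightarrow> bool" where
  "bounded_extension U E \<longleftrightarrow>
     (\<forall>f\<in>L2space Qdom (\<lambda>_. 1). E f \<in> L2space Qdom (\<lambda>_. 1)) \<and>
     (\<forall>f\<in>L2space Qdom (\<lambda>_. 1). \<forall>g\<in>L2space Qdom (\<lambda>_. 1). \<forall>r::real.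
        AE p in lborel. p \<in> Qdom \<longrightarrow> E (\<lambda>p. r * f p + g p) p = r *\<^sub>R E f p + E g p) \<and>
     L2_op_norm E < \<infinity> \<and>
     (\<forall>g\<in>test_functions Qdom. AE p in lborel. p \<in> Qdom \<longrightarrow> E g p = U g p)"

text \<open>By density of \<open>C\<^sub>c\<^sup>\<infinity>(Q)\<close> a bounded extension is unique almost everywhere, so the infimum
  is over at most one value; it is \<open>\<infinity>\<close> if there is no bounded extension.\<close>

definition op_norm ::
    "(('n::finite spacetime \<Rightarrow> real) \<Rightarrow> 'n spacetime \<Rightarrow> 'n mat) \<Rightarrow> ennreal" where
  "op_norm U = (INF E\<in>{E. bounded_extension U E}. L2_op_norm E)"

end

theory Submission
  imports Defs "HOL-Real_Asymp.Real_Asymp"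
begin

text \<open>
  After division by the square root of the weight \<open>s\<^sup>\<alpha> F\<close>, the operator becomes the Hessian of
  the backward heat potential \<open>v\<close> of \<open>f\<close>, which solves \<open>P\<^sub>A v = f\<close> and vanishes at late times.
  Hence a test function \<open>g\<close> gives an element of \<open>\<W>\<^sub>\<alpha>\<^sub>,\<^sub>0\<close> whose quotient dominates
  \<open>\<parallel>\<T>g\<parallel> / \<parallel>g\<parallel>\<close>, and \<open>\<parallel>\<T>\<parallel> \<le> \<P>\<close>.  Conversely, for \<open>u \<in> \<W>\<^sub>\<alpha>\<^sub>,\<^sub>0\<close> the
  residual \<open>P\<^sub>A u\<close>, corrected for a spatial cutoff, is an \<open>L\<^sup>2\<close> limit of test functions.  Pairing with
  forward potentials of second derivatives of test functions shows that the Hessians of the potentials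
  converge weakly to \<open>D\<^sup>2u\<close> on compact sets, and weak lower semicontinuity of the norm gives
  \<open>\<P> \<le> \<parallel>\<T>\<parallel>\<close>.  Doubling survives the vague limit as a polynomial growth bound, so tangent
  tuples are heat tuples.
\<close>

subsection \<open>Smooth functions and test functions\<close>

text \<open>The kernel of the operator is singular: for fixed t > s the Hessian of the heat kernel
  has spatial L^1 norm of order 1/(t-s), so the double integral need not converge absolutely. Every
  computation therefore puts the derivatives on the test function, where integrability of the heat
  kernel itself is enough; the prescribed order of integration permits this. Elements of W0 lie only
  in weighted spaces, and the weight may decay like a Gaussian in space, so they need not be
  integrable against a heat kernel and cannot be compared with potentials directly. This forces the
  spatial cutoff; its errors vanish because W0 controls \<open>u\<close> and \<open>Du\<close> in
  the weighted norm. The zero trace is what allows integration by parts in time against functions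
  that do not vanish at s = B. Of F three properties are used: smoothness and positivity for
  positive times, and, on bounded time intervals away from 0, growth at most like exp (\<eta> |z|^2)
  for every \<eta> > 0. The last one is beaten by the Gaussian decay of the potentials, whatever its
  rate.\<close>

lemma dderiv_eq: "(f has_derivative f') (at x) \<Longrightarrow> dderiv e f x = f' e"
  unfolding dderiv_def using frechet_derivative_at by metis

lemma has_dderiv: "f differentiable at x \<Longrightarrow> (f has_derivative (\<lambda>h. dderiv h f x)) (at x)"
  unfolding dderiv_def using frechet_derivative_works by (metis (no_types, lifting) ext)

lemma dderiv_cong:
  assumes "open S" "x \<in> S" "\<And>y. y \<in> S \<Longrightarrow> f y = g y"
  shows "dderiv e f x = dderiv e g x"
proof -
  have "(f has_derivative f') (at x) \<longleftrightarrow> (g has_derivative f') (at x)" for f'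
    using assms has_derivative_transform_within_open[of _ _ x UNIV S] by metis
  then show ?thesis by (simp add: dderiv_def frechet_derivative_def)
qed

text \<open>The weight is smooth for positive times only, so \<open>Ck\<close> is needed relative to
  a set. Derivatives are taken in the full space; \<open>S\<close> is meant to be open.\<close>

primrec Ck_on :: "nat \<Rightarrow> 'x::euclidean_space set \<Rightarrow> ('x \<Rightarrow> real) \<Rightarrow> bool" where
  "Ck_on 0 S f \<longleftrightarrow> continuous_on S f"
| "Ck_on (Suc k) S f \<longleftrightarrow> (\<forall>x\<in>S. f differentiable at x) \<and> (\<forall>e. Ck_on k S (dderiv e f))"

definition smooth_on :: "'x::euclidean_space set \<Rightarrow> ('x \<Rightarrow> real) \<Rightarrow> bool" where
  "smooth_on S f \<longleftrightarrow> (\<forall>k. Ck_on k S f)"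

lemma smooth_iff_smooth_on: "smooth f \<longleftrightarrow> smooth_on UNIV f"
proof -
  have "Ck k f = Ck_on k UNIV f" for k by (induct k arbitrary: f) simp_all
  then show ?thesis by (simp add: smooth_def smooth_on_def)
qed

lemma Ck_on_cong:
  assumes "open S"
  shows "Ck_on k S f \<Longrightarrow> (\<And>x. x \<in> S \<Longrightarrow> f x = g x) \<Longrightarrow> Ck_on k S g"
proof (induct k arbitrary: f g)
  case 0
  then show ?case by (auto cong: continuous_on_cong)
next
  case (Suc k)
  have d: "g differentiable at x" if x: "x \<in> S" for x
  proof -
    obtain f' where "(f has_derivative f') (at x)" using Suc(2) x by (force simp: differentiable_def)
    from has_derivative_transform_within_open[OF this assms x Suc(3)]
    show ?thesis by (auto simp: differentiable_def)
  qed
  have "Ck_on k S (dderiv e g)" for e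
  proof (rule Suc(1))
    show "Ck_on k S (dderiv e f)" using Suc(2) by simp
    show "dderiv e f x = dderiv e g x" if "x \<in> S" for x
      using assms that Suc(3) by (rule dderiv_cong)
  qed
  then show ?case using d by auto
qed

lemma Ck_on_Suc: "Ck_on (Suc k) S f \<Longrightarrow> Ck_on k S f"
proof (induct k arbitrary: f)
  case 0
  then show ?case
    by (auto intro!: differentiable_imp_continuous_on simp: differentiable_on_def
        differentiable_at_withinI)
qed auto

lemma Ck_on_subset: "Ck_on k S f \<Longrightarrow> T \<subseteq> S \<Longrightarrow> Ck_on k T f"
  by (induct k arbitrary: f) (auto intro: continuous_on_subset)

lemma Ck_on_Un:
  "open S \<Longrightarrow> open T \<Longrightarrow> Ck_on k S f \<Longrightarrow> Ck_on k T f \<Longrightarrow> Ck_on k (S \<union> T) f"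
  by (induct k arbitrary: f) (auto intro: continuous_on_open_Un)

lemma Ck_on_const: "Ck_on k S (\<lambda>x. c)"
proof (induct k arbitrary: c)
  case (Suc k)
  have "dderiv e (\<lambda>x. c) = (\<lambda>x. 0)" for e :: 'a by (auto simp: dderiv_def)
  then show ?case using Suc by simp
qed auto

lemma Ck_on_add:
  assumes "open S"
  shows "Ck_on k S f \<Longrightarrow> Ck_on k S g \<Longrightarrow> Ck_on k S (\<lambda>x. f x + g x)"
proof (induct k arbitrary: f g)
  case (Suc k)
  have "Ck_on k S (dderiv e (\<lambda>x. f x + g x))" for e
  proof (rule Ck_on_cong[OF assms, where f="\<lambda>x. dderiv e f x + dderiv e g x"])
    show "Ck_on k S (\<lambda>x. dderiv e f x + dderiv e g x)" using Suc by auto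
    show "dderiv e f x + dderiv e g x = dderiv e (\<lambda>x. f x + g x) x" if "x \<in> S" for x
      using Suc(2,3) that by (intro dderiv_eq[symmetric] has_derivative_add has_dderiv) auto
  qed
  then show ?case using Suc by auto
qed (auto intro: continuous_intros)

lemma Ck_on_mult:
  assumes "open S"
  shows "Ck_on k S f \<Longrightarrow> Ck_on k S g \<Longrightarrow> Ck_on k S (\<lambda>x. f x * g x)"
proof (induct k arbitrary: f g)
  case (Suc k)
  have "Ck_on k S (dderiv e (\<lambda>x. f x * g x))" for e
  proof (rule Ck_on_cong[OF assms, where f="\<lambda>x. f x * dderiv e g x + dderiv e f x * g x"])
    show "Ck_on k S (\<lambda>x. f x * dderiv e g x + dderiv e f x * g x)"
      using Suc(2,3) Ck_on_Suc[OF Suc(2)] Ck_on_Suc[OF Suc(3)]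
      by (intro Ck_on_add assms Suc(1)) auto
    show "f x * dderiv e g x + dderiv e f x * g x = dderiv e (\<lambda>x. f x * g x) x" if "x \<in> S" for x
      using Suc(2,3) that by (intro dderiv_eq[symmetric] has_derivative_mult has_dderiv) auto
  qed
  then show ?case using Suc by auto
qed (auto intro: continuous_intros)

lemma Ck_on_compose:
  fixes h :: "real \<Rightarrow> real"
  assumes "open S"
  shows "Ck_on k T h \<Longrightarrow> Ck_on k S f \<Longrightarrow> f ` S \<subseteq> T \<Longrightarrow> Ck_on k S (\<lambda>x. h (f x))"
proof (induct k arbitrary: h)
  case 0
  then show ?case by (auto intro: continuous_on_compose2)
next
  case (Suc k)
  have *: "((\<lambda>x. h (f x)) has_derivative (\<lambda>e. dderiv 1 h (f x) * dderiv e f x)) (at x)"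
    if "x \<in> S" for x
  proof -
    have h: "(h has_derivative (\<lambda>c. dderiv c h (f x))) (at (f x))"
      using Suc(2,4) that by (auto intro: has_dderiv)
    have "(f has_derivative (\<lambda>e. dderiv e f x)) (at x)"
      using Suc(3) that by (auto intro: has_dderiv)
    from has_derivative_compose[OF this h]
    have c: "((\<lambda>x. h (f x)) has_derivative (\<lambda>e. dderiv (dderiv e f x) h (f x))) (at x)" .
    from h have l: "linear (\<lambda>c. dderiv c h (f x))" by (rule has_derivative_linear)
    have e: "dderiv r h (f x) = dderiv 1 h (f x) * r" for r
      using linear_cmul[OF l, of r 1] by simp
    show ?thesis using c by (subst (asm) e)
  qed
  have "Ck_on k S (dderiv e (\<lambda>x. h (f x)))" for e
  proof (rule Ck_on_cong[OF assms, where f="\<lambda>x. dderiv 1 h (f x) * dderiv e f x"])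
    have "Ck_on k S (\<lambda>x. dderiv 1 h (f x))"
      using Suc(2) by (intro Suc(1)[OF _ Ck_on_Suc[OF Suc(3)] Suc(4)]) simp
    then show "Ck_on k S (\<lambda>x. dderiv 1 h (f x) * dderiv e f x)"
      using Suc(3) by (intro Ck_on_mult assms) auto
    show "dderiv 1 h (f x) * dderiv e f x = dderiv e (\<lambda>x. h (f x)) x" if "x \<in> S" for x
      using dderiv_eq[OF *[OF that]] by simp
  qed
  then show ?case using * by (auto simp: differentiable_def)
qed

lemma dderiv_compose_affine:
  assumes "bounded_linear L" "f differentiable at (b + L x)"
  shows "((\<lambda>x. f (b + L x)) has_derivative (\<lambda>e. dderiv (L e) f (b + L x))) (at x)"
proof -
  have "((\<lambda>x. b + L x) has_derivative L) (at x)"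
    using has_derivative_add[OF has_derivative_const bounded_linear_imp_has_derivative[OF assms(1)]]
    by auto
  from has_derivative_compose[OF this has_dderiv[OF assms(2)]] show ?thesis .
qed

lemma Ck_on_compose_affine:
  assumes "open S" "bounded_linear L" "(\<lambda>x. b + L x) ` S \<subseteq> T"
  shows "Ck_on k T f \<Longrightarrow> Ck_on k S (\<lambda>x. f (b + L x))"
proof (induct k arbitrary: f)
  case 0
  have "continuous_on S (\<lambda>x. b + L x)"
    using linear_continuous_on[OF assms(2)] by (intro continuous_on_add continuous_on_const)
  then show ?case using continuous_on_compose2[of T f S "\<lambda>x. b + L x"] 0 assms(3) by simp
next
  case (Suc k)
  have *: "((\<lambda>x. f (b + L x)) has_derivative (\<lambda>e. dderiv (L e) f (b + L x))) (at x)"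
    if "x \<in> S" for x
    using Suc(2) that assms(3) by (intro dderiv_compose_affine[OF assms(2)]) auto
  have "Ck_on k S (dderiv e (\<lambda>x. f (b + L x)))" for e
  proof (rule Ck_on_cong[OF assms(1), where f="\<lambda>x. dderiv (L e) f (b + L x)"])
    show "Ck_on k S (\<lambda>x. dderiv (L e) f (b + L x))"
      using Suc by auto
    show "dderiv (L e) f (b + L x) = dderiv e (\<lambda>x. f (b + L x)) x" if "x \<in> S" for x
      using dderiv_eq[OF *[OF that]] by simp
  qed
  then show ?case using * by (auto simp: differentiable_def)
qed

lemma smooth_on_cong:
  "open S \<Longrightarrow> smooth_on S f \<Longrightarrow> (\<And>x. x \<in> S \<Longrightarrow> f x = g x) \<Longrightarrow> smooth_on S g"
  using Ck_on_cong unfolding smooth_on_def by blast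

lemma smooth_on_subset: "smooth_on S f \<Longrightarrow> T \<subseteq> S \<Longrightarrow> smooth_on T f"
  using Ck_on_subset unfolding smooth_on_def by blast

lemma smooth_on_Un: "open S \<Longrightarrow> open T \<Longrightarrow> smooth_on S f \<Longrightarrow> smooth_on T f \<Longrightarrow> smooth_on (S \<union> T) f"
  using Ck_on_Un unfolding smooth_on_def by blast

lemma smooth_on_const: "smooth_on S (\<lambda>x. c)"
  by (simp add: Ck_on_const smooth_on_def)

lemma smooth_on_add: "open S \<Longrightarrow> smooth_on S f \<Longrightarrow> smooth_on S g \<Longrightarrow> smooth_on S (\<lambda>x. f x + g x)"
  using Ck_on_add unfolding smooth_on_def by blast

lemma smooth_on_mult: "open S \<Longrightarrow> smooth_on S f \<Longrightarrow> smooth_on S g \<Longrightarrow> smooth_on S (\<lambda>x. f x * g x)"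
  using Ck_on_mult unfolding smooth_on_def by blast

lemma smooth_on_minus: "open S \<Longrightarrow> smooth_on S f \<Longrightarrow> smooth_on S (\<lambda>x. - f x)"
  using smooth_on_mult[OF _ smooth_on_const, of S f "-1"] by simp

lemma smooth_on_diff: "open S \<Longrightarrow> smooth_on S f \<Longrightarrow> smooth_on S g \<Longrightarrow> smooth_on S (\<lambda>x. f x - g x)"
  using smooth_on_add[OF _ _ smooth_on_minus, of S f g] by simp

lemma smooth_on_sum:
  "open S \<Longrightarrow> (\<And>i. i \<in> I \<Longrightarrow> smooth_on S (f i)) \<Longrightarrow> smooth_on S (\<lambda>x. \<Sum>i\<in>I. f i x)"
  by (induct I rule: infinite_finite_induct) (auto intro: smooth_on_const smooth_on_add)

lemma smooth_on_prod:
  "open S \<Longrightarrow> (\<And>i. i \<in> I \<Longrightarrow> smooth_on S (f i)) \<Longrightarrow> smooth_on S (\<lambda>x. \<Prod>i\<in>I. f i x)"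
  by (induct I rule: infinite_finite_induct) (auto intro: smooth_on_const smooth_on_mult)

lemma smooth_on_compose:
  fixes h :: "real \<Rightarrow> real"
  shows "open S \<Longrightarrow> smooth_on T h \<Longrightarrow> smooth_on S f \<Longrightarrow> f ` S \<subseteq> T \<Longrightarrow> smooth_on S (\<lambda>x. h (f x))"
  using Ck_on_compose unfolding smooth_on_def by blast

lemma smooth_on_compose_affine:
  "open S \<Longrightarrow> bounded_linear L \<Longrightarrow> (\<lambda>x. b + L x) ` S \<subseteq> T \<Longrightarrow> smooth_on T f \<Longrightarrow>
    smooth_on S (\<lambda>x. f (b + L x))"
  using Ck_on_compose_affine unfolding smooth_on_def by blast

lemma smooth_on_continuous: "smooth_on S f \<Longrightarrow> continuous_on S f"
  unfolding smooth_on_def by (metis Ck_on.simps(1))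

lemma smooth_on_differentiable: "smooth_on S f \<Longrightarrow> x \<in> S \<Longrightarrow> f differentiable at x"
  unfolding smooth_on_def by (metis Ck_on.simps(2))

lemma smooth_on_dderiv: "smooth_on S f \<Longrightarrow> smooth_on S (dderiv e f)"
  unfolding smooth_on_def by (metis Ck_on.simps(2))

text \<open>Avoids formulas for derivatives of order k: it is enough to name a family of
  differentiable functions that contains \<open>f\<close> and to which directional derivatives
  belong again, up to equality on \<open>S\<close>. Convolutions with a fixed kernel or a fixed
  measure form such families.\<close>

lemma smooth_on_coinduct:
  assumes "open S" "P f"
    and c: "\<And>f. P f \<Longrightarrow> continuous_on S f"
    and d: "\<And>f x. P f \<Longrightarrow> x \<in> S \<Longrightarrow> f differentiable at x"
    and n: "\<And>f e. P f \<Longrightarrow> \<exists>g. P g \<and> (\<forall>x\<in>S. dderiv e f x = g x)"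
  shows "smooth_on S f"
proof -
  have "P f \<Longrightarrow> Ck_on k S f" for k f
  proof (induct k arbitrary: f)
    case (Suc k)
    have "Ck_on k S (dderiv e f)" for e
    proof -
      obtain g where "P g" "\<forall>x\<in>S. dderiv e f x = g x" using n[OF Suc(2)] by blast
      then show ?thesis using Ck_on_cong[OF \<open>open S\<close> Suc(1), of g "dderiv e f"] by auto
    qed
    then show ?case using d[OF Suc(2)] by auto
  qed (simp add: c)
  then show ?thesis using assms(2) by (simp add: smooth_on_def)
qed

lemma smooth_on_linear:
  assumes "open S" "bounded_linear f"
  shows "smooth_on S f"
proof -
  have "Ck_on k S f" for k
  proof (cases k)
    case 0
    then show ?thesis using linear_continuous_on[OF assms(2)] by simp
  next
    case (Suc m)
    have "dderiv e f = (\<lambda>x. f e)" for e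
      using dderiv_eq[OF bounded_linear_imp_has_derivative[OF assms(2)]] by auto
    then show ?thesis
      using Suc assms(2) by (auto intro: Ck_on_const bounded_linear_imp_differentiable)
  qed
  then show ?thesis by (simp add: smooth_on_def)
qed

lemma smooth_on_field_coinduct:
  fixes f :: "real \<Rightarrow> real"
  assumes "open S" "P f"
    and d: "\<And>f. P f \<Longrightarrow> \<exists>g. P g \<and> (\<forall>x\<in>S. (f has_real_derivative g x) (at x))"
  shows "smooth_on S f"
proof -
  \<comment> \<open>A directional derivative on the line is the direction \<open>e\<close> times the
    ordinary derivative, so the family has to be closed under constant multiples.\<close>
  define Q where "Q f \<longleftrightarrow> (\<exists>g c. P g \<and> (\<forall>x\<in>S. f x = c * g x))" for f
  have D: "\<exists>g. P g \<and> (\<forall>x\<in>S. (f has_real_derivative c * g x) (at x))"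
    if Ph: "P h" "\<forall>x\<in>S. f x = c * h x" for f h :: "real \<Rightarrow> real" and c
  proof -
    obtain g where g: "P g" "\<forall>x\<in>S. (h has_real_derivative g x) (at x)" using d[OF Ph(1)] by blast
    have "(f has_real_derivative c * g x) (at x)" if "x \<in> S" for x
    proof -
      have "((\<lambda>x. c * h x) has_real_derivative c * g x) (at x)"
        using g(2) that by (auto intro!: DERIV_cmult)
      then show ?thesis
        using DERIV_cong_ev[of x x f "\<lambda>x. c * h x"] \<open>\<forall>x\<in>S. f x = c * h x\<close> \<open>open S\<close> that
        by (auto simp: eventually_nhds)
    qed
    then show ?thesis using g(1) by blast
  qed
  show ?thesis
  proof (rule smooth_on_coinduct[where P=Q])
    show "open S" by fact
    show "Q f" using \<open>P f\<close> by (auto simp: Q_def intro!: exI[of _ f] exI[of _ 1])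
    show diff: "f differentiable at x" if "Q f" "x \<in> S" for f x
      using that D[of _ f] unfolding Q_def
      by (metis real_differentiable_def)
    show "continuous_on S f" if "Q f" for f
      using diff[OF that]
      by (auto intro!: differentiable_imp_continuous_on simp: differentiable_on_def
        differentiable_at_withinI)
    show "\<exists>g. Q g \<and> (\<forall>x\<in>S. dderiv e f x = g x)" if Qf: "Q f" for f e
    proof -
      obtain h c where h: "P h" "\<forall>x\<in>S. f x = c * h x" using Qf by (auto simp: Q_def)
      from D[OF h] obtain g where g: "P g" "\<forall>x\<in>S. (f has_real_derivative c * g x) (at x)" by blast
      have "dderiv e f x = (c * e) * g x" if "x \<in> S" for x
        using dderiv_eq[of f "(*) (c * g x)"] g(2) that by (simp add: has_field_derivative_def)
      then show ?thesis using g(1) unfolding Q_def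
        by (intro exI[of _ "\<lambda>x. (c * e) * g x"]) auto
    qed
  qed
qed

text \<open>Reciprocals, square roots and reciprocal square roots of positive smooth functions are
  obtained by composition with these powers.\<close>

lemma smooth_on_powr: "smooth_on {0<..} (\<lambda>t. t powr p :: real)"
proof (rule smooth_on_field_coinduct[where P="\<lambda>f. \<exists>c p. f = (\<lambda>t. c * t powr p)"])
  show "\<exists>c pa. (\<lambda>t. t powr p) = (\<lambda>t. c * t powr pa)" by (rule exI[of _ 1]) auto
  fix f :: "real \<Rightarrow> real" assume "\<exists>c p. f = (\<lambda>t. c * t powr p)"
  then obtain c p where f: "f = (\<lambda>t. c * t powr p)" by blast
  have "((\<lambda>t. c * t powr p) has_real_derivative (c * p) * x powr (p - 1)) (at x)" if "x > 0" for x
    using that by (auto intro!: derivative_eq_intros simp: powr_diff)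
  then show "\<exists>g. (\<exists>c p. g = (\<lambda>t. c * t powr p)) \<and> (\<forall>x\<in>{0<..}. (f has_real_derivative g x) (at x))"
    unfolding f by (intro exI[of _ "\<lambda>t. (c * p) * t powr (p - 1)"]) auto
qed auto

section \<open>A smooth step function and cutoffs of balls\<close>

lemma poly_times_exp_minus_tendsto_0:
  fixes p :: "real poly"
  shows "((\<lambda>x. x ^ k * poly p x * exp (- x)) \<longlongrightarrow> 0) at_top"
\<comment> \<open>Splitting off the lowest coefficient leaves a factor x, which the free exponent
  \<open>k\<close> takes up.\<close>
proof (induct p arbitrary: k)
  case (pCons a p)
  have "((\<lambda>x::real. a * (x ^ k / exp x) + x ^ Suc k * poly p x * exp (- x)) \<longlongrightarrow> a * 0 + 0) at_top"
    by (intro tendsto_add tendsto_mult_left tendsto_power_div_exp_0 pCons(2))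
  then show ?case by (simp add: exp_minus field_simps)
qed simp

lemma poly_inverse_times_exp_tendsto_0:
  fixes p :: "real poly"
  shows "((\<lambda>t. poly p (1 / t) * exp (- 1 / t)) \<longlongrightarrow> 0) (at_right 0)"
proof -
  have "filterlim (\<lambda>t::real. 1 / t) at_top (at_right 0)"
    by (simp add: filterlim_inverse_at_top_right flip: inverse_eq_divide)
  from filterlim_compose[OF poly_times_exp_minus_tendsto_0[of 0 p] this] show ?thesis by simp
qed

definition flat_exp :: "real \<Rightarrow> real" where
  "flat_exp t = (if t > 0 then exp (- 1 / t) else 0)"

text \<open>A polynomial in 1/t times exp (-1/t) keeps this form under differentiation: with x = 1/t
  the new polynomial is x^2 (p - p'). This is the closure property that
  \<open>smooth_on_field_coinduct\<close> asks for.\<close>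

lemma poly_flat_exp_has_derivative:
  fixes p :: "real poly"
  defines "f \<equiv> \<lambda>p t. if t > 0 then poly p (1 / t) * exp (- 1 / t) else (0 :: real)"
  shows "(f p has_real_derivative f ([:0, 0, 1:] * (p - pderiv p)) x) (at x)"
proof -
  consider "x > 0" | "x < 0" | "x = 0" by linarith
  then show ?thesis
  proof cases
    case 1
    have "((\<lambda>t. poly p (1 / t) * exp (- 1 / t)) has_real_derivative
        poly ([:0, 0, 1:] * (p - pderiv p)) (1 / x) * exp (- 1 / x)) (at x)"
      using 1 by (auto intro!: derivative_eq_intros simp: power2_eq_square field_simps)
    moreover have "\<forall>\<^sub>F t in nhds x. f p t = poly p (1 / t) * exp (- 1 / t)"
      using eventually_nhds_in_open[of "{0<..}" x] 1 by (auto simp: f_def elim: eventually_mono)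
    ultimately show ?thesis
      using 1 DERIV_cong_ev[OF refl] by (force simp: f_def)
  next
    case 2
    have "\<forall>\<^sub>F t in nhds x. f p t = 0"
      using eventually_nhds_in_open[of "{..<0}" x] 2 by (auto simp: f_def elim: eventually_mono)
    then have "(f p has_real_derivative 0) (at x) \<longleftrightarrow> ((\<lambda>_. 0) has_real_derivative 0) (at x)"
      by (intro DERIV_cong_ev) auto
    then show ?thesis using 2 by (simp add: f_def)
  next
    case 3
    \<comment> \<open>The difference quotient at 0 has the same form again, with x p(x) in place of
      p, so its limit is already known.\<close>
    have "((\<lambda>t. poly (pCons 0 p) (1 / t) * exp (- 1 / t)) \<longlongrightarrow> 0) (at_right 0)"
      by (rule poly_inverse_times_exp_tendsto_0)
    then have r: "((\<lambda>t. (f p t - f p 0) / (t - 0)) \<longlongrightarrow> 0) (at_right 0)"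
      by (rule filterlim_cong[THEN iffD1, rotated -1, OF _ refl refl])
        (auto simp: f_def eventually_at_filter)
    have l: "((\<lambda>t. (f p t - f p 0) / (t - 0)) \<longlongrightarrow> 0) (at_left 0)"
      by (rule tendsto_eventually) (auto simp: f_def eventually_at_filter)
    from l r have "((\<lambda>t. (f p t - f p 0) / (t - 0)) \<longlongrightarrow> 0) (at 0)"
      by (simp add: filterlim_split_at)
    then show ?thesis using 3 by (simp add: has_field_derivative_iff f_def)
  qed
qed

lemma smooth_on_flat_exp: "smooth_on UNIV flat_exp"
proof (rule smooth_on_field_coinduct[where
      P="\<lambda>f. \<exists>p. f = (\<lambda>t. if t > 0 then poly p (1 / t) * exp (- 1 / t) else 0)"])
  show "\<exists>p. flat_exp = (\<lambda>t. if t > 0 then poly p (1 / t) * exp (- 1 / t) else 0)"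
    by (rule exI[of _ 1]) (auto simp: flat_exp_def)
qed (use poly_flat_exp_has_derivative in blast)+

text \<open>The denominator never vanishes, since 2 - t and t - 1 are not both nonpositive.\<close>

definition smooth_step :: "real \<Rightarrow> real" where
  "smooth_step t = flat_exp (2 - t) / (flat_exp (2 - t) + flat_exp (t - 1))"

lemma smooth_step_bounds: "0 \<le> smooth_step t" "smooth_step t \<le> 1"
  and smooth_step_1: "t \<le> 1 \<Longrightarrow> smooth_step t = 1"
  and smooth_step_0: "t \<ge> 2 \<Longrightarrow> smooth_step t = 0"
proof -
  have "x \<ge> 0 \<Longrightarrow> y \<ge> 0 \<Longrightarrow> x / (x + y) \<le> 1" for x y :: real
    by (cases "x + y = 0") (auto simp: divide_le_eq)
  then show "0 \<le> smooth_step t" "smooth_step t \<le> 1" "t \<le> 1 \<Longrightarrow> smooth_step t = 1"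
    "t \<ge> 2 \<Longrightarrow> smooth_step t = 0"
    by (auto simp: smooth_step_def flat_exp_def)
qed

lemma smooth_on_smooth_step: "smooth_on UNIV smooth_step"
proof -
  have 1: "smooth_on UNIV (\<lambda>t. flat_exp (2 - t))"
    using smooth_on_compose_affine[OF open_UNIV bounded_linear_minus[OF bounded_linear_ident] _ smooth_on_flat_exp, of 2]
    by simp
  have 2: "smooth_on UNIV (\<lambda>t. flat_exp (t - 1))"
    using smooth_on_compose_affine[OF open_UNIV bounded_linear_ident _ smooth_on_flat_exp, of "-1"]
    by simp
  have pos: "flat_exp (2 - t) + flat_exp (t - 1) > 0" for t
    by (auto simp: flat_exp_def add_pos_pos)
  have "smooth_on UNIV (\<lambda>t. flat_exp (2 - t) * (flat_exp (2 - t) + flat_exp (t - 1)) powr (- 1))"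
    by (intro smooth_on_mult open_UNIV 1 smooth_on_compose[OF _ smooth_on_powr] smooth_on_add 2)
      (auto simp: pos)
  then show ?thesis
    by (rule smooth_on_cong[rotated])
      (auto simp: smooth_step_def powr_minus_divide less_imp_le[OF pos])
qed

lemma smooth_on_norm_power2: "open S \<Longrightarrow> smooth_on S (\<lambda>x. (norm (x - a))\<^sup>2)"
proof -
  assume S: "open S"
  have "smooth_on S (\<lambda>x. \<Sum>b\<in>Basis. (x \<bullet> b + (- (a \<bullet> b))) * (x \<bullet> b + (- (a \<bullet> b))))"
    using S by (intro smooth_on_sum smooth_on_mult smooth_on_add smooth_on_const
        smooth_on_linear bounded_linear_inner_left)
  moreover have "(norm (x - a))\<^sup>2 = (\<Sum>b\<in>Basis. (x \<bullet> b + (- (a \<bullet> b))) * (x \<bullet> b + (- (a \<bullet> b))))" for x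
    unfolding power2_norm_eq_inner by (subst euclidean_inner) (simp add: inner_diff_left)
  ultimately show ?thesis by simp
qed

text \<open>The squared norm keeps the function smooth at the centre. The transition then ends at
  radius sqrt 2 r, inside the radius \<open>2 * r\<close> used below.\<close>

definition ball_cutoff :: "'x::euclidean_space \<Rightarrow> real \<Rightarrow> 'x \<Rightarrow> real" where
  "ball_cutoff a r x = smooth_step ((norm (x - a))\<^sup>2 * (1 / r\<^sup>2))"

lemma smooth_on_ball_cutoff: "smooth_on UNIV (ball_cutoff a r)"
  unfolding ball_cutoff_def
  by (intro smooth_on_compose[OF _ smooth_on_smooth_step] smooth_on_mult smooth_on_norm_power2
      smooth_on_const) auto

lemma ball_cutoff_bounds: "0 \<le> ball_cutoff a r x" "ball_cutoff a r x \<le> 1"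
  by (auto simp: ball_cutoff_def smooth_step_bounds)

lemma ball_cutoff_1: "r > 0 \<Longrightarrow> norm (x - a) \<le> r \<Longrightarrow> ball_cutoff a r x = 1"
  unfolding ball_cutoff_def
  by (intro smooth_step_1) (auto simp: divide_simps intro!: power_mono)

lemma ball_cutoff_0: "r > 0 \<Longrightarrow> norm (x - a) \<ge> 2 * r \<Longrightarrow> ball_cutoff a r x = 0"
  unfolding ball_cutoff_def
proof (intro smooth_step_0)
  assume "r > 0" "norm (x - a) \<ge> 2 * r"
  then have "(2 * r)\<^sup>2 \<le> (norm (x - a))\<^sup>2" by (intro power_mono) auto
  then have "4 * r\<^sup>2 \<le> (norm (x - a))\<^sup>2" by (simp add: power_mult_distrib)
  then have "2 * r\<^sup>2 \<le> (norm (x - a))\<^sup>2" using zero_le_power2[of r] by linarith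
  then show "2 \<le> (norm (x - a))\<^sup>2 * (1 / r\<^sup>2)"
    using \<open>r > 0\<close> by (simp add: field_simps)
qed

section \<open>Test functions and a smooth Urysohn lemma\<close>

lemma support_subset_closed: "closed C \<Longrightarrow> (\<And>x. x \<notin> C \<Longrightarrow> f x = 0) \<Longrightarrow> closure {x. f x \<noteq> 0} \<subseteq> C"
  by (intro closure_minimal) auto

lemma test_functionsI:
  assumes "smooth_on UNIV f" "compact C" "C \<subseteq> \<Omega>" "\<And>x. x \<notin> C \<Longrightarrow> f x = 0"
  shows "f \<in> test_functions \<Omega>"
proof -
  have "closure {x. f x \<noteq> 0} \<subseteq> C"
    using assms by (intro support_subset_closed compact_imp_closed) auto
  moreover from this have "compact (closure {x. f x \<noteq> 0})"
    using assms(2) by (meson bounded_subset closed_closure compact_eq_bounded_closed)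
  ultimately show ?thesis
    using assms by (auto simp: test_functions_def smooth_iff_smooth_on)
qed

lemma test_functionsE:
  assumes "f \<in> test_functions \<Omega>"
  obtains C where "compact C" "C \<subseteq> \<Omega>" "\<And>x. x \<notin> C \<Longrightarrow> f x = 0" "smooth_on UNIV f"
proof (rule that)
  show "f x = 0" if "x \<notin> closure {x. f x \<noteq> 0}" for x
    using that closure_subset[of "{x. f x \<noteq> 0}"] by blast
qed (use assms in \<open>auto simp: test_functions_def smooth_iff_smooth_on\<close>)

lemma test_functions_mono: "\<Omega> \<subseteq> \<Omega>' \<Longrightarrow> f \<in> test_functions \<Omega> \<Longrightarrow> f \<in> test_functions \<Omega>'"
  by (auto simp: test_functions_def)

lemma test_functions_smooth: "f \<in> test_functions \<Omega> \<Longrightarrow> smooth_on UNIV f"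
  by (auto simp: test_functions_def smooth_iff_smooth_on)

lemma test_functions_continuous: "f \<in> test_functions \<Omega> \<Longrightarrow> continuous_on UNIV f"
  using smooth_on_continuous test_functions_smooth by blast

lemma test_functions_measurable: "f \<in> test_functions \<Omega> \<Longrightarrow> f \<in> borel_measurable borel"
  using borel_measurable_continuous_onI test_functions_continuous by blast

lemma test_functions_zero: "f \<in> test_functions \<Omega> \<Longrightarrow> x \<notin> \<Omega> \<Longrightarrow> f x = 0"
  by (elim test_functionsE) blast

lemma test_functions_0: "(\<lambda>x. 0) \<in> test_functions \<Omega>"
  by (rule test_functionsI[of _ "{}"]) (auto intro: smooth_on_const)

lemma test_functions_add:
  assumes "f \<in> test_functions \<Omega>" "g \<in> test_functions \<Omega>"
  shows "(\<lambda>x. f x + g x) \<in> test_functions \<Omega>"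
proof -
  obtain C D where "compact C" "C \<subseteq> \<Omega>" "\<And>x. x \<notin> C \<Longrightarrow> f x = 0" "smooth_on UNIV f"
    "compact D" "D \<subseteq> \<Omega>" "\<And>x. x \<notin> D \<Longrightarrow> g x = 0" "smooth_on UNIV g"
    using assms by (metis test_functionsE)
  then show ?thesis
    by (intro test_functionsI[of _ "C \<union> D"] smooth_on_add) auto
qed

lemma test_functions_mult_smooth_on:
  assumes "f \<in> test_functions \<Omega>" "open \<Omega>" "smooth_on \<Omega> g"
  shows "(\<lambda>x. g x * f x) \<in> test_functions \<Omega>"
proof -
  obtain C where C: "compact C" "C \<subseteq> \<Omega>" "\<And>x. x \<notin> C \<Longrightarrow> f x = 0" "smooth_on UNIV f"
    using assms by (metis test_functionsE)
  have "smooth_on \<Omega> (\<lambda>x. g x * f x)"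
    using assms smooth_on_subset[OF C(4)] by (intro smooth_on_mult) auto
  moreover have "smooth_on (- C) (\<lambda>x. g x * f x)"
    using C by (intro smooth_on_cong[OF _ smooth_on_const[of _ 0]])
      (auto intro: compact_imp_closed)
  ultimately have "smooth_on (\<Omega> \<union> - C) (\<lambda>x. g x * f x)"
    using assms(2) C(1) by (intro smooth_on_Un) (auto intro: compact_imp_closed)
  moreover have "\<Omega> \<union> - C = UNIV" using C(2) by auto
  ultimately show ?thesis using C by (intro test_functionsI[of _ C]) auto
qed

lemma test_functions_cmult: "f \<in> test_functions \<Omega> \<Longrightarrow> (\<lambda>x. c * f x) \<in> test_functions \<Omega>"
  by (erule test_functionsE, rule test_functionsI[of "\<lambda>x. c * f x"])
    (auto intro!: smooth_on_mult smooth_on_const)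

lemma test_functions_diff:
  "f \<in> test_functions \<Omega> \<Longrightarrow> g \<in> test_functions \<Omega> \<Longrightarrow> (\<lambda>x. f x - g x) \<in> test_functions \<Omega>"
  using test_functions_add[of f \<Omega> "\<lambda>x. (-1) * g x"] test_functions_cmult[of g \<Omega> "-1"] by simp

lemma test_functions_sum:
  "(\<And>i. i \<in> I \<Longrightarrow> f i \<in> test_functions \<Omega>) \<Longrightarrow> (\<lambda>x. \<Sum>i\<in>I. f i x) \<in> test_functions \<Omega>"
  by (induct I rule: infinite_finite_induct) (auto intro: test_functions_0 test_functions_add)

lemma test_functions_dderiv:
  assumes "f \<in> test_functions \<Omega>"
  shows "dderiv e f \<in> test_functions \<Omega>"
proof -
  obtain C where C: "compact C" "C \<subseteq> \<Omega>" "\<And>x. x \<notin> C \<Longrightarrow> f x = 0" "smooth_on UNIV f"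
    using assms by (metis test_functionsE)
  have "dderiv e f x = 0" if "x \<notin> C" for x
    using dderiv_cong[of "- C" x f "\<lambda>_. 0" e] C that compact_imp_closed[OF C(1)]
    by (auto simp: dderiv_def)
  then show ?thesis
    using C smooth_on_dderiv by (intro test_functionsI[of _ C]) auto
qed

lemma continuous_compact_support_bounded:
  fixes f :: "'x::euclidean_space \<Rightarrow> real"
  assumes "continuous_on UNIV f" "compact C" "\<And>x. x \<notin> C \<Longrightarrow> f x = 0"
  obtains B where "B > 0" "\<And>x. \<bar>f x\<bar> \<le> B"
proof -
  have "compact (f ` C)" using assms by (meson compact_continuous_image continuous_on_subset subset_UNIV)
  then obtain B where "B > 0" "\<forall>y\<in>f ` C. norm y \<le> B" using compact_imp_bounded bounded_pos by metis
  then have "\<bar>f x\<bar> \<le> B" for x using assms(3)[of x] by (cases "x \<in> C") auto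
  then show ?thesis using \<open>B > 0\<close> that by blast
qed

lemma test_functions_bounded:
  assumes "f \<in> test_functions \<Omega>"
  obtains B where "B > 0" "\<And>x. \<bar>f x\<bar> \<le> B"
  using assms continuous_compact_support_bounded smooth_on_continuous by (metis test_functionsE)

text \<open>Over a finite cover of \<open>K\<close> by balls, the product of the factors 1 -
  \<open>ball_cutoff\<close> is 0 as soon as one cutoff is 1 and is 1 where all of them vanish. This
  needs neither mollification nor a partition of unity.\<close>

lemma smooth_urysohn:
  fixes U :: "'x::euclidean_space set"
  assumes "compact K" "open U" "K \<subseteq> U"
  obtains \<phi> where "\<phi> \<in> test_functions U" "\<And>x. 0 \<le> \<phi> x" "\<And>x. \<phi> x \<le> 1" "\<And>x. x \<in> K \<Longrightarrow> \<phi> x = 1"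
proof -
  have "\<exists>r>0. cball x (2 * r) \<subseteq> U" if x: "x \<in> U" for x
  proof -
    obtain e where "e > 0" "cball x e \<subseteq> U" using x assms(2) open_contains_cball by blast
    then show ?thesis by (intro exI[of _ "e / 2"]) auto
  qed
  then obtain r where r: "\<And>x. x \<in> U \<Longrightarrow> r x > 0 \<and> cball x (2 * r x) \<subseteq> U" by metis
  obtain D where D: "D \<subseteq> K" "finite D" "K \<subseteq> (\<Union>x\<in>D. ball x (r x))"
  proof (rule compactE_image[OF assms(1)])
    show "K \<subseteq> (\<Union>x\<in>K. ball x (r x))" using r assms(3) by force
  qed auto
  define \<phi> where "\<phi> x = 1 - (\<Prod>a\<in>D. 1 - ball_cutoff a (r a) x)" for x
  have D': "a \<in> U" if "a \<in> D" for a using D assms that by auto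
  have p: "0 \<le> (\<Prod>a\<in>D. 1 - ball_cutoff a (r a) x)" "(\<Prod>a\<in>D. 1 - ball_cutoff a (r a) x) \<le> 1" for x
    using ball_cutoff_bounds by (auto intro!: prod_nonneg prod_le_1)
  show ?thesis
  proof
    show "\<phi> \<in> test_functions U"
    proof (rule test_functionsI)
      show "smooth_on UNIV \<phi>" unfolding \<phi>_def
        by (intro smooth_on_diff smooth_on_prod smooth_on_const open_UNIV smooth_on_ball_cutoff)
      show "compact (\<Union>a\<in>D. cball a (2 * r a))" using D by auto
      show "(\<Union>a\<in>D. cball a (2 * r a)) \<subseteq> U" using r D' by blast
      show "\<phi> x = 0" if "x \<notin> (\<Union>a\<in>D. cball a (2 * r a))" for x
      proof -
        have "ball_cutoff a (r a) x = 0" if "a \<in> D" for a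
          using \<open>x \<notin> _\<close> that r[OF D'[OF that]]
          by (intro ball_cutoff_0) (auto simp: dist_norm norm_minus_commute)
        then show ?thesis by (simp add: \<phi>_def)
      qed
    qed
    show "0 \<le> \<phi> x" "\<phi> x \<le> 1" for x using p[of x] by (auto simp: \<phi>_def)
    show "\<phi> x = 1" if x: "x \<in> K" for x
    proof -
      obtain a where a: "a \<in> D" "x \<in> ball a (r a)" using D x by blast
      then have "ball_cutoff a (r a) x = 1"
        using r[OF D'[OF a(1)]] by (intro ball_cutoff_1) (auto simp: dist_norm norm_minus_commute)
      then have "(\<Prod>a\<in>D. 1 - ball_cutoff a (r a) x) = 0"
        using a D by (intro prod_zero) auto
      then show ?thesis by (simp add: \<phi>_def)
    qed
  qed
qed

section \<open>Square roots of extended nonnegative reals\<close>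

lemma ennreal_power2_le_iff: "(a::ennreal)\<^sup>2 \<le> b\<^sup>2 \<longleftrightarrow> a \<le> b"
proof
  assume "a \<le> b" then show "a\<^sup>2 \<le> b\<^sup>2" by (rule power_mono) simp
next
  assume *: "a\<^sup>2 \<le> b\<^sup>2"
  show "a \<le> b"
  proof (cases a; cases b)
    fix x y :: real assume "a = ennreal x" "b = ennreal y" "0 \<le> x" "0 \<le> y"
    then show ?thesis using * by (auto simp: ennreal_power intro: power2_le_imp_le)
  next
    fix y :: real assume "a = \<top>" "b = ennreal y" "0 \<le> y"
    then show ?thesis using * by (auto simp: ennreal_power top_unique)
  qed auto
qed

lemma ennsqrt_power2: "(ennsqrt x)\<^sup>2 = x"
  by (cases x) (auto simp: ennsqrt_def ennreal_power)

lemma ennsqrt_power2': "ennsqrt (x\<^sup>2) = x"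
  by (metis antisym ennreal_power2_le_iff ennsqrt_power2 order_refl)

lemma ennsqrt_le_iff: "ennsqrt x \<le> ennsqrt y \<longleftrightarrow> x \<le> y"
  by (metis ennreal_power2_le_iff ennsqrt_power2)

lemma ennsqrt_mult: "ennsqrt (x * y) = ennsqrt x * ennsqrt y"
  by (metis ennsqrt_power2 ennsqrt_power2' power_mult_distrib)

lemma ennsqrt_ennreal: "0 \<le> x \<Longrightarrow> ennsqrt (ennreal x) = ennreal (sqrt x)"
  by (simp add: ennsqrt_def)

lemma ennsqrt_0: "ennsqrt 0 = 0" by (simp add: ennsqrt_def)

lemma ennsqrt_eq_0_iff: "ennsqrt x = 0 \<longleftrightarrow> x = 0"
  by (metis ennsqrt_power2 ennsqrt_0 power_zero_numeral)

lemma ennsqrt_less_top_iff: "ennsqrt x < \<top> \<longleftrightarrow> x < \<top>"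
  by (cases x) (auto simp: ennsqrt_def)

subsection \<open>The unweighted norm\<close>

text \<open>All weighted norms on subsets are reduced to this one by moving the indicator and the
  square root of the weight into the function. The triangle inequality and the Cauchy-Schwarz
  inequality are then proved once.\<close>

definition nrm :: "('x::euclidean_space \<Rightarrow> 'b::real_normed_vector) \<Rightarrow> ennreal" where
  "nrm f = ennsqrt (\<integral>\<^sup>+x. ennreal ((norm (f x))\<^sup>2) \<partial>lborel)"

lemma nrm_power2: "(nrm f)\<^sup>2 = (\<integral>\<^sup>+x. ennreal ((norm (f x))\<^sup>2) \<partial>lborel)"
  by (simp add: nrm_def ennsqrt_power2)

lemma L2norm_eq_nrm:
  assumes "\<And>x. x \<in> \<Omega> \<Longrightarrow> 0 \<le> w x"
  shows "L2norm \<Omega> w f = nrm (\<lambda>x. indicat_real \<Omega> x *\<^sub>R (sqrt (w x) *\<^sub>R f x))"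
  unfolding L2norm_def nrm_def
  by (intro arg_cong[where f=ennsqrt] nn_integral_cong)
    (use assms in \<open>auto simp: indicator_def power_mult_distrib\<close>)

lemma L2norm_one_eq_nrm: "L2norm \<Omega> (\<lambda>_. 1) f = nrm (\<lambda>x. indicat_real \<Omega> x *\<^sub>R f x)"
  by (simp add: L2norm_eq_nrm)

lemma nrm_mono_AE:
  assumes "AE x in lborel. norm (f x) \<le> norm (g x)"
  shows "nrm f \<le> nrm g"
  unfolding nrm_def ennsqrt_le_iff
  by (rule nn_integral_mono_AE) (use assms in \<open>auto elim!: eventually_mono intro!: ennreal_leI power_mono\<close>)

lemma nrm_mono: "(\<And>x. norm (f x) \<le> norm (g x)) \<Longrightarrow> nrm f \<le> nrm g"
  by (rule nrm_mono_AE) simp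

lemma nrm_cong_AE: "AE x in lborel. f x = g x \<Longrightarrow> nrm f = nrm g"
  by (intro antisym nrm_mono_AE) (auto elim: eventually_mono)

lemma nrm_cong_norm: "(\<And>x. norm (f x) = norm (g x)) \<Longrightarrow> nrm f = nrm g"
  by (simp add: nrm_def)

lemma nrm_norm: "nrm (\<lambda>x. norm (f x)) = nrm f"
  by (rule nrm_cong_norm) simp

lemma nrm_0 [simp]: "nrm (\<lambda>x. 0) = 0"
  by (simp add: nrm_def ennsqrt_0)

lemma nrm_eq_0_AE:
  fixes f :: "'x::euclidean_space \<Rightarrow> 'b::real_normed_vector"
  assumes "(\<lambda>x. norm (f x)) \<in> borel_measurable borel" "nrm f = 0"
  shows "AE x in lborel. f x = 0"
proof -
  have "(\<integral>\<^sup>+x. ennreal ((norm (f x))\<^sup>2) \<partial>lborel) = 0"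
    using assms(2) by (simp add: nrm_def ennsqrt_eq_0_iff)
  then have "AE x in lborel. ennreal ((norm (f x))\<^sup>2) = 0"
    using assms(1) by (subst (asm) nn_integral_0_iff_AE) auto
  then show ?thesis by eventually_elim (auto simp: ennreal_eq_0_iff)
qed

text \<open>No measurability is assumed, so the constant is pulled out of the integral through the
  supremum over simple functions. That gives one inequality for every positive factor; applying it
  to the inverse factor gives the other.\<close>

lemma nrm_scaleR: "nrm (\<lambda>x. c *\<^sub>R f x) = ennreal \<bar>c\<bar> * nrm f"
proof -
  have "(\<integral>\<^sup>+x. ennreal ((norm (c *\<^sub>R f x))\<^sup>2) \<partial>lborel) = (\<integral>\<^sup>+x. ennreal (c\<^sup>2) * ennreal ((norm (f x))\<^sup>2) \<partial>lborel)"
    by (simp add: power_mult_distrib ennreal_mult)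
  also have "\<dots> = ennreal (c\<^sup>2) * (\<integral>\<^sup>+x. ennreal ((norm (f x))\<^sup>2) \<partial>lborel)"
    if "c \<noteq> 0"
  proof -
    have "(\<integral>\<^sup>+x. ennreal (c\<^sup>2) * g x \<partial>lborel) = ennreal (c\<^sup>2) * (\<integral>\<^sup>+x. g x \<partial>lborel)" for g :: "'a \<Rightarrow> ennreal"
    proof (rule antisym)
      have le: "ennreal k * integral\<^sup>N lborel h \<le> (\<integral>\<^sup>+x. ennreal k * h x \<partial>lborel)"
        if "k > 0" for k and h :: "'a \<Rightarrow> ennreal"
        unfolding nn_integral_def SUP_mult_left_ennreal
      proof (rule SUP_least, safe)
        fix s :: "'a \<Rightarrow> ennreal" assume s: "simple_function lborel s" "s \<le> h"
        show "ennreal k * integral\<^sup>S lborel s \<le> \<Squnion> (integral\<^sup>S lborel ` {g. simple_function lborel g \<and> g \<le> (\<lambda>x. ennreal k * h x)})"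
          using s by (intro SUP_upper2[of "\<lambda>x. ennreal k * s x"])
            (auto simp: le_fun_def intro!: mult_left_mono)
      qed
      show "ennreal (c\<^sup>2) * (\<integral>\<^sup>+x. g x \<partial>lborel) \<le> (\<integral>\<^sup>+x. ennreal (c\<^sup>2) * g x \<partial>lborel)"
        using that by (intro le) auto
      have "ennreal (1 / c\<^sup>2) * (\<integral>\<^sup>+x. ennreal (c\<^sup>2) * g x \<partial>lborel) \<le>
          (\<integral>\<^sup>+x. ennreal (1 / c\<^sup>2) * (ennreal (c\<^sup>2) * g x) \<partial>lborel)"
        using that by (intro le) auto
      also have "\<dots> = (\<integral>\<^sup>+x. g x \<partial>lborel)"
        using that by (simp add: mult.assoc[symmetric] ennreal_mult[symmetric])
      finally have "ennreal (c\<^sup>2) * (ennreal (1 / c\<^sup>2) * (\<integral>\<^sup>+x. ennreal (c\<^sup>2) * g x \<partial>lborel)) \<le>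
          ennreal (c\<^sup>2) * (\<integral>\<^sup>+x. g x \<partial>lborel)" by (rule mult_left_mono) simp
      then show "(\<integral>\<^sup>+x. ennreal (c\<^sup>2) * g x \<partial>lborel) \<le> ennreal (c\<^sup>2) * (\<integral>\<^sup>+x. g x \<partial>lborel)"
        using that by (simp add: mult.assoc[symmetric] ennreal_mult[symmetric])
    qed
    then show ?thesis .
  qed
  finally show ?thesis
    by (cases "c = 0") (auto simp: nrm_def ennsqrt_mult ennsqrt_ennreal ennsqrt_0)
qed

lemma nrm_Cauchy_Schwarz:
  fixes f g :: "'x::euclidean_space \<Rightarrow> real"
  assumes [measurable]: "f \<in> borel_measurable borel" "g \<in> borel_measurable borel"
  shows "(\<integral>\<^sup>+x. ennreal (\<bar>f x\<bar> * \<bar>g x\<bar>) \<partial>lborel) \<le> nrm f * nrm g"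
proof -
  have "(\<integral>\<^sup>+x. ennreal \<bar>f x\<bar> * ennreal \<bar>g x\<bar> \<partial>lborel)\<^sup>2 \<le> (nrm f)\<^sup>2 * (nrm g)\<^sup>2"
    unfolding nrm_power2
    by (rule order_trans[OF Cauchy_Schwarz_nn_integral]) (auto simp: ennreal_power)
  then show ?thesis
    by (simp add: ennreal_mult power_mult_distrib[symmetric] ennreal_power2_le_iff)
qed

lemma nrm_triangle_real:
  fixes f g :: "'x::euclidean_space \<Rightarrow> real"
  assumes [measurable]: "f \<in> borel_measurable borel" "g \<in> borel_measurable borel"
    and nn: "\<And>x. 0 \<le> f x" "\<And>x. 0 \<le> g x"
  shows "nrm (\<lambda>x. f x + g x) \<le> nrm f + nrm g"
proof -
  have "(nrm (\<lambda>x. f x + g x))\<^sup>2 = (\<integral>\<^sup>+x. ennreal ((f x)\<^sup>2) + (2 * ennreal (\<bar>f x\<bar> * \<bar>g x\<bar>) + ennreal ((g x)\<^sup>2)) \<partial>lborel)"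
    unfolding nrm_power2
  proof (rule nn_integral_cong)
    fix x
    have "2 * ennreal (\<bar>f x\<bar> * \<bar>g x\<bar>) = ennreal (2 * (f x * g x))"
      using nn[of x] by (subst ennreal_mult) auto
    then show "ennreal ((norm (f x + g x))\<^sup>2) = ennreal ((f x)\<^sup>2) + (2 * ennreal (\<bar>f x\<bar> * \<bar>g x\<bar>) + ennreal ((g x)\<^sup>2))"
      using nn[of x] by (simp add: ennreal_plus[symmetric] power2_sum del: ennreal_plus)
  qed
  also have "\<dots> = (nrm f)\<^sup>2 + (2 * (\<integral>\<^sup>+x. ennreal (\<bar>f x\<bar> * \<bar>g x\<bar>) \<partial>lborel) + (nrm g)\<^sup>2)"
    unfolding nrm_power2 by (simp add: nn_integral_add nn_integral_cmult)
  also have "\<dots> \<le> (nrm f)\<^sup>2 + (2 * (nrm f * nrm g) + (nrm g)\<^sup>2)"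
    by (intro add_mono order_refl mult_left_mono nrm_Cauchy_Schwarz) auto
  also have "\<dots> = (nrm f + nrm g)\<^sup>2" by (simp add: power2_sum algebra_simps)
  finally show ?thesis by (simp add: ennreal_power2_le_iff)
qed

lemma nrm_triangle:
  fixes f g :: "'x::euclidean_space \<Rightarrow> 'b::real_normed_vector"
  assumes "(\<lambda>x. norm (f x)) \<in> borel_measurable borel" "(\<lambda>x. norm (g x)) \<in> borel_measurable borel"
  shows "nrm (\<lambda>x. f x + g x) \<le> nrm f + nrm g"
proof -
  have "nrm (\<lambda>x. f x + g x) \<le> nrm (\<lambda>x. norm (f x) + norm (g x))"
    by (intro nrm_mono) (auto simp: norm_triangle_ineq)
  also have "\<dots> \<le> nrm (\<lambda>x. norm (f x)) + nrm (\<lambda>x. norm (g x))"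
    using assms by (intro nrm_triangle_real) auto
  finally show ?thesis by (simp add: nrm_norm)
qed

lemma nrm_minus: "nrm (\<lambda>x. - f x) = nrm f"
  by (rule nrm_cong_norm) simp

lemma nrm_minus_commute: "nrm (\<lambda>x. f x - g x) = nrm (\<lambda>x. g x - f x)"
  by (rule nrm_cong_norm) (simp add: norm_minus_commute)

lemma nrm_triangle_diff:
  fixes f g :: "'x::euclidean_space \<Rightarrow> 'b::{second_countable_topology, real_normed_vector}"
  assumes [measurable]: "f \<in> borel_measurable borel" "g \<in> borel_measurable borel"
    "h \<in> borel_measurable borel"
  shows "nrm (\<lambda>x. f x - h x) \<le> nrm (\<lambda>x. f x - g x) + nrm (\<lambda>x. g x - h x)"
  using nrm_triangle[of "\<lambda>x. f x - g x" "\<lambda>x. g x - h x"] by simp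

lemma nrm_sum:
  fixes f :: "'i \<Rightarrow> 'x::euclidean_space \<Rightarrow> 'b::{second_countable_topology, real_normed_vector}"
  assumes "finite I" "\<And>i. i \<in> I \<Longrightarrow> f i \<in> borel_measurable borel"
  shows "nrm (\<lambda>x. \<Sum>i\<in>I. f i x) \<le> (\<Sum>i\<in>I. nrm (f i))"
  using assms
proof (induct I rule: finite_induct)
  case (insert i I)
  then have [measurable]: "f i \<in> borel_measurable borel" "\<And>j. j \<in> I \<Longrightarrow> f j \<in> borel_measurable borel" by auto
  have "nrm (\<lambda>x. f i x + (\<Sum>i\<in>I. f i x)) \<le> nrm (f i) + nrm (\<lambda>x. \<Sum>i\<in>I. f i x)"
    by (intro nrm_triangle) measurable
  also have "\<dots> \<le> nrm (f i) + (\<Sum>i\<in>I. nrm (f i))"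
    using insert by (intro add_left_mono) auto
  finally show ?case using insert by simp
qed simp

lemma nrm_integrable_mult:
  fixes f g :: "'x::euclidean_space \<Rightarrow> real"
  assumes [measurable]: "f \<in> borel_measurable borel" "g \<in> borel_measurable borel"
    and "nrm f < \<infinity>" "nrm g < \<infinity>"
  shows "integrable lborel (\<lambda>x. f x * g x)"
    and "ennreal \<bar>\<integral>x. f x * g x \<partial>lborel\<bar> \<le> nrm f * nrm g"
proof -
  have le: "(\<integral>\<^sup>+x. ennreal (norm (f x * g x)) \<partial>lborel) \<le> nrm f * nrm g"
    using nrm_Cauchy_Schwarz[of f g] by (simp add: abs_mult)
  also have "\<dots> < \<infinity>" using assms by (simp add: ennreal_mult_less_top)
  finally show int: "integrable lborel (\<lambda>x. f x * g x)" by (intro integrableI_bounded) auto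
  show "ennreal \<bar>\<integral>x. f x * g x \<partial>lborel\<bar> \<le> nrm f * nrm g"
    using order_trans[OF integral_norm_bound_ennreal[OF int] le] by simp
qed

text \<open>Convergence of the norms makes them finite only eventually, hence the eventual form of
  the second conclusion.\<close>

lemma tendsto_integral_mult_0:
  fixes d :: "nat \<Rightarrow> 'x::euclidean_space \<Rightarrow> real"
  assumes [measurable]: "\<And>k. d k \<in> borel_measurable borel" "h \<in> borel_measurable borel"
    and h: "nrm h < \<infinity>" and lim: "(\<lambda>k. nrm (d k)) \<longlonglongrightarrow> 0"
  shows "(\<lambda>k. LBINT x. d k x * h x) \<longlonglongrightarrow> 0"
    and "\<forall>\<^sub>F k in sequentially. integrable lborel (\<lambda>x. d k x * h x)"
proof -
  have ev: "\<forall>\<^sub>F k in sequentially. nrm (d k) < \<infinity>" using order_tendstoD(2)[OF lim, of \<infinity>] by simp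
  then show "\<forall>\<^sub>F k in sequentially. integrable lborel (\<lambda>x. d k x * h x)"
    by eventually_elim (intro nrm_integrable_mult(1) h; simp)
  have "(\<lambda>k. nrm (d k) * nrm h) \<longlonglongrightarrow> 0 * nrm h"
    using h lim by (intro tendsto_mult_ennreal tendsto_const) auto
  then have lim0: "(\<lambda>k. nrm (d k) * nrm h) \<longlonglongrightarrow> 0" by simp
  have "\<forall>\<^sub>F k in sequentially. ennreal \<bar>\<integral>x. d k x * h x \<partial>lborel\<bar> \<le> nrm (d k) * nrm h"
    using ev by eventually_elim (intro nrm_integrable_mult(2) h; simp)
  then have "(\<lambda>k. ennreal \<bar>\<integral>x. d k x * h x \<partial>lborel\<bar>) \<longlonglongrightarrow> 0"
    by (rule tendsto_sandwich[OF always_eventually _ tendsto_const lim0, rotated]) simp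
  then have "(\<lambda>k. \<bar>\<integral>x. d k x * h x \<partial>lborel\<bar>) \<longlonglongrightarrow> 0"
    by (subst (asm) ennreal_0[symmetric], subst (asm) tendsto_ennreal_iff) auto
  then show "(\<lambda>k. LBINT x. d k x * h x) \<longlonglongrightarrow> 0" by (simp add: tendsto_rabs_zero_iff)
qed

lemma tendsto_integral_mult_nrm:
  fixes f :: "nat \<Rightarrow> 'x::euclidean_space \<Rightarrow> real"
  assumes [measurable]: "\<And>k. f k \<in> borel_measurable borel" "g \<in> borel_measurable borel"
    "h \<in> borel_measurable borel"
    and fin: "\<And>k. nrm (f k) < \<infinity>" "nrm g < \<infinity>" "nrm h < \<infinity>"
    and lim: "(\<lambda>k. nrm (\<lambda>x. f k x - g x)) \<longlonglongrightarrow> 0"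
  shows "(\<lambda>k. LBINT x. f k x * h x) \<longlonglongrightarrow> (LBINT x. g x * h x)"
proof -
  have "(\<lambda>k. (LBINT x. (f k x - g x) * h x) + (LBINT x. g x * h x)) \<longlonglongrightarrow> 0 + (LBINT x. g x * h x)"
    by (intro tendsto_add tendsto_const tendsto_integral_mult_0(1) fin(3) lim) measurable
  moreover have "(LBINT x. (f k x - g x) * h x) + (LBINT x. g x * h x) = (LBINT x. f k x * h x)" for k
    using nrm_integrable_mult(1)[of "f k" h] nrm_integrable_mult(1)[of g h] fin
    by (simp add: left_diff_distrib)
  ultimately show ?thesis by simp
qed

subsection \<open>Density of test functions\<close>

definition test_approx :: "'x::euclidean_space set \<Rightarrow> ('x \<Rightarrow> real) \<Rightarrow> bool" where
  "test_approx \<Omega> f \<longleftrightarrow> (\<forall>e>0. \<exists>\<phi>\<in>test_functions \<Omega>. nrm (\<lambda>x. \<phi> x - f x) < ennreal e)"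

lemma test_approx_add:
  assumes [measurable]: "f \<in> borel_measurable borel" "g \<in> borel_measurable borel"
    and "test_approx \<Omega> f" "test_approx \<Omega> g"
  shows "test_approx \<Omega> (\<lambda>x. f x + g x)"
  unfolding test_approx_def
proof (intro allI impI)
  fix e :: real assume "e > 0"
  then have e2: "e / 2 > 0" by simp
  from assms(3)[unfolded test_approx_def, rule_format, OF e2]
    assms(4)[unfolded test_approx_def, rule_format, OF e2]
  obtain \<phi> \<psi> where p: "\<phi> \<in> test_functions \<Omega>" "nrm (\<lambda>x. \<phi> x - f x) < ennreal (e / 2)"
    "\<psi> \<in> test_functions \<Omega>" "nrm (\<lambda>x. \<psi> x - g x) < ennreal (e / 2)" by blast
  note [measurable] = test_functions_measurable[OF p(1)] test_functions_measurable[OF p(3)]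
  have "nrm (\<lambda>x. (\<phi> x + \<psi> x) - (f x + g x)) = nrm (\<lambda>x. (\<phi> x - f x) + (\<psi> x - g x))"
    by (rule nrm_cong_norm) (simp add: algebra_simps)
  also have "\<dots> \<le> nrm (\<lambda>x. \<phi> x - f x) + nrm (\<lambda>x. \<psi> x - g x)"
    by (rule nrm_triangle) measurable
  also have "\<dots> < ennreal (e / 2) + ennreal (e / 2)"
    using p by (intro add_strict_mono) auto
  also have "\<dots> = ennreal e" using \<open>e > 0\<close> by (simp add: ennreal_plus[symmetric] del: ennreal_plus)
  finally show "\<exists>\<phi>\<in>test_functions \<Omega>. nrm (\<lambda>x. \<phi> x - (f x + g x)) < ennreal e"
    by (intro bexI[OF _ test_functions_add[OF p(1,3)]])
qed

lemma test_approx_cmult: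
  assumes "test_approx \<Omega> f"
  shows "test_approx \<Omega> (\<lambda>x. c * f x)"
  unfolding test_approx_def
proof (intro allI impI)
  fix e :: real assume "e > 0"
  then have "e / (\<bar>c\<bar> + 1) > 0" by simp
  then obtain \<phi> where p: "\<phi> \<in> test_functions \<Omega>" "nrm (\<lambda>x. \<phi> x - f x) < ennreal (e / (\<bar>c\<bar> + 1))"
    using assms[unfolded test_approx_def, rule_format, of "e / (\<bar>c\<bar> + 1)"] by blast
  have "nrm (\<lambda>x. c * \<phi> x - c * f x) = ennreal \<bar>c\<bar> * nrm (\<lambda>x. \<phi> x - f x)"
    using nrm_scaleR[of c "\<lambda>x. \<phi> x - f x"] by (simp add: algebra_simps)
  also have "\<dots> \<le> ennreal \<bar>c\<bar> * ennreal (e / (\<bar>c\<bar> + 1))"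
    using p by (intro mult_left_mono) auto
  also have "\<dots> = ennreal (\<bar>c\<bar> * (e / (\<bar>c\<bar> + 1)))" using \<open>e > 0\<close> by (subst ennreal_mult) auto
  also have "\<dots> < ennreal e"
    using \<open>e > 0\<close> by (intro ennreal_lessI) (auto simp: field_simps)
  finally show "\<exists>\<phi>\<in>test_functions \<Omega>. nrm (\<lambda>x. \<phi> x - c * f x) < ennreal e"
    by (intro bexI[OF _ test_functions_cmult[OF p(1)]])
qed

lemma test_approx_limit:
  fixes f :: "'x::euclidean_space \<Rightarrow> real"
  assumes [measurable]: "\<And>k. F k \<in> borel_measurable borel" "f \<in> borel_measurable borel"
    and F: "\<And>k. test_approx \<Omega> (F k)" "(\<lambda>k. nrm (\<lambda>x. F k x - f x)) \<longlonglongrightarrow> 0"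
  shows "test_approx \<Omega> f"
  unfolding test_approx_def
proof (intro allI impI)
  fix e :: real assume "e > 0"
  then have "0 < ennreal (e / 2)" by simp
  from order_tendstoD(2)[OF F(2) this]
  obtain k where k: "nrm (\<lambda>x. F k x - f x) < ennreal (e / 2)"
    by (auto simp: eventually_sequentially)
  obtain \<phi> where p: "\<phi> \<in> test_functions \<Omega>" "nrm (\<lambda>x. \<phi> x - F k x) < ennreal (e / 2)"
    using F(1)[of k, unfolded test_approx_def, rule_format, of "e / 2"] \<open>e > 0\<close> by auto
  note [measurable] = test_functions_measurable[OF p(1)]
  have "nrm (\<lambda>x. \<phi> x - f x) \<le> nrm (\<lambda>x. \<phi> x - F k x) + nrm (\<lambda>x. F k x - f x)"
    by (rule nrm_triangle_diff) auto
  also have "\<dots> < ennreal (e / 2) + ennreal (e / 2)"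
    using p k by (intro add_strict_mono) auto
  also have "\<dots> = ennreal e" using \<open>e > 0\<close> by (simp add: ennreal_plus[symmetric] del: ennreal_plus)
  finally show "\<exists>\<phi>\<in>test_functions \<Omega>. nrm (\<lambda>x. \<phi> x - f x) < ennreal e"
    using p(1) by blast
qed

text \<open>Inner and outer regularity place \<open>B\<close> between a compact set and an open set.
  A smooth Urysohn function between these differs from the indicator only on the two small
  difference sets, and there by at most 1.\<close>

lemma test_approx_indicator:
  fixes \<Omega> :: "'x::euclidean_space set"
  assumes "open \<Omega>" "B \<in> sets borel" "B \<subseteq> \<Omega>" "emeasure lborel B < \<infinity>"
  shows "test_approx \<Omega> (indicat_real B)"
  unfolding test_approx_def
proof (intro allI impI)
  fix e :: real assume "e > 0"
  \<comment> \<open>Each of the two error sets receives measure at most \<open>d\<close>, so the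
    squared distance is at most half of the square of \<open>e\<close>, which leaves room for the
    strict inequality.\<close>
  define d where "d = e\<^sup>2 / 4"
  have d: "d > 0" using \<open>e > 0\<close> by (simp add: d_def)
  \<comment> \<open>Inner regularity is applied to a finite measure, namely Lebesgue measure
    restricted to \<open>B\<close>.\<close>
  have "finite_measure (density lborel (indicator B))"
    using assms by (intro finite_measureI) (auto simp: emeasure_density nn_integral_indicator)
  then have "emeasure (density lborel (indicator B)) B =
      (SUP K\<in>{K. K \<subseteq> B \<and> compact K}. emeasure (density lborel (indicator B)) K)"
    using assms by (intro inner_regular) (auto simp: finite_measure.emeasure_finite)
  also have "\<dots> = (SUP K\<in>{K. K \<subseteq> B \<and> compact K}. emeasure lborel K)"
  proof (intro SUP_cong refl)
    fix K assume K: "K \<in> {K. K \<subseteq> B \<and> compact K}"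
    then have "emeasure (density lborel (indicator B)) K = (\<integral>\<^sup>+x. indicator K x \<partial>lborel)"
      using assms(2) borel_compact[of K]
      by (subst emeasure_density) (auto intro!: nn_integral_cong simp del: nn_integral_indicator split: split_indicator)
    then show "emeasure (density lborel (indicator B)) K = emeasure lborel K"
      using K borel_compact[of K] by simp
  qed
  also have "emeasure (density lborel (indicator B)) B = (\<integral>\<^sup>+x. indicator B x \<partial>lborel)"
    using assms(2) by (subst emeasure_density) (auto intro!: nn_integral_cong simp del: nn_integral_indicator split: split_indicator)
  finally have sup: "emeasure lborel B = (SUP K\<in>{K. K \<subseteq> B \<and> compact K}. emeasure lborel K)"
    using assms(2) by simp
  have "\<exists>K. K \<subseteq> B \<and> compact K \<and> emeasure lborel B < emeasure lborel K + ennreal d"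
  proof (cases "emeasure lborel B = 0")
    case True
    then show ?thesis using d by (intro exI[of _ "{}"]) auto
  next
    case False
    then have "emeasure lborel B - ennreal d < emeasure lborel B"
      using assms(4) d by (intro ennreal_between) (auto simp: zero_less_iff_neq_zero)
    then obtain K where "K \<subseteq> B" "compact K" "emeasure lborel B - ennreal d < emeasure lborel K"
      unfolding sup less_SUP_iff by blast
    moreover from this have "emeasure lborel B < emeasure lborel K + ennreal d"
      using ennreal_minus_mono[of "emeasure lborel K + ennreal d" "emeasure lborel B" "ennreal d" "ennreal d"]
      by (intro ccontr[of "emeasure lborel B < _"]) (auto simp: not_less)
    ultimately show ?thesis by blast
  qed
  then obtain K where K: "K \<subseteq> B" "compact K" "emeasure lborel B < emeasure lborel K + ennreal d" by blast
  have mK: "K \<in> sets borel" using K(2) by (auto intro: borel_compact)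
  have BK: "emeasure lborel (B - K) \<le> ennreal d"
  proof -
    have "emeasure lborel (B - K) = emeasure lborel B - emeasure lborel K"
    proof (intro emeasure_Diff)
      have "emeasure lborel K \<le> emeasure lborel B" using K(1) assms(2) by (intro emeasure_mono) auto
      then show "emeasure lborel K \<noteq> \<infinity>" using assms(4) by auto
    qed (use K mK assms(2) in auto)
    also have "\<dots> \<le> ennreal d" using K(3) assms(4) by (auto simp add: ennreal_minus_le_iff less_imp_le)
    finally show ?thesis .
  qed
  obtain U0 where U0: "open U0" "B \<subseteq> U0" "emeasure lborel (U0 - B) < ennreal d"
    using outer_regular_lborel[OF assms(2) d] by blast
  have "open (U0 \<inter> \<Omega>)" "K \<subseteq> U0 \<inter> \<Omega>" using K(1) U0(1,2) assms(1,3) by auto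
  from smooth_urysohn[OF K(2) this]
  obtain \<phi> where \<phi>: "\<phi> \<in> test_functions (U0 \<inter> \<Omega>)" "\<And>x. 0 \<le> \<phi> x" "\<And>x. \<phi> x \<le> 1" "\<And>x. x \<in> K \<Longrightarrow> \<phi> x = 1"
    by blast
  have "(nrm (\<lambda>x. \<phi> x - indicat_real B x))\<^sup>2 \<le> (\<integral>\<^sup>+x. indicator (B - K) x + indicator (U0 - B) x \<partial>lborel)"
    unfolding nrm_power2
  proof (rule nn_integral_mono)
    fix x
    have sq: "(\<phi> x - 1)\<^sup>2 \<le> 1" "(\<phi> x)\<^sup>2 \<le> 1"
      using \<phi>(2,3)[of x] by (auto intro!: power_le_one simp: power2_commute[of "\<phi> x"] )
    have z: "x \<notin> U0 \<Longrightarrow> \<phi> x = 0" using test_functions_zero[OF \<phi>(1)] by auto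
    show "ennreal ((norm (\<phi> x - indicat_real B x))\<^sup>2) \<le> indicator (B - K) x + indicator (U0 - B) x"
      using sq z \<phi>(4)[of x] K(1) U0(2) by (auto simp: indicator_def ennreal_le_1)
  qed
  also have "\<dots> = emeasure lborel (B - K) + emeasure lborel (U0 - B)"
  proof -
    have [measurable]: "U0 - B \<in> sets borel" "B - K \<in> sets borel"
      using assms(2) mK borel_open[OF U0(1)] by auto
    show ?thesis by (subst nn_integral_add) auto
  qed
  also have "\<dots> \<le> ennreal d + ennreal d" using BK U0(3) by (intro add_mono) auto
  also have "\<dots> = ennreal (e\<^sup>2 / 2)" using d by (simp add: ennreal_plus[symmetric] d_def del: ennreal_plus)
  also have "\<dots> = (ennreal (sqrt (e\<^sup>2 / 2)))\<^sup>2" by (simp add: ennreal_power)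
  finally have "nrm (\<lambda>x. \<phi> x - indicat_real B x) \<le> ennreal (sqrt (e\<^sup>2 / 2))"
    by (simp only: ennreal_power2_le_iff)
  also have "\<dots> < ennreal e"
    using \<open>e > 0\<close> by (intro ennreal_lessI) (auto intro!: real_less_lsqrt)
  finally show "\<exists>\<phi>\<in>test_functions \<Omega>. nrm (\<lambda>x. \<phi> x - indicat_real B x) < ennreal e"
    using test_functions_mono[OF _ \<phi>(1), of \<Omega>] by auto
qed

text \<open>The two side conditions are implications so that they take part in the induction over
  measurable functions. They pass to summands and to approximations from below because all functions
  involved are nonnegative.\<close>

lemma test_approx_nonneg:
  fixes f :: "'x::euclidean_space \<Rightarrow> real"
  assumes \<Omega>: "open \<Omega>" and f: "f \<in> borel_measurable borel" "\<And>x. 0 \<le> f x"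
  shows "nrm f < \<infinity> \<longrightarrow> (\<forall>x. x \<notin> \<Omega> \<longrightarrow> f x = 0) \<longrightarrow> test_approx \<Omega> f"
  using f
proof (induct rule: borel_measurable_induct_real)
  case (set A)
  show ?case
  proof (intro impI)
    assume a: "nrm (indicat_real A) < \<infinity>" "\<forall>x. x \<notin> \<Omega> \<longrightarrow> indicat_real A x = 0"
    have "(nrm (indicat_real A))\<^sup>2 = (\<integral>\<^sup>+x. indicator A x \<partial>lborel)"
      unfolding nrm_power2 by (intro nn_integral_cong) (auto simp: indicator_def)
    also have "\<dots> = emeasure lborel A" using set by simp
    finally have "emeasure lborel A < \<infinity>"
      using a(1) by (metis infinity_ennreal_def ennreal_mult_less_top power2_eq_square)
    then show "test_approx \<Omega> (indicat_real A)"
      using set a \<Omega> by (intro test_approx_indicator) (auto simp: indicator_def split: if_splits)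
  qed
next
  case (mult u c)
  show ?case
  proof (intro impI)
    assume a: "nrm (\<lambda>x. c * u x) < \<infinity>" "\<forall>x. x \<notin> \<Omega> \<longrightarrow> c * u x = 0"
    show "test_approx \<Omega> (\<lambda>x. c * u x)"
    proof (cases "c = 0")
      case True
      then show ?thesis using test_functions_0[of \<Omega>] by (auto simp: test_approx_def intro!: bexI[of _ "\<lambda>_. 0"])
    next
      case False
      then have "nrm u < \<infinity>"
        using a(1) nrm_scaleR[of c u] mult(1) by (auto simp: ennreal_mult_less_top)
      then show ?thesis using mult(4) a False by (intro test_approx_cmult) auto
    qed
  qed
next
  case (add u v)
  show ?case
  proof (intro impI)
    assume a: "nrm (\<lambda>x. v x + u x) < \<infinity>" "\<forall>x. x \<notin> \<Omega> \<longrightarrow> v x + u x = 0"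
    have "nrm u \<le> nrm (\<lambda>x. v x + u x)" "nrm v \<le> nrm (\<lambda>x. v x + u x)"
      using add(2,5) by (auto intro!: nrm_mono simp: abs_of_nonneg)
    moreover have "\<forall>x. x \<notin> \<Omega> \<longrightarrow> u x = 0" "\<forall>x. x \<notin> \<Omega> \<longrightarrow> v x = 0"
      using a(2) add(2,5) by (metis add_nonneg_eq_0_iff)+
    ultimately show "test_approx \<Omega> (\<lambda>x. v x + u x)"
      using add(1,3,4,7) a(1) by (intro test_approx_add) auto
  qed
next
  case (seq U)
  note [measurable] = seq(1) f(1)
  show ?case
  proof (intro impI)
    assume a: "nrm f < \<infinity>" "\<forall>x. x \<notin> \<Omega> \<longrightarrow> f x = 0"
    have U_le: "U i x \<le> f x" for i x
      using seq(4,5) by (intro incseq_le) (auto simp: incseq_def le_fun_def)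
    have lim: "(\<lambda>k. \<integral>\<^sup>+x. ennreal ((norm (U k x - f x))\<^sup>2) \<partial>lborel) \<longlonglongrightarrow> (\<integral>\<^sup>+(x :: 'x). ennreal 0 \<partial>lborel)"
    proof (rule nn_integral_dominated_convergence[where w="\<lambda>x. ennreal ((norm (f x))\<^sup>2)"
            and u="\<lambda>k x. ennreal ((norm (U k x - f x))\<^sup>2)" and u'="\<lambda>x. ennreal 0"])
      show "(\<integral>\<^sup>+x. ennreal ((norm (f x))\<^sup>2) \<partial>lborel) < \<infinity>"
        using a(1) by (simp add: nrm_def ennsqrt_less_top_iff)
      show "AE x in lborel. ennreal ((norm (U k x - f x))\<^sup>2) \<le> ennreal ((norm (f x))\<^sup>2)" for k
      proof (intro AE_I2 ennreal_leI power_mono)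
        show "norm (U k x - f x) \<le> norm (f x)" for x
          using U_le[of k x] seq(2)[of k x] f(2)[of x] by simp
      qed simp
      have "(\<lambda>k. ennreal ((norm (U k x - f x))\<^sup>2)) \<longlonglongrightarrow> ennreal 0" for x
      proof (rule tendsto_ennrealI)
        have "(\<lambda>k. (norm (U k x - f x))\<^sup>2) \<longlonglongrightarrow> (norm (f x - f x))\<^sup>2"
          using seq(5)[of x] by (intro tendsto_intros) auto
        then show "(\<lambda>k. (norm (U k x - f x))\<^sup>2) \<longlonglongrightarrow> 0" by simp
      qed
      then show "AE x in lborel. (\<lambda>k. ennreal ((norm (U k x - f x))\<^sup>2)) \<longlonglongrightarrow> ennreal 0" by simp
    qed measurable
    show "test_approx \<Omega> f"
    proof (rule test_approx_limit[where F=U])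
      show "test_approx \<Omega> (U k)" for k
      proof -
        have "nrm (U k) \<le> nrm f" using U_le seq(2) f(2) by (intro nrm_mono) (auto simp: abs_of_nonneg)
        moreover have "\<forall>x. x \<notin> \<Omega> \<longrightarrow> U k x = 0" using a(2) U_le seq(2) by (metis antisym)
        ultimately show ?thesis using seq(3)[of k] a(1) by auto
      qed
      show "(\<lambda>k. nrm (\<lambda>x. U k x - f x)) \<longlonglongrightarrow> 0"
      proof (rule order_tendstoI)
        fix e :: ennreal assume "0 < e"
        then have "0 < e\<^sup>2" by (simp add: zero_less_iff_neq_zero)
        from order_tendstoD(2)[OF lim, of "e\<^sup>2"] this
        have "\<forall>\<^sub>F k in sequentially. (nrm (\<lambda>x. U k x - f x))\<^sup>2 < e\<^sup>2" by (simp add: nrm_power2)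
        then show "\<forall>\<^sub>F k in sequentially. nrm (\<lambda>x. U k x - f x) < e"
          by eventually_elim (metis ennreal_power2_le_iff not_le)
      qed auto
    qed auto
  qed
qed

theorem test_functions_dense:
  fixes f :: "'x::euclidean_space \<Rightarrow> real"
  assumes "open \<Omega>" and [measurable]: "f \<in> borel_measurable borel"
    and "nrm f < \<infinity>" "\<And>x. x \<notin> \<Omega> \<Longrightarrow> f x = 0"
  shows "test_approx \<Omega> f"
proof -
  have "test_approx \<Omega> (\<lambda>x. max 0 (f x))" "test_approx \<Omega> (\<lambda>x. max 0 (- f x))"
    using assms by (intro test_approx_nonneg[rule_format]; auto intro: le_less_trans[OF nrm_mono, of _ f])+
  from test_approx_add[OF _ _ this(1) test_approx_cmult[OF this(2), of "-1"]]
  have "test_approx \<Omega> (\<lambda>x. max 0 (f x) + (- 1) * max 0 (- f x))" by simp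
  moreover have "max 0 (f x) + (- 1) * max 0 (- f x) = f x" for x by (auto simp: max_def)
  ultimately show ?thesis by simp
qed

text \<open>The geometric rate makes the increments summable in norm; a bounded operator then maps
  the sequence to one that converges almost everywhere.\<close>

lemma test_functions_dense_sequence:
  fixes f :: "'x::euclidean_space \<Rightarrow> real"
  assumes "open \<Omega>" "f \<in> borel_measurable borel" "nrm f < \<infinity>" "\<And>x. x \<notin> \<Omega> \<Longrightarrow> f x = 0"
  obtains \<phi> where "\<And>k. \<phi> k \<in> test_functions \<Omega>" "\<And>k. nrm (\<lambda>x. \<phi> k x - f x) < ennreal ((1 / 2) ^ k)"
proof -
  have "\<exists>\<phi>\<in>test_functions \<Omega>. nrm (\<lambda>x. \<phi> x - f x) < ennreal ((1 / 2) ^ k)" for k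
    using test_functions_dense[OF assms] unfolding test_approx_def by simp
  then show ?thesis using that by metis
qed

lemma tendsto_0_geometric:
  fixes a :: "nat \<Rightarrow> ennreal"
  assumes "\<And>k. a k \<le> ennreal ((1 / 2) ^ k)"
  shows "a \<longlonglongrightarrow> 0"
proof (rule tendsto_sandwich[OF _ _ tendsto_const])
  have "(\<lambda>k. ennreal ((1 / 2) ^ k)) \<longlonglongrightarrow> ennreal 0"
    by (intro tendsto_ennrealI LIMSEQ_realpow_zero) auto
  then show "(\<lambda>k. ennreal ((1 / 2) ^ k)) \<longlonglongrightarrow> 0" by simp
qed (use assms in auto)

section \<open>Differentiation under the integral sign and integration by parts\<close>

lemma has_derivative_integral_parametric:
  fixes f :: "'a::euclidean_space \<Rightarrow> 'b \<Rightarrow> real"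
  assumes r: "r > 0"
    and int: "\<And>x. x \<in> ball x0 r \<Longrightarrow> integrable M (f x)"
    and der: "\<And>x y. x \<in> ball x0 r \<Longrightarrow> y \<in> space M \<Longrightarrow> ((\<lambda>x. f x y) has_derivative f' x y) (at x)"
    and bnd: "\<And>x y h. x \<in> ball x0 r \<Longrightarrow> y \<in> space M \<Longrightarrow> \<bar>f' x y h\<bar> \<le> b y * norm h"
    and b: "integrable M b"
    and meas: "\<And>h. (\<lambda>y. f' x0 y h) \<in> borel_measurable M"
  shows "((\<lambda>x. \<integral>y. f x y \<partial>M) has_derivative (\<lambda>h. \<integral>y. f' x0 y h \<partial>M)) (at x0)"
proof -
  have x0: "x0 \<in> ball x0 r" using r by simp
  have b0: "0 \<le> b y" if "y \<in> space M" for y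
    using bnd[OF x0 that, of "SOME i. i \<in> Basis"] by (auto simp: norm_Basis SOME_Basis)
  have lin: "linear (f' x0 y)" if "y \<in> space M" for y
    using der[OF x0 that] has_derivative_linear by blast
  have intf': "integrable M (\<lambda>y. f' x0 y h)" for h
  proof (rule Bochner_Integration.integrable_bound[of _ "\<lambda>y. b y * norm h"])
    show "AE y in M. norm (f' x0 y h) \<le> norm (b y * norm h)"
      using bnd[OF x0] b0 by (intro AE_I2) (simp add: abs_mult)
  qed (use b meas in auto)
  have bl: "bounded_linear (\<lambda>h. \<integral>y. f' x0 y h \<partial>M)"
  proof (rule bounded_linear_intro)
    fix u v :: 'a and c :: real
    have "(\<integral>y. f' x0 y (u + v) \<partial>M) = (\<integral>y. f' x0 y u + f' x0 y v \<partial>M)"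
      by (rule Bochner_Integration.integral_cong) (auto simp: linear_add[OF lin])
    then show "(\<integral>y. f' x0 y (u + v) \<partial>M) = (\<integral>y. f' x0 y u \<partial>M) + (\<integral>y. f' x0 y v \<partial>M)"
      by (simp add: intf')
    have "(\<integral>y. f' x0 y (c *\<^sub>R u) \<partial>M) = (\<integral>y. c * f' x0 y u \<partial>M)"
      by (rule Bochner_Integration.integral_cong) (auto simp: linear_cmul[OF lin])
    then show "(\<integral>y. f' x0 y (c *\<^sub>R u) \<partial>M) = c *\<^sub>R (\<integral>y. f' x0 y u \<partial>M)" by simp
    have "norm (\<integral>y. f' x0 y u \<partial>M) \<le> (\<integral>y. norm (f' x0 y u) \<partial>M)" by (rule integral_norm_bound)
    also have "\<dots> \<le> (\<integral>y. b y * norm u \<partial>M)"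
      by (rule integral_mono) (use b intf' bnd[OF x0] in auto)
    finally show "norm (\<integral>y. f' x0 y u \<partial>M) \<le> norm u * (\<integral>y. b y \<partial>M)" by (simp add: mult.commute)
  qed
  \<comment> \<open>By the mean value inequality the bound on the derivative also bounds the
    increments. Hence \<open>2 * b\<close> dominates the difference quotient minus the
    derivative.\<close>
  have lip: "\<bar>f x y - f x0 y\<bar> \<le> b y * norm (x - x0)" if "x \<in> ball x0 r" "y \<in> space M" for x y
  proof -
    have "norm (f x y - f x0 y) \<le> b y * norm (x - x0)"
    proof (rule differentiable_bound[OF convex_ball _ _ that(1) x0])
      show "((\<lambda>x. f x y) has_derivative f' x y) (at x within ball x0 r)" if "x \<in> ball x0 r" for x
        using der[OF that \<open>y \<in> space M\<close>] by (rule has_derivative_at_withinI)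
      show "onorm (f' x y) \<le> b y" if "x \<in> ball x0 r" for x
        using bnd[OF that \<open>y \<in> space M\<close>] by (intro onorm_le) (simp add: mult.commute)
    qed
    then show ?thesis by simp
  qed
  have "(\<lambda>h. norm ((\<integral>y. f (x0 + h) y \<partial>M) - (\<integral>y. f x0 y \<partial>M) - (\<integral>y. f' x0 y h \<partial>M)) / norm h) \<midarrow>0\<rightarrow> 0"
    unfolding tendsto_at_iff_sequentially
  proof (intro allI impI, unfold o_def)
    fix X :: "nat \<Rightarrow> 'a" assume X: "\<forall>i. X i \<in> UNIV - {0}" "X \<longlonglongrightarrow> 0"
    \<comment> \<open>The bounds hold only in the ball; the quotient is set to 0 for the finitely
      many n with x0 + X n outside.\<close>
    define q where "q n y = (if norm (X n) < r then
        (f (x0 + X n) y - f x0 y - f' x0 y (X n)) / norm (X n) else 0)" for n y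
    have in_ball: "x0 + X n \<in> ball x0 r" if "norm (X n) < r" for n
      using that by (simp add: dist_norm)
    have "(\<lambda>n. \<integral>y. q n y \<partial>M) \<longlonglongrightarrow> (\<integral>y. 0 \<partial>M)"
    proof (rule integral_dominated_convergence[where w="\<lambda>y. 2 * b y"])
      show "q n \<in> borel_measurable M" for n
        using int[OF in_ball, of n] int[OF x0] meas[of "X n"] unfolding q_def by (cases "norm (X n) < r") auto
      show "AE y in M. (\<lambda>n. q n y) \<longlonglongrightarrow> 0"
      proof (intro AE_I2)
        fix y assume y: "y \<in> space M"
        have "(\<lambda>h. norm (f (x0 + h) y - f x0 y - f' x0 y h) / norm h) \<midarrow>0\<rightarrow> 0"
          using der[OF x0 y] by (simp add: has_derivative_at)
        then have "(\<lambda>n. norm (f (x0 + X n) y - f x0 y - f' x0 y (X n)) / norm (X n)) \<longlonglongrightarrow> 0"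
          using X unfolding tendsto_at_iff_sequentially o_def by blast
        then show "(\<lambda>n. q n y) \<longlonglongrightarrow> 0"
          by (rule Lim_null_comparison[rotated]) (auto simp: q_def)
      qed
      show "AE y in M. norm (q n y) \<le> 2 * b y" for n
      proof (intro AE_I2)
        fix y assume y: "y \<in> space M"
        show "norm (q n y) \<le> 2 * b y"
        proof (cases "norm (X n) < r")
          case True
          have "\<bar>f (x0 + X n) y - f x0 y\<bar> \<le> b y * norm (X n)" using lip[OF in_ball[OF True] y] by simp
          moreover have "\<bar>f' x0 y (X n)\<bar> \<le> b y * norm (X n)" using bnd[OF x0 y] .
          ultimately have "\<bar>f (x0 + X n) y - f x0 y - f' x0 y (X n)\<bar> \<le> 2 * b y * norm (X n)" by linarith
          then show ?thesis using X(1) True by (simp add: q_def divide_le_eq abs_divide)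
        qed (use b0[OF y] in \<open>simp add: q_def\<close>)
      qed
    qed (use b in auto)
    then have lim: "(\<lambda>n. norm (\<integral>y. q n y \<partial>M)) \<longlonglongrightarrow> 0" using tendsto_norm_zero by fastforce
    have ev: "\<forall>\<^sub>F n in sequentially. norm (X n) < r"
      using order_tendstoD(2)[OF tendsto_norm_zero[OF X(2)] r] .
    show "(\<lambda>n. norm ((\<integral>y. f (x0 + X n) y \<partial>M) - (\<integral>y. f x0 y \<partial>M) - (\<integral>y. f' x0 y (X n) \<partial>M)) / norm (X n)) \<longlonglongrightarrow> 0"
      by (rule Lim_transform_eventually[OF lim], use ev in eventually_elim)
        (simp add: q_def int[OF in_ball] int[OF x0] intf')
  qed
  with bl show ?thesis by (simp add: has_derivative_at)
qed

lemma lborel_translate: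
  fixes f :: "'x::euclidean_space \<Rightarrow> 'b::{banach, second_countable_topology}"
  assumes [measurable]: "f \<in> borel_measurable borel"
  shows "(LBINT x. f (c + x)) = (LBINT x. f x)"
    "integrable lborel (\<lambda>x. f (c + x)) \<longleftrightarrow> integrable lborel f"
proof -
  have "integral\<^sup>L (distr lborel borel ((+) c)) f = (LBINT x. f (c + x))"
    by (rule integral_distr) auto
  then show "(LBINT x. f (c + x)) = (LBINT x. f x)" by (simp add: lborel_distr_plus)
  have "integrable (distr lborel borel ((+) c)) f \<longleftrightarrow> integrable lborel (\<lambda>x. f (c + x))"
    by (rule integrable_distr_eq) auto
  then show "integrable lborel (\<lambda>x. f (c + x)) \<longleftrightarrow> integrable lborel f" by (simp add: lborel_distr_plus)
qed

lemma lborel_reflect: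
  fixes f :: "'x::euclidean_space \<Rightarrow> real"
  assumes [measurable]: "f \<in> borel_measurable borel"
  shows "(LBINT x. f (- x)) = (LBINT x. f x)"
    "integrable lborel (\<lambda>x. f (- x)) \<longleftrightarrow> integrable lborel f"
proof -
  have e: "distr lborel borel (\<lambda>x. - x) = (lborel :: 'x measure)"
    by (subst (2) lborel_affine[of "-1" 0]) (auto simp: density_1)
  have "integral\<^sup>L (distr lborel borel uminus) f = (LBINT x. f (- x))"
    by (rule integral_distr) auto
  then show "(LBINT x. f (- x)) = (LBINT x. f x)" by (simp add: e)
  have "integrable (distr lborel borel uminus) f \<longleftrightarrow> integrable lborel (\<lambda>x. f (- x))"
    by (rule integrable_distr_eq) auto
  then show "integrable lborel (\<lambda>x. f (- x)) \<longleftrightarrow> integrable lborel f" by (simp add: e)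
qed

lemma integrable_continuous_compact_support:
  fixes f :: "'x::euclidean_space \<Rightarrow> real"
  assumes "compact C" "continuous_on C f" "\<And>x. x \<notin> C \<Longrightarrow> f x = 0"
  shows "integrable lborel f"
proof -
  have "integrable lborel (\<lambda>x. indicat_real C x *\<^sub>R f x)"
    using borel_integrable_compact[OF assms(1,2)] by simp
  moreover have "(\<lambda>x. indicat_real C x *\<^sub>R f x) = f" using assms(3) by (auto simp: indicator_def fun_eq_iff)
  ultimately show ?thesis by simp
qed

lemmas integral_finite_sum = Bochner_Integration.integral_sum Bochner_Integration.integrable_sum

lemma test_functions_integrable: "f \<in> test_functions \<Omega> \<Longrightarrow> integrable lborel f"
  by (elim test_functionsE)
    (metis integrable_continuous_compact_support smooth_on_continuous continuous_on_subset subset_UNIV)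

lemma test_functions_dderiv_bounded:
  assumes f: "f \<in> test_functions \<Omega>"
  obtains B where "B > 0" "\<And>x h. \<bar>dderiv h f x\<bar> \<le> B * norm h"
proof -
  have "\<exists>B>0. \<forall>x. \<bar>dderiv b f x\<bar> \<le> B" for b
    using test_functions_bounded[OF test_functions_dderiv[OF f]] by metis
  then obtain B where B: "\<And>b. B b > 0" "\<And>b x. \<bar>dderiv b f x\<bar> \<le> B b" by metis
  have "\<bar>dderiv h f x\<bar> \<le> (\<Sum>b\<in>Basis. B b) * norm h" for h x
  proof -
    have d: "(f has_derivative (\<lambda>h. dderiv h f x)) (at x)"
      using has_dderiv smooth_on_differentiable[OF test_functions_smooth[OF f]] by blast
    note lin = has_derivative_linear[OF d]
    have "dderiv h f x = dderiv (\<Sum>b\<in>Basis. (h \<bullet> b) *\<^sub>R b) f x" by (simp add: euclidean_representation)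
    also have "\<dots> = (\<Sum>b\<in>Basis. (h \<bullet> b) * dderiv b f x)"
      using linear_sum[OF lin, of "\<lambda>b. (h \<bullet> b) *\<^sub>R b" Basis] by (simp add: linear_cmul[OF lin])
    finally have "dderiv h f x = (\<Sum>b\<in>Basis. (h \<bullet> b) * dderiv b f x)" .
    also have "\<bar>\<dots>\<bar> \<le> (\<Sum>b\<in>Basis. \<bar>(h \<bullet> b) * dderiv b f x\<bar>)" by (rule sum_abs)
    also have "\<dots> \<le> (\<Sum>b\<in>Basis. norm h * B b)"
      by (intro sum_mono) (auto simp: abs_mult intro!: mult_mono B Basis_le_norm)
    finally show ?thesis by (simp add: sum_distrib_left mult.commute)
  qed
  moreover have "(\<Sum>b\<in>(Basis :: 'a set). B b) > 0" using B by (intro sum_pos) auto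
  ultimately show ?thesis using that by blast
qed

lemma dderiv_linear:
  assumes "f differentiable at x"
  shows "linear (\<lambda>h. dderiv h f x)"
  using has_dderiv[OF assms] has_derivative_linear by blast

text \<open>By translation invariance the integral of h (t e + x) over x does not depend on t; its
  derivative at t = 0, taken under the integral sign, is the claim. Domination is required for all
  shifts with |t| < 1, and so the lemma covers Gaussians as well as compact supports.\<close>

lemma integral_dderiv_eq_0_dominated:
  fixes h :: "'x::euclidean_space \<Rightarrow> real"
  assumes d: "\<And>x. h differentiable at x" and hi: "integrable lborel h"
    and [measurable]: "dderiv e h \<in> borel_measurable borel"
    and B: "integrable lborel B" "\<And>t x. \<bar>t\<bar> < 1 \<Longrightarrow> \<bar>dderiv e h (t *\<^sub>R e + x)\<bar> \<le> B x"
  shows "(LBINT x. dderiv e h x) = 0"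
proof -
  have hm [measurable]: "h \<in> borel_measurable borel" using borel_measurable_integrable[OF hi] by simp
  have "((\<lambda>t. LBINT x. h (t *\<^sub>R e + x)) has_derivative
      (\<lambda>s. LBINT x. s * dderiv e h (0 *\<^sub>R e + x))) (at (0 :: real))"
  proof (rule has_derivative_integral_parametric[where r=1 and
        f'="\<lambda>t x s. s * dderiv e h (t *\<^sub>R e + x)" and b=B])
    show "integrable lborel (\<lambda>x. h (t *\<^sub>R e + x))" for t :: real
      using hi by (simp add: lborel_translate)
    show "((\<lambda>t. h (t *\<^sub>R e + x)) has_derivative (\<lambda>s. s * dderiv e h (t *\<^sub>R e + x))) (at t)" for t x
    proof -
      have "((\<lambda>t. t *\<^sub>R e + x) has_derivative (\<lambda>s. s *\<^sub>R e)) (at t)"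
        by (auto intro!: derivative_eq_intros)
      from has_derivative_compose[OF this has_dderiv[OF d]]
      show ?thesis by (simp add: linear_cmul[OF dderiv_linear[OF d]])
    qed
    show "\<bar>s * dderiv e h (t *\<^sub>R e + x)\<bar> \<le> B x * norm s" if t: "t \<in> ball 0 1" for t x s
      using mult_left_mono[OF B(2)[of t x], of "\<bar>s\<bar>"] t by (simp add: abs_mult mult.commute)
  qed (use B in auto)
  moreover have "(\<lambda>t::real. LBINT x. h (t *\<^sub>R e + x)) = (\<lambda>t. LBINT x. h x)"
    using lborel_translate(1)[OF hm] by auto
  ultimately have "((\<lambda>t::real. LBINT x. h x) has_derivative (\<lambda>s. s * (LBINT x. dderiv e h x))) (at 0)"
    by simp
  from has_derivative_unique[OF this has_derivative_const[of "LBINT x. h x"]]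
  have "(\<lambda>s::real. s * (LBINT x. dderiv e h x)) = (\<lambda>s. 0)" .
  from fun_cong[OF this, of 1] show ?thesis by simp
qed

lemma integral_dderiv_eq_0:
  fixes h :: "'x::euclidean_space \<Rightarrow> real"
  assumes d: "\<And>x. h differentiable at x" and c: "continuous_on UNIV (dderiv e h)"
    and C: "compact C" "\<And>x. x \<notin> C \<Longrightarrow> h x = 0"
  shows "(LBINT x. dderiv e h x) = 0"
proof -
  have hc: "continuous_on UNIV h"
    using d by (simp add: continuous_on_eq_continuous_at differentiable_imp_continuous_within)
  have z: "dderiv e h x = 0" if "x \<notin> C" for x
    using dderiv_cong[of "- C" x h "\<lambda>_. 0" e] C that compact_imp_closed[OF C(1)]
    by (auto simp: dderiv_def)
  obtain B where B: "B > 0" "\<And>x. \<bar>dderiv e h x\<bar> \<le> B"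
    using continuous_compact_support_bounded[OF c C(1) z] by blast
  obtain R where R: "\<And>x. x \<in> C \<Longrightarrow> norm x \<le> R"
    using compact_imp_bounded[OF C(1)] by (auto simp: bounded_iff)
  show ?thesis
  \<comment> \<open>The bounding ball is enlarged by \<open>norm e\<close> because it has to contain
    the supports of all translates with |t| < 1.\<close>
  proof (rule integral_dderiv_eq_0_dominated[OF d, where B="\<lambda>x. B * indicat_real (cball 0 (R + norm e)) x"])
    show "integrable lborel h"
      using hc C by (intro integrable_continuous_compact_support[OF C(1)]) (auto intro: continuous_on_subset)
    show "dderiv e h \<in> borel_measurable borel" using c borel_measurable_continuous_onI by blast
    show "\<bar>dderiv e h (t *\<^sub>R e + x)\<bar> \<le> B * indicat_real (cball 0 (R + norm e)) x"
      if t: "\<bar>t\<bar> < 1" for t x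
    proof (cases "t *\<^sub>R e + x \<in> C")
      case True
      have "norm x \<le> norm (t *\<^sub>R e + x) + norm (t *\<^sub>R e)" using norm_triangle_ineq4[of "t *\<^sub>R e + x" "t *\<^sub>R e"] by simp
      also have "\<dots> \<le> R + norm e"
        using R[OF True] t mult_right_mono[of "\<bar>t\<bar>" 1 "norm e"] by (intro add_mono) auto
      finally have "x \<in> cball 0 (R + norm e)" by simp
      then show ?thesis using B(2)[of "t *\<^sub>R e + x"] by simp
    qed (use z B(1) in simp)
    show "integrable lborel (\<lambda>x. B * indicat_real (cball 0 (R + norm e)) x)"
      using emeasure_lborel_cball_finite[of 0 "R + norm e"]
      by (intro integrable_mult_right integrable_real_indicator) auto
  qed
qed

lemma dderiv_mult:
  assumes "f differentiable at x" "g differentiable at x"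
  shows "dderiv e (\<lambda>x. f x * g x) x = f x * dderiv e g x + dderiv e f x * g x"
  by (intro dderiv_eq has_derivative_mult has_dderiv assms)

lemma dderiv_add:
  assumes "f differentiable at x" "g differentiable at x"
  shows "dderiv e (\<lambda>x. f x + g x) x = dderiv e f x + dderiv e g x"
  by (intro dderiv_eq has_derivative_add has_dderiv assms)

lemma dderiv_cmult:
  assumes "f differentiable at x"
  shows "dderiv e (\<lambda>x. c * f x) x = c * dderiv e f x"
  by (intro dderiv_eq has_derivative_mult_right has_dderiv assms)

lemma integration_by_parts_dderiv:
  fixes f g :: "'x::euclidean_space \<Rightarrow> real"
  assumes d: "\<And>x. f differentiable at x" "\<And>x. g differentiable at x"
    and c: "continuous_on UNIV (dderiv e f)" "continuous_on UNIV (dderiv e g)"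
    and C: "compact C" "\<And>x. x \<notin> C \<Longrightarrow> f x = 0"
  shows "(LBINT x. f x * dderiv e g x) = - (LBINT x. dderiv e f x * g x)"
proof -
  have fc: "continuous_on UNIV f" "continuous_on UNIV g"
    using d by (simp_all add: continuous_on_eq_continuous_at differentiable_imp_continuous_within)
  have z: "dderiv e f x = 0" if "x \<notin> C" for x
    using dderiv_cong[of "- C" x f "\<lambda>_. 0" e] C that compact_imp_closed[OF C(1)]
    by (auto simp: dderiv_def)
  have eq: "dderiv e (\<lambda>x. f x * g x) = (\<lambda>x. f x * dderiv e g x + dderiv e f x * g x)"
    using d by (auto simp: dderiv_mult)
  have "(LBINT x. dderiv e (\<lambda>x. f x * g x) x) = 0"
  proof (rule integral_dderiv_eq_0[OF _ _ C(1)])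
    show "continuous_on UNIV (dderiv e (\<lambda>x. f x * g x))" unfolding eq
      using fc c by (intro continuous_intros)
  qed (use d C in auto)
  moreover have "integrable lborel (\<lambda>x. f x * dderiv e g x)" "integrable lborel (\<lambda>x. dderiv e f x * g x)"
    by (rule integrable_continuous_compact_support[OF C(1)], use fc c C z in
        \<open>auto intro!: continuous_intros intro: continuous_on_subset\<close>)+
  ultimately show ?thesis by (simp add: eq)
qed

subsection \<open>Convolution with an integrable kernel\<close>

text \<open>The sign of the shift makes kernels supported in positive time look into the future, as in
  \<open>\<T>\<close>.\<close>

definition kconv :: "('x::euclidean_space \<Rightarrow> real) \<Rightarrow> ('x \<Rightarrow> real) \<Rightarrow> 'x \<Rightarrow> real" where
  "kconv k f p = (LBINT r. k r * f (p + r))"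

lemma kconv_integrable:
  fixes k f :: "'x::euclidean_space \<Rightarrow> real"
  assumes k: "integrable lborel k" and f: "f \<in> borel_measurable borel" "\<And>x. \<bar>f x\<bar> \<le> B"
  shows "integrable lborel (\<lambda>r. k r * f (p + r))"
proof (rule Bochner_Integration.integrable_bound[of _ "\<lambda>r. B * k r"])
  note [measurable] = borel_measurable_integrable[OF k] f(1)
  show "(\<lambda>r. k r * f (p + r)) \<in> borel_measurable lborel" by measurable
  show "AE r in lborel. norm (k r * f (p + r)) \<le> norm (B * k r)"
  proof (intro AE_I2)
    fix r
    have "\<bar>f (p + r)\<bar> * \<bar>k r\<bar> \<le> \<bar>B\<bar> * \<bar>k r\<bar>"
      using f(2)[of "p + r"] by (intro mult_right_mono) auto
    then show "norm (k r * f (p + r)) \<le> norm (B * k r)" by (simp add: abs_mult mult.commute)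
  qed
qed (use k in simp)

text \<open>All derivatives fall on the test function. Integrability of the kernel is therefore
  enough, and the singularity of the heat kernel at time 0 causes no difficulty.\<close>

lemma kconv_has_derivative:
  assumes k: "integrable lborel k" and f: "f \<in> test_functions \<Omega>"
  shows "(kconv k f has_derivative (\<lambda>h. kconv k (dderiv h f) p)) (at p)"
proof -
  note [measurable] = borel_measurable_integrable[OF k] test_functions_measurable[OF f]
    test_functions_measurable[OF test_functions_dderiv[OF f]]
  obtain B where B: "B > 0" "\<And>x h. \<bar>dderiv h f x\<bar> \<le> B * norm h"
    using test_functions_dderiv_bounded[OF f] by blast
  obtain B' where B': "\<And>x. \<bar>f x\<bar> \<le> B'" using test_functions_bounded[OF f] by blast
  have df: "f differentiable at x" for x
    using smooth_on_differentiable[OF test_functions_smooth[OF f]] by blast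
  have "((\<lambda>p. LBINT r. k r * f (p + r)) has_derivative
      (\<lambda>h. LBINT r. k r * dderiv h f (p + r))) (at p)"
  proof (rule has_derivative_integral_parametric[where r=1 and
        f'="\<lambda>p r h. k r * dderiv h f (p + r)" and b="\<lambda>r. \<bar>k r\<bar> * B"])
    show "integrable lborel (\<lambda>r. k r * f (p + r))" for p
      using test_functions_measurable[OF f] B' by (rule kconv_integrable[OF k])
    show "((\<lambda>p. k r * f (p + r)) has_derivative (\<lambda>h. k r * dderiv h f (p + r))) (at p)" for p r
      using dderiv_compose_affine[OF bounded_linear_ident, of f r p] df
      by (intro has_derivative_mult_right) (simp add: add.commute)
    show "\<bar>k r * dderiv h f (p + r)\<bar> \<le> \<bar>k r\<bar> * B * norm h" for p r h
      using mult_left_mono[OF B(2)[of h "p + r"], of "\<bar>k r\<bar>"] by (simp add: abs_mult mult.assoc)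
  qed (use k in auto)
  then show ?thesis by (simp add: kconv_def[abs_def])
qed

lemma kconv_dderiv:
  assumes "integrable lborel k" "f \<in> test_functions \<Omega>"
  shows "dderiv e (kconv k f) = kconv k (dderiv e f)"
  using dderiv_eq[OF kconv_has_derivative[OF assms]] by auto

lemma smooth_on_kconv:
  assumes k: "integrable lborel k" and f: "f \<in> test_functions \<Omega>"
  shows "smooth_on UNIV (kconv k f)"
proof (rule smooth_on_coinduct[where P="\<lambda>u. \<exists>f\<in>test_functions \<Omega>. u = kconv k f"])
  show d: "u differentiable at x" if "\<exists>f\<in>test_functions \<Omega>. u = kconv k f" for u x
    using that kconv_has_derivative[OF k] by (auto simp: differentiable_def)
  show "continuous_on UNIV u" if "\<exists>f\<in>test_functions \<Omega>. u = kconv k f" for u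
    using d[OF that] by (simp add: continuous_on_eq_continuous_at differentiable_imp_continuous_within)
  show "\<exists>g. (\<exists>f\<in>test_functions \<Omega>. g = kconv k f) \<and> (\<forall>x\<in>UNIV. dderiv e u x = g x)"
    if u: "\<exists>f\<in>test_functions \<Omega>. u = kconv k f" for u e
  proof -
    obtain f where "f \<in> test_functions \<Omega>" "u = kconv k f" using u by blast
    then show ?thesis using kconv_dderiv[OF k] test_functions_dderiv[of f \<Omega> e]
      by (intro exI[of _ "kconv k (dderiv e f)"]) auto
  qed
qed (use f in auto)

lemma integrable_lborel_pair_mult:
  fixes f :: "'x::euclidean_space \<Rightarrow> real" and g :: "'y::euclidean_space \<Rightarrow> real"
  assumes "integrable lborel f" "integrable lborel g"
  shows "integrable (lborel \<Otimes>\<^sub>M lborel) (\<lambda>(x, y). f x * g y)"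
proof (rule lborel_pair.Fubini_integrable)
  note [measurable] = borel_measurable_integrable[OF assms(1)] borel_measurable_integrable[OF assms(2)]
  show "(\<lambda>(x, y). f x * g y) \<in> borel_measurable (lborel \<Otimes>\<^sub>M lborel)" by measurable
qed (use assms in \<open>auto simp: abs_mult\<close>)

text \<open>Fubini twice; in between, the translation by r in the variable p and the reflection of
  r. The pairs are integrable because one test function is bounded while the other one and the
  kernel are integrable.\<close>

lemma kconv_adjoint:
  fixes k f g :: "'x::euclidean_space \<Rightarrow> real"
  assumes k: "integrable lborel k" and f: "f \<in> test_functions \<Omega>" and g: "g \<in> test_functions \<Omega>'"
  shows "(LBINT p. kconv k f p * g p) = (LBINT p. f p * kconv (\<lambda>r. k (- r)) g p)"
proof -
  note [measurable] = borel_measurable_integrable[OF k] test_functions_measurable[OF f] test_functions_measurable[OF g]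
  have km [measurable]: "k \<in> borel_measurable borel" using borel_measurable_integrable[OF k] by simp
  obtain B where B: "\<And>x. \<bar>f x\<bar> \<le> B" "B > 0" using test_functions_bounded[OF f] by blast
  have gk: "integrable (lborel \<Otimes>\<^sub>M lborel) (\<lambda>(p, r). g p * k r)"
    using integrable_lborel_pair_mult[OF test_functions_integrable[OF g] k] .
  have int: "integrable (lborel \<Otimes>\<^sub>M lborel) (\<lambda>(p, r). k r * f (p + r) * g p)"
  proof (rule Bochner_Integration.integrable_bound[of _ "\<lambda>x. B * (case x of (p, r) \<Rightarrow> g p * k r)"])
    show "AE x in lborel \<Otimes>\<^sub>M lborel. norm (case x of (p, r) \<Rightarrow> k r * f (p + r) * g p)
        \<le> norm (B * (case x of (p, r) \<Rightarrow> g p * k r))"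
    proof (intro AE_I2)
      fix x :: "'x \<times> 'x"
      have "\<bar>f (fst x + snd x)\<bar> * (\<bar>g (fst x)\<bar> * \<bar>k (snd x)\<bar>) \<le> B * (\<bar>g (fst x)\<bar> * \<bar>k (snd x)\<bar>)"
        by (intro mult_right_mono B) auto
      then show "norm (case x of (p, r) \<Rightarrow> k r * f (p + r) * g p)
        \<le> norm (B * (case x of (p, r) \<Rightarrow> g p * k r))"
        using B(2) by (simp add: split_beta abs_mult ac_simps)
    qed
  qed (use gk in \<open>auto simp del: integrable_mult_right_iff\<close>)
  have "(LBINT p. kconv k f p * g p) = (LBINT p. (LBINT r. k r * f (p + r) * g p))"
    by (simp add: kconv_def)
  also have "\<dots> = (LBINT r. (LBINT p. k r * f (p + r) * g p))"
    by (rule lborel_pair.Fubini_integral[symmetric]) (use int in simp)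
  also have "\<dots> = (LBINT r. (LBINT p. k r * f p * g (p + - r)))"
  proof (rule Bochner_Integration.integral_cong[OF refl])
    fix r
    show "(LBINT p. k r * f (p + r) * g p) = (LBINT p. k r * f p * g (p + - r))"
      using lborel_translate(1)[of "\<lambda>p. k r * f p * g (p + - r)" r] by (simp add: add.commute)
  qed
  also have "\<dots> = (LBINT r. (LBINT p. k (- r) * f p * g (p + r)))"
    using lborel_reflect(1)[of "\<lambda>r. LBINT p. k (- r) * f p * g (p + r)"] by simp
  also have "\<dots> = (LBINT p. (LBINT r. k (- r) * f p * g (p + r)))"
  proof (rule lborel_pair.Fubini_integral)
    obtain B' where B': "\<And>x. \<bar>g x\<bar> \<le> B'" "B' > 0" using test_functions_bounded[OF g] by blast
    have fk: "integrable (lborel \<Otimes>\<^sub>M lborel) (\<lambda>(p, r). f p * k (- r))"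
      using integrable_lborel_pair_mult[OF test_functions_integrable[OF f], of "\<lambda>r. k (- r)"] k
      by (simp add: lborel_reflect)
    show "integrable (lborel \<Otimes>\<^sub>M lborel) (\<lambda>(p, r). k (- r) * f p * g (p + r))"
    proof (rule Bochner_Integration.integrable_bound[of _ "\<lambda>x. B' * (case x of (p, r) \<Rightarrow> f p * k (- r))"])
      show "AE x in lborel \<Otimes>\<^sub>M lborel. norm (case x of (p, r) \<Rightarrow> k (- r) * f p * g (p + r))
          \<le> norm (B' * (case x of (p, r) \<Rightarrow> f p * k (- r)))"
      proof (intro AE_I2)
        fix x :: "'x \<times> 'x"
        have "\<bar>g (fst x + snd x)\<bar> * (\<bar>f (fst x)\<bar> * \<bar>k (- snd x)\<bar>) \<le> B' * (\<bar>f (fst x)\<bar> * \<bar>k (- snd x)\<bar>)"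
          by (intro mult_right_mono B') auto
        then show "norm (case x of (p, r) \<Rightarrow> k (- r) * f p * g (p + r))
          \<le> norm (B' * (case x of (p, r) \<Rightarrow> f p * k (- r)))"
          using B'(2) by (simp add: split_beta abs_mult ac_simps)
      qed
    qed (use fk in \<open>auto simp del: integrable_mult_right_iff\<close>)
  qed
  also have "\<dots> = (LBINT p. f p * kconv (\<lambda>r. k (- r)) g p)"
    by (simp add: kconv_def ac_simps flip: integral_mult_right_zero)
  finally show ?thesis .
qed

subsection \<open>Integration over time slabs\<close>

text \<open>The fundamental theorem of calculus on each vertical line, combined by Fubini. The
  spatial bound on the support of the derivative provides joint integrability.\<close>

lemma slab_integral_time_derivative:
  fixes \<zeta> \<zeta>' :: "real \<times> 'x::euclidean_space \<Rightarrow> real"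
  assumes ab: "a \<le> b"
    and d: "\<And>s z. a \<le> s \<Longrightarrow> s \<le> b \<Longrightarrow> ((\<lambda>s. \<zeta> (s, z)) has_real_derivative \<zeta>' (s, z)) (at s within {a..b})"
    and c: "continuous_on ({a..b} \<times> UNIV) \<zeta>'"
    and z: "\<And>s z. a \<le> s \<Longrightarrow> s \<le> b \<Longrightarrow> z \<notin> cball 0 R \<Longrightarrow> \<zeta>' (s, z) = 0"
  shows "(LBINT p. indicat_real ({a..b} \<times> UNIV) p * \<zeta>' p) = (LBINT z. \<zeta> (b, z) - \<zeta> (a, z))"
    and "integrable lborel (\<lambda>p. indicat_real ({a..b} \<times> UNIV) p * \<zeta>' p)"
proof -
  let ?g = "\<lambda>p. indicat_real ({a..b} \<times> UNIV) p * \<zeta>' p"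
  have g: "?g = (\<lambda>p. indicat_real ({a..b} \<times> cball 0 R) p *\<^sub>R \<zeta>' p)"
    using z by (auto simp: indicator_def fun_eq_iff)
  show int: "integrable lborel ?g" unfolding g
    by (intro borel_integrable_compact compact_Times continuous_on_subset[OF c]) auto
  have "(LBINT p. ?g p) = (LBINT z. (LBINT s. ?g (s, z)))"
    using lborel_pair.integral_snd[of "\<lambda>s z. ?g (s, z)"] int by (simp add: lborel_prod split_beta')
  also have "\<dots> = (LBINT z. \<zeta> (b, z) - \<zeta> (a, z))"
  proof (rule Bochner_Integration.integral_cong[OF refl])
    fix z :: 'x
    have "(LBINT s. indicat_real {a..b} s *\<^sub>R \<zeta>' (s, z)) = \<zeta> (b, z) - \<zeta> (a, z)"
    proof (rule integral_FTC_atLeastAtMost[OF ab])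
      show "((\<lambda>s. \<zeta> (s, z)) has_vector_derivative \<zeta>' (s, z)) (at s within {a..b})" if "a \<le> s" "s \<le> b" for s
        using d[OF that] by (simp add: has_real_derivative_iff_has_vector_derivative)
      show "continuous_on {a..b} (\<lambda>s. \<zeta>' (s, z))"
        by (intro continuous_on_compose2[OF c] continuous_intros) auto
    qed
    moreover have "(\<lambda>s. ?g (s, z)) = (\<lambda>s. indicat_real {a..b} s *\<^sub>R \<zeta>' (s, z))"
      by (auto simp: indicator_def fun_eq_iff)
    ultimately show "(LBINT s. ?g (s, z)) = \<zeta> (b, z) - \<zeta> (a, z)" by (simp only:)
  qed
  finally show "(LBINT p. ?g p) = (LBINT z. \<zeta> (b, z) - \<zeta> (a, z))" .
qed

section \<open>Positive definite matrices\<close>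

lemma matrix_inv_works:
  fixes C :: "real^'n^'n"
  assumes "invertible C"
  shows "C ** matrix_inv C = mat 1" "matrix_inv C ** C = mat 1"
  using assms someI_ex[of "\<lambda>A'. C ** A' = mat 1 \<and> A' ** C = mat 1"]
  unfolding invertible_def matrix_inv_def by auto

lemma posdef_invertible:
  fixes C :: "'n::finite mat"
  assumes "posdef C"
  shows "invertible C"
proof -
  have "x = 0" if "C *v x = 0" for x
    using assms that unfolding posdef_def by (metis inner_zero_right less_irrefl)
  then obtain B where "B ** C = mat 1" using matrix_left_invertible_ker by blast
  then show ?thesis using matrix_left_right_inverse invertible_def by blast
qed

lemma symmetric_mat_inner:
  fixes C :: "'n::finite mat"
  assumes "symmetric_mat C"
  shows "(C *v x) \<bullet> y = x \<bullet> (C *v y)"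
  using assms unfolding symmetric_mat_def by (metis dot_lmul_matrix vector_transpose_matrix)

lemma posdef_inverse:
  fixes C :: "'n::finite mat"
  assumes "posdef C"
  shows "posdef (matrix_inv C)"
proof -
  let ?Q = "matrix_inv C"
  note inv = matrix_inv_works[OF posdef_invertible[OF assms]]
  have sym: "transpose C = C" using assms by (simp add: posdef_def symmetric_mat_def)
  have "transpose ?Q ** C = mat 1"
    using inv(1) sym by (metis matrix_transpose_mul transpose_mat)
  then have "transpose ?Q = ?Q"
    using inv(1) by (metis matrix_mul_assoc matrix_mul_lid matrix_mul_rid)
  moreover have "0 < x \<bullet> (?Q *v x)" if "x \<noteq> 0" for x
  proof -
    have x: "C *v (?Q *v x) = x" by (simp add: matrix_vector_mul_assoc inv)
    then have "?Q *v x \<noteq> 0" using that by auto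
    then have "0 < (?Q *v x) \<bullet> (C *v (?Q *v x))" using assms by (simp add: posdef_def)
    then show ?thesis by (simp add: x inner_commute)
  qed
  ultimately show ?thesis by (simp add: posdef_def symmetric_mat_def)
qed

lemma continuous_on_matrix_vector_mult: "continuous_on S ((*v) (C :: real^'n^'m))"
  by (intro linear_continuous_on matrix_vector_mul_bounded_linear)

text \<open>The constant is the minimum of the quadratic form on the unit sphere, attained by
  compactness.\<close>

lemma posdef_coercive:
  fixes C :: "'n::finite mat"
  assumes "posdef C"
  obtains l where "l > 0" "\<And>x. l * (norm x)\<^sup>2 \<le> x \<bullet> (C *v x)"
proof -
  have "continuous_on (sphere 0 1) (\<lambda>x. x \<bullet> (C *v x))"
    by (intro continuous_on_inner continuous_on_id continuous_on_matrix_vector_mult)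
  moreover have "axis undefined 1 \<in> sphere (0 :: real^'n) 1" by simp
  ultimately obtain u where u: "u \<in> sphere 0 1" "\<And>x. x \<in> sphere 0 1 \<Longrightarrow> u \<bullet> (C *v u) \<le> x \<bullet> (C *v x)"
    using continuous_attains_inf[of "sphere 0 1" "\<lambda>x. x \<bullet> (C *v x)"] by (metis compact_sphere empty_iff)
  have "u \<noteq> 0" using u(1) by auto
  then have "u \<bullet> (C *v u) > 0" using assms by (simp add: posdef_def)
  moreover have "u \<bullet> (C *v u) * (norm x)\<^sup>2 \<le> x \<bullet> (C *v x)" for x
  proof (cases "x = 0")
    case False
    let ?y = "(1 / norm x) *\<^sub>R x"
    have "u \<bullet> (C *v u) \<le> ?y \<bullet> (C *v ?y)" using False by (intro u(2)) simp
    also have "\<dots> = (x \<bullet> (C *v x)) / (norm x)\<^sup>2"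
      by (simp add: matrix_vector_mult_scaleR power2_eq_square)
    finally show ?thesis using False by (simp add: pos_le_divide_eq)
  qed simp
  ultimately show ?thesis using that by blast
qed

lemma posdef_scaleR:
  fixes C :: "'n::finite mat"
  assumes "posdef C" "c > 0"
  shows "posdef (c *\<^sub>R C)"
  using assms unfolding posdef_def symmetric_mat_def
  by (simp add: scaleR_matrix_vector_assoc[symmetric] transpose_scalar)

lemma matrix_inv_scaleR:
  fixes C :: "'n::finite mat"
  assumes "posdef C" "c > 0"
  shows "matrix_inv (c *\<^sub>R C) = (1 / c) *\<^sub>R matrix_inv C"
proof -
  note inv = matrix_inv_works[OF posdef_invertible[OF assms(1)]]
  note inv' = matrix_inv_works[OF posdef_invertible[OF posdef_scaleR[OF assms]]]
  have "(c *\<^sub>R C) ** ((1 / c) *\<^sub>R matrix_inv C) = mat 1"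
    using assms(2) inv by (simp add: matrix_scalar_ac scalar_matrix_assoc[symmetric])
  then show ?thesis using inv'(2) by (metis matrix_mul_assoc matrix_mul_lid matrix_mul_rid)
qed

lemma det_scaleR_mat:
  fixes C :: "'n::finite mat"
  shows "det (c *\<^sub>R C) = c ^ CARD('n) * det C"
proof -
  have "c *\<^sub>R C = matrix ((*\<^sub>R) c) ** C"
    by (simp add: matrix_eq matrix_vector_mul_assoc[symmetric] matrix_works scaleR_matrix_vector_assoc[symmetric] bounded_linear.linear[OF bounded_linear_scaleR_right])
  then show ?thesis by (simp only: det_mul det_matrix_scaleR)
qed

subsection \<open>Gaussian integrals\<close>

lemma nn_integral_exp_norm_power2:
  assumes c: "c > 0"
  shows "(\<integral>\<^sup>+(x::'x::euclidean_space). ennreal (exp (- c * (norm x)\<^sup>2)) \<partial>lborel) = ennreal (sqrt (pi / c) ^ DIM('x))"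
proof -
  have one: "(\<integral>\<^sup>+t. ennreal (exp (- c * t\<^sup>2)) \<partial>lborel) = ennreal (sqrt (pi / c))"
  proof -
    define \<sigma> where "\<sigma> = sqrt (1 / (2 * c))"
    have \<sigma>: "\<sigma> > 0" "\<sigma>\<^sup>2 = 1 / (2 * c)" using c by (auto simp: \<sigma>_def)
    have "exp (- c * t\<^sup>2) = sqrt (pi / c) * normal_density 0 \<sigma> t" for t
    proof -
      have "2 * pi * \<sigma>\<^sup>2 = pi / c" using \<sigma> c by simp
      moreover have "- (t - 0)\<^sup>2 / (2 * \<sigma>\<^sup>2) = - c * t\<^sup>2" using \<sigma> c by simp
      ultimately show ?thesis using c by (simp add: normal_density_def)
    qed
    then have "(\<integral>\<^sup>+t. ennreal (exp (- c * t\<^sup>2)) \<partial>lborel) = (\<integral>\<^sup>+t. ennreal (sqrt (pi / c)) * ennreal (normal_density 0 \<sigma> t) \<partial>lborel)"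
      using c by (intro nn_integral_cong) (auto simp: ennreal_mult)
    also have "\<dots> = ennreal (sqrt (pi / c)) * (\<integral>\<^sup>+t. ennreal (normal_density 0 \<sigma> t) \<partial>lborel)"
      by (intro nn_integral_cmult) measurable
    also have "(\<integral>\<^sup>+t. ennreal (normal_density 0 \<sigma> t) \<partial>lborel) = 1"
      using \<sigma> by (subst nn_integral_eq_integral) auto
    finally show ?thesis by simp
  qed
  have "exp (- c * (norm x)\<^sup>2) = (\<Prod>b\<in>Basis. exp (- c * (x \<bullet> b)\<^sup>2))" for x :: 'x
  proof -
    have "(norm x)\<^sup>2 = (\<Sum>b\<in>Basis. (x \<bullet> b)\<^sup>2)"
      unfolding power2_norm_eq_inner by (subst euclidean_inner) (simp add: power2_eq_square)
    then show ?thesis by (simp add: exp_sum[symmetric] sum_distrib_left)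
  qed
  then have "(\<integral>\<^sup>+x. ennreal (exp (- c * (norm (x::'x))\<^sup>2)) \<partial>lborel) =
      (\<integral>\<^sup>+x. (\<Prod>b\<in>Basis. ennreal (exp (- c * ((x::'x) \<bullet> b)\<^sup>2))) \<partial>lborel)"
    by (simp add: prod_ennreal)
  also have "\<dots> = (\<Prod>b\<in>(Basis::'x set). \<integral>\<^sup>+t. ennreal (exp (- c * t\<^sup>2)) \<partial>lborel)"
    by (rule nn_integral_lborel_prod) auto
  also have "\<dots> = ennreal (sqrt (pi / c) ^ DIM('x))"
    using c unfolding one by (simp add: ennreal_power)
  finally show ?thesis .
qed

lemma integrable_exp_norm_power2:
  assumes "c > 0"
  shows "integrable lborel (\<lambda>x::'x::euclidean_space. exp (- c * (norm x)\<^sup>2))"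
  by (rule integrableI_nonneg) (use nn_integral_exp_norm_power2[OF assms, where 'x='x] in auto)

text \<open>Used throughout to absorb polynomial factors into Gaussians at the price of a slightly
  worse exponent.\<close>

lemma norm_le_exp_norm_power2:
  assumes "c > 0"
  shows "(norm x)\<^sup>2 \<le> (1 / c) * exp (c * (norm x)\<^sup>2)" "norm x \<le> (1 + 1 / c) * exp (c * (norm x)\<^sup>2)"
proof -
  have "c * (norm x)\<^sup>2 \<le> exp (c * (norm x)\<^sup>2)" using exp_ge_add_one_self[of "c * (norm x)\<^sup>2"] by linarith
  then show 1: "(norm x)\<^sup>2 \<le> (1 / c) * exp (c * (norm x)\<^sup>2)" using assms by (simp add: field_simps)
  have "norm x \<le> 1 + (norm x)\<^sup>2"
    using zero_le_power2[of "norm x - 1 / 2"] by (simp add: power2_eq_square algebra_simps)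
  also have "\<dots> \<le> exp (c * (norm x)\<^sup>2) + (1 / c) * exp (c * (norm x)\<^sup>2)"
    using 1 assms by (intro add_mono) auto
  finally show "norm x \<le> (1 + 1 / c) * exp (c * (norm x)\<^sup>2)" by (simp add: algebra_simps)
qed

text \<open>The unnormalised Gaussian with precision matrix \<open>P\<close>, that is, with
  covariance the inverse of \<open>P\<close>. Parametrising by the precision makes the exponent
  linear in the parameter.\<close>

definition qexp :: "'n::finite mat \<Rightarrow> real^'n \<Rightarrow> real" where
  "qexp P x = exp (- (x \<bullet> (P *v x)) / 2)"

lemma qexp_has_derivative:
  fixes P :: "'n::finite mat"
  assumes "symmetric_mat P"
  shows "(qexp P has_derivative (\<lambda>h. - (h \<bullet> (P *v x)) * qexp P x)) (at x)"
proof -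
  have "((\<lambda>x. P *v x) has_derivative (\<lambda>h. P *v h)) (at x)"
    by (intro bounded_linear_imp_has_derivative matrix_vector_mul_bounded_linear)
  then have "((\<lambda>x. exp (- (x \<bullet> (P *v x)) / 2)) has_derivative
      (\<lambda>h. exp (- (x \<bullet> (P *v x)) / 2) * (- (x \<bullet> (P *v h) + h \<bullet> (P *v x)) / 2))) (at x)"
    by (auto intro!: derivative_eq_intros simp: fun_eq_iff field_simps)
  moreover have "exp (- (x \<bullet> (P *v x)) / 2) * (- (x \<bullet> (P *v h) + h \<bullet> (P *v x)) / 2)
      = - (h \<bullet> (P *v x)) * qexp P x" for h
  proof -
    have "x \<bullet> (P *v h) = h \<bullet> (P *v x)"
      using symmetric_mat_inner[OF assms, of x h] by (simp add: inner_commute)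
    then show ?thesis by (simp add: qexp_def)
  qed
  ultimately show ?thesis
    by (simp add: qexp_def[abs_def])
qed

lemma qexp_measurable [measurable]: "qexp P \<in> borel_measurable borel"
  unfolding qexp_def
  by (auto intro!: borel_measurable_continuous_onI continuous_intros continuous_on_matrix_vector_mult)

lemma qexp_le:
  assumes "\<And>x. l * (norm x)\<^sup>2 \<le> x \<bullet> (P *v x)"
  shows "qexp P x \<le> exp (- (l / 2) * (norm x)\<^sup>2)"
  using assms[of x] by (simp add: qexp_def)

lemma matrix_norm_bound:
  fixes H :: "'n::finite mat"
  obtains K where "K > 0" "\<And>x y. \<bar>x \<bullet> (H *v y)\<bar> \<le> K * norm x * norm y"
proof -
  obtain K where K: "K > 0" "\<And>x. norm (H *v x) \<le> norm x * K"
    using bounded_linear.pos_bounded[OF matrix_vector_mul_bounded_linear[of H]] by metis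
  have "\<bar>x \<bullet> (H *v y)\<bar> \<le> K * norm x * norm y" for x y
  proof -
    have "\<bar>x \<bullet> (H *v y)\<bar> \<le> norm x * norm (H *v y)" by (rule Cauchy_Schwarz_ineq2)
    also have "\<dots> \<le> norm x * (norm y * K)" by (intro mult_left_mono K) simp
    finally show ?thesis by (simp add: mult_ac)
  qed
  then show ?thesis using that K(1) by blast
qed

lemma qexp_integrable:
  assumes l: "l > 0" "\<And>x. l * (norm x)\<^sup>2 \<le> x \<bullet> (P *v x)"
  shows "integrable lborel (qexp P)" "integrable lborel (\<lambda>x. (x $ i * x $ j) * qexp P x)"
    "integrable lborel (\<lambda>x. norm x * qexp P x)"
proof -
  have e: "integrable lborel (\<lambda>x::real^'a. exp (- (l / 4) * (norm x)\<^sup>2))"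
    using l by (intro integrable_exp_norm_power2) auto
  \<comment> \<open>Coercivity bounds \<open>qexp\<close> by exp (-(l/2) |x|^2); one half of this
    exponent is reserved for polynomial factors, the other half gives integrability.\<close>
  have le: "exp ((l / 4) * (norm x)\<^sup>2) * qexp P x \<le> exp (- (l / 4) * (norm x)\<^sup>2)" for x
    using l(2)[of x] by (simp add: qexp_def mult_exp_exp)
  have pos: "0 \<le> qexp P x" for x by (simp add: qexp_def)
  show "integrable lborel (qexp P)"
  proof (rule Bochner_Integration.integrable_bound[OF e])
    have "qexp P x \<le> exp ((l / 4) * (norm x)\<^sup>2) * qexp P x" for x
      using mult_right_mono[OF _ pos, of 1 "exp ((l / 4) * (norm x)\<^sup>2)" x] l(1) by simp
    from order_trans[OF this le]
    show "AE x in lborel. norm (qexp P x) \<le> norm (exp (- (l / 4) * (norm x)\<^sup>2))" using pos by simp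
  qed simp
  show "integrable lborel (\<lambda>x. norm x * qexp P x)"
  proof (rule Bochner_Integration.integrable_bound[of _ "\<lambda>x::real^'a. (1 + 1 / (l / 4)) * exp (- (l / 4) * (norm x)\<^sup>2)"])
    have "norm x * qexp P x \<le> (1 + 1 / (l / 4)) * (exp ((l / 4) * (norm x)\<^sup>2) * qexp P x)" for x
      using mult_right_mono[OF norm_le_exp_norm_power2(2)[of "l / 4" x] pos] l(1) by (simp add: mult.assoc)
    also have "\<dots>x \<le> (1 + 1 / (l / 4)) * exp (- (l / 4) * (norm x)\<^sup>2)" for x
      using l(1) by (intro mult_left_mono le) auto
    finally show "AE x in lborel. norm (norm x * qexp P x) \<le> norm ((1 + 1 / (l / 4)) * exp (- (l / 4) * (norm x)\<^sup>2))"
      using pos l(1) by (simp add: abs_of_nonneg)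
  qed (use e in auto)
  show "integrable lborel (\<lambda>x. (x $ i * x $ j) * qexp P x)"
  proof (rule Bochner_Integration.integrable_bound[of _ "\<lambda>x::real^'a. (1 / (l / 4)) * exp (- (l / 4) * (norm x)\<^sup>2)"])
    have "\<bar>x $ i * x $ j\<bar> * qexp P x \<le> (1 / (l / 4)) * exp (- (l / 4) * (norm x)\<^sup>2)" for x
    proof -
      have "\<bar>x $ i * x $ j\<bar> \<le> norm x * norm x"
        unfolding abs_mult by (intro mult_mono component_le_norm_cart) auto
      then have "\<bar>x $ i * x $ j\<bar> \<le> (1 / (l / 4)) * exp ((l / 4) * (norm x)\<^sup>2)"
        using norm_le_exp_norm_power2(1)[of "l / 4" x] l(1) by (simp add: power2_eq_square)
      from mult_right_mono[OF this pos[of x]] have "\<bar>x $ i * x $ j\<bar> * qexp P x \<le>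
          (1 / (l / 4)) * (exp ((l / 4) * (norm x)\<^sup>2) * qexp P x)" by (simp add: mult.assoc)
      also have "\<dots> \<le> (1 / (l / 4)) * exp (- (l / 4) * (norm x)\<^sup>2)"
        using l(1) by (intro mult_left_mono le) auto
      finally show ?thesis .
    qed
    then show "AE x in lborel. norm ((x $ i * x $ j) * qexp P x) \<le> norm ((1 / (l / 4)) * exp (- (l / 4) * (norm x)\<^sup>2))"
      using pos l(1) by (simp add: abs_mult)
  qed (use e in auto)
qed

lemma inner_axis_one: "axis i (1::real) \<bullet> x = x $ i"
  by (simp add: inner_axis inner_commute)

text \<open>The derivative of x_j \<open>qexp P x\<close> in direction i integrates to 0, and it is
  the difference of the two integrands that are compared.\<close>

lemma qexp_second_moment:
  fixes P :: "'n::finite mat"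
  assumes "symmetric_mat P" and l: "l > 0" "\<And>x. l * (norm x)\<^sup>2 \<le> x \<bullet> (P *v x)"
  shows "(LBINT x. (x $ j * (P *v x) $ i) * qexp P x) = (if i = j then integral\<^sup>L lborel (qexp P) else 0)"
    and "integrable lborel (\<lambda>x. (x $ j * (P *v x) $ i) * qexp P x)"
proof -
  define h where "h x = x $ j * qexp P x" for x
  define D where "D x = (if i = j then qexp P x else 0) - (x $ j * (P *v x) $ i) * qexp P x" for x
  have hd: "(h has_derivative (\<lambda>e. e $ j * qexp P x - (x $ j * (e \<bullet> (P *v x))) * qexp P x)) (at x)" for x
    unfolding h_def
    by (rule has_derivative_eq_rhs, rule has_derivative_mult[OF _ qexp_has_derivative[OF assms(1)]])
      (auto intro!: derivative_eq_intros bounded_linear_imp_has_derivative bounded_linear_vec_nth simp: algebra_simps)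
  have D: "dderiv (axis i 1) h = D"
  proof
    fix x
    have "axis i (1::real) $ j = (if i = j then 1 else 0)" by (simp add: axis_def)
    then show "dderiv (axis i 1) h x = D x" using dderiv_eq[OF hd] by (simp add: D_def inner_axis_one)
  qed
  note int = qexp_integrable[OF l]
  have s: "(x $ j * (P *v x) $ i) * qexp P x = (\<Sum>k\<in>UNIV. P $ i $ k * ((x $ j * x $ k) * qexp P x))" for x
    by (simp add: matrix_vector_mult_def sum_distrib_left sum_distrib_right mult_ac)
  show int2: "integrable lborel (\<lambda>x. (x $ j * (P *v x) $ i) * qexp P x)"
    unfolding s by (intro Bochner_Integration.integrable_sum integrable_mult_right int)
  have "(LBINT x. dderiv (axis i 1) h x) = 0"
  proof -
    obtain K where K: "K > 0" "\<And>x y. \<bar>x \<bullet> (P *v y)\<bar> \<le> K * norm x * norm y" using matrix_norm_bound by metis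
    have bd: "\<bar>D (t *\<^sub>R axis i 1 + x)\<bar> \<le> (1 + K / (l / 4)) * (exp (l / 4) * exp (- (l / 8) * (norm x)\<^sup>2))"
      if "\<bar>t\<bar> < 1" for t x
    proof -
      let ?y = "t *\<^sub>R axis i 1 + x"
      have q: "0 \<le> qexp P ?y" by (simp add: qexp_def)
      have "\<bar>?y $ j * (P *v ?y) $ i\<bar> \<le> norm ?y * (K * 1 * norm ?y)"
        unfolding abs_mult using K(2)[of "axis i 1" ?y]
        by (intro mult_mono component_le_norm_cart) (auto simp: inner_axis_one norm_axis_1)
      also have "\<dots> \<le> K * ((1 / (l / 4)) * exp ((l / 4) * (norm ?y)\<^sup>2))"
        using mult_left_mono[OF norm_le_exp_norm_power2(1)[of "l / 4" ?y], of K] l(1) K(1)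
        by (simp add: power2_eq_square mult_ac)
      finally have A: "\<bar>?y $ j * (P *v ?y) $ i\<bar> \<le> (K / (l / 4)) * exp ((l / 4) * (norm ?y)\<^sup>2)" by simp
      have B: "(if i = j then 1 else 0) \<le> exp ((l / 4) * (norm ?y)\<^sup>2)" using l(1) by simp
      have "\<bar>D ?y\<bar> \<le> (if i = j then 1 else 0) * qexp P ?y + \<bar>?y $ j * (P *v ?y) $ i\<bar> * qexp P ?y"
        using q abs_triangle_ineq4[of "(if i = j then 1 else 0) * qexp P ?y" "(?y $ j * (P *v ?y) $ i) * qexp P ?y"]
        unfolding D_def by (simp add: abs_mult split: if_splits)
      also have "\<dots> \<le> exp ((l / 4) * (norm ?y)\<^sup>2) * qexp P ?y + (K / (l / 4)) * exp ((l / 4) * (norm ?y)\<^sup>2) * qexp P ?y"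
        using q A B by (intro add_mono mult_right_mono) auto
      also have "\<dots> = (1 + K / (l / 4)) * (exp ((l / 4) * (norm ?y)\<^sup>2) * qexp P ?y)" by (simp add: algebra_simps)
      also have "\<dots> \<le> (1 + K / (l / 4)) * exp (- (l / 4) * (norm ?y)\<^sup>2)"
        using l(1) l(2)[of ?y] K(1) by (intro mult_left_mono) (auto simp: qexp_def mult_exp_exp)
      also have "\<dots> \<le> (1 + K / (l / 4)) * (exp (l / 4) * exp (- (l / 8) * (norm x)\<^sup>2))"
      proof (intro mult_left_mono)
        \<comment> \<open>A shift by a vector of norm at most 1 costs the constant factor exp (l/4)
          and one half of the exponent.\<close>
        have "norm x \<le> norm ?y + 1"
          using norm_triangle_ineq4[of ?y "t *\<^sub>R axis i 1"] that by (simp add: norm_axis_1)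
        then have "(norm x)\<^sup>2 \<le> (norm ?y + 1)\<^sup>2" by (intro power_mono) auto
        also have "\<dots> \<le> 2 * (norm ?y)\<^sup>2 + 2"
          using zero_le_power2[of "norm ?y - 1"] by (simp add: power2_sum power2_diff)
        finally have "(l / 8) * (norm x)\<^sup>2 \<le> (l / 8) * (2 * (norm ?y)\<^sup>2 + 2)" using l(1) by (intro mult_left_mono) auto
        then show "exp (- (l / 4) * (norm ?y)\<^sup>2) \<le> exp (l / 4) * exp (- (l / 8) * (norm x)\<^sup>2)"
          by (simp add: mult_exp_exp algebra_simps)
      qed (use l(1) K(1) in auto)
      finally show ?thesis .
    qed
    show ?thesis
    proof (rule integral_dderiv_eq_0_dominated[where B="\<lambda>x. (1 + K / (l / 4)) * (exp (l / 4) * exp (- (l / 8) * (norm x)\<^sup>2))"])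
      show "h differentiable at x" for x using hd by (auto simp: differentiable_def)
      show "integrable lborel h"
      proof (rule Bochner_Integration.integrable_bound[OF int(3)])
        show "h \<in> borel_measurable lborel" unfolding h_def by simp
        show "AE x in lborel. norm (h x) \<le> norm (norm x * qexp P x)"
          by (auto simp: h_def abs_mult qexp_def intro!: AE_I2 mult_right_mono component_le_norm_cart)
      qed
      have "continuous_on UNIV (\<lambda>x. (P *v x) $ i)"
        by (intro continuous_on_component continuous_on_matrix_vector_mult)
      from borel_measurable_continuous_onI[OF this] have [measurable]: "(\<lambda>x. (P *v x) $ i) \<in> borel_measurable borel" .
      show "dderiv (axis i 1) h \<in> borel_measurable borel" unfolding D D_def by measurable
      show "\<bar>dderiv (axis i 1) h (t *\<^sub>R axis i 1 + x)\<bar> \<le> (1 + K / (l / 4)) * (exp (l / 4) * exp (- (l / 8) * (norm x)\<^sup>2))"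
        if "\<bar>t\<bar> < 1" for t x using bd[OF that] unfolding D by simp
      show "integrable lborel (\<lambda>x::real^'n. (1 + K / (l / 4)) * (exp (l / 4) * exp (- (l / 8) * (norm x)\<^sup>2)))"
        using l(1) by (intro integrable_mult_right integrable_exp_norm_power2) auto
    qed
  qed
  then show "(LBINT x. (x $ j * (P *v x) $ i) * qexp P x) = (if i = j then integral\<^sup>L lborel (qexp P) else 0)"
    unfolding D D_def using int(1) int2 by (cases "i = j") auto
qed

text \<open>In the Leibniz expansion a permutation other than the identity moves at least two
  indices: with a also its image p a. After one factor has been differentiated another one still
  vanishes at s = 0, so only the identity contributes.\<close>

lemma det_one_plus_has_derivative:
  fixes M :: "'n::finite mat"
  shows "((\<lambda>s. det (mat 1 + s *\<^sub>R M)) has_real_derivative trace M) (at 0)"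
proof -
  have e: "(mat 1 + s *\<^sub>R M) $ i $ j = (if i = j then 1 else 0) + s * M $ i $ j" for s i j
    by (simp add: mat_def)
  have d: "((\<lambda>s. \<Prod>i\<in>UNIV. (if i = p i then 1 else 0) + s * M $ i $ p i) has_real_derivative
      (if p = id then trace M else 0)) (at 0)" if "inj p" for p :: "'n \<Rightarrow> 'n"
  proof -
    have "((\<lambda>s. \<Prod>i\<in>UNIV. (if i = p i then 1 else 0) + s * M $ i $ p i) has_real_derivative
        (\<Sum>i\<in>UNIV. M $ i $ p i * (\<Prod>j\<in>UNIV - {i}. (if j = p j then 1 else 0) + 0 * M $ j $ p j))) (at 0)"
      by (rule has_field_derivative_prod) (auto intro!: derivative_eq_intros)
    moreover have "(\<Sum>i\<in>UNIV. M $ i $ p i * (\<Prod>j\<in>UNIV - {i}. (if j = p j then 1 else 0) + 0 * M $ j $ p j))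
        = (if p = id then trace M else 0)"
    proof (cases "p = id")
      case False
      then obtain a where a: "p a \<noteq> a" by (auto simp: fun_eq_iff)
      then have pa: "p (p a) \<noteq> p a" using \<open>inj p\<close> by (meson injD)
      have "(\<Prod>j\<in>UNIV - {i}. (if j = p j then 1 else 0) + 0 * M $ j $ p j) = 0" for i
      proof (rule prod_zero)
        show "\<exists>j\<in>UNIV - {i}. (if j = p j then 1 else 0) + 0 * M $ j $ p j = 0"
          using a pa by (intro bexI[of _ "if i = a then p a else a"]) auto
      qed simp
      then show ?thesis using False by (simp only: mult_zero_right sum.neutral_const if_False)
    qed (simp add: trace_def)
    ultimately show ?thesis by simp
  qed
  have "((\<lambda>s. \<Sum>p\<in>{p. p permutes (UNIV :: 'n set)}. of_int (sign p) * (\<Prod>i\<in>UNIV. (if i = p i then 1 else 0) + s * M $ i $ p i))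
      has_real_derivative (\<Sum>p\<in>{p. p permutes (UNIV :: 'n set)}. of_int (sign p) * (if p = id then trace M else 0))) (at 0)"
    by (intro DERIV_sum DERIV_cmult d) (auto intro: permutes_inj)
  moreover have "(\<Sum>p\<in>{p. p permutes (UNIV :: 'n set)}. of_int (sign p) * (if p = id then trace M else 0)) =
      (\<Sum>p\<in>{p. p permutes (UNIV :: 'n set)}. if p = id then trace M else 0)"
    by (intro sum.cong) (auto simp: sign_id)
  moreover have "\<dots> = trace M"
    by (subst sum.delta) (auto simp: permutes_id finite_permutations)
  ultimately show ?thesis unfolding det_def e by simp
qed

lemma matrix_mult_add_rdistrib:
  fixes A B :: "real^'n^'m"
  shows "(A + B) ** C = A ** C + B ** C"
  by (simp add: matrix_matrix_mult_def vec_eq_iff sum.distrib distrib_right)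

lemma qexp_integral_has_derivative:
  fixes P H :: "'n::finite mat"
  assumes l: "l > 0" "\<And>x. l * (norm x)\<^sup>2 \<le> x \<bullet> (P *v x)"
  shows "((\<lambda>s. integral\<^sup>L lborel (qexp (P + s *\<^sub>R H))) has_real_derivative
      (LBINT x. - (x \<bullet> (H *v x)) / 2 * qexp P x)) (at 0)"
proof -
  obtain K where K: "K > 0" "\<And>x y. \<bar>x \<bullet> (H *v y)\<bar> \<le> K * norm x * norm y" using matrix_norm_bound by metis
  \<comment> \<open>The radius l / (2 K) is chosen so that the perturbation uses up at most half of
    the coercivity.\<close>
  have coer: "(l / 2) * (norm x)\<^sup>2 \<le> x \<bullet> ((P + s *\<^sub>R H) *v x)" if s: "\<bar>s\<bar> < l / (2 * K)" for s x
  proof -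
    have "\<bar>s * (x \<bullet> (H *v x))\<bar> \<le> (l / (2 * K)) * (K * norm x * norm x)"
      unfolding abs_mult using s K by (intro mult_mono) auto
    also have "\<dots> = (l / 2) * (norm x)\<^sup>2" using K(1) by (simp add: power2_eq_square)
    finally have "s * (x \<bullet> (H *v x)) \<ge> - ((l / 2) * (norm x)\<^sup>2)" by linarith
    moreover have "x \<bullet> ((P + s *\<^sub>R H) *v x) = x \<bullet> (P *v x) + s * (x \<bullet> (H *v x))"
      by (simp add: matrix_vector_mult_add_rdistrib inner_add_right scaleR_matrix_vector_assoc[symmetric])
    ultimately show ?thesis using l(2)[of x] by (simp add: field_simps)
  qed
  have [measurable]: "(\<lambda>x. x \<bullet> (H *v x)) \<in> borel_measurable borel"
    by (auto intro!: borel_measurable_continuous_onI continuous_intros continuous_on_matrix_vector_mult)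
  have "((\<lambda>s. LBINT x. qexp (P + s *\<^sub>R H) x) has_derivative
      (\<lambda>h. LBINT x. h * (- (x \<bullet> (H *v x)) / 2 * qexp (P + 0 *\<^sub>R H) x))) (at (0 :: real))"
  proof (rule has_derivative_integral_parametric[where r="l / (2 * K)" and
        f'="\<lambda>s x h. h * (- (x \<bullet> (H *v x)) / 2 * qexp (P + s *\<^sub>R H) x)" and
        b="\<lambda>x. (K / 2 * (8 / l)) * exp (- (l / 8) * (norm x)\<^sup>2)"])
    show "l / (2 * K) > 0" using l K by simp
    show "integrable lborel (\<lambda>x. qexp (P + s *\<^sub>R H) x)" if "s \<in> ball 0 (l / (2 * K))" for s
      using that l(1) by (intro qexp_integrable(1)[of "l / 2"] coer) auto
    show "((\<lambda>s. qexp (P + s *\<^sub>R H) x) has_derivative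
        (\<lambda>h. h * (- (x \<bullet> (H *v x)) / 2 * qexp (P + s *\<^sub>R H) x))) (at s)" for s x
    proof -
      have e: "qexp (P + s *\<^sub>R H) x = exp (- (x \<bullet> (P *v x)) / 2 + s * (- (x \<bullet> (H *v x)) / 2))" for s
        by (simp add: qexp_def matrix_vector_mult_add_rdistrib inner_add_right scaleR_matrix_vector_assoc[symmetric] add_divide_distrib)
      show ?thesis unfolding e by (auto intro!: derivative_eq_intros)
    qed
    show "\<bar>h * (- (x \<bullet> (H *v x)) / 2 * qexp (P + s *\<^sub>R H) x)\<bar> \<le> (K / 2 * (8 / l)) * exp (- (l / 8) * (norm x)\<^sup>2) * norm h"
      if s: "s \<in> ball 0 (l / (2 * K))" for s x h
    proof -
      \<comment> \<open>With half of the coercivity left, \<open>qexp\<close> is at most exp (-(l/4)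
        |x|^2). Half of that exponent absorbs the factor |x|^2, which is where 8 / l comes
        from.\<close>
      have "\<bar>x \<bullet> (H *v x)\<bar> / 2 * qexp (P + s *\<^sub>R H) x \<le> (K * norm x * norm x) / 2 * exp (- ((l / 2) / 2) * (norm x)\<^sup>2)"
        using s K l(1) by (intro mult_mono divide_right_mono qexp_le coer) (auto simp: qexp_def)
      also have "\<dots> = K / 2 * ((norm x)\<^sup>2 * exp (- (l / 4) * (norm x)\<^sup>2))" by (simp add: power2_eq_square)
      also have "\<dots> \<le> K / 2 * ((1 / (l / 8)) * exp ((l / 8) * (norm x)\<^sup>2) * exp (- (l / 4) * (norm x)\<^sup>2))"
        using K(1) l(1) by (intro mult_left_mono mult_right_mono norm_le_exp_norm_power2) auto
      also have "\<dots> = (K / 2 * (8 / l)) * exp (- (l / 8) * (norm x)\<^sup>2)"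
        by (simp add: mult.assoc mult_exp_exp)
      finally have "\<bar>x \<bullet> (H *v x)\<bar> / 2 * qexp (P + s *\<^sub>R H) x \<le> (K / 2 * (8 / l)) * exp (- (l / 8) * (norm x)\<^sup>2)" .
      from mult_left_mono[OF this, of "\<bar>h\<bar>"] show ?thesis
        by (simp add: abs_mult qexp_def mult_ac)
    qed
    show "integrable lborel (\<lambda>x::real^'n. (K / 2 * (8 / l)) * exp (- (l / 8) * (norm x)\<^sup>2))"
      using l(1) by (intro integrable_mult_right integrable_exp_norm_power2) auto
  qed measurable
  moreover have "(\<lambda>h. LBINT x. h * (- (x \<bullet> (H *v x)) / 2 * qexp (P + 0 *\<^sub>R H) x)) =
      (*) (LBINT x. - (x \<bullet> (H *v x)) / 2 * qexp P x)"
    by (rule ext) (simp only: integral_mult_right_zero scaleR_zero_left add_0_right mult.commute)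
  ultimately show ?thesis by (simp only: has_field_derivative_def)
qed

text \<open>Writing H x as \<open>H ** matrix_inv P\<close> applied to P x turns the moments into
  those of \<open>qexp_second_moment\<close>, so the inverse appears without diagonalising
  \<open>P\<close>.\<close>

lemma trace_inner_moment:
  fixes P H :: "'n::finite mat"
  assumes P: "posdef P" and l: "l > 0" "\<And>x. l * (norm x)\<^sup>2 \<le> x \<bullet> (P *v x)"
  shows "(LBINT x. (x \<bullet> (H *v x)) * qexp P x) = trace (H ** matrix_inv P) * integral\<^sup>L lborel (qexp P)"
proof -
  let ?Q = "matrix_inv P"
  have sym: "symmetric_mat P" using P by (simp add: posdef_def)
  note inv = matrix_inv_works[OF posdef_invertible[OF P]]
  have "H *v x = (H ** ?Q) *v (P *v x)" for x
    by (metis inv(2) matrix_mul_assoc matrix_mul_rid matrix_vector_mul_assoc)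
  then have e: "(x \<bullet> (H *v x)) * qexp P x = (\<Sum>j\<in>UNIV. \<Sum>i\<in>UNIV. (H ** ?Q) $ j $ i * ((x $ j * (P *v x) $ i) * qexp P x))" for x
    by (simp add: inner_vec_def matrix_vector_mult_def[of "H ** ?Q"] sum_distrib_left sum_distrib_right mult_ac)
  have "(LBINT x. (x \<bullet> (H *v x)) * qexp P x) =
      (\<Sum>j\<in>UNIV. \<Sum>i\<in>UNIV. (H ** ?Q) $ j $ i * (LBINT x. (x $ j * (P *v x) $ i) * qexp P x))"
    unfolding e
    by (simp add: integral_finite_sum qexp_second_moment(2)[OF sym l])
  also have "\<dots> = (\<Sum>j\<in>UNIV. \<Sum>i\<in>UNIV. (if i = j then (H ** ?Q) $ j $ i * integral\<^sup>L lborel (qexp P) else 0))"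
    unfolding qexp_second_moment(1)[OF sym l] by (intro sum.cong) auto
  also have "\<dots> = trace (H ** ?Q) * integral\<^sup>L lborel (qexp P)"
    by (simp add: trace_def sum_distrib_right)
  finally show ?thesis .
qed

text \<open>Along the segment from the identity to \<open>P\<close> the left-hand side has derivative zero, by Jacobi's
  formula and the second moments of \<open>qexp\<close>.\<close>

lemma qexp_integral_power2_det:
  fixes P :: "'n::finite mat"
  assumes P: "posdef P"
  shows "(integral\<^sup>L lborel (qexp P))\<^sup>2 * det P = (2 * pi) ^ CARD('n)"
proof -
  define H where "H = P - mat 1"
  define R where "R s = mat 1 + s *\<^sub>R H" for s :: real
  define \<Phi> where "\<Phi> s = (integral\<^sup>L lborel (qexp (R s)))\<^sup>2 * det (R s)" for s
  obtain l0 where l0: "l0 > 0" "\<And>x. l0 * (norm x)\<^sup>2 \<le> x \<bullet> (P *v x)" using posdef_coercive[OF P] by blast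
  define l where "l = min 1 l0"
  have l: "l > 0" using l0 by (simp add: l_def)
  have Rx: "x \<bullet> (R s *v x) = (1 - s) * (norm x)\<^sup>2 + s * (x \<bullet> (P *v x))" for s x
    by (simp add: R_def H_def matrix_vector_mult_add_rdistrib matrix_vector_mult_diff_rdistrib
        scaleR_matrix_vector_assoc[symmetric] inner_add_right inner_diff_right power2_norm_eq_inner algebra_simps)
  have coer: "l * (norm x)\<^sup>2 \<le> x \<bullet> (R s *v x)" if "0 \<le> s" "s \<le> 1" for s x
  proof -
    have "(1 - s) * (l * (norm x)\<^sup>2) + s * (l * (norm x)\<^sup>2) \<le> (1 - s) * (norm x)\<^sup>2 + s * (x \<bullet> (P *v x))"
    proof (intro add_mono mult_left_mono)
      have "l * (norm x)\<^sup>2 \<le> 1 * (norm x)\<^sup>2" by (intro mult_right_mono) (auto simp: l_def)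
      then show "l * (norm x)\<^sup>2 \<le> (norm x)\<^sup>2" by simp
      have "l * (norm x)\<^sup>2 \<le> l0 * (norm x)\<^sup>2" by (intro mult_right_mono) (auto simp: l_def)
      then show "l * (norm x)\<^sup>2 \<le> x \<bullet> (P *v x)" using l0(2)[of x] by linarith
    qed (use that in auto)
    then show ?thesis unfolding Rx by (simp add: algebra_simps)
  qed
  have tP: "transpose P = P" using P by (simp add: posdef_def symmetric_mat_def)
  have pd: "posdef (R s)" if "0 \<le> s" "s \<le> 1" for s
    unfolding posdef_def symmetric_mat_def
  proof (intro conjI allI impI)
    show "transpose (R s) = R s" using tP
      by (simp add: R_def H_def transpose_def vec_eq_iff mat_def)
    fix x :: "real^'n" assume "x \<noteq> 0"
    then have "0 < l * (norm x)\<^sup>2" using l by simp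
    then show "0 < x \<bullet> (R s *v x)" using coer[OF that, of x] by linarith
  qed
  have deriv: "(\<Phi> has_real_derivative 0) (at s)" if s: "0 \<le> s" "s \<le> 1" for s
  proof -
    let ?I = "integral\<^sup>L lborel (qexp (R s))" and ?t = "trace (H ** matrix_inv (R s))"
    note inv = matrix_inv_works[OF posdef_invertible[OF pd[OF s]]]
    have RS: "R (s + t) = R s + t *\<^sub>R H" for t by (simp add: R_def algebra_simps)
    have "((\<lambda>t. integral\<^sup>L lborel (qexp (R s + t *\<^sub>R H))) has_real_derivative
        (LBINT x. - (x \<bullet> (H *v x)) / 2 * qexp (R s) x)) (at 0)"
      by (rule qexp_integral_has_derivative[OF l coer[OF s]])
    moreover have "(LBINT x. - (x \<bullet> (H *v x)) / 2 * qexp (R s) x) =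
        (LBINT x. (- 1 / 2) * ((x \<bullet> (H *v x)) * qexp (R s) x))" by simp
    moreover have "\<dots> = - (?t * ?I) / 2"
      using trace_inner_moment[OF pd[OF s] l coer[OF s]] by (subst integral_mult_right_zero) simp
    ultimately have I: "((\<lambda>t. integral\<^sup>L lborel (qexp (R s + t *\<^sub>R H))) has_real_derivative - (?t * ?I) / 2) (at 0)"
      by simp
    \<comment> \<open>Factoring out \<open>R s\<close> reduces the derivative of the determinant to
      the one at the identity matrix.\<close>
    have "det (R s + t *\<^sub>R H) = det (R s) * det (mat 1 + t *\<^sub>R (H ** matrix_inv (R s)))" for t
    proof -
      have "R s + t *\<^sub>R H = (mat 1 + t *\<^sub>R (H ** matrix_inv (R s))) ** R s"
        by (simp add: matrix_mult_add_rdistrib scalar_matrix_assoc[symmetric] matrix_mul_assoc[symmetric] inv)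
      then show ?thesis by (simp add: det_mul mult.commute)
    qed
    then have D: "((\<lambda>t. det (R s + t *\<^sub>R H)) has_real_derivative det (R s) * ?t) (at 0)"
      using DERIV_cmult[OF det_one_plus_has_derivative[of "H ** matrix_inv (R s)"], of "det (R s)"] by simp
    have "((\<lambda>t. \<Phi> (s + t)) has_real_derivative 0) (at 0)"
      unfolding \<Phi>_def RS
      by (rule DERIV_cong, rule DERIV_mult[OF DERIV_power[OF I] D]) (simp add: power2_eq_square algebra_simps)
    then show ?thesis using DERIV_shift[of \<Phi> 0 0 s] by (simp add: add.commute)
  qed
  have "\<Phi> 1 = \<Phi> 0"
  proof (rule DERIV_isconst_end[of 0 1 \<Phi>])
    show "continuous_on {0..1} \<Phi>"
      using deriv by (intro continuous_at_imp_continuous_on ballI) (auto intro: DERIV_isCont)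
  qed (use deriv in auto)
  moreover have "\<Phi> 1 = (integral\<^sup>L lborel (qexp P))\<^sup>2 * det P" by (simp add: \<Phi>_def R_def H_def)
  moreover have "\<Phi> 0 = (2 * pi) ^ CARD('n)"
  proof -
    have q: "qexp (mat 1) = (\<lambda>x::real^'n. exp (- (1 / 2) * (norm x)\<^sup>2))"
      by (auto simp: qexp_def power2_norm_eq_inner)
    have "integral\<^sup>L lborel (qexp (mat 1) :: real^'n \<Rightarrow> real) = sqrt (2 * pi) ^ CARD('n)"
      unfolding q using nn_integral_exp_norm_power2[of "1 / 2", where 'x="real^'n"]
      by (subst integral_eq_nn_integral) (auto simp: mult.commute)
    then show ?thesis by (simp add: \<Phi>_def R_def power_even_eq[symmetric] power_mult[symmetric] mult.commute[of _ 2])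
      (simp add: power_mult)
  qed
  ultimately show ?thesis by simp
qed

text \<open>Read off from the Gaussian integral: a square times the determinant is a positive
  number. No eigenvalues are needed.\<close>

lemma posdef_det_pos:
  fixes P :: "'n::finite mat"
  assumes "posdef P"
  shows "0 < det P"
proof (rule ccontr)
  assume "\<not> 0 < det P"
  then have "(integral\<^sup>L lborel (qexp P))\<^sup>2 * det P \<le> 0" by (simp add: mult_nonneg_nonpos)
  moreover have "(0::real) < (2 * pi) ^ CARD('n)" by simp
  ultimately show False using qexp_integral_power2_det[OF assms] by linarith
qed

lemma gauss_eq_qexp: "gauss C x = qexp (matrix_inv C) x / sqrt ((2 * pi) ^ CARD('n) * det C)"
  for C :: "'n::finite mat"
  by (simp add: gauss_def qexp_def)

lemma gauss_integral:
  fixes C :: "'n::finite mat"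
  assumes C: "posdef C"
  shows "integral\<^sup>L lborel (gauss C) = 1" "integrable lborel (gauss C)"
proof -
  let ?Q = "matrix_inv C"
  note Q = posdef_inverse[OF C]
  obtain l where l: "l > 0" "\<And>x. l * (norm x)\<^sup>2 \<le> x \<bullet> (?Q *v x)" using posdef_coercive[OF Q] by blast
  have "det ?Q * det C = 1"
    using arg_cong[OF matrix_inv_works(2)[OF posdef_invertible[OF C]], of det] by (simp add: det_mul)
  then have "(integral\<^sup>L lborel (qexp ?Q))\<^sup>2 = (2 * pi) ^ CARD('n) * det C"
    using arg_cong[OF qexp_integral_power2_det[OF Q], of "\<lambda>x. x * det C"] by (simp add: mult.assoc)
  moreover have "integral\<^sup>L lborel (qexp ?Q) \<ge> 0" by (intro Bochner_Integration.integral_nonneg) (simp add: qexp_def)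
  ultimately have "integral\<^sup>L lborel (qexp ?Q) = sqrt ((2 * pi) ^ CARD('n) * det C)"
    by (simp add: real_sqrt_unique)
  moreover have "sqrt ((2 * pi) ^ CARD('n) * det C) \<noteq> 0"
    using posdef_det_pos[OF C] by simp
  ultimately show "integral\<^sup>L lborel (gauss C) = 1" by (simp add: gauss_eq_qexp[abs_def])
  show "integrable lborel (gauss C)"
    using qexp_integrable(1)[OF l] by (simp add: gauss_eq_qexp[abs_def])
qed

subsection \<open>Heat kernel and heat potentials\<close>

text \<open>Covariance 2 \<tau> A makes this the fundamental solution of the heat equation with
  operator A : D^2.\<close>

definition hk :: "'n::finite mat \<Rightarrow> real \<Rightarrow> real^'n \<Rightarrow> real" where
  "hk A \<tau> x = gauss ((2 * \<tau>) *\<^sub>R A) x"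

text \<open>The factor in the kernel of the operator that remains after the weights and
  \<open>matrix_sqrt q\<close> are removed. It is written in the form in which it occurs there;
  \<open>hk_hess_entry\<close> identifies it as the Hessian of \<open>hk A\<close>.\<close>

definition hk_hess :: "'n::finite mat \<Rightarrow> real \<Rightarrow> real^'n \<Rightarrow> 'n mat" where
  "hk_hess A \<tau> x = (hk A \<tau> x / (2 * \<tau>)) *\<^sub>R
     ((1 / (2 * \<tau>)) *\<^sub>R (matrix_inv A ** outer x ** matrix_inv A) - matrix_inv A)"

lemma symmetric_mat_entry: "symmetric_mat Q \<Longrightarrow> Q $ i $ j = Q $ j $ i"
  by (simp add: symmetric_mat_def transpose_def vec_eq_iff)

lemma hk_formula:
  fixes A :: "'n::finite mat"
  assumes A: "posdef A" and \<tau>: "\<tau> > 0"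
  shows "hk A \<tau> x = (1 / sqrt ((4 * pi) ^ CARD('n) * det A)) * \<tau> powr (- real CARD('n) / 2) *
    exp (- (x \<bullet> (matrix_inv A *v x)) / (4 * \<tau>))"
proof -
  have "sqrt (\<tau> ^ CARD('n)) = \<tau> powr (real CARD('n) / 2)"
    using \<tau> by (simp add: powr_realpow[symmetric] powr_half_sqrt[symmetric] powr_powr)
  moreover have "(2 * pi) ^ CARD('n) * det ((2 * \<tau>) *\<^sub>R A) = ((4 * pi) ^ CARD('n) * det A) * \<tau> ^ CARD('n)"
  proof -
    have "(2 * pi) ^ CARD('n) * (2 * \<tau>) ^ CARD('n) = (4 * pi) ^ CARD('n) * \<tau> ^ CARD('n)"
      unfolding power_mult_distrib[symmetric] by (intro arg_cong[of _ _ "\<lambda>x. x ^ _"]) simp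
    note e = this
    show ?thesis unfolding det_scaleR_mat mult.assoc[symmetric] e by (simp only: mult_ac)
  qed
  ultimately have "sqrt ((2 * pi) ^ CARD('n) * det ((2 * \<tau>) *\<^sub>R A)) =
      sqrt ((4 * pi) ^ CARD('n) * det A) * \<tau> powr (real CARD('n) / 2)"
    by (simp only: real_sqrt_mult)
  then show ?thesis
    using \<tau> by (simp add: hk_def gauss_def matrix_inv_scaleR[OF A] powr_minus_divide
        scaleR_matrix_vector_assoc[symmetric])
qed

lemma hk_pos: "posdef A \<Longrightarrow> \<tau> > 0 \<Longrightarrow> hk A \<tau> x > 0"
  by (simp add: hk_formula posdef_det_pos)

lemma hk_even: "hk A \<tau> (- x) = hk A \<tau> x" for A :: "'a::finite mat"
proof -
  have "C *v (- x) = - (C *v x)" for C :: "'a mat"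
    using matrix_vector_mult_scaleR[of C "-1" x] by simp
  then show ?thesis by (simp add: hk_def gauss_def)
qed

lemma hk_integral:
  assumes "posdef A" "\<tau> > 0"
  shows "integral\<^sup>L lborel (hk A \<tau>) = 1" "integrable lborel (hk A \<tau>)"
  using gauss_integral[OF posdef_scaleR[OF assms(1), of "2 * \<tau>"]] assms(2)
  by (simp_all add: hk_def[abs_def])

lemma hk_has_derivative:
  fixes A :: "'n::finite mat"
  assumes A: "posdef A" and \<tau>: "\<tau> > 0"
  shows "(hk A \<tau> has_derivative (\<lambda>h. - (1 / (2 * \<tau>)) * (h \<bullet> (matrix_inv A *v x)) * hk A \<tau> x)) (at x)"
proof -
  let ?C = "(2 * \<tau>) *\<^sub>R A"
  have C: "posdef ?C" using posdef_scaleR[OF A] \<tau> by simp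
  have "symmetric_mat (matrix_inv ?C)" using posdef_inverse[OF C] by (simp add: posdef_def)
  from qexp_has_derivative[OF this]
  have "((\<lambda>x. qexp (matrix_inv ?C) x * (1 / sqrt ((2 * pi) ^ CARD('n) * det ?C))) has_derivative
      (\<lambda>h. (- (h \<bullet> (matrix_inv ?C *v x)) * qexp (matrix_inv ?C) x) * (1 / sqrt ((2 * pi) ^ CARD('n) * det ?C)))) (at x)"
    by (rule has_derivative_mult_left)
  then show ?thesis
    using \<tau> by (simp add: hk_def[abs_def] gauss_eq_qexp matrix_inv_scaleR[OF A] scaleR_matrix_vector_assoc[symmetric])
qed

lemma hk_dderiv:
  assumes "posdef A" "\<tau> > 0"
  shows "dderiv e (hk A \<tau>) x = - (1 / (2 * \<tau>)) * (e \<bullet> (matrix_inv A *v x)) * hk A \<tau> x"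
  by (rule dderiv_eq[OF hk_has_derivative[OF assms]])

lemma hk_dderiv_has_derivative:
  fixes A :: "'n::finite mat"
  assumes A: "posdef A" and \<tau>: "\<tau> > 0"
  shows "(dderiv e (hk A \<tau>) has_derivative (\<lambda>h. ((1 / (2 * \<tau>)) * (1 / (2 * \<tau>)) * (e \<bullet> (matrix_inv A *v x)) * (h \<bullet> (matrix_inv A *v x))
      - (1 / (2 * \<tau>)) * (e \<bullet> (matrix_inv A *v h))) * hk A \<tau> x)) (at x)"
proof -
  have "((\<lambda>x. e \<bullet> (matrix_inv A *v x)) has_derivative (\<lambda>h. e \<bullet> (matrix_inv A *v h))) (at x)"
    by (intro bounded_linear_imp_has_derivative bounded_linear_compose[OF bounded_linear_inner_right]
        matrix_vector_mul_bounded_linear)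
  note d = has_derivative_mult[OF has_derivative_mult_right[OF this, of "- (1 / (2 * \<tau>))"] hk_has_derivative[OF assms]]
  have "dderiv e (hk A \<tau>) = (\<lambda>x. - (1 / (2 * \<tau>)) * (e \<bullet> (matrix_inv A *v x)) * hk A \<tau> x)"
    using hk_dderiv[OF assms] by auto
  then show ?thesis
    by (simp only:) (rule has_derivative_eq_rhs[OF d], simp add: fun_eq_iff algebra_simps)
qed

lemma quad_outer_entry:
  fixes Q :: "'n::finite mat"
  assumes "symmetric_mat Q"
  shows "(Q ** outer x ** Q) $ i $ j = (Q *v x) $ i * (Q *v x) $ j"
proof -
  have "Q $ k $ j = Q $ j $ k" for k
    using assms by (rule symmetric_mat_entry)
  then have "(Q *v x) $ j = (\<Sum>k\<in>UNIV. x $ k * Q $ k $ j)"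
    by (simp add: matrix_vector_mult_def mult.commute)
  moreover have "(Q ** outer x ** Q) $ i $ j = (\<Sum>k\<in>UNIV. (Q *v x) $ i * x $ k * Q $ k $ j)"
    by (simp add: matrix_matrix_mult_def matrix_vector_mult_def outer_def sum_distrib_right mult.assoc)
  ultimately show ?thesis by (simp add: sum_distrib_left mult.assoc)
qed

lemma hk_hess_entry:
  fixes A :: "'n::finite mat"
  assumes A: "posdef A" and \<tau>: "\<tau> > 0"
  shows "hk_hess A \<tau> x $ i $ j = dderiv (axis i 1) (dderiv (axis j 1) (hk A \<tau>)) x"
    and "hk_hess A \<tau> x $ i $ j = hk A \<tau> x / (2 * \<tau>) *
      ((1 / (2 * \<tau>)) * ((matrix_inv A *v x) $ i * (matrix_inv A *v x) $ j) - matrix_inv A $ i $ j)"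
proof -
  have sym: "symmetric_mat (matrix_inv A)" using posdef_inverse[OF A] by (simp add: posdef_def)
  show e: "hk_hess A \<tau> x $ i $ j = hk A \<tau> x / (2 * \<tau>) *
      ((1 / (2 * \<tau>)) * ((matrix_inv A *v x) $ i * (matrix_inv A *v x) $ j) - matrix_inv A $ i $ j)"
    by (simp add: hk_hess_def quad_outer_entry[OF sym])
  have "(matrix_inv A *v axis i 1) $ j = matrix_inv A $ j $ i"
    by (simp add: matrix_vector_mult_basis column_def)
  also have "\<dots> = matrix_inv A $ i $ j"
    using sym by (rule symmetric_mat_entry)
  finally show "hk_hess A \<tau> x $ i $ j = dderiv (axis i 1) (dderiv (axis j 1) (hk A \<tau>)) x"
    unfolding dderiv_eq[OF hk_dderiv_has_derivative[OF assms]] e inner_axis_one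
    using \<tau> by (simp add: field_simps)
qed

text \<open>The heat equation. With n the dimension, both sides equal ((x . A^{-1} x) / (4 \<tau>^2)
  - n / (2 \<tau>)) times the kernel: contracting A with the square of the vector A^{-1} x gives x .
  A^{-1} x, and contracting it with A^{-1} gives n.\<close>

lemma hk_time_derivative:
  fixes A :: "'n::finite mat"
  assumes A: "posdef A" and \<tau>: "\<tau> > 0"
  shows "((\<lambda>\<tau>. hk A \<tau> x) has_real_derivative (\<Sum>i\<in>UNIV. \<Sum>j\<in>UNIV. A $ i $ j * hk_hess A \<tau> x $ i $ j)) (at \<tau>)"
proof -
  let ?Q = "matrix_inv A" and ?n = "real CARD('n)"
  let ?c = "1 / sqrt ((4 * pi) ^ CARD('n) * det A)"
  note inv = matrix_inv_works[OF posdef_invertible[OF A]]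
  have sQ: "symmetric_mat ?Q" using posdef_inverse[OF A] by (simp add: posdef_def)
  have "((\<lambda>\<tau>. ?c * \<tau> powr (- ?n / 2) * exp (- (x \<bullet> (?Q *v x)) / (4 * \<tau>))) has_real_derivative
      ((x \<bullet> (?Q *v x)) / (4 * \<tau>\<^sup>2) - ?n / (2 * \<tau>)) * hk A \<tau> x) (at \<tau>)"
  proof -
    have p: "((\<lambda>\<tau>. \<tau> powr (- ?n / 2)) has_real_derivative (- ?n / 2) * \<tau> powr (- ?n / 2 - 1)) (at \<tau>)"
      using has_real_derivative_powr[OF \<tau>, of "- ?n / 2"] .
    have e: "((\<lambda>\<tau>. exp (- (x \<bullet> (?Q *v x)) / (4 * \<tau>))) has_real_derivative
        exp (- (x \<bullet> (?Q *v x)) / (4 * \<tau>)) * ((x \<bullet> (?Q *v x)) / (4 * \<tau>\<^sup>2))) (at \<tau>)"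
      using \<tau> by (auto intro!: derivative_eq_intros simp: power2_eq_square field_simps)
    have pw: "\<tau> powr (- ?n / 2 - 1) = \<tau> powr (- ?n / 2) / \<tau>" using \<tau> by (simp add: powr_diff)
    have alg: "c * (- n / 2 * (P / \<tau>)) * E + E * (q / (4 * \<tau>\<^sup>2)) * (c * P) =
        (q / (4 * \<tau>\<^sup>2) - n / (2 * \<tau>)) * (c * P * E)" for c P E q n :: real
      using \<tau> by (simp add: field_simps power2_eq_square)
    show ?thesis unfolding hk_formula[OF A \<tau>]
      by (rule DERIV_cong[OF DERIV_mult[OF DERIV_cmult[OF p] e]]) (simp only: pw alg)
  qed
  then have d: "((\<lambda>\<tau>. hk A \<tau> x) has_real_derivative ((x \<bullet> (?Q *v x)) / (4 * \<tau>\<^sup>2) - ?n / (2 * \<tau>)) * hk A \<tau> x) (at \<tau>)"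
    by (rule has_field_derivative_transform_within_open[of _ _ _ "{0<..}"])
      (use \<tau> hk_formula[OF A] in auto)
  have q1: "(\<Sum>i\<in>UNIV. \<Sum>j\<in>UNIV. A $ i $ j * ((?Q *v x) $ i * (?Q *v x) $ j)) = x \<bullet> (?Q *v x)"
  proof -
    have "(\<Sum>i\<in>UNIV. \<Sum>j\<in>UNIV. A $ i $ j * ((?Q *v x) $ i * (?Q *v x) $ j)) = (?Q *v x) \<bullet> (A *v (?Q *v x))"
      by (simp add: inner_vec_def matrix_vector_mult_def[of A] sum_distrib_left mult_ac)
    also have "A *v (?Q *v x) = x" by (simp add: matrix_vector_mul_assoc inv)
    finally show ?thesis by (simp add: inner_commute)
  qed
  have q2: "(\<Sum>i\<in>UNIV. \<Sum>j\<in>UNIV. A $ i $ j * ?Q $ i $ j) = ?n"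
  proof -
    have s: "?Q $ i $ j = ?Q $ j $ i" for i j
      using sQ by (rule symmetric_mat_entry)
    have "(\<Sum>i\<in>UNIV. \<Sum>j\<in>UNIV. A $ i $ j * ?Q $ i $ j) = trace (A ** ?Q)"
      unfolding trace_def matrix_matrix_mult_def by (simp, subst s, simp)
    then show ?thesis by (simp add: inv trace_def mat_def)
  qed
  have "(\<Sum>i\<in>UNIV. \<Sum>j\<in>UNIV. A $ i $ j * hk_hess A \<tau> x $ i $ j) =
      hk A \<tau> x / (2 * \<tau>) * ((1 / (2 * \<tau>)) * (\<Sum>i\<in>UNIV. \<Sum>j\<in>UNIV. A $ i $ j * ((?Q *v x) $ i * (?Q *v x) $ j))
        - (\<Sum>i\<in>UNIV. \<Sum>j\<in>UNIV. A $ i $ j * ?Q $ i $ j))"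
    unfolding hk_hess_entry(2)[OF assms]
    by (simp add: sum_distrib_left sum_subtractf[symmetric] right_diff_distrib mult_ac)
  also have "\<dots> = ((x \<bullet> (?Q *v x)) / (4 * \<tau>\<^sup>2) - ?n / (2 * \<tau>)) * hk A \<tau> x"
    unfolding q1 q2 using \<tau> by (simp add: field_simps power2_eq_square)
  finally show ?thesis using d by simp
qed

lemma hk_continuous: "posdef A \<Longrightarrow> continuous_on ({0<..} \<times> UNIV) (\<lambda>(\<tau>, x). hk A \<tau> x)"
proof -
  assume A: "posdef A"
  have "continuous_on ({0<..} \<times> UNIV) (\<lambda>p. (1 / sqrt ((4 * pi) ^ CARD('a) * det A)) * fst p powr (- real CARD('a) / 2) *
    exp (- (snd p \<bullet> (matrix_inv A *v snd p)) / (4 * fst p)))"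
    by (intro continuous_intros continuous_on_compose2[OF continuous_on_matrix_vector_mult[of UNIV]]) auto
  then show ?thesis
    by (rule continuous_on_cong[THEN iffD1, rotated -1]) (auto simp: hk_formula[OF A])
qed

lemma hk_hess_continuous:
  assumes A: "posdef A"
  shows "continuous_on ({0<..} \<times> UNIV) (\<lambda>(\<tau>, x). hk_hess A \<tau> x $ i $ j)"
proof -
  have "continuous_on ({0<..} \<times> UNIV) (\<lambda>p. (case p of (\<tau>, x) \<Rightarrow> hk A \<tau> x) / (2 * fst p) *
      ((1 / (2 * fst p)) * ((matrix_inv A *v snd p) $ i * (matrix_inv A *v snd p) $ j) - matrix_inv A $ i $ j))"
    by (intro continuous_intros hk_continuous[OF A] continuous_on_component
        continuous_on_compose2[OF continuous_on_matrix_vector_mult[of UNIV]]) auto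
  then show ?thesis
    by (rule continuous_on_cong[THEN iffD1, rotated -1]) (auto simp: hk_hess_entry(2)[OF A])
qed

text \<open>The condition on \<epsilon> lets the factor exp (\<epsilon> |x|^2) use at most half of
  the Gaussian exponent; the remaining half is that of the kernel at time 2 \<tau>. The constant
  compensates for the change of the normalising power of time.\<close>

lemma hk_exp_bound:
  fixes A :: "'n::finite mat"
  assumes A: "posdef A" and l: "\<And>x. l * (norm x)\<^sup>2 \<le> x \<bullet> (matrix_inv A *v x)" and \<tau>: "\<tau> > 0"
    and \<epsilon>: "8 * \<tau> * \<epsilon> \<le> l"
  shows "hk A \<tau> x * exp (\<epsilon> * (norm x)\<^sup>2) \<le> 2 powr (real CARD('n) / 2) * hk A (2 * \<tau>) x"
proof -
  let ?q = "x \<bullet> (matrix_inv A *v x)" and ?c = "1 / sqrt ((4 * pi) ^ CARD('n) * det A)" and ?n = "real CARD('n)"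
  have "8 * \<tau> * \<epsilon> * (norm x)\<^sup>2 \<le> l * (norm x)\<^sup>2" using \<epsilon> by (intro mult_right_mono) auto
  also have "\<dots> \<le> ?q" by (rule l)
  finally have "\<epsilon> * (norm x)\<^sup>2 \<le> ?q / (8 * \<tau>)" using \<tau> by (simp add: field_simps)
  then have "- ?q / (4 * \<tau>) + \<epsilon> * (norm x)\<^sup>2 \<le> - ?q / (4 * (2 * \<tau>))" using \<tau> by (simp add: field_simps)
  then have e: "exp (- ?q / (4 * \<tau>)) * exp (\<epsilon> * (norm x)\<^sup>2) \<le> exp (- ?q / (4 * (2 * \<tau>)))"
    by (simp add: mult_exp_exp)
  have "2 powr (?n / 2) * (2 * \<tau>) powr (- ?n / 2) = \<tau> powr (- ?n / 2)"
    using \<tau> by (simp add: powr_mult powr_add[symmetric] mult.assoc[symmetric])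
  moreover have "0 \<le> ?c * \<tau> powr (- ?n / 2)" using posdef_det_pos[OF A] by simp
  from mult_left_mono[OF e this]
  have "hk A \<tau> x * exp (\<epsilon> * (norm x)\<^sup>2) \<le> ?c * \<tau> powr (- ?n / 2) * exp (- ?q / (4 * (2 * \<tau>)))"
    unfolding hk_formula[OF A \<tau>] by (simp add: mult.assoc)
  moreover have "2 powr (?n / 2) * hk A (2 * \<tau>) x =
      ?c * (2 powr (?n / 2) * (2 * \<tau>) powr (- ?n / 2)) * exp (- ?q / (4 * (2 * \<tau>)))"
    using \<tau> by (subst hk_formula[OF A]) (auto simp only: mult_ac)
  ultimately show ?thesis by (simp only:)
qed

text \<open>Bounding the norm of x / sqrt \<tau> by an exponential produces the parabolic factor
  sqrt \<tau>. Its decay as \<tau> tends to 0 gives the initial value of the kernel below.\<close>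

lemma hk_first_moment:
  fixes A :: "'n::finite mat"
  assumes A: "posdef A"
  obtains C where "C > 0" "\<And>\<tau>. \<tau> > 0 \<Longrightarrow> integrable lborel (\<lambda>x. hk A \<tau> x * norm x)"
    "\<And>\<tau>. \<tau> > 0 \<Longrightarrow> (LBINT x. hk A \<tau> x * norm x) \<le> C * sqrt \<tau>"
proof -
  obtain l where l: "l > 0" "\<And>x. l * (norm x)\<^sup>2 \<le> x \<bullet> (matrix_inv A *v x)"
    using posdef_coercive[OF posdef_inverse[OF A]] by blast
  define C where "C = (1 + 1 / (l / 8)) * 2 powr (real CARD('n) / 2)"
  have le: "hk A \<tau> x * norm x \<le> (C * sqrt \<tau>) * hk A (2 * \<tau>) x" if \<tau>: "\<tau> > 0" for \<tau> x
  proof -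
    have "norm ((1 / sqrt \<tau>) *\<^sub>R x) \<le> (1 + 1 / (l / 8)) * exp ((l / 8) * (norm ((1 / sqrt \<tau>) *\<^sub>R x))\<^sup>2)"
      using l(1) by (intro norm_le_exp_norm_power2) auto
    then have "norm x \<le> sqrt \<tau> * ((1 + 1 / (l / 8)) * exp ((l / (8 * \<tau>)) * (norm x)\<^sup>2))"
      using \<tau> by (simp add: power_mult_distrib power_divide field_simps)
    from mult_left_mono[OF this less_imp_le[OF hk_pos[OF A \<tau>, of x]]]
    have "hk A \<tau> x * norm x \<le> sqrt \<tau> * (1 + 1 / (l / 8)) * (hk A \<tau> x * exp ((l / (8 * \<tau>)) * (norm x)\<^sup>2))"
      by (simp add: mult_ac)
    also have "\<dots> \<le> sqrt \<tau> * (1 + 1 / (l / 8)) * (2 powr (real CARD('n) / 2) * hk A (2 * \<tau>) x)"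
      using l \<tau> by (intro mult_left_mono hk_exp_bound[OF A, of l]) auto
    finally show ?thesis by (simp add: C_def mult_ac)
  qed
  have m: "hk A \<tau> \<in> borel_measurable borel" if "\<tau> > 0" for \<tau>
    using borel_measurable_integrable[OF hk_integral(2)[OF A that]] by simp
  have int: "integrable lborel (\<lambda>x. hk A \<tau> x * norm x)" if \<tau>: "\<tau> > 0" for \<tau>
  proof (rule Bochner_Integration.integrable_bound[of _ "\<lambda>x. (C * sqrt \<tau>) * hk A (2 * \<tau>) x"])
    show "integrable lborel (\<lambda>x. (C * sqrt \<tau>) * hk A (2 * \<tau>) x)"
      using hk_integral(2)[OF A, of "2 * \<tau>"] \<tau> by simp
    show "AE x in lborel. norm (hk A \<tau> x * norm x) \<le> norm ((C * sqrt \<tau>) * hk A (2 * \<tau>) x)"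
    proof (intro AE_I2)
      fix x
      have "0 \<le> hk A \<tau> x * norm x" using hk_pos[OF A \<tau>, of x] by simp
      then show "norm (hk A \<tau> x * norm x) \<le> norm ((C * sqrt \<tau>) * hk A (2 * \<tau>) x)"
        using le[OF \<tau>, of x] by simp
    qed
  qed (use m[OF \<tau>] in simp)
  show ?thesis
  proof
    show "C > 0" using l by (simp add: C_def add_pos_pos)
    show "integrable lborel (\<lambda>x. hk A \<tau> x * norm x)" if "\<tau> > 0" for \<tau> by (rule int[OF that])
    show "(LBINT x. hk A \<tau> x * norm x) \<le> C * sqrt \<tau>" if \<tau>: "\<tau> > 0" for \<tau>
    proof -
      have "(LBINT x. hk A \<tau> x * norm x) \<le> (LBINT x. (C * sqrt \<tau>) * hk A (2 * \<tau>) x)"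
        using \<tau> hk_integral(2)[OF A, of "2 * \<tau>"] by (intro integral_mono int le) auto
      then show ?thesis using hk_integral(1)[OF A, of "2 * \<tau>"] \<tau> by simp
    qed
  qed
qed

text \<open>Truncation at \<open>M\<close> makes the kernel integrable on space-time; it does not affect potentials of
  functions that vanish after time \<open>M\<close>.\<close>

definition hk_st :: "'n::finite mat \<Rightarrow> real \<Rightarrow> 'n spacetime \<Rightarrow> real" where
  "hk_st A M = (\<lambda>(\<tau>, x). if 0 < \<tau> \<and> \<tau> \<le> M then hk A \<tau> x else 0)"

lemma hk_st_measurable [measurable]:
  assumes "posdef A"
  shows "hk_st A M \<in> borel_measurable borel"
proof -
  have "(\<lambda>p. indicat_real ({0<..M} \<times> UNIV) p *\<^sub>R (case p of (\<tau>, x) \<Rightarrow> hk A \<tau> x)) \<in> borel_measurable borel"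
    by (intro borel_measurable_continuous_on_indicator continuous_on_subset[OF hk_continuous[OF assms]] borel_Times) auto
  moreover have "hk_st A M = (\<lambda>p. indicat_real ({0<..M} \<times> UNIV) p *\<^sub>R (case p of (\<tau>, x) \<Rightarrow> hk A \<tau> x))"
    by (auto simp: hk_st_def fun_eq_iff indicator_def)
  ultimately show ?thesis by simp
qed

text \<open>A Gaussian moment that is uniform over all times up to \<open>M\<close>: on each time
  slice it is at most 2^(n/2), n being the dimension. It is the source of the spatial Gaussian decay
  of potentials.\<close>

lemma hk_st_exp_integrable:
  fixes A :: "'n::finite mat"
  assumes A: "posdef A" and M: "M > 0"
  obtains \<epsilon> where "\<epsilon> > 0" "integrable lborel (\<lambda>r. hk_st A M r * exp (\<epsilon> * (norm (snd r))\<^sup>2))"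
proof -
  obtain l where l: "l > 0" "\<And>x. l * (norm x)\<^sup>2 \<le> x \<bullet> (matrix_inv A *v x)"
    using posdef_coercive[OF posdef_inverse[OF A]] by blast
  \<comment> \<open>The latest time \<open>M\<close> is the worst case in the condition 8 \<tau>
    \<epsilon> <= l of \<open>hk_exp_bound\<close>.\<close>
  define \<epsilon> where "\<epsilon> = l / (8 * M)"
  have \<epsilon>: "\<epsilon> > 0" using l M by (simp add: \<epsilon>_def)
  have "integrable lborel (\<lambda>r. hk_st A M r * exp (\<epsilon> * (norm (snd r))\<^sup>2))"
  proof (rule integrableI_nonneg)
    note [measurable] = hk_st_measurable[OF A, of M]
    have [measurable]: "(\<lambda>r::'n spacetime. exp (\<epsilon> * (norm (snd r))\<^sup>2)) \<in> borel_measurable borel"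
      by (intro borel_measurable_continuous_onI continuous_intros)
    show m: "(\<lambda>r. hk_st A M r * exp (\<epsilon> * (norm (snd r))\<^sup>2)) \<in> borel_measurable lborel" by measurable
    show "AE x in lborel. 0 \<le> hk_st A M x * exp (\<epsilon> * (norm (snd x))\<^sup>2)"
      using less_imp_le[OF hk_pos[OF A]] by (auto simp: hk_st_def split: prod.splits)
    have "(\<integral>\<^sup>+r. ennreal (hk_st A M r * exp (\<epsilon> * (norm (snd r))\<^sup>2)) \<partial>lborel) =
        (\<integral>\<^sup>+\<tau>. \<integral>\<^sup>+x. ennreal (hk_st A M (\<tau>, x) * exp (\<epsilon> * (norm x)\<^sup>2)) \<partial>lborel \<partial>lborel)"
      using m by (subst lborel_prod[symmetric], subst lborel.nn_integral_fst[symmetric]) (simp_all add: lborel_prod)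
    also have "\<dots> \<le> (\<integral>\<^sup>+\<tau>. ennreal (2 powr (real CARD('n) / 2)) * indicator {0<..M} \<tau> \<partial>lborel)"
    proof (rule nn_integral_mono)
      fix \<tau> :: real
      show "(\<integral>\<^sup>+x. ennreal (hk_st A M (\<tau>, x) * exp (\<epsilon> * (norm x)\<^sup>2)) \<partial>lborel) \<le> ennreal (2 powr (real CARD('n) / 2)) * indicator {0<..M} \<tau>"
      proof (cases "0 < \<tau> \<and> \<tau> \<le> M")
        case True
        then have e: "8 * \<tau> * \<epsilon> \<le> l" using M l(1) by (simp add: \<epsilon>_def field_simps)
        have "(\<integral>\<^sup>+x. ennreal (hk_st A M (\<tau>, x) * exp (\<epsilon> * (norm x)\<^sup>2)) \<partial>lborel) \<le>
            (\<integral>\<^sup>+x. ennreal (2 powr (real CARD('n) / 2) * hk A (2 * \<tau>) x) \<partial>lborel)"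
          using True hk_exp_bound[OF A l(2) _ e] by (intro nn_integral_mono ennreal_leI) (simp add: hk_st_def)
        also have "\<dots> = ennreal (LBINT x. 2 powr (real CARD('n) / 2) * hk A (2 * \<tau>) x)"
          using True hk_integral(2)[OF A, of "2 * \<tau>"] less_imp_le[OF hk_pos[OF A, of "2 * \<tau>"]]
          by (intro nn_integral_eq_integral integrable_mult_right) auto
        also have "\<dots> = ennreal (2 powr (real CARD('n) / 2))"
          using True hk_integral(1)[OF A, of "2 * \<tau>"] by simp
        finally show ?thesis using True by simp
      qed (auto simp: hk_st_def)
    qed
    also have "\<dots> = ennreal (2 powr (real CARD('n) / 2)) * emeasure lborel {0<..M}"
      by (simp add: nn_integral_cmult_indicator)
    also have "\<dots> < \<infinity>" using M by (simp add: ennreal_mult_less_top)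
    finally show "(\<integral>\<^sup>+r. ennreal (hk_st A M r * exp (\<epsilon> * (norm (snd r))\<^sup>2)) \<partial>lborel) < \<infinity>" .
  qed
  then show ?thesis using \<epsilon> that by blast
qed

lemma hk_st_nonneg: "posdef A \<Longrightarrow> 0 \<le> hk_st A M r"
  using less_imp_le[OF hk_pos] by (auto simp: hk_st_def split: prod.splits)

lemma hk_st_integrable:
  assumes A: "posdef A"
  shows "integrable lborel (hk_st A M)"
proof (cases "M > 0")
  case True
  obtain \<epsilon> where e: "\<epsilon> > 0" "integrable lborel (\<lambda>r. hk_st A M r * exp (\<epsilon> * (norm (snd r))\<^sup>2))"
    using hk_st_exp_integrable[OF A True] by blast
  show ?thesis
  proof (rule Bochner_Integration.integrable_bound[OF e(2)])
    show "AE r in lborel. norm (hk_st A M r) \<le> norm (hk_st A M r * exp (\<epsilon> * (norm (snd r))\<^sup>2))"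
    proof (intro AE_I2)
      fix r
      have "hk_st A M r * 1 \<le> hk_st A M r * exp (\<epsilon> * (norm (snd r))\<^sup>2)"
        using e(1) by (intro mult_left_mono hk_st_nonneg[OF A]) auto
      then show "norm (hk_st A M r) \<le> norm (hk_st A M r * exp (\<epsilon> * (norm (snd r))\<^sup>2))"
        using hk_st_nonneg[OF A, of M r] by simp
    qed
  qed (use hk_st_measurable[OF A] in simp)
next
  case False
  then have "hk_st A M = (\<lambda>_. 0)" by (auto simp: hk_st_def)
  then show ?thesis by simp
qed

lemma bounded_linear_time_zero: "bounded_linear (\<lambda>x::'a::real_normed_vector. (0::real, x))"
  by (rule bounded_linear_intro[where K=1]) (auto simp: norm_Pair)

lemma bounded_linear_space_zero: "bounded_linear (\<lambda>x::real. (x, 0::'a::real_normed_vector))"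
  by (rule bounded_linear_intro[where K=1]) (auto simp: norm_Pair)

lemma spacetime_slice_test_function:
  fixes f :: "'n::finite spacetime \<Rightarrow> real"
  assumes f: "f \<in> test_functions UNIV"
  shows "(\<lambda>x. f (p + (\<tau>, x))) \<in> test_functions UNIV"
    and "dderiv h (\<lambda>x. f (p + (\<tau>, x))) x = dderiv (0, h) f (p + (\<tau>, x))"
proof -
  obtain C where C: "compact C" "\<And>x. x \<notin> C \<Longrightarrow> f x = 0" "smooth_on UNIV f"
    using f by (metis test_functionsE)
  have e: "(\<lambda>x. f (p + (\<tau>, x))) = (\<lambda>x. f ((p + (\<tau>, 0)) + (0, x)))" by (simp add: add.assoc)
  have "dderiv h (\<lambda>x. f ((p + (\<tau>, 0)) + (0, x))) x = dderiv (0, h) f ((p + (\<tau>, 0)) + (0, x))"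
    by (intro dderiv_eq dderiv_compose_affine[OF bounded_linear_time_zero] smooth_on_differentiable[OF C(3)]) simp
  then show "dderiv h (\<lambda>x. f (p + (\<tau>, x))) x = dderiv (0, h) f (p + (\<tau>, x))" by (simp add: add.assoc)
  show "(\<lambda>x. f (p + (\<tau>, x))) \<in> test_functions UNIV"
  proof (rule test_functionsI)
    show "smooth_on UNIV (\<lambda>x. f (p + (\<tau>, x)))"
      by (subst e, rule smooth_on_compose_affine[OF _ bounded_linear_time_zero _ C(3)]) auto
    show "compact ((\<lambda>q. snd q - snd p) ` C)"
      by (intro compact_continuous_image C continuous_intros)
    fix x assume x: "x \<notin> (\<lambda>q. snd q - snd p) ` C"
    show "f (p + (\<tau>, x)) = 0"
    proof (rule C(2), rule notI)
      assume "p + (\<tau>, x) \<in> C"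
      then have "snd (p + (\<tau>, x)) - snd p \<in> (\<lambda>q. snd q - snd p) ` C" by blast
      with x show False by simp
    qed
  qed auto
qed

lemma spacetime_time_derivative:
  fixes f :: "'n::finite spacetime \<Rightarrow> real"
  assumes "f differentiable at (p + (\<tau>, x))"
  shows "((\<lambda>\<tau>. f (p + (\<tau>, x))) has_real_derivative dderiv (1, 0) f (p + (\<tau>, x))) (at \<tau>)"
proof -
  have d: "f differentiable at (p + (0, x) + (\<tau>, 0))" using assms by (simp add: add.assoc)
  have h: "((\<lambda>\<tau>. f (p + (\<tau>, x))) has_derivative (\<lambda>s. dderiv (s, 0) f (p + (\<tau>, x)))) (at \<tau>)"
    using dderiv_compose_affine[OF bounded_linear_space_zero d] by (simp add: add.assoc)
  have "(\<lambda>s. dderiv (s, 0) f (p + (\<tau>, x))) = (*) (dderiv (1, 0) f (p + (\<tau>, x)))"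
  proof
    fix s
    show "dderiv (s, 0) f (p + (\<tau>, x)) = dderiv (1, 0) f (p + (\<tau>, x)) * s"
      using linear_cmul[OF dderiv_linear[OF assms], of s "(1, 0)"] by simp
  qed
  then show ?thesis using h by (simp only: has_field_derivative_def)
qed

lemma test_function_translate_bounded:
  fixes f :: "'n::finite spacetime \<Rightarrow> real"
  assumes f: "f \<in> test_functions UNIV"
  obtains R where "R > 0" "\<And>\<tau> x. norm x > R \<Longrightarrow> f (p + (\<tau>, x)) = 0"
proof -
  obtain C where C: "compact C" "\<And>x. x \<notin> C \<Longrightarrow> f x = 0" using f by (metis test_functionsE)
  obtain R where R: "R > 0" "\<And>x. x \<in> C \<Longrightarrow> norm x \<le> R"
    using compact_imp_bounded[OF C(1)] by (auto simp: bounded_pos)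
  have "f (p + (\<tau>, x)) = 0" if "norm x > R + norm (snd p)" for \<tau> x
  proof (rule C(2), rule notI)
    assume "p + (\<tau>, x) \<in> C"
    then have "norm (snd (p + (\<tau>, x))) \<le> R"
      using R(2)[of "p + (\<tau>, x)"] norm_snd_le by (metis order_trans prod.collapse)
    then show False using that norm_triangle_ineq4[of "snd p + x" "snd p"] by simp
  qed
  then show ?thesis using that[of "R + norm (snd p)"] R(1) by (simp add: add_pos_nonneg)
qed

lemma dderiv_continuous: "smooth_on UNIV f \<Longrightarrow> continuous_on UNIV (dderiv e f)"
  using smooth_on_dderiv smooth_on_continuous by blast

text \<open>At a fixed positive time the kernel is regular, so both derivatives move onto it without
  boundary terms. They arrive in the opposite order, which the symmetry of the inverse of
  \<open>A\<close> makes irrelevant.\<close>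

lemma hk_hess_integration_by_parts:
  fixes A :: "'n::finite mat" and \<phi> :: "real^'n \<Rightarrow> real"
  assumes A: "posdef A" and \<tau>: "\<tau> > 0" and \<phi>: "\<phi> \<in> test_functions UNIV"
  shows "(LBINT x. hk A \<tau> x * dderiv (axis i 1) (dderiv (axis j 1) \<phi>) x) = (LBINT x. hk_hess A \<tau> x $ i $ j * \<phi> x)"
    and "integrable lborel (\<lambda>x. hk_hess A \<tau> x $ i $ j * \<phi> x)"
proof -
  let ?K = "hk A \<tau>" and ?i = "axis i (1::real)" and ?j = "axis j (1::real)"
  have slice: "continuous_on UNIV (\<lambda>x. (\<tau>, x))" by (intro continuous_intros)
  have cK: "continuous_on UNIV ?K"
    using continuous_on_compose2[OF hk_continuous[OF A] slice] \<tau> by (auto simp: image_subset_iff)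
  have cD: "continuous_on UNIV (dderiv e ?K)" for e
  proof -
    have "dderiv e ?K = (\<lambda>x. - (1 / (2 * \<tau>)) * (e \<bullet> (matrix_inv A *v x)) * ?K x)"
      using hk_dderiv[OF A \<tau>] by auto
    then show ?thesis by (simp only:) (intro continuous_intros cK continuous_on_matrix_vector_mult)
  qed
  have cH: "continuous_on UNIV (\<lambda>x. hk_hess A \<tau> x $ i $ j)" for i j
    using continuous_on_compose2[OF hk_hess_continuous[OF A] slice] \<tau> by (auto simp: image_subset_iff)
  have eH: "dderiv (axis i 1) (dderiv (axis j 1) ?K) = (\<lambda>x. hk_hess A \<tau> x $ i $ j)" for i j
    using hk_hess_entry(1)[OF A \<tau>] by auto
  have dK: "?K differentiable at x" "dderiv e ?K differentiable at x" for x e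
    using hk_has_derivative[OF A \<tau>] hk_dderiv_has_derivative[OF A \<tau>] unfolding differentiable_def by blast+
  note \<phi>j = test_functions_dderiv[OF \<phi>, of ?j]
  obtain C where C: "compact C" "\<And>x. x \<notin> C \<Longrightarrow> \<phi> x = 0" using \<phi> by (metis test_functionsE)
  obtain C' where C': "compact C'" "\<And>x. x \<notin> C' \<Longrightarrow> dderiv ?j \<phi> x = 0" using \<phi>j by (metis test_functionsE)
  note s = test_functions_smooth[OF \<phi>] test_functions_smooth[OF \<phi>j]
  note s = smooth_on_differentiable[OF s(1) UNIV_I] smooth_on_differentiable[OF s(2) UNIV_I]
    dderiv_continuous[OF s(1)] dderiv_continuous[OF s(2)]
  have "(LBINT x. dderiv ?j \<phi> x * dderiv ?i ?K x) = - (LBINT x. dderiv ?i (dderiv ?j \<phi>) x * ?K x)"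
    by (rule integration_by_parts_dderiv[OF _ _ _ _ C'])
      (use dK s cD in auto)
  moreover have "(LBINT x. \<phi> x * dderiv ?j (dderiv ?i ?K) x) = - (LBINT x. dderiv ?j \<phi> x * dderiv ?i ?K x)"
    by (rule integration_by_parts_dderiv[OF _ _ _ _ C])
      (use dK s cH in \<open>auto simp: eH\<close>)
  ultimately have "(LBINT x. hk A \<tau> x * dderiv ?i (dderiv ?j \<phi>) x) = (LBINT x. hk_hess A \<tau> x $ j $ i * \<phi> x)"
    unfolding eH by (simp add: mult.commute)
  moreover have "hk_hess A \<tau> x $ j $ i = hk_hess A \<tau> x $ i $ j" for x
    using symmetric_mat_entry[of "matrix_inv A" i j] posdef_inverse[OF A]
    unfolding hk_hess_entry(2)[OF A \<tau>] by (simp add: posdef_def mult.commute)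
  ultimately show "(LBINT x. hk A \<tau> x * dderiv ?i (dderiv ?j \<phi>) x) = (LBINT x. hk_hess A \<tau> x $ i $ j * \<phi> x)"
    by simp
  show "integrable lborel (\<lambda>x. hk_hess A \<tau> x $ i $ j * \<phi> x)"
    by (rule integrable_continuous_compact_support[OF C(1)])
      (use C in \<open>auto intro!: continuous_on_mult continuous_on_subset[OF cH]
          continuous_on_subset[OF test_functions_continuous[OF \<phi>]]\<close>)
qed

text \<open>The kernel has mass 1 and \<open>f\<close> is Lipschitz, so the error is at most the
  Lipschitz constant times \<epsilon> plus the first moment of the kernel. The term \<epsilon> is
  due to the time argument of \<open>f\<close>, which moves along.\<close>

lemma hk_initial_value:
  fixes A :: "'n::finite mat" and f :: "'n spacetime \<Rightarrow> real"
  assumes A: "posdef A" and f: "f \<in> test_functions UNIV"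
  shows "((\<lambda>\<epsilon>. LBINT x. hk A \<epsilon> x * f (p + (\<epsilon>, x))) \<longlongrightarrow> f p) (at_right 0)"
proof -
  obtain B where B: "B > 0" "\<And>x h. \<bar>dderiv h f x\<bar> \<le> B * norm h"
    using test_functions_dderiv_bounded[OF f] by blast
  obtain B' where B': "B' > 0" "\<And>x. \<bar>f x\<bar> \<le> B'" using test_functions_bounded[OF f] by blast
  obtain C where C: "C > 0" "\<And>\<tau>. \<tau> > 0 \<Longrightarrow> integrable lborel (\<lambda>x. hk A \<tau> x * norm x)"
    "\<And>\<tau>. \<tau> > 0 \<Longrightarrow> (LBINT x. hk A \<tau> x * norm x) \<le> C * sqrt \<tau>"
    using hk_first_moment[OF A] by blast
  have [measurable]: "f \<in> borel_measurable borel" by (rule test_functions_measurable[OF f])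
  have lip: "\<bar>f (p + q) - f p\<bar> \<le> B * norm q" for q
  proof -
    have "norm (f (p + q) - f p) \<le> B * norm ((p + q) - p)"
    proof (rule differentiable_bound[OF convex_UNIV])
      show "(f has_derivative (\<lambda>h. dderiv h f x)) (at x within UNIV)" for x
        using has_dderiv[OF smooth_on_differentiable[OF test_functions_smooth[OF f] UNIV_I]] by simp
      show "onorm (\<lambda>h. dderiv h f x) \<le> B" for x
        using B(2) by (intro onorm_le) (simp add: mult.commute)
    qed auto
    then show ?thesis by simp
  qed
  have le: "norm ((LBINT x. hk A \<epsilon> x * f (p + (\<epsilon>, x))) - f p) \<le> B * (\<epsilon> + C * sqrt \<epsilon>)" if e: "\<epsilon> > 0" for \<epsilon>
  proof -
    note K = hk_integral[OF A e]
    have [measurable]: "hk A \<epsilon> \<in> borel_measurable borel" using borel_measurable_integrable[OF K(2)] by simp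
    have i1: "integrable lborel (\<lambda>x. hk A \<epsilon> x * f (p + (\<epsilon>, x)))"
    proof (rule Bochner_Integration.integrable_bound[of _ "\<lambda>x. B' * hk A \<epsilon> x"])
      show "AE x in lborel. norm (hk A \<epsilon> x * f (p + (\<epsilon>, x))) \<le> norm (B' * hk A \<epsilon> x)"
        using B' less_imp_le[OF hk_pos[OF A e]]
        by (intro AE_I2) (simp add: abs_mult mult.commute[of B'] mult_left_mono)
      show "(\<lambda>x. hk A \<epsilon> x * f (p + (\<epsilon>, x))) \<in> borel_measurable lborel" by measurable
    qed (use K in simp)
    have "(LBINT x. hk A \<epsilon> x * f (p + (\<epsilon>, x))) - f p = (LBINT x. hk A \<epsilon> x * f (p + (\<epsilon>, x)) - hk A \<epsilon> x * f p)"
      using K i1 by (subst Bochner_Integration.integral_diff) auto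
    also have "norm \<dots> \<le> (LBINT x. B * (\<epsilon> * hk A \<epsilon> x + hk A \<epsilon> x * norm x))"
    proof (rule order_trans[OF integral_norm_bound integral_mono])
      have "integrable lborel (\<lambda>x. hk A \<epsilon> x * f (p + (\<epsilon>, x)) - hk A \<epsilon> x * f p)" using K i1 by simp
      then show "integrable lborel (\<lambda>x. norm (hk A \<epsilon> x * f (p + (\<epsilon>, x)) - hk A \<epsilon> x * f p))"
        by (rule integrable_norm)
      show "integrable lborel (\<lambda>x. B * (\<epsilon> * hk A \<epsilon> x + hk A \<epsilon> x * norm x))"
        using K C(2)[OF e] by simp
      fix x :: "real^'n"
      have n: "norm (\<epsilon>, x) \<le> \<epsilon> + norm x" using norm_Pair_le[of \<epsilon> x] e by simp
      have k: "0 \<le> hk A \<epsilon> x" using hk_pos[OF A e] less_imp_le by blast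
      have "norm (hk A \<epsilon> x * f (p + (\<epsilon>, x)) - hk A \<epsilon> x * f p) = hk A \<epsilon> x * \<bar>f (p + (\<epsilon>, x)) - f p\<bar>"
        using k by (simp add: right_diff_distrib[symmetric] abs_mult)
      also have "\<dots> \<le> hk A \<epsilon> x * (B * (\<epsilon> + norm x))"
        using n B(1) k by (intro mult_left_mono order_trans[OF lip]) auto
      finally show "norm (hk A \<epsilon> x * f (p + (\<epsilon>, x)) - hk A \<epsilon> x * f p) \<le> B * (\<epsilon> * hk A \<epsilon> x + hk A \<epsilon> x * norm x)"
        by (simp add: algebra_simps)
    qed
    also have "\<dots> = B * (\<epsilon> + (LBINT x. hk A \<epsilon> x * norm x))"
      using K C(2)[OF e] by simp
    also have "\<dots> \<le> B * (\<epsilon> + C * sqrt \<epsilon>)" using B(1) C(3)[OF e] by (intro mult_left_mono) auto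
    finally show ?thesis .
  qed
  have "((\<lambda>\<epsilon>. (LBINT x. hk A \<epsilon> x * f (p + (\<epsilon>, x))) - f p) \<longlongrightarrow> 0) (at_right 0)"
  proof (rule Lim_null_comparison)
    show "\<forall>\<^sub>F \<epsilon> in at_right 0. norm ((LBINT x. hk A \<epsilon> x * f (p + (\<epsilon>, x))) - f p) \<le> B * (\<epsilon> + C * sqrt \<epsilon>)"
      using le by (auto simp: eventually_at_filter)
    have "((\<lambda>\<epsilon>. B * (\<epsilon> + C * sqrt \<epsilon>)) \<longlongrightarrow> B * (0 + C * sqrt 0)) (at_right 0)"
      by (intro tendsto_intros)
    then show "((\<lambda>\<epsilon>. B * (\<epsilon> + C * sqrt \<epsilon>)) \<longlongrightarrow> 0) (at_right 0)" by simp
  qed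
  then show ?thesis by (simp add: LIM_zero_iff)
qed

section \<open>The heat equation for space-time potentials\<close>

abbreviation dderiv2 :: "'n::finite \<Rightarrow> 'n \<Rightarrow> ('n spacetime \<Rightarrow> real) \<Rightarrow> 'n spacetime \<Rightarrow> real" where
  "dderiv2 i j f \<equiv> dderiv (e_space i) (dderiv (e_space j) f)"

text \<open>This is minus P_A applied to \<open>f\<close>, the formal adjoint of the negative of the
  operator d/ds - A : D^2.\<close>

definition heat_adj :: "'n::finite mat \<Rightarrow> ('n spacetime \<Rightarrow> real) \<Rightarrow> 'n spacetime \<Rightarrow> real" where
  "heat_adj A f q = dderiv e_time f q + (\<Sum>i\<in>UNIV. \<Sum>j\<in>UNIV. A $ i $ j * dderiv2 i j f q)"

lemma heat_adj_test_function:
  assumes "f \<in> test_functions \<Omega>"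
  shows "heat_adj A f \<in> test_functions \<Omega>"
  unfolding heat_adj_def[abs_def]
  by (intro test_functions_add test_functions_sum test_functions_cmult test_functions_dderiv assms)

lemma indicator_slab_integrable:
  fixes g :: "'n::finite spacetime \<Rightarrow> real"
  assumes "a > 0" "continuous_on ({0<..} \<times> UNIV) g" "\<And>\<tau> x. norm x > R \<Longrightarrow> g (\<tau>, x) = 0"
  shows "integrable lborel (\<lambda>r. indicat_real ({a..b} \<times> UNIV) r * g r)"
proof -
  have "integrable lborel (\<lambda>r. indicat_real ({a..b} \<times> cball 0 R) r *\<^sub>R g r)"
    using assms(1) by (intro borel_integrable_compact compact_Times continuous_on_subset[OF assms(2)]) auto
  moreover have "(\<lambda>r. indicat_real ({a..b} \<times> cball 0 R) r *\<^sub>R g r) = (\<lambda>r. indicat_real ({a..b} \<times> UNIV) r * g r)"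
    using assms(3) by (auto simp: indicator_def fun_eq_iff not_le)
  ultimately show ?thesis by simp
qed

text \<open>For time lags between \<epsilon> and \<open>M\<close> the space derivatives are moved
  onto the kernel, and the heat equation turns the integrand into the time derivative of the kernel
  times the shifted \<open>f\<close>. The boundary term at lag \<open>M\<close> vanishes because
  \<open>f\<close> is zero there, and the one at \<epsilon> is an average of \<open>f\<close> that
  tends to f(p).\<close>

theorem heat_potential_identity:
  fixes A :: "'n::finite mat" and f :: "'n spacetime \<Rightarrow> real"
  assumes A: "posdef A" and f: "f \<in> test_functions UNIV" and M: "M > 0"
    and z: "\<And>s z. s \<ge> fst p + M \<Longrightarrow> f (s, z) = 0"
  shows "kconv (hk_st A M) (heat_adj A f) p = - f p"
proof -
  let ?g = "heat_adj A f"
  note g = heat_adj_test_function[OF f, of A]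
  obtain R where R: "R > 0" "\<And>\<tau> x. norm x > R \<Longrightarrow> f (p + (\<tau>, x)) = 0"
    using test_function_translate_bounded[OF f] by blast
  note ft = test_functions_dderiv[OF f, of e_time]
  have fij: "dderiv2 i j f \<in> test_functions UNIV" for i j
    by (intro test_functions_dderiv f)
  have cont: "continuous_on S (\<lambda>r. h (p + r))" if "h \<in> test_functions UNIV" for h S
    by (rule continuous_on_compose2[OF test_functions_continuous[OF that]]) (auto intro!: continuous_intros)
  have J: "(LBINT r. indicat_real ({\<epsilon>..M} \<times> UNIV) r * (hk_st A M r * ?g (p + r))) = - (LBINT x. hk A \<epsilon> x * f (p + (\<epsilon>, x)))"
    if e: "0 < \<epsilon>" "\<epsilon> \<le> M" for \<epsilon>
  proof -
    let ?I = "indicat_real ({\<epsilon>..M} \<times> UNIV) :: 'n spacetime \<Rightarrow> real"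
    let ?K = "\<lambda>r. case r of (\<tau>, x) \<Rightarrow> hk A \<tau> x"
    have int: "integrable lborel (\<lambda>r. ?I r * (k r * h (p + r)))"
      if h: "h \<in> test_functions UNIV" and k: "continuous_on ({0<..} \<times> UNIV) k" for h and k :: "'n spacetime \<Rightarrow> real"
    proof -
      obtain R where R: "R > 0" "\<And>\<tau> x. norm x > R \<Longrightarrow> h (p + (\<tau>, x)) = 0"
        using test_function_translate_bounded[OF h] by blast
      show ?thesis
        using e R(2) by (intro indicator_slab_integrable[where R=R] continuous_on_mult k cont h) auto
    qed
    have space: "(LBINT r. ?I r * (?K r * dderiv2 i j f (p + r))) =
        (LBINT r. ?I r * ((case r of (\<tau>, x) \<Rightarrow> hk_hess A \<tau> x $ i $ j) * f (p + r)))" for i j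
    proof -
      have "(LBINT r. ?I r * (?K r * dderiv2 i j f (p + r))) =
          (LBINT \<tau>. \<integral>x. ?I (\<tau>, x) * (hk A \<tau> x * dderiv2 i j f (p + (\<tau>, x))) \<partial>lborel)"
        using lborel_pair.integral_fst'[of "\<lambda>r. ?I r * (?K r * dderiv2 i j f (p + r))"]
          int[OF fij hk_continuous[OF A]] by (simp add: lborel_prod)
      also have "\<dots> = (LBINT \<tau>. \<integral>x. ?I (\<tau>, x) * (hk_hess A \<tau> x $ i $ j * f (p + (\<tau>, x))) \<partial>lborel)"
      proof (rule Bochner_Integration.integral_cong[OF refl])
        fix \<tau> :: real
        show "(LBINT x. ?I (\<tau>, x) * (hk A \<tau> x * dderiv2 i j f (p + (\<tau>, x)))) =
            (LBINT x. ?I (\<tau>, x) * (hk_hess A \<tau> x $ i $ j * f (p + (\<tau>, x))))"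
        proof (cases "\<tau> \<in> {\<epsilon>..M}")
          case True
          have "dderiv (axis i 1) (dderiv (axis j 1) (\<lambda>x. f (p + (\<tau>, x)))) x =
              dderiv2 i j f (p + (\<tau>, x))" for x
          proof -
            have "dderiv (axis j 1) (\<lambda>x. f (p + (\<tau>, x))) = (\<lambda>x. dderiv (e_space j) f (p + (\<tau>, x)))"
              by (intro ext spacetime_slice_test_function(2)[OF f])
            then show ?thesis using spacetime_slice_test_function(2)[OF test_functions_dderiv[OF f]] by simp
          qed
          with hk_hess_integration_by_parts(1)[OF A _ spacetime_slice_test_function(1)[OF f, of p \<tau>], of \<tau> i j]
          show ?thesis using True e by (simp add: indicator_def)
        qed (simp add: indicator_def)
      qed
      also have "\<dots> = (LBINT r. ?I r * ((case r of (\<tau>, x) \<Rightarrow> hk_hess A \<tau> x $ i $ j) * f (p + r)))"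
        using lborel_pair.integral_fst'[of "\<lambda>r. ?I r * ((case r of (\<tau>, x) \<Rightarrow> hk_hess A \<tau> x $ i $ j) * f (p + r))"]
          int[OF f hk_hess_continuous[OF A]] by (simp add: lborel_prod)
      finally show ?thesis .
    qed
    let ?T = "\<lambda>r. case r of (\<tau>, x) \<Rightarrow> (\<Sum>i\<in>UNIV. \<Sum>j\<in>UNIV. A $ i $ j * hk_hess A \<tau> x $ i $ j)"
    let ?\<zeta>' = "\<lambda>r. ?T r * f (p + r) + ?K r * dderiv e_time f (p + r)"
    have cT: "continuous_on ({0<..} \<times> UNIV) ?T"
    proof -
      have "continuous_on ({0<..} \<times> UNIV) (\<lambda>r. \<Sum>i\<in>UNIV. \<Sum>j\<in>UNIV. A $ i $ j * (case r of (\<tau>, x) \<Rightarrow> hk_hess A \<tau> x $ i $ j))"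
        by (intro continuous_intros hk_hess_continuous[OF A])
      then show ?thesis by (simp add: split_beta')
    qed
    have "(LBINT r. ?I r * (hk_st A M r * ?g (p + r))) = (LBINT r. ?I r * (?K r * dderiv e_time f (p + r)) +
        (\<Sum>i\<in>UNIV. \<Sum>j\<in>UNIV. A $ i $ j * (?I r * (?K r * dderiv2 i j f (p + r)))))"
    proof (rule Bochner_Integration.integral_cong[OF refl])
      fix r :: "'n spacetime"
      have "?I r * hk_st A M r = ?I r * ?K r" using e by (auto simp: indicator_def hk_st_def split: prod.splits)
      then have "?I r * (hk_st A M r * ?g (p + r)) = ?I r * ?K r * ?g (p + r)" by (simp only: mult.assoc[symmetric])
      then show "?I r * (hk_st A M r * ?g (p + r)) = ?I r * (?K r * dderiv e_time f (p + r)) +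
        (\<Sum>i\<in>UNIV. \<Sum>j\<in>UNIV. A $ i $ j * (?I r * (?K r * dderiv2 i j f (p + r))))"
        by (simp add: heat_adj_def distrib_left sum_distrib_left mult_ac)
    qed
    also have "\<dots> = (LBINT r. ?I r * (?K r * dderiv e_time f (p + r))) +
        (\<Sum>i\<in>UNIV. \<Sum>j\<in>UNIV. A $ i $ j * (LBINT r. ?I r * (?K r * dderiv2 i j f (p + r))))"
      using int[OF ft hk_continuous[OF A]] int[OF fij hk_continuous[OF A]]
      by (simp add: integral_finite_sum)
    also have "\<dots> = (LBINT r. ?I r * (?K r * dderiv e_time f (p + r))) +
        (\<Sum>i\<in>UNIV. \<Sum>j\<in>UNIV. A $ i $ j * (LBINT r. ?I r * ((case r of (\<tau>, x) \<Rightarrow> hk_hess A \<tau> x $ i $ j) * f (p + r))))"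
      by (simp only: space)
    also have "\<dots> = (LBINT r. ?I r * (?K r * dderiv e_time f (p + r)) +
        (\<Sum>i\<in>UNIV. \<Sum>j\<in>UNIV. A $ i $ j * (?I r * ((case r of (\<tau>, x) \<Rightarrow> hk_hess A \<tau> x $ i $ j) * f (p + r)))))"
      using int[OF ft hk_continuous[OF A]] int[OF f hk_hess_continuous[OF A]]
      by (simp add: integral_finite_sum)
    also have "\<dots> = (LBINT r. ?I r * ?\<zeta>' r)"
      by (rule Bochner_Integration.integral_cong[OF refl])
        (simp add: split_beta' distrib_left sum_distrib_left sum_distrib_right mult_ac)
    also have "\<dots> = (LBINT x. ?K (M, x) * f (p + (M, x)) - ?K (\<epsilon>, x) * f (p + (\<epsilon>, x)))"
    proof (rule slab_integral_time_derivative(1)[OF e(2), where \<zeta>="\<lambda>r. ?K r * f (p + r)" and \<zeta>'="?\<zeta>'"])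
      fix s :: real and z :: "real^'n" assume s: "\<epsilon> \<le> s" "s \<le> M"
      have "((\<lambda>s. hk A s z * f (p + (s, z))) has_real_derivative
          ?T (s, z) * f (p + (s, z)) + dderiv e_time f (p + (s, z)) * hk A s z) (at s)"
        using s e hk_time_derivative[OF A, of s z]
          spacetime_time_derivative[OF smooth_on_differentiable[OF test_functions_smooth[OF f]]]
        by (intro DERIV_mult) auto
      then show "((\<lambda>s. ?K (s, z) * f (p + (s, z))) has_real_derivative ?\<zeta>' (s, z)) (at s within {\<epsilon>..M})"
        by (simp add: mult.commute has_field_derivative_at_within)
      have z0: "f (p + (s, z)) = 0" if "z \<notin> cball 0 R" for s z using R(2) that by simp
      show "?\<zeta>' (s, z) = 0" if zz: "z \<notin> cball 0 R"
      proof -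
        have "((\<lambda>s. f (p + (s, z))) has_real_derivative dderiv e_time f (p + (s, z))) (at s)"
          by (rule spacetime_time_derivative[OF smooth_on_differentiable[OF test_functions_smooth[OF f]]]) simp
        moreover have "((\<lambda>s. f (p + (s, z))) has_real_derivative 0) (at s)" by (simp add: z0[OF zz])
        ultimately have "dderiv e_time f (p + (s, z)) = 0" by (rule DERIV_unique)
        then show ?thesis using z0[OF zz] by simp
      qed
    next
      show "continuous_on ({\<epsilon>..M} \<times> UNIV) ?\<zeta>'"
        using e by (intro continuous_on_add continuous_on_mult cont f ft
            continuous_on_subset[OF cT] continuous_on_subset[OF hk_continuous[OF A]]) auto
    qed
    also have "\<dots> = - (LBINT x. hk A \<epsilon> x * f (p + (\<epsilon>, x)))"
      using z[of "fst p + M"] by (simp add: plus_prod_def)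
    finally show ?thesis .
  qed
  define e where "e n = M / (real n + 2)" for n
  have e: "0 < e n" "e n \<le> M" for n using M by (auto simp: e_def field_simps)
  have e0: "e \<longlonglongrightarrow> 0"
    unfolding e_def by real_asymp
  \<comment> \<open>With the derivatives on \<open>f\<close> the full integrand is integrable, so
    the small lags may be removed and restored by dominated convergence.\<close>
  have "(\<lambda>n. LBINT r. indicat_real ({e n..M} \<times> UNIV) r * (hk_st A M r * ?g (p + r))) \<longlonglongrightarrow>
      (LBINT r. hk_st A M r * ?g (p + r))"
  proof (rule integral_dominated_convergence[where w="\<lambda>r. norm (hk_st A M r * ?g (p + r))"])
    obtain B where B: "\<And>x. \<bar>?g x\<bar> \<le> B" using test_functions_bounded[OF g] by blast
    have int: "integrable lborel (\<lambda>r. hk_st A M r * ?g (p + r))"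
      using test_functions_measurable[OF g] B by (rule kconv_integrable[OF hk_st_integrable[OF A]])
    then show "integrable lborel (\<lambda>r. norm (hk_st A M r * ?g (p + r)))" by (rule integrable_norm)
    show m: "(\<lambda>r. hk_st A M r * ?g (p + r)) \<in> borel_measurable lborel" using int by auto
    have "{e n..M} \<times> UNIV \<in> sets (borel :: 'n spacetime measure)" for n by (intro borel_Times) auto
    then show "(\<lambda>r. indicat_real ({e n..M} \<times> UNIV) r * (hk_st A M r * ?g (p + r))) \<in> borel_measurable lborel" for n
      by (intro borel_measurable_times[OF _ m] borel_measurable_indicator) auto
    show "AE r in lborel. norm (indicat_real ({e n..M} \<times> UNIV) r * (hk_st A M r * ?g (p + r))) \<le> norm (hk_st A M r * ?g (p + r))" for n
      by (intro AE_I2) (simp add: indicator_def)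
    show "AE r in lborel. (\<lambda>n. indicat_real ({e n..M} \<times> UNIV) r * (hk_st A M r * ?g (p + r))) \<longlonglongrightarrow> hk_st A M r * ?g (p + r)"
    proof (intro AE_I2)
      fix r :: "'n spacetime"
      obtain \<tau> x where r: "r = (\<tau>, x)" by (cases r)
      show "(\<lambda>n. indicat_real ({e n..M} \<times> UNIV) r * (hk_st A M r * ?g (p + r))) \<longlonglongrightarrow> hk_st A M r * ?g (p + r)"
      proof (cases "0 < \<tau> \<and> \<tau> \<le> M")
        case True
        then have "\<forall>\<^sub>F n in sequentially. e n < \<tau>" using order_tendstoD(2)[OF e0] by blast
        then have "\<forall>\<^sub>F n in sequentially. indicat_real ({e n..M} \<times> UNIV) r * (hk_st A M r * ?g (p + r)) = hk_st A M r * ?g (p + r)"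
          by eventually_elim (use True r in \<open>auto simp: indicator_def\<close>)
        then show ?thesis by (rule tendsto_eventually)
      next
        case False
        then have "hk_st A M r = 0" by (auto simp: hk_st_def r)
        then show ?thesis by simp
      qed
    qed
  qed
  moreover have "(\<lambda>n. LBINT r. indicat_real ({e n..M} \<times> UNIV) r * (hk_st A M r * ?g (p + r))) \<longlonglongrightarrow> - f p"
  proof -
    have "filterlim e (at_right 0) sequentially"
      using e0 e(1) by (auto simp: filterlim_at less_imp_neq[symmetric])
    from filterlim_compose[OF hk_initial_value[OF A f, of p] this]
    have "(\<lambda>n. LBINT x. hk A (e n) x * f (p + (e n, x))) \<longlonglongrightarrow> f p" .
    from tendsto_minus[OF this] show ?thesis by (simp only: J[OF e])
  qed
  ultimately show ?thesis
    using LIMSEQ_unique unfolding kconv_def by blast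
qed

subsection \<open>Heat tuples\<close>

lemma open_Qdom: "open (Qdom :: 'n::finite spacetime set)"
  by (intro open_Times) auto

text \<open>Built for \<open>smooth_on_coinduct\<close>: every space-time derivative of the basic
  Gaussian arises from multiplications by coordinates and by the inverse time, and each member has
  Gaussian bounds on time strips away from 0. The normalising power of the time, which may be
  fractional, is kept outside.\<close>

inductive gauss_kernel :: "'n::finite mat \<Rightarrow> ('n spacetime \<Rightarrow> real) \<Rightarrow> bool" for Q where
  base: "gauss_kernel Q (\<lambda>p. exp (- (snd p \<bullet> (Q *v snd p)) / 2 * inverse (fst p)))"
| add: "gauss_kernel Q G \<Longrightarrow> gauss_kernel Q G' \<Longrightarrow> gauss_kernel Q (\<lambda>p. G p + G' p)"
| cmult: "gauss_kernel Q G \<Longrightarrow> gauss_kernel Q (\<lambda>p. c * G p)"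
| coord: "gauss_kernel Q G \<Longrightarrow> gauss_kernel Q (\<lambda>p. (snd p \<bullet> v) * G p)"
| inv: "gauss_kernel Q G \<Longrightarrow> gauss_kernel Q (\<lambda>p. inverse (fst p) * G p)"

lemma gauss_kernel_sum:
  "finite I \<Longrightarrow> I \<noteq> {} \<Longrightarrow> (\<And>i. i \<in> I \<Longrightarrow> gauss_kernel Q (G i)) \<Longrightarrow> gauss_kernel Q (\<lambda>p. \<Sum>i\<in>I. G i p)"
  by (induct I rule: finite_ne_induct) (auto intro: gauss_kernel.add)

lemma gauss_kernel_quadratic:
  fixes Q :: "'n::finite mat"
  assumes "gauss_kernel Q G"
  shows "gauss_kernel Q (\<lambda>p. (snd p \<bullet> (Q *v snd p)) * G p)"
proof -
  have "gauss_kernel Q (\<lambda>p. \<Sum>i\<in>UNIV. \<Sum>j\<in>UNIV. Q $ i $ j * ((snd p \<bullet> axis i 1) * ((snd p \<bullet> axis j 1) * G p)))"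
    by (intro gauss_kernel_sum gauss_kernel.cmult gauss_kernel.coord assms) auto
  moreover have "(\<Sum>i\<in>UNIV. \<Sum>j\<in>UNIV. Q $ i $ j * ((x \<bullet> axis i 1) * ((x \<bullet> axis j 1) * g))) = (x \<bullet> (Q *v x)) * g"
    for x :: "real^'n" and g
  proof -
    have "x \<bullet> axis i (1 :: real) = x $ i" for i by (simp add: inner_axis)
    then show ?thesis
      by (simp only:) (simp add: inner_vec_def matrix_vector_mult_def sum_distrib_left sum_distrib_right mult_ac)
  qed
  ultimately show ?thesis by simp
qed

lemma gauss_kernel_dderiv:
  fixes Q :: "'n::finite mat"
  assumes sQ: "symmetric_mat Q" and G: "gauss_kernel Q G"
  shows "\<exists>G'. \<forall>e. gauss_kernel Q (G' e) \<and> (\<forall>p\<in>Qdom. (G has_derivative (\<lambda>e. G' e p)) (at p))"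
  using G
proof induct
  case base
  let ?E = "\<lambda>p::'n spacetime. exp (- (snd p \<bullet> (Q *v snd p)) / 2 * inverse (fst p))"
  let ?G = "\<lambda>e p. (-1) * (inverse (fst p) * ((snd p \<bullet> (Q *v snd e)) * ?E p)) +
      (fst e / 2) * (inverse (fst p) * (inverse (fst p) * ((snd p \<bullet> (Q *v snd p)) * ?E p)))"
  have "gauss_kernel Q (?G e)" for e
    by (intro gauss_kernel.add gauss_kernel.cmult gauss_kernel.inv gauss_kernel.coord gauss_kernel_quadratic gauss_kernel.base)
  moreover have "(?E has_derivative (\<lambda>e. ?G e p)) (at p)" if p: "p \<in> Qdom" for p
  proof -
    have 1: "((\<lambda>p. Q *v snd p) has_derivative (\<lambda>e. Q *v snd e)) (at p)"
      by (intro bounded_linear_imp_has_derivative bounded_linear_compose[OF matrix_vector_mul_bounded_linear bounded_linear_snd])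
    have 2: "(snd has_derivative snd) (at p)" "(fst has_derivative fst) (at p)"
      by (intro bounded_linear_imp_has_derivative bounded_linear_snd bounded_linear_fst)+
    have 3: "snd p \<bullet> (Q *v snd e) = snd e \<bullet> (Q *v snd p)" for e :: "'n spacetime"
      using symmetric_mat_inner[OF sQ, of "snd p" "snd e"] by (simp add: inner_commute)
    have p0: "fst p \<noteq> 0" using p by auto
    let ?N = "\<lambda>p::'n spacetime. snd p \<bullet> (Q *v snd p)" and ?i = "inverse (fst p)"
    have N: "(?N has_derivative (\<lambda>e. snd p \<bullet> (Q *v snd e) + snd e \<bullet> (Q *v snd p))) (at p)"
      by (rule has_derivative_inner[OF 2(1) 1])
    have I: "((\<lambda>p::'n spacetime. inverse (fst p)) has_derivative (\<lambda>e. - (?i * fst e * ?i))) (at p)"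
      by (rule Deriv.has_derivative_inverse[OF p0 2(2)])
    note E = has_derivative_exp[OF has_derivative_mult[OF has_derivative_mult_right[OF N, of "- 1 / 2"] I]]
    have "(\<lambda>p. exp (- 1 / 2 * ?N p * inverse (fst p))) = ?E" by (auto simp: fun_eq_iff)
    moreover have "(- 1 / 2 * ?N p * - (?i * fst e * ?i) + - 1 / 2 * (snd p \<bullet> (Q *v snd e) + snd e \<bullet> (Q *v snd p)) * ?i)
        * exp (- 1 / 2 * ?N p * ?i) = ?G e p" for e
      unfolding 3[of e, symmetric] by (simp add: algebra_simps)
    ultimately show ?thesis using E by (simp only: mult.commute[of "exp _"])
  qed
  ultimately show ?case by (intro exI[of _ ?G]) blast
next
  case (add G1 G2)
  then obtain D1 D2 where D: "\<forall>e. gauss_kernel Q (D1 e) \<and> (\<forall>p\<in>Qdom. (G1 has_derivative (\<lambda>e. D1 e p)) (at p))"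
    "\<forall>e. gauss_kernel Q (D2 e) \<and> (\<forall>p\<in>Qdom. (G2 has_derivative (\<lambda>e. D2 e p)) (at p))" by blast
  then show ?case
    by (intro exI[of _ "\<lambda>e p. D1 e p + D2 e p"]) (auto intro: gauss_kernel.add has_derivative_add)
next
  case (cmult G c)
  then obtain D where D: "\<forall>e. gauss_kernel Q (D e) \<and> (\<forall>p\<in>Qdom. (G has_derivative (\<lambda>e. D e p)) (at p))" by blast
  then show ?case
    by (intro exI[of _ "\<lambda>e p. c * D e p"]) (auto intro: gauss_kernel.cmult has_derivative_mult_right)
next
  case (coord G v)
  then obtain D where D: "\<forall>e. gauss_kernel Q (D e) \<and> (\<forall>p\<in>Qdom. (G has_derivative (\<lambda>e. D e p)) (at p))" by blast
  have "((\<lambda>p. (snd p \<bullet> v) * G p) has_derivative (\<lambda>e. (snd p \<bullet> v) * D e p + (snd e \<bullet> v) * G p)) (at p)"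
    if "p \<in> Qdom" for p
  proof (rule has_derivative_mult)
    show "((\<lambda>p. snd p \<bullet> v) has_derivative (\<lambda>e. snd e \<bullet> v)) (at p)"
      by (intro bounded_linear_imp_has_derivative bounded_linear_compose[OF bounded_linear_inner_left bounded_linear_snd])
  qed (use D that in auto)
  then show ?case using D coord(1)
    by (intro exI[of _ "\<lambda>e p. (snd p \<bullet> v) * D e p + (snd e \<bullet> v) * G p"])
      (auto intro!: gauss_kernel.add gauss_kernel.coord gauss_kernel.cmult)
next
  case (inv G)
  then obtain D where D: "\<forall>e. gauss_kernel Q (D e) \<and> (\<forall>p\<in>Qdom. (G has_derivative (\<lambda>e. D e p)) (at p))" by blast
  have "((\<lambda>p. inverse (fst p) * G p) has_derivative
      (\<lambda>e. inverse (fst p) * D e p + (- fst e) * (inverse (fst p) * (inverse (fst p) * G p)))) (at p)"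
    if "p \<in> Qdom" for p
  proof -
    have p0: "fst p \<noteq> 0" using that by auto
    have 2: "(fst has_derivative fst) (at p)" by (intro bounded_linear_imp_has_derivative bounded_linear_fst)
    have "((\<lambda>p. inverse (fst p)) has_derivative (\<lambda>e. - (inverse (fst p) * fst e * inverse (fst p)))) (at p)"
      by (rule Deriv.has_derivative_inverse[OF p0 2])
    from has_derivative_mult[OF this, of G "\<lambda>e. D e p"] D that show ?thesis
      by (auto simp: mult_ac)
  qed
  moreover have "gauss_kernel Q (\<lambda>p. inverse (fst p) * D e p + (- fst e) * (inverse (fst p) * (inverse (fst p) * G p)))" for e
    by (intro gauss_kernel.add gauss_kernel.inv gauss_kernel.cmult) (use D inv(1) in blast)+
  ultimately show ?case
    by (intro exI[of _ "\<lambda>e p. inverse (fst p) * D e p + (- fst e) * (inverse (fst p) * (inverse (fst p) * G p))"]) blast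
qed

text \<open>Along the construction of the family, a coordinate factor is paid for with half of the
  Gaussian exponent and an inverse time with the constant 1 / t0.\<close>

lemma gauss_kernel_bound:
  fixes Q :: "'n::finite mat"
  assumes Q: "posdef Q" and t: "0 < t0" and G: "gauss_kernel Q G"
  shows "\<exists>C \<kappa>. C > 0 \<and> \<kappa> > 0 \<and> (\<forall>p. t0 \<le> fst p \<longrightarrow> fst p \<le> t1 \<longrightarrow> \<bar>G p\<bar> \<le> C * exp (- \<kappa> * (norm (snd p))\<^sup>2))"
  using G
proof induct
  case base
  obtain l where l: "l > 0" "\<And>x. l * (norm x)\<^sup>2 \<le> x \<bullet> (Q *v x)" using posdef_coercive[OF Q] by blast
  \<comment> \<open>The maximum bounds the time on the strip and keeps \<kappa> positive whatever
    \<open>t1\<close> is.\<close>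
  define \<kappa> where "\<kappa> = (l / 2) / (max t0 t1)"
  have "\<bar>exp (- (snd p \<bullet> (Q *v snd p)) / 2 * inverse (fst p))\<bar> \<le> 1 * exp (- \<kappa> * (norm (snd p))\<^sup>2)"
    if "t0 \<le> fst p" "fst p \<le> t1" for p :: "'n spacetime"
  proof -
    have "(l / 2 * (norm (snd p))\<^sup>2) / max t0 t1 \<le> ((snd p \<bullet> (Q *v snd p)) / 2) / fst p"
    proof (intro frac_le)
      have "0 \<le> l * (norm (snd p))\<^sup>2" using l(1) by simp
      then show "0 \<le> snd p \<bullet> (Q *v snd p) / 2" using l(2)[of "snd p"] by linarith
    qed (use l(2)[of "snd p"] that t in auto)
    moreover have "(l / 2 * (norm (snd p))\<^sup>2) / max t0 t1 = \<kappa> * (norm (snd p))\<^sup>2" by (simp add: \<kappa>_def)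
    ultimately have "- (snd p \<bullet> (Q *v snd p)) / 2 * inverse (fst p) \<le> - \<kappa> * (norm (snd p))\<^sup>2"
      unfolding minus_divide_left[symmetric] mult_minus_left neg_le_iff_le
      by (simp only: divide_inverse[of _ "fst p"])
    then show ?thesis by (simp only: abs_exp_cancel mult_1 exp_le_cancel_iff)
  qed
  moreover have "\<kappa> > 0" using l(1) t by (simp add: \<kappa>_def)
  ultimately show ?case by (intro exI[of _ 1] exI[of _ \<kappa>]) auto
next
  case (add G1 G2)
  then obtain C1 k1 C2 k2 where b: "C1 > 0" "k1 > 0" "C2 > 0" "k2 > 0"
    "\<And>p. t0 \<le> fst p \<Longrightarrow> fst p \<le> t1 \<Longrightarrow> \<bar>G1 p\<bar> \<le> C1 * exp (- k1 * (norm (snd p))\<^sup>2)"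
    "\<And>p. t0 \<le> fst p \<Longrightarrow> fst p \<le> t1 \<Longrightarrow> \<bar>G2 p\<bar> \<le> C2 * exp (- k2 * (norm (snd p))\<^sup>2)" by metis
  have "\<bar>G1 p + G2 p\<bar> \<le> (C1 + C2) * exp (- min k1 k2 * (norm (snd p))\<^sup>2)"
    if "t0 \<le> fst p" "fst p \<le> t1" for p
  proof -
    have "\<bar>G1 p + G2 p\<bar> \<le> C1 * exp (- k1 * (norm (snd p))\<^sup>2) + C2 * exp (- k2 * (norm (snd p))\<^sup>2)"
      using b(5,6)[OF that] by linarith
    also have "\<dots> \<le> C1 * exp (- min k1 k2 * (norm (snd p))\<^sup>2) + C2 * exp (- min k1 k2 * (norm (snd p))\<^sup>2)"
      using b by (intro add_mono mult_left_mono) (auto intro: mult_right_mono)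
    finally show ?thesis by (simp add: distrib_right)
  qed
  then show ?case using b by (intro exI[of _ "C1 + C2"] exI[of _ "min k1 k2"]) auto
next
  case (cmult G c)
  then obtain C k where b: "C > 0" "k > 0"
    "\<And>p. t0 \<le> fst p \<Longrightarrow> fst p \<le> t1 \<Longrightarrow> \<bar>G p\<bar> \<le> C * exp (- k * (norm (snd p))\<^sup>2)" by metis
  have "\<bar>c * G p\<bar> \<le> ((\<bar>c\<bar> + 1) * C) * exp (- k * (norm (snd p))\<^sup>2)" if "t0 \<le> fst p" "fst p \<le> t1" for p
    unfolding abs_mult mult.assoc using b(3)[OF that] by (intro mult_mono) auto
  then show ?case using b by (intro exI[of _ "(\<bar>c\<bar> + 1) * C"] exI[of _ k]) (auto intro: mult_pos_pos add_nonneg_pos)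
next
  case (coord G v)
  then obtain C k where b: "C > 0" "k > 0"
    "\<And>p. t0 \<le> fst p \<Longrightarrow> fst p \<le> t1 \<Longrightarrow> \<bar>G p\<bar> \<le> C * exp (- k * (norm (snd p))\<^sup>2)" by metis
  have "\<bar>(snd p \<bullet> v) * G p\<bar> \<le> ((1 + 1 / (k / 2)) * (norm v + 1) * C) * exp (- (k / 2) * (norm (snd p))\<^sup>2)"
    if "t0 \<le> fst p" "fst p \<le> t1" for p
  proof -
    have "\<bar>snd p \<bullet> v\<bar> \<le> norm (snd p) * norm v" by (rule Cauchy_Schwarz_ineq2)
    also have "\<dots> \<le> ((1 + 1 / (k / 2)) * exp ((k / 2) * (norm (snd p))\<^sup>2)) * (norm v + 1)"
      using b(2) by (intro mult_mono norm_le_exp_norm_power2) auto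
    finally have "\<bar>(snd p \<bullet> v) * G p\<bar> \<le> ((1 + 1 / (k / 2)) * exp ((k / 2) * (norm (snd p))\<^sup>2)) * (norm v + 1) *
        (C * exp (- k * (norm (snd p))\<^sup>2))"
      unfolding abs_mult using b(3)[OF that] b(2) by (intro mult_mono) auto
    also have "\<dots> = ((1 + 1 / (k / 2)) * (norm v + 1) * C) * (exp ((k / 2) * (norm (snd p))\<^sup>2) * exp (- k * (norm (snd p))\<^sup>2))"
      by (simp only: mult_ac)
    also have "exp ((k / 2) * (norm (snd p))\<^sup>2) * exp (- k * (norm (snd p))\<^sup>2) = exp (- (k / 2) * (norm (snd p))\<^sup>2)"
      by (simp add: mult_exp_exp)
    finally show ?thesis .
  qed
  moreover have "(1 + 1 / (k / 2)) * (norm v + 1) * C > 0" using b by (auto intro!: mult_pos_pos add_pos_pos add_nonneg_pos)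
  ultimately show ?case using b(2) by (intro exI[of _ "(1 + 1 / (k / 2)) * (norm v + 1) * C"] exI[of _ "k / 2"]) auto
next
  case (inv G)
  then obtain C k where b: "C > 0" "k > 0"
    "\<And>p. t0 \<le> fst p \<Longrightarrow> fst p \<le> t1 \<Longrightarrow> \<bar>G p\<bar> \<le> C * exp (- k * (norm (snd p))\<^sup>2)" by metis
  have "\<bar>inverse (fst p) * G p\<bar> \<le> (inverse t0 * C) * exp (- k * (norm (snd p))\<^sup>2)" if "t0 \<le> fst p" "fst p \<le> t1" for p
    unfolding abs_mult mult.assoc using b(3)[OF that] t that by (intro mult_mono) auto
  then show ?case using b t by (intro exI[of _ "inverse t0 * C"] exI[of _ k]) auto
qed

text \<open>Separates the variables by |y|^2 <= 2 |z - y|^2 + 2 |z|^2: the factor in y is integrable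
  against the measure of a heat tuple, the factor in z is locally bounded.\<close>

lemma exp_norm_diff_le:
  assumes "\<kappa> \<ge> 0"
  shows "exp (- \<kappa> * (norm (z - y))\<^sup>2) \<le> exp (\<kappa> * (norm z)\<^sup>2) * exp (- (\<kappa> / 2) * (norm y)\<^sup>2)"
proof -
  have "norm y \<le> norm (z - y) + norm z" using norm_triangle_ineq4[of z "z - y"] by simp
  then have "(norm y)\<^sup>2 \<le> (norm (z - y) + norm z)\<^sup>2" by (intro power_mono) auto
  also have "\<dots> \<le> 2 * (norm (z - y))\<^sup>2 + 2 * (norm z)\<^sup>2"
    using zero_le_power2[of "norm (z - y) - norm z"] by (simp add: power2_sum power2_diff)
  finally have "\<kappa> * (norm y)\<^sup>2 \<le> \<kappa> * (2 * (norm (z - y))\<^sup>2 + 2 * (norm z)\<^sup>2)" using assms by (intro mult_left_mono)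
  then have "- \<kappa> * (norm (z - y))\<^sup>2 \<le> \<kappa> * (norm z)\<^sup>2 + - (\<kappa> / 2) * (norm y)\<^sup>2" by (simp add: algebra_simps)
  then show ?thesis by (simp add: exp_add[symmetric])
qed

locale gauss_measure =
  fixes \<theta> :: "(real^'n::finite) measure"
  assumes sets_\<theta> [measurable_cong, simp]: "sets \<theta> = sets borel"
    and exp_finite: "c > 0 \<Longrightarrow> (\<integral>\<^sup>+z. ennreal (exp (- c * (norm z)\<^sup>2)) \<partial>\<theta>) < \<infinity>"
begin

lemma space_\<theta> [simp]: "space \<theta> = UNIV"
  using sets_eq_imp_space_eq[OF sets_\<theta>] by simp

lemma exp_integrable: "c > 0 \<Longrightarrow> integrable \<theta> (\<lambda>z. exp (- c * (norm z)\<^sup>2))"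
  using exp_finite by (intro integrableI_nonneg) (auto simp: measurable_cong_sets[OF sets_\<theta> refl])

lemma borel_measurable_\<theta>: "f \<in> borel_measurable borel \<Longrightarrow> f \<in> borel_measurable \<theta>"
  by (simp add: measurable_cong_sets[OF sets_\<theta> refl])

definition conv :: "('n spacetime \<Rightarrow> real) \<Rightarrow> 'n spacetime \<Rightarrow> real" where
  "conv G p = (\<integral>y. G (p - (0, y)) \<partial>\<theta>)"

lemma gauss_kernel_continuous:
  assumes "posdef Q" "gauss_kernel Q G"
  shows "continuous_on Qdom G"
proof -
  have "symmetric_mat Q" using assms(1) by (simp add: posdef_def)
  then obtain G' where G': "\<And>e. gauss_kernel Q (G' e) \<and> (\<forall>p\<in>Qdom. (G has_derivative (\<lambda>e. G' e p)) (at p))"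
    using gauss_kernel_dderiv assms(2) by metis
  show ?thesis
    by (rule continuous_at_imp_continuous_on) (use G' has_derivative_continuous in blast)
qed

lemma gauss_kernel_slice_measurable:
  assumes "posdef Q" "gauss_kernel Q G" "p \<in> Qdom"
  shows "(\<lambda>y. G (p - (0, y))) \<in> borel_measurable borel"
  using assms(3)
  by (intro borel_measurable_continuous_onI continuous_on_compose2[OF gauss_kernel_continuous[OF assms(1,2)]] continuous_intros)
    (auto simp: minus_prod_def)

lemma gauss_kernel_integrable:
  assumes Q: "posdef Q" and G: "gauss_kernel Q G" and p: "p \<in> Qdom"
  shows "integrable \<theta> (\<lambda>y. G (p - (0, y)))"
proof -
  obtain C \<kappa> where b: "C > 0" "\<kappa> > 0" "\<And>q. fst p \<le> fst q \<Longrightarrow> fst q \<le> fst p \<Longrightarrow> \<bar>G q\<bar> \<le> C * exp (- \<kappa> * (norm (snd q))\<^sup>2)"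
  proof -
    have "0 < fst p" using p by auto
    from gauss_kernel_bound[OF Q this G, of "fst p"] show ?thesis using that by blast
  qed
  show ?thesis
  proof (rule Bochner_Integration.integrable_bound[of _ "\<lambda>y. C * (exp (\<kappa> * (norm (snd p))\<^sup>2) * exp (- (\<kappa> / 2) * (norm y)\<^sup>2))"])
    show "integrable \<theta> (\<lambda>y. C * (exp (\<kappa> * (norm (snd p))\<^sup>2) * exp (- (\<kappa> / 2) * (norm y)\<^sup>2)))"
      using b by (intro integrable_mult_right exp_integrable) auto
    show "(\<lambda>y. G (p - (0, y))) \<in> borel_measurable \<theta>"
      by (intro borel_measurable_\<theta> gauss_kernel_slice_measurable[OF Q G p])
    show "AE y in \<theta>. norm (G (p - (0, y))) \<le> norm (C * (exp (\<kappa> * (norm (snd p))\<^sup>2) * exp (- (\<kappa> / 2) * (norm y)\<^sup>2)))"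
    proof (intro AE_I2)
      fix y
      have "\<bar>G (p - (0, y))\<bar> \<le> C * exp (- \<kappa> * (norm (snd p - y))\<^sup>2)" using b(3)[of "p - (0, y)"] by simp
      also have "\<dots> \<le> C * (exp (\<kappa> * (norm (snd p))\<^sup>2) * exp (- (\<kappa> / 2) * (norm y)\<^sup>2))"
        using b by (intro mult_left_mono exp_norm_diff_le) auto
      finally show "norm (G (p - (0, y))) \<le> norm (C * (exp (\<kappa> * (norm (snd p))\<^sup>2) * exp (- (\<kappa> / 2) * (norm y)\<^sup>2)))"
        using b(1) by simp
    qed
  qed
qed

lemma conv_has_derivative:
  assumes Q: "posdef Q" and G: "gauss_kernel Q G" and p: "p \<in> Qdom"
    and G': "\<And>e. gauss_kernel Q (G' e)" "\<And>e p. p \<in> Qdom \<Longrightarrow> (G has_derivative (\<lambda>e. G' e p)) (at p)"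
  shows "(conv G has_derivative (\<lambda>e. conv (G' e) p)) (at p)"
proof -
  \<comment> \<open>With half of the time as radius, the ball around p stays in times at least
    \<open>r\<close>, where uniform Gaussian bounds hold.\<close>
  define r where "r = fst p / 2"
  have r: "r > 0" using p by (auto simp: r_def)
  have "\<exists>C \<kappa>. C > 0 \<and> \<kappa> > 0 \<and> (\<forall>q. r \<le> fst q \<longrightarrow> fst q \<le> fst p + r \<longrightarrow> \<bar>G' b q\<bar> \<le> C * exp (- \<kappa> * (norm (snd q))\<^sup>2))" for b
    by (rule gauss_kernel_bound[OF Q r G'(1)])
  then obtain C \<kappa> where b: "\<And>b. C b > 0" "\<And>b. \<kappa> b > 0"
    "\<And>b q. r \<le> fst q \<Longrightarrow> fst q \<le> fst p + r \<Longrightarrow> \<bar>G' b q\<bar> \<le> C b * exp (- \<kappa> b * (norm (snd q))\<^sup>2)" by metis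
  have in_ball: "r \<le> fst x" "fst x \<le> fst p + r" "norm (snd x) \<le> norm (snd p) + r" "x \<in> Qdom" if "x \<in> ball p r" for x
  proof -
    have d: "dist (fst x) (fst p) < r" "dist (snd x) (snd p) < r"
      using that dist_fst_le[of x p] dist_snd_le[of x p] by (auto simp: dist_commute)
    then show "r \<le> fst x" "fst x \<le> fst p + r" by (auto simp: dist_real_def r_def abs_if split: if_splits)
    with r show "x \<in> Qdom" by (cases x) auto
    show "norm (snd x) \<le> norm (snd p) + r"
      using d(2) norm_triangle_ineq2[of "snd x" "snd p"] by (simp add: dist_norm)
  qed
  have "((\<lambda>p. \<integral>y. G (p - (0, y)) \<partial>\<theta>) has_derivative (\<lambda>e. \<integral>y. G' e (p - (0, y)) \<partial>\<theta>)) (at p)"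
  \<comment> \<open>The Gaussian constants depend on the direction, so the derivative is expanded in
    the basis and the bounds are added.\<close>
  proof (rule has_derivative_integral_parametric[where r=r and f'="\<lambda>p y e. G' e (p - (0, y))" and
        b="\<lambda>y. \<Sum>b\<in>Basis. C b * (exp (\<kappa> b * (norm (snd p) + r)\<^sup>2) * exp (- (\<kappa> b / 2) * (norm y)\<^sup>2))"])
    show "integrable \<theta> (\<lambda>y. G (x - (0, y)))" if "x \<in> ball p r" for x
      by (rule gauss_kernel_integrable[OF Q G in_ball(4)[OF that]])
    show "((\<lambda>x. G (x - (0, y))) has_derivative (\<lambda>e. G' e (x - (0, y)))) (at x)" if "x \<in> ball p r" for x y
    proof -
      have "x - (0, y) \<in> Qdom" using in_ball(4)[OF that] by (cases x) auto
      from G'(2)[OF this] have "(G has_derivative (\<lambda>e. G' e (x - (0, y)))) (at (x - (0, y)))" .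
      moreover have "((\<lambda>x. x - (0, y)) has_derivative (\<lambda>e. e)) (at x)" by (auto intro!: derivative_eq_intros)
      ultimately show ?thesis using has_derivative_compose by blast
    qed
    show "\<bar>G' h (x - (0, y))\<bar> \<le> (\<Sum>b\<in>Basis. C b * (exp (\<kappa> b * (norm (snd p) + r)\<^sup>2) * exp (- (\<kappa> b / 2) * (norm y)\<^sup>2))) * norm h"
      if x: "x \<in> ball p r" for x y h
    proof -
      have xQ: "x - (0, y) \<in> Qdom" using in_ball(4)[OF x] by (cases x) auto
      note lin = has_derivative_linear[OF G'(2)[OF xQ]]
      have "G' h (x - (0, y)) = G' (\<Sum>b\<in>Basis. (h \<bullet> b) *\<^sub>R b) (x - (0, y))" by (simp add: euclidean_representation)
      also have "\<dots> = (\<Sum>b\<in>Basis. (h \<bullet> b) * G' b (x - (0, y)))"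
        using linear_sum[OF lin, of "\<lambda>b. (h \<bullet> b) *\<^sub>R b" Basis] by (simp add: linear_cmul[OF lin])
      also have "\<bar>\<dots>\<bar> \<le> (\<Sum>b\<in>Basis. \<bar>(h \<bullet> b) * G' b (x - (0, y))\<bar>)" by (rule sum_abs)
      also have "\<dots> \<le> (\<Sum>b\<in>Basis. norm h * (C b * (exp (\<kappa> b * (norm (snd p) + r)\<^sup>2) * exp (- (\<kappa> b / 2) * (norm y)\<^sup>2))))"
      proof (intro sum_mono)
        fix b :: "'n spacetime" assume bB: "b \<in> Basis"
        have "\<bar>G' b (x - (0, y))\<bar> \<le> C b * exp (- \<kappa> b * (norm (snd x - y))\<^sup>2)"
          using b(3)[of "x - (0, y)" b] in_ball[OF x] by simp
        also have "\<dots> \<le> C b * (exp (\<kappa> b * (norm (snd x))\<^sup>2) * exp (- (\<kappa> b / 2) * (norm y)\<^sup>2))"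
          using b(1,2)[of b] by (intro mult_left_mono exp_norm_diff_le) auto
        also have "\<dots> \<le> C b * (exp (\<kappa> b * (norm (snd p) + r)\<^sup>2) * exp (- (\<kappa> b / 2) * (norm y)\<^sup>2))"
          using b(1,2)[of b] in_ball(3)[OF x] r
          by (intro mult_left_mono mult_right_mono) (auto intro!: mult_left_mono power_mono)
        finally have "\<bar>G' b (x - (0, y))\<bar> \<le> C b * (exp (\<kappa> b * (norm (snd p) + r)\<^sup>2) * exp (- (\<kappa> b / 2) * (norm y)\<^sup>2))" .
        then show "\<bar>(h \<bullet> b) * G' b (x - (0, y))\<bar> \<le> norm h * (C b * (exp (\<kappa> b * (norm (snd p) + r)\<^sup>2) * exp (- (\<kappa> b / 2) * (norm y)\<^sup>2)))"
          unfolding abs_mult using Basis_le_norm[OF bB, of h] by (intro mult_mono) auto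
      qed
      finally show ?thesis by (simp add: sum_distrib_left mult.commute)
    qed
    show "integrable \<theta> (\<lambda>y. \<Sum>b\<in>Basis. C b * (exp (\<kappa> b * (norm (snd p) + r)\<^sup>2) * exp (- (\<kappa> b / 2) * (norm y)\<^sup>2)))"
      using b(2) by (intro Bochner_Integration.integrable_sum integrable_mult_right exp_integrable) auto
    show "(\<lambda>y. G' h (p - (0, y))) \<in> borel_measurable \<theta>" for h
      by (intro borel_measurable_\<theta> gauss_kernel_slice_measurable[OF Q G'(1) p])
  qed (rule r)
  then show ?thesis by (simp add: conv_def[abs_def])
qed

lemma smooth_on_conv:
  assumes Q: "posdef Q" and G: "gauss_kernel Q G"
  shows "smooth_on Qdom (conv G)"
proof (rule smooth_on_coinduct[where P="\<lambda>u. \<exists>G. gauss_kernel Q G \<and> u = conv G", OF open_Qdom])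
  have sQ: "symmetric_mat Q" using Q by (simp add: posdef_def)
  have D: "\<exists>G'. (\<forall>e. gauss_kernel Q (G' e)) \<and> (\<forall>p\<in>Qdom. (conv G has_derivative (\<lambda>e. conv (G' e) p)) (at p))"
    if "gauss_kernel Q G" for G
  proof -
    obtain G' where "\<And>e. gauss_kernel Q (G' e)" "\<And>e p. p \<in> Qdom \<Longrightarrow> (G has_derivative (\<lambda>e. G' e p)) (at p)"
      using gauss_kernel_dderiv[OF sQ \<open>gauss_kernel Q G\<close>] by metis
    note G' = this
    have "(conv G has_derivative (\<lambda>e. conv (G' e) p)) (at p)" if "p \<in> Qdom" for p
      by (rule conv_has_derivative[OF Q \<open>gauss_kernel Q G\<close> that G'])
    then show ?thesis using G'(1) by blast
  qed
  show "\<exists>Ga. gauss_kernel Q Ga \<and> conv G = conv Ga" using G by blast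
  show d: "u differentiable at x" if "\<exists>G. gauss_kernel Q G \<and> u = conv G" "x \<in> Qdom" for u x
    using that D unfolding differentiable_def by blast
  show "continuous_on Qdom u" if "\<exists>G. gauss_kernel Q G \<and> u = conv G" for u
    using d[OF that] by (intro continuous_at_imp_continuous_on) (auto intro: differentiable_imp_continuous_within)
  show "\<exists>g. (\<exists>G. gauss_kernel Q G \<and> g = conv G) \<and> (\<forall>x\<in>Qdom. dderiv e u x = g x)"
    if u: "\<exists>G. gauss_kernel Q G \<and> u = conv G" for u e
  proof -
    obtain G where G: "gauss_kernel Q G" "u = conv G" using u by blast
    obtain G' where G': "\<forall>e. gauss_kernel Q (G' e)" "\<forall>p\<in>Qdom. (conv G has_derivative (\<lambda>e. conv (G' e) p)) (at p)"
      using D[OF G(1)] by blast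
    then have "\<forall>p\<in>Qdom. dderiv e u p = conv (G' e) p" using dderiv_eq G(2) by blast
    then show ?thesis using G'(1) by blast
  qed
qed

end

section \<open>The weight of a heat tuple\<close>

lemma heat_tuple_gauss_measure:
  assumes "heat_tuple (\<theta>, a, A, q)"
  shows "gauss_measure \<theta>"
  using assms by unfold_locales (auto simp: heat_tuple_def radon_def)

text \<open>Splits off the power of the time, which is outside \<open>gauss_kernel\<close>; its
  smoothness comes from \<open>smooth_on_powr\<close> instead.\<close>

lemma heat_F_eq_conv:
  fixes a :: "'n::finite mat"
  assumes H: "heat_tuple (\<theta>, a, A, q)" and p: "p \<in> Qdom"
  shows "heat_F (\<theta>, a, A, q) p = (1 / sqrt ((2 * pi) ^ CARD('n) * det a)) * fst p powr (- real CARD('n) / 2) *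
    gauss_measure.conv \<theta> (\<lambda>p. exp (- (snd p \<bullet> (matrix_inv a *v snd p)) / 2 * inverse (fst p))) p"
proof -
  interpret gauss_measure \<theta> using heat_tuple_gauss_measure[OF H] .
  have a: "posdef a" using H by (simp add: heat_tuple_def)
  obtain \<tau> z where pz: "p = (\<tau>, z)" "\<tau> > 0" using p by (cases p) auto
  have g: "gauss (\<tau> *\<^sub>R a) x = (1 / sqrt ((2 * pi) ^ CARD('n) * det a)) * \<tau> powr (- real CARD('n) / 2) *
      exp (- (x \<bullet> (matrix_inv a *v x)) / 2 * inverse \<tau>)" for x
  proof -
    have e: "gauss (\<tau> *\<^sub>R a) x = hk a (\<tau> / 2) x" by (simp add: hk_def)
    have "sqrt ((4 * pi) ^ CARD('n) * det a) = 2 powr (real CARD('n) / 2) * sqrt ((2 * pi) ^ CARD('n) * det a)"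
    proof -
      have "sqrt (2 ^ CARD('n)) = 2 powr (real CARD('n) / 2)"
        by (simp add: powr_realpow[symmetric] powr_half_sqrt[symmetric] powr_powr)
      moreover have "(4 * pi) ^ CARD('n) = 2 ^ CARD('n) * (2 * pi) ^ CARD('n)"
        unfolding power_mult_distrib[symmetric] by (intro arg_cong[of _ _ "\<lambda>x. x ^ _"]) simp
      ultimately show ?thesis by (simp only: real_sqrt_mult mult.assoc)
    qed
    moreover have "(\<tau> / 2) powr (- real CARD('n) / 2) = 2 powr (real CARD('n) / 2) * \<tau> powr (- real CARD('n) / 2)"
      using pz(2) by (simp add: powr_divide powr_minus_divide)
    moreover have "- (x \<bullet> (matrix_inv a *v x)) / (4 * (\<tau> / 2)) = - (x \<bullet> (matrix_inv a *v x)) / 2 * inverse \<tau>"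
      by (simp add: inverse_eq_divide)
    moreover have "hk a (\<tau> / 2) x = (1 / sqrt ((4 * pi) ^ CARD('n) * det a)) * (\<tau> / 2) powr (- real CARD('n) / 2) *
        exp (- (x \<bullet> (matrix_inv a *v x)) / (4 * (\<tau> / 2)))"
      using pz(2) by (intro hk_formula[OF a]) simp
    ultimately show ?thesis unfolding e by (simp only:) simp
  qed
  show ?thesis
    unfolding conv_def heat_F_def pz by (simp add: g)
qed

lemma heat_F_gauss_integrable:
  assumes H: "heat_tuple (\<theta>, a, A, q)" and \<tau>: "\<tau> > 0"
  shows "integrable \<theta> (\<lambda>y. gauss (\<tau> *\<^sub>R a) (z - y))"
proof -
  interpret gauss_measure \<theta> using heat_tuple_gauss_measure[OF H] .
  have a: "posdef a" using H by (simp add: heat_tuple_def)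
  have "integrable \<theta> (\<lambda>y. exp (- (snd ((\<tau>, z) - (0, y)) \<bullet> (matrix_inv a *v snd ((\<tau>, z) - (0, y)))) / 2 * inverse (fst ((\<tau>, z) - (0, y)))))"
    using gauss_kernel_integrable[OF posdef_inverse[OF a] gauss_kernel.base, of "(\<tau>, z)"] \<tau> by simp
  moreover have "gauss (\<tau> *\<^sub>R a) (z - y) = exp (- (snd ((\<tau>, z) - (0, y)) \<bullet> (matrix_inv a *v snd ((\<tau>, z) - (0, y)))) / 2 * inverse (fst ((\<tau>, z) - (0, y))))
     / sqrt ((2 * pi) ^ CARD('a) * det (\<tau> *\<^sub>R a))" for y
    using \<tau> by (simp add: gauss_def matrix_inv_scaleR[OF a] scaleR_matrix_vector_assoc[symmetric] inverse_eq_divide)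
  ultimately show ?thesis by simp
qed

lemma heat_F_pos:
  fixes a :: "'n::finite mat"
  assumes H: "heat_tuple (\<theta>, a, A, q)" and p: "p \<in> Qdom"
  shows "0 < heat_F (\<theta>, a, A, q) p"
proof -
  interpret gauss_measure \<theta> using heat_tuple_gauss_measure[OF H] .
  have a: "posdef a" using H by (simp add: heat_tuple_def)
  obtain \<tau> z where pz: "p = (\<tau>, z)" "\<tau> > 0" using p by (cases p) auto
  have g: "gauss (\<tau> *\<^sub>R a) x > 0" for x
    using posdef_det_pos[OF posdef_scaleR[OF a pz(2)]] by (simp add: gauss_def)
  have "(\<integral>y. gauss (\<tau> *\<^sub>R a) (z - y) \<partial>\<theta>) \<noteq> 0"
  proof
    assume "(\<integral>y. gauss (\<tau> *\<^sub>R a) (z - y) \<partial>\<theta>) = 0"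
    then have "AE y in \<theta>. gauss (\<tau> *\<^sub>R a) (z - y) = 0"
      using integral_nonneg_eq_0_iff_AE[OF heat_F_gauss_integrable[OF H pz(2)]] g less_imp_le by blast
    then have "AE y in \<theta>. False" by eventually_elim (metis g less_irrefl)
    then have "emeasure \<theta> (space \<theta>) = 0" by (rule ae_filter_eq_bot_iff[THEN iffD1, OF trivial_limit_def[THEN iffD2]])
    then show False using H by (simp add: heat_tuple_def)
  qed
  moreover have "(\<integral>y. gauss (\<tau> *\<^sub>R a) (z - y) \<partial>\<theta>) \<ge> 0"
    using g less_imp_le by (intro Bochner_Integration.integral_nonneg) auto
  ultimately show ?thesis by (simp add: heat_F_def pz)
qed

lemma heat_F_smooth_on:
  fixes a :: "'n::finite mat"
  assumes H: "heat_tuple (\<theta>, a, A, q)"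
  shows "smooth_on Qdom (heat_F (\<theta>, a, A, q))"
proof -
  interpret gauss_measure \<theta> using heat_tuple_gauss_measure[OF H] .
  have a: "posdef a" using H by (simp add: heat_tuple_def)
  have "smooth_on Qdom (\<lambda>p. (1 / sqrt ((2 * pi) ^ CARD('n) * det a)) * fst p powr (- real CARD('n) / 2) *
    conv (\<lambda>p. exp (- (snd p \<bullet> (matrix_inv a *v snd p)) / 2 * inverse (fst p))) p)"
    by (intro smooth_on_mult open_Qdom smooth_on_const smooth_on_conv[OF posdef_inverse[OF a] gauss_kernel.base]
        smooth_on_compose[OF _ smooth_on_powr] smooth_on_linear bounded_linear_fst) auto
  then show ?thesis
    by (rule smooth_on_cong[OF open_Qdom]) (simp add: heat_F_eq_conv[OF H])
qed

text \<open>The measure integrates every Gaussian, however wide, and therefore the growth exponent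
  \<eta> can be made as small as desired. This freedom is essential: the potentials decay with some
  Gaussian rate that cannot be prescribed.\<close>

lemma heat_F_bound:
  fixes a :: "'n::finite mat"
  assumes H: "heat_tuple (\<theta>, a, A, q)" and t: "0 < t0" and \<eta>: "\<eta> > 0"
  obtains C where "C > 0" "\<And>p. t0 \<le> fst p \<Longrightarrow> fst p \<le> t1 \<Longrightarrow> heat_F (\<theta>, a, A, q) p \<le> C * exp (\<eta> * (norm (snd p))\<^sup>2)"
proof -
  interpret gauss_measure \<theta> using heat_tuple_gauss_measure[OF H] .
  have a: "posdef a" using H by (simp add: heat_tuple_def)
  let ?G = "\<lambda>p::'n spacetime. exp (- (snd p \<bullet> (matrix_inv a *v snd p)) / 2 * inverse (fst p))"
  let ?c = "1 / sqrt ((2 * pi) ^ CARD('n) * det a)"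
  obtain C \<kappa> where b: "C > 0" "\<kappa> > 0" "\<And>p. t0 \<le> fst p \<Longrightarrow> fst p \<le> t1 \<Longrightarrow> \<bar>?G p\<bar> \<le> C * exp (- \<kappa> * (norm (snd p))\<^sup>2)"
    using gauss_kernel_bound[OF posdef_inverse[OF a] t gauss_kernel.base, of t1] by blast
  \<comment> \<open>Replacing \<kappa> by a number below \<eta> brings the growth in z down to the
    required rate; in exchange a wider Gaussian is integrated against the measure.\<close>
  define k where "k = min \<kappa> \<eta>"
  have k: "k > 0" "k \<le> \<kappa>" "k \<le> \<eta>" using b \<eta> by (auto simp: k_def)
  define I where "I = (\<integral>y. exp (- (k / 2) * (norm y)\<^sup>2) \<partial>\<theta>)"
  have I: "I \<ge> 0" unfolding I_def by (intro Bochner_Integration.integral_nonneg) auto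
  have iI: "integrable \<theta> (\<lambda>y. exp (- (k / 2) * (norm y)\<^sup>2))" using k by (intro exp_integrable) auto
  have c: "?c \<ge> 0" using posdef_det_pos[OF a] by simp
  have "heat_F (\<theta>, a, A, q) p \<le> (?c * t0 powr (- real CARD('n) / 2) * (C * I) + 1) * exp (\<eta> * (norm (snd p))\<^sup>2)"
    if p: "t0 \<le> fst p" "fst p \<le> t1" for p
  proof -
    have pQ: "p \<in> Qdom" using p t by (cases p) auto
    have "conv ?G p \<le> (\<integral>y. C * (exp (k * (norm (snd p))\<^sup>2) * exp (- (k / 2) * (norm y)\<^sup>2)) \<partial>\<theta>)"
      unfolding conv_def
    proof (rule integral_mono)
      show "integrable \<theta> (\<lambda>y. ?G (p - (0, y)))"
        by (rule gauss_kernel_integrable[OF posdef_inverse[OF a] gauss_kernel.base pQ])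
      show "integrable \<theta> (\<lambda>y. C * (exp (k * (norm (snd p))\<^sup>2) * exp (- (k / 2) * (norm y)\<^sup>2)))"
        using iI by simp
      fix y
      have "?G (p - (0, y)) \<le> C * exp (- \<kappa> * (norm (snd p - y))\<^sup>2)" using b(3)[of "p - (0, y)"] p by simp
      also have "\<dots> \<le> C * exp (- k * (norm (snd p - y))\<^sup>2)"
        using b(1) k by (intro mult_left_mono) (auto intro: mult_right_mono)
      also have "\<dots> \<le> C * (exp (k * (norm (snd p))\<^sup>2) * exp (- (k / 2) * (norm y)\<^sup>2))"
        using b(1) k by (intro mult_left_mono exp_norm_diff_le) auto
      finally show "?G (p - (0, y)) \<le> C * (exp (k * (norm (snd p))\<^sup>2) * exp (- (k / 2) * (norm y)\<^sup>2))" .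
    qed
    also have "\<dots> = (C * I) * exp (k * (norm (snd p))\<^sup>2)" by (simp add: I_def)
    also have "\<dots> \<le> (C * I) * exp (\<eta> * (norm (snd p))\<^sup>2)"
      using b(1) I k by (intro mult_left_mono) (auto intro: mult_right_mono)
    finally have A: "conv ?G p \<le> (C * I) * exp (\<eta> * (norm (snd p))\<^sup>2)" .
    have B: "fst p powr (- real CARD('n) / 2) \<le> t0 powr (- real CARD('n) / 2)"
      using p t by (intro powr_mono2') auto
    have cv: "0 \<le> conv ?G p" unfolding conv_def by (intro Bochner_Integration.integral_nonneg) auto
    have "heat_F (\<theta>, a, A, q) p \<le> (?c * t0 powr (- real CARD('n) / 2)) * ((C * I) * exp (\<eta> * (norm (snd p))\<^sup>2))"
      unfolding heat_F_eq_conv[OF H pQ] using A B c cv b(1) I by (intro mult_mono mult_left_mono) auto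
    also have "\<dots> = (?c * t0 powr (- real CARD('n) / 2) * (C * I)) * exp (\<eta> * (norm (snd p))\<^sup>2)" by simp
    also have "\<dots> \<le> (?c * t0 powr (- real CARD('n) / 2) * (C * I) + 1) * exp (\<eta> * (norm (snd p))\<^sup>2)"
      by (intro mult_right_mono) auto
    finally show ?thesis .
  qed
  moreover have "?c * t0 powr (- real CARD('n) / 2) * (C * I) + 1 > 0"
    using c b(1) I by (intro add_nonneg_pos mult_nonneg_nonneg) auto
  ultimately show ?thesis using that by blast
qed

lemma tweight_pos:
  assumes "heat_tuple H" "p \<in> Qdom"
  shows "0 < tweight \<alpha> (heat_F H) p"
  using assms heat_F_pos by (cases H; cases p) (auto simp: tweight_def intro!: mult_pos_pos)

lemma tweight_smooth_on:
  fixes H :: "'n::finite tuple"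
  assumes "heat_tuple H"
  shows "smooth_on Qdom (tweight \<alpha> (heat_F H))"
proof -
  have "smooth_on Qdom (heat_F H)" using assms heat_F_smooth_on by (cases H) auto
  moreover have "smooth_on Qdom (\<lambda>p::'n spacetime. fst p powr \<alpha>)"
    by (intro open_Qdom smooth_on_compose[OF _ smooth_on_powr] smooth_on_linear bounded_linear_fst) auto
  ultimately have "smooth_on Qdom (\<lambda>p::'n spacetime. fst p powr \<alpha> * heat_F H p)"
    by (intro smooth_on_mult open_Qdom)
  then show ?thesis by (simp add: tweight_def split_beta')
qed

text \<open>Thus multiplying or dividing by the square root of the weight maps test functions on Q
  to test functions on Q.\<close>

lemma smooth_on_sqrt_weight:
  assumes "heat_tuple H"
  shows "smooth_on Qdom (\<lambda>p. sqrt (tweight \<alpha> (heat_F H) p))"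
    and "smooth_on Qdom (\<lambda>p. 1 / sqrt (tweight \<alpha> (heat_F H) p))"
proof -
  have s: "smooth_on Qdom (\<lambda>p. tweight \<alpha> (heat_F H) p powr r)" for r
    using tweight_pos[OF assms]
    by (intro smooth_on_compose[OF open_Qdom smooth_on_powr tweight_smooth_on[OF assms]]) auto
  show "smooth_on Qdom (\<lambda>p. sqrt (tweight \<alpha> (heat_F H) p))"
    by (rule smooth_on_cong[OF open_Qdom s[of "1/2"]]) (simp add: powr_half_sqrt less_imp_le tweight_pos[OF assms])
  show "smooth_on Qdom (\<lambda>p. 1 / sqrt (tweight \<alpha> (heat_F H) p))"
    by (rule smooth_on_cong[OF open_Qdom s[of "-1/2"]])
      (simp add: powr_minus_divide powr_half_sqrt less_imp_le tweight_pos[OF assms])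
qed

subsection \<open>Bounded extensions\<close>

text \<open>Fatou's lemma applied to the squared norms.\<close>

lemma nrm_liminf:
  fixes f :: "nat \<Rightarrow> 'x::euclidean_space \<Rightarrow> 'b::{second_countable_topology, real_normed_vector}"
  assumes [measurable]: "\<And>n. f n \<in> borel_measurable borel"
    and lim: "AE x in lborel. (\<lambda>n. f n x) \<longlonglongrightarrow> g x" and C: "\<And>n. n \<ge> N \<Longrightarrow> nrm (f n) \<le> C"
  shows "nrm g \<le> C"
proof -
  have "(nrm g)\<^sup>2 \<le> (\<integral>\<^sup>+x. liminf (\<lambda>n. ennreal ((norm (f n x))\<^sup>2)) \<partial>lborel)"
    unfolding nrm_power2
  proof (rule nn_integral_mono_AE, use lim in eventually_elim)
    fix x assume "(\<lambda>n. f n x) \<longlonglongrightarrow> g x"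
    then have "(\<lambda>n. ennreal ((norm (f n x))\<^sup>2)) \<longlonglongrightarrow> ennreal ((norm (g x))\<^sup>2)"
      by (intro tendsto_ennrealI tendsto_intros)
    then show "ennreal ((norm (g x))\<^sup>2) \<le> liminf (\<lambda>n. ennreal ((norm (f n x))\<^sup>2))"
      by (intro eq_refl lim_imp_Liminf[symmetric] trivial_limit_sequentially)
  qed
  also have "\<dots> \<le> liminf (\<lambda>n. \<integral>\<^sup>+x. ennreal ((norm (f n x))\<^sup>2) \<partial>lborel)"
    by (rule nn_integral_liminf) auto
  also have "\<dots> \<le> C\<^sup>2"
  proof (rule Liminf_le)
    show "\<forall>\<^sub>F n in sequentially. (\<integral>\<^sup>+x. ennreal ((norm (f n x))\<^sup>2) \<partial>lborel) \<le> C\<^sup>2"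
      unfolding eventually_sequentially nrm_power2[symmetric] ennreal_power2_le_iff using C by blast
  qed auto
  finally show ?thesis by (simp add: ennreal_power2_le_iff)
qed

lemma ennreal_geometric_sum_le: "(\<Sum>k<n. C * ennreal ((1 / 2) ^ k)) \<le> C * 2"
proof -
  have "(\<Sum>k<n. C * ennreal ((1 / 2) ^ k)) = C * ennreal (\<Sum>k<n. (1 / 2) ^ k)"
    by (simp add: sum_distrib_left[symmetric] sum_ennreal)
  also have "\<dots> \<le> C * ennreal 2"
  proof (intro mult_left_mono ennreal_leI)
    have "(\<Sum>k<n. (1 / 2) ^ k) = 2 - 2 * (1 / 2 :: real) ^ n" by (induct n) auto
    then show "(\<Sum>k<n. (1 / 2 :: real) ^ k) \<le> 2" by simp
  qed simp
  finally show ?thesis by simp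
qed

text \<open>The Riesz-Fischer argument. The sums of the norms of the increments are bounded in L^2;
  by monotone convergence their supremum is finite almost everywhere, so the increments are
  absolutely summable there. Fatou's lemma on the tails gives the rate.\<close>

lemma nrm_Cauchy_limit:
  fixes X :: "nat \<Rightarrow> 'x::euclidean_space \<Rightarrow> 'b::{second_countable_topology, banach}"
  assumes X [measurable]: "\<And>n. X n \<in> borel_measurable borel"
    and C: "\<And>n. nrm (\<lambda>x. X (Suc n) x - X n x) \<le> C * ennreal ((1 / 2) ^ n)" "C < \<infinity>"
  shows "AE x in lborel. (\<lambda>n. X n x) \<longlonglongrightarrow> lim (\<lambda>n. X n x)"
    and "nrm (\<lambda>x. lim (\<lambda>n. X n x) - X n x) \<le> C * 2 * ennreal ((1 / 2) ^ n)"
proof -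
  define D where "D n x = norm (X (Suc n) x - X n x)" for n x
  have [measurable]: "D n \<in> borel_measurable borel" for n unfolding D_def by measurable
  define S where "S n x = (\<Sum>k<n. D k x)" for n x
  have [measurable]: "S n \<in> borel_measurable borel" for n unfolding S_def by measurable
  have S0: "0 \<le> S n x" for n x by (auto simp: S_def D_def intro: sum_nonneg)
  have nS: "nrm (S n) \<le> C * 2" for n
  proof -
    have "nrm (S n) \<le> (\<Sum>k<n. nrm (D k))" unfolding S_def by (rule nrm_sum) auto
    also have "\<dots> \<le> (\<Sum>k<n. C * ennreal ((1 / 2) ^ k))"
      using C(1) by (intro sum_mono) (simp add: D_def[abs_def] nrm_norm)
    finally show ?thesis using ennreal_geometric_sum_le order_trans by blast
  qed
  have inc: "incseq (\<lambda>n x. ennreal ((S n x)\<^sup>2))"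
    by (intro monoI le_funI ennreal_leI power_mono S0) (auto simp: S_def D_def intro: sum_mono2)
  have "(\<integral>\<^sup>+x. (SUP n. ennreal ((S n x)\<^sup>2)) \<partial>lborel) = (SUP n. \<integral>\<^sup>+x. ennreal ((S n x)\<^sup>2) \<partial>lborel)"
    by (rule nn_integral_monotone_convergence_SUP[OF inc]) auto
  also have "\<dots> \<le> (C * 2)\<^sup>2"
  proof (rule SUP_least)
    fix n
    have "(nrm (S n))\<^sup>2 \<le> (C * 2)\<^sup>2" using nS by (simp only: ennreal_power2_le_iff)
    then show "(\<integral>\<^sup>+x. ennreal ((S n x)\<^sup>2) \<partial>lborel) \<le> (C * 2)\<^sup>2" using S0 by (simp add: nrm_power2)
  qed
  also have "\<dots> < \<infinity>" using C(2) by (simp add: power2_eq_square ennreal_mult_less_top)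
  finally have fin: "(\<integral>\<^sup>+x. (SUP n. ennreal ((S n x)\<^sup>2)) \<partial>lborel) \<noteq> \<infinity>" by simp
  have "AE x in lborel. (SUP n. ennreal ((S n x)\<^sup>2)) \<noteq> \<infinity>"
    by (rule nn_integral_PInf_AE[OF _ fin]) measurable
  then show AE: "AE x in lborel. (\<lambda>n. X n x) \<longlonglongrightarrow> lim (\<lambda>n. X n x)"
  proof eventually_elim
    fix x assume "(SUP n. ennreal ((S n x)\<^sup>2)) \<noteq> \<infinity>"
    then obtain B where B: "0 \<le> B" "(SUP n. ennreal ((S n x)\<^sup>2)) = ennreal B"
      by (cases "SUP n. ennreal ((S n x)\<^sup>2)") auto
    have "S n x \<le> sqrt B" for n
    proof -
      have "ennreal ((S n x)\<^sup>2) \<le> ennreal B" unfolding B(2)[symmetric] by (rule SUP_upper) simp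
      then have "(S n x)\<^sup>2 \<le> B" using B(1) by simp
      then show ?thesis using S0[of n x] by (simp add: real_le_rsqrt)
    qed
    then have "summable (\<lambda>k. D k x)"
      by (intro summableI_nonneg_bounded[of _ "sqrt B"]) (auto simp: S_def D_def)
    then have "summable (\<lambda>k. X (Suc k) x - X k x)" unfolding D_def by (rule summable_norm_cancel)
    then have "convergent (\<lambda>n. \<Sum>k<n. X (Suc k) x - X k x)" by (simp add: summable_iff_convergent)
    then have "convergent (\<lambda>n. X n x - X 0 x)" by (simp only: sum_lessThan_telescope[of "\<lambda>k. X k x"])
    then have "convergent (\<lambda>n. X n x)" by (simp add: convergent_diff_const_right_iff)
    then show "(\<lambda>n. X n x) \<longlonglongrightarrow> lim (\<lambda>n. X n x)" by (simp add: convergent_LIMSEQ_iff)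
  qed
  have diff: "nrm (\<lambda>x. X (n + m) x - X n x) \<le> C * 2 * ennreal ((1 / 2) ^ n)" for m
  proof -
    have "(\<lambda>x. X (n + m) x - X n x) = (\<lambda>x. \<Sum>k<m. X (Suc (n + k)) x - X (n + k) x)"
      using sum_lessThan_telescope[of "\<lambda>k. X (n + k) _"] by (auto simp: fun_eq_iff)
    then have "nrm (\<lambda>x. X (n + m) x - X n x) \<le> (\<Sum>k<m. nrm (\<lambda>x. X (Suc (n + k)) x - X (n + k) x))"
      by (simp only:) (rule nrm_sum, auto)
    also have "\<dots> \<le> (\<Sum>k<m. C * ennreal ((1 / 2) ^ n) * ennreal ((1 / 2) ^ k))"
    proof (intro sum_mono)
      fix k
      have "nrm (\<lambda>x. X (Suc (n + k)) x - X (n + k) x) \<le> C * ennreal ((1 / 2) ^ (n + k))" by (rule C(1))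
      then show "nrm (\<lambda>x. X (Suc (n + k)) x - X (n + k) x) \<le> C * ennreal ((1 / 2) ^ n) * ennreal ((1 / 2) ^ k)"
        by (simp add: power_add ennreal_mult mult.assoc)
    qed
    also have "\<dots> \<le> C * ennreal ((1 / 2) ^ n) * 2" by (rule ennreal_geometric_sum_le)
    finally show ?thesis by (simp add: mult_ac)
  qed
  show "nrm (\<lambda>x. lim (\<lambda>n. X n x) - X n x) \<le> C * 2 * ennreal ((1 / 2) ^ n)"
  proof (rule nrm_liminf[where f="\<lambda>m x. X (n + m) x - X n x" and N=0])
    show "AE x in lborel. (\<lambda>m. X (n + m) x - X n x) \<longlonglongrightarrow> lim (\<lambda>n. X n x) - X n x"
      using AE
    proof eventually_elim
      fix x assume "(\<lambda>n. X n x) \<longlonglongrightarrow> lim (\<lambda>n. X n x)"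
      from LIMSEQ_ignore_initial_segment[OF this, of n]
      show "(\<lambda>m. X (n + m) x - X n x) \<longlonglongrightarrow> lim (\<lambda>n. X n x) - X n x"
        by (intro tendsto_diff tendsto_const) (simp add: add.commute)
    qed
  qed (use diff in auto)
qed

lemma ennreal_le_of_geometric:
  fixes a b c :: ennreal
  assumes "\<And>k. a \<le> b + c * ennreal ((1 / 2) ^ k)" "c < \<infinity>"
  shows "a \<le> b"
proof (rule LIMSEQ_le_const)
  have "(\<lambda>k. ennreal ((1 / 2) ^ k)) \<longlonglongrightarrow> ennreal 0"
    by (intro tendsto_ennrealI LIMSEQ_realpow_zero) auto
  then have "(\<lambda>k. b + c * ennreal ((1 / 2) ^ k)) \<longlonglongrightarrow> b + c * 0"
    using assms(2) by (intro tendsto_add tendsto_const ennreal_tendsto_cmult) auto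
  then show "(\<lambda>k. b + c * ennreal ((1 / 2) ^ k)) \<longlonglongrightarrow> b" by simp
qed (use assms in auto)

lemma ennreal_divide_leI:
  fixes x y K :: ennreal
  assumes "x \<le> K * y" "y < \<infinity>"
  shows "x / y \<le> K"
proof (cases "y = 0")
  case False
  then show ?thesis using assms by (intro divide_le_posI_ennreal) (auto simp: mult.commute zero_less_iff_neq_zero)
qed (use assms in simp)

text \<open>Finiteness of \<open>K\<close> rules out the value \<infinity> of x / 0 for positive x,
  so a vanishing denominator forces x = 0.\<close>

lemma ennreal_divide_leD:
  fixes x y K :: ennreal
  assumes "x / y \<le> K" "y < \<infinity>" "K < \<infinity>"
  shows "x \<le> K * y"
proof (cases "y = 0")
  case True
  have "x = 0"
  proof (rule ccontr)
    assume "x \<noteq> 0"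
    then have "x / y = \<top>" using True by (simp add: divide_ennreal_def ennreal_mult_eq_top_iff)
    then show False using assms by (auto simp: top_unique)
  qed
  then show ?thesis by simp
next
  case False
  then have "x = (x / y) * y" using assms(2) by (simp add: ennreal_divide_times mult_divide_eq_ennreal)
  also have "\<dots> \<le> K * y" by (intro mult_right_mono assms) simp
  finally show ?thesis .
qed

lemma nrm_continuous_compact:
  fixes h :: "'x::euclidean_space \<Rightarrow> real"
  assumes "compact K" "continuous_on K h" "V \<subseteq> K"
  shows "nrm (\<lambda>x. indicat_real V x * h x) < \<infinity>"
proof -
  obtain b where b: "\<And>x. x \<in> K \<Longrightarrow> norm (h x) \<le> b" "b > 0"
    using compact_imp_bounded[OF compact_continuous_image[OF assms(2,1)]] by (auto simp: bounded_pos)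
  have "(nrm (\<lambda>x. indicat_real V x * h x))\<^sup>2 \<le> (\<integral>\<^sup>+x. ennreal (b\<^sup>2) * indicator K x \<partial>lborel)"
    unfolding nrm_power2
  proof (rule nn_integral_mono)
    fix x
    show "ennreal ((norm (indicat_real V x * h x))\<^sup>2) \<le> ennreal (b\<^sup>2) * indicator K x"
      using b(1)[of x] assms(3) power_mono[of "\<bar>h x\<bar>" b 2] by (auto simp: indicator_def intro!: ennreal_leI)
  qed
  also have "\<dots> = ennreal (b\<^sup>2) * emeasure lborel K"
    using assms(1) by (intro nn_integral_cmult_indicator) (auto intro: borel_compact)
  also have "\<dots> < \<infinity>"
    using emeasure_compact_finite[OF assms(1)] by (simp add: ennreal_mult_less_top)
  finally show ?thesis unfolding nrm_power2 by (simp add: nrm_def ennsqrt_less_top_iff)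
qed

lemma nrm_test_function_finite:
  assumes "f \<in> test_functions \<Omega>"
  shows "nrm f < \<infinity>"
proof -
  obtain C where C: "compact C" "\<And>x. x \<notin> C \<Longrightarrow> f x = 0" using assms by (metis test_functionsE)
  have "(\<lambda>x. indicat_real C x * f x) = f" using C(2) by (auto simp: fun_eq_iff indicator_def)
  then show ?thesis
    using nrm_continuous_compact[OF C(1) continuous_on_subset[OF test_functions_continuous[OF assms]] order_refl] by simp
qed

lemma test_functions_L2space:
  fixes g :: "'n::finite spacetime \<Rightarrow> real"
  assumes g: "g \<in> test_functions Qdom"
  shows "g \<in> L2space Qdom (\<lambda>_. 1)" "(\<lambda>p. indicat_real Qdom p *\<^sub>R g p) = g"
proof -
  show e: "(\<lambda>p. indicat_real Qdom p *\<^sub>R g p) = g"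
    using test_functions_zero[OF g] by (auto simp: fun_eq_iff indicator_def)
  show "g \<in> L2space Qdom (\<lambda>_. 1)"
    unfolding L2space_def set_borel_measurable_def mem_Collect_eq L2norm_one_eq_nrm e
    using test_functions_measurable[OF g] nrm_test_function_finite[OF g] by simp
qed

text \<open>The extension has to act on functions, not on classes. For each \<open>f\<close> an
  approximating sequence of test functions is chosen once and for all, and the image is the
  pointwise limit of the images. Different choices agree only almost everywhere, hence linearity and
  the extension property are recovered from norm estimates that are geometrically small in
  k.\<close>

lemma bounded_extension_exists:
  fixes T :: "('n::finite spacetime \<Rightarrow> real) \<Rightarrow> 'n spacetime \<Rightarrow> 'n mat"
  assumes meas: "\<And>g. g \<in> test_functions Qdom \<Longrightarrow> (\<lambda>p. indicat_real Qdom p *\<^sub>R T g p) \<in> borel_measurable borel"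
    and lin: "\<And>g h r p. g \<in> test_functions Qdom \<Longrightarrow> h \<in> test_functions Qdom \<Longrightarrow> p \<in> Qdom \<Longrightarrow>
      T (\<lambda>p. r * g p + h p) p = r *\<^sub>R T g p + T h p"
    and bnd: "\<And>g. g \<in> test_functions Qdom \<Longrightarrow> nrm (\<lambda>p. indicat_real Qdom p *\<^sub>R T g p) \<le> K * nrm g"
    and K: "K < \<infinity>"
  shows "\<exists>E. bounded_extension T E \<and> L2_op_norm E \<le> K"
proof -
  let ?L = "L2space Qdom (\<lambda>_. 1) :: ('n spacetime \<Rightarrow> real) set"
  \<comment> \<open>Elements of \<open>L2space\<close> are measurable on \<open>Qdom\<close> only;
    cutting makes them measurable on the whole space without changing the norm.\<close>
  define cut where "cut f = (\<lambda>p. indicat_real Qdom p * f p)" for f :: "'n spacetime \<Rightarrow> real"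
  have cut_L: "cut f \<in> borel_measurable borel" "nrm (cut f) < \<infinity>" if "f \<in> ?L" for f
    using that by (auto simp: L2space_def set_borel_measurable_def L2norm_one_eq_nrm cut_def)
  have ex: "\<exists>\<phi>. (\<forall>k. \<phi> k \<in> test_functions Qdom) \<and> (\<forall>k. nrm (\<lambda>x. \<phi> k x - cut f x) \<le> ennreal ((1 / 2) ^ k))"
    if f: "f \<in> ?L" for f
  proof -
    obtain \<phi> where "\<And>k. \<phi> k \<in> test_functions Qdom" "\<And>k. nrm (\<lambda>x. \<phi> k x - cut f x) < ennreal ((1 / 2) ^ k)"
    proof (rule test_functions_dense_sequence[OF open_Qdom cut_L[OF f]])
      show "cut f x = 0" if "x \<notin> Qdom" for x using that by (simp add: cut_def)
    qed blast
    then show ?thesis by (intro exI[of _ \<phi>]) (auto intro: less_imp_le)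
  qed
  define \<phi> where "\<phi> f = (SOME \<phi>. (\<forall>k. \<phi> k \<in> test_functions Qdom) \<and>
      (\<forall>k. nrm (\<lambda>x. \<phi> k x - cut f x) \<le> ennreal ((1 / 2) ^ k)))" for f
  have \<phi>: "\<phi> f k \<in> test_functions Qdom" "nrm (\<lambda>x. \<phi> f k x - cut f x) \<le> ennreal ((1 / 2) ^ k)"
    if "f \<in> ?L" for f k
    using someI_ex[OF ex[OF that]] by (simp_all add: \<phi>_def[of f, symmetric])
  define T' where "T' g = (\<lambda>p. indicat_real Qdom p *\<^sub>R T g p)" for g
  have T'_meas: "g \<in> test_functions Qdom \<Longrightarrow> T' g \<in> borel_measurable borel" for g
    unfolding T'_def by (rule meas)
  have T'_lin: "T' (\<lambda>p. r * g p + h p) p = r *\<^sub>R T' g p + T' h p"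
    if "g \<in> test_functions Qdom" "h \<in> test_functions Qdom" for g h r p
    using lin[OF that, of p r] by (cases "p \<in> Qdom") (auto simp: T'_def)
  have T'_diff: "T' (\<lambda>p. g p - h p) p = T' g p - T' h p"
    if "g \<in> test_functions Qdom" "h \<in> test_functions Qdom" for g h p
    using T'_lin[OF that(2,1), of "-1" p] by simp
  have T'_bnd: "nrm (T' g) \<le> K * nrm g" if "g \<in> test_functions Qdom" for g
    unfolding T'_def by (rule bnd[OF that])
  have T'_diff_bnd: "nrm (\<lambda>p. T' g p - T' h p) \<le> K * nrm (\<lambda>p. g p - h p)"
    if "g \<in> test_functions Qdom" "h \<in> test_functions Qdom" for g h
  proof -
    have "T' (\<lambda>p. g p - h p) = (\<lambda>p. T' g p - T' h p)" using T'_diff[OF that] by auto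
    then show ?thesis using T'_bnd[OF test_functions_diff[OF that]] by (simp only:)
  qed
  have tm: "g \<in> test_functions Qdom \<Longrightarrow> g \<in> borel_measurable borel" for g :: "'n spacetime \<Rightarrow> real"
    by (rule test_functions_measurable)
  \<comment> \<open>Where the sequence diverges \<open>lim\<close> has some unspecified value; this
    happens on a null set only.\<close>
  define E where "E f = (\<lambda>p. lim (\<lambda>k. T' (\<phi> f k) p))" for f
  have K2: "K * 2 < \<infinity>" "K * 2 * 2 < \<infinity>" using K by (auto simp: ennreal_mult_less_top)
  have step: "nrm (\<lambda>p. T' (\<phi> f (Suc k)) p - T' (\<phi> f k) p) \<le> K * 2 * ennreal ((1 / 2) ^ k)" if f: "f \<in> ?L" for f k
  proof -
    have "nrm (\<lambda>p. T' (\<phi> f (Suc k)) p - T' (\<phi> f k) p) \<le> K * nrm (\<lambda>p. \<phi> f (Suc k) p - \<phi> f k p)"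
      by (rule T'_diff_bnd[OF \<phi>(1)[OF f] \<phi>(1)[OF f]])
    also have "nrm (\<lambda>p. \<phi> f (Suc k) p - \<phi> f k p) \<le>
        nrm (\<lambda>p. \<phi> f (Suc k) p - cut f p) + nrm (\<lambda>p. cut f p - \<phi> f k p)"
      by (rule nrm_triangle_diff[OF tm[OF \<phi>(1)[OF f]] cut_L(1)[OF f] tm[OF \<phi>(1)[OF f]]])
    also have "\<dots> \<le> ennreal ((1 / 2) ^ Suc k) + ennreal ((1 / 2) ^ k)"
      using \<phi>(2)[OF f] by (intro add_mono) (auto simp: nrm_minus_commute[of "cut f"] simp del: power_Suc)
    also have "\<dots> \<le> 2 * ennreal ((1 / 2) ^ k)"
      unfolding mult_2 by (intro add_mono ennreal_leI) auto
    finally show ?thesis by (simp add: mult_left_mono mult.assoc)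
  qed
  have conv: "nrm (\<lambda>p. E f p - T' (\<phi> f k) p) \<le> K * 2 * 2 * ennreal ((1 / 2) ^ k)" if f: "f \<in> ?L" for f k
    unfolding E_def using T'_meas[OF \<phi>(1)[OF f]] by (rule nrm_Cauchy_limit(2)[OF _ step[OF f] K2(1)])
  have E_meas: "E f \<in> borel_measurable borel" if f: "f \<in> ?L" for f
    unfolding E_def using T'_meas[OF \<phi>(1)[OF f]] by (intro borel_measurable_lim_metric) auto
  have E_out: "indicat_real Qdom p *\<^sub>R E f p = E f p" for f p
    by (cases "p \<in> Qdom") (auto simp: E_def T'_def)
  have phi_bnd: "nrm (\<phi> f k) \<le> nrm (cut f) + ennreal ((1 / 2) ^ k)" if f: "f \<in> ?L" for f k
  proof -
    have "nrm (\<lambda>p. (\<phi> f k p - cut f p) + cut f p) \<le> nrm (\<lambda>p. \<phi> f k p - cut f p) + nrm (cut f)"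
      using tm[OF \<phi>(1)[OF f]] cut_L(1)[OF f] by (intro nrm_triangle) auto
    also have "\<dots> \<le> ennreal ((1 / 2) ^ k) + nrm (cut f)" using \<phi>(2)[OF f] by (intro add_mono) auto
    finally show ?thesis by (simp add: add.commute)
  qed
  have E_bnd: "nrm (E f) \<le> K * nrm (cut f)" if f: "f \<in> ?L" for f
  proof (rule ennreal_le_of_geometric)
    fix k
    have "nrm (\<lambda>p. (E f p - T' (\<phi> f k) p) + T' (\<phi> f k) p) \<le> nrm (\<lambda>p. E f p - T' (\<phi> f k) p) + nrm (T' (\<phi> f k))"
      using E_meas[OF f] T'_meas[OF \<phi>(1)[OF f]] by (intro nrm_triangle) auto
    also have "\<dots> \<le> K * 2 * 2 * ennreal ((1 / 2) ^ k) + K * (nrm (cut f) + ennreal ((1 / 2) ^ k))"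
      using conv[OF f] order_trans[OF T'_bnd[OF \<phi>(1)[OF f]] mult_left_mono[OF phi_bnd[OF f]]]
      by (intro add_mono) auto
    finally show "nrm (E f) \<le> K * nrm (cut f) + (K * 2 * 2 + K) * ennreal ((1 / 2) ^ k)"
      by (simp add: distrib_left distrib_right ac_simps)
  next
    show "K * 2 * 2 + K < \<infinity>" using K K2 by simp
  qed
  have E_L: "E f \<in> L2space Qdom (\<lambda>_. 1)" if f: "f \<in> ?L" for f
  proof -
    have "K * nrm (cut f) < \<infinity>" using K cut_L(2)[OF f] by (simp add: ennreal_mult_less_top)
    then show ?thesis using E_bnd[OF f] E_meas[OF f]
      by (auto simp: L2space_def set_borel_measurable_def L2norm_one_eq_nrm E_out)
  qed
  have AE_of_geometric: "AE p in lborel. X p = 0"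
    if "X \<in> borel_measurable borel" "\<And>k. nrm X \<le> c * ennreal ((1 / 2) ^ k)" "c < \<infinity>"
    for X :: "'n spacetime \<Rightarrow> 'n mat" and c
  proof -
    have "nrm X \<le> 0" using that(2,3) by (intro ennreal_le_of_geometric[of _ 0 c]) auto
    then have "nrm X = 0" by simp
    then show ?thesis using that(1) by (intro nrm_eq_0_AE) auto
  qed
  have E_lin: "AE p in lborel. p \<in> Qdom \<longrightarrow> E (\<lambda>p. r * f p + g p) p = r *\<^sub>R E f p + E g p"
    if f: "f \<in> ?L" and g: "g \<in> ?L" and h: "(\<lambda>p. r * f p + g p) \<in> ?L" for f g r
  proof -
    let ?h = "\<lambda>p. r * f p + g p"
    note m = E_meas[OF f] E_meas[OF g] E_meas[OF h] T'_meas[OF \<phi>(1)[OF f]] T'_meas[OF \<phi>(1)[OF g]] T'_meas[OF \<phi>(1)[OF h]]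
      tm[OF \<phi>(1)[OF f]] tm[OF \<phi>(1)[OF g]] tm[OF \<phi>(1)[OF h]] cut_L(1)[OF f] cut_L(1)[OF g] cut_L(1)[OF h]
    note [measurable] = m
    have "AE p in lborel. E ?h p - (r *\<^sub>R E f p + E g p) = 0"
    proof (rule AE_of_geometric)
      fix k
      let ?c = "ennreal ((1 / 2) ^ k)"
      let ?a = "\<lambda>p. E ?h p - T' (\<phi> ?h k) p" and ?b = "\<lambda>p. r *\<^sub>R (T' (\<phi> f k) p - E f p)"
        and ?d = "\<lambda>p. T' (\<phi> g k) p - E g p"
      \<comment> \<open>The approximations of the three functions are chosen independently. Their
        mismatch \<open>?t\<close> is a test function of small norm, so the bound on test functions
        applies to it.\<close>
      let ?t = "\<lambda>p. \<phi> ?h k p - (r * \<phi> f k p + \<phi> g k p)"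
      have rt: "(\<lambda>p. r * \<phi> f k p + \<phi> g k p) \<in> test_functions Qdom"
        by (intro test_functions_add test_functions_cmult \<phi> f g)
      have tt: "?t \<in> test_functions Qdom" by (rule test_functions_diff[OF \<phi>(1)[OF h] rt])
      note [measurable] = T'_meas[OF tt]
      have eT: "T' (\<phi> ?h k) p - (r *\<^sub>R T' (\<phi> f k) p + T' (\<phi> g k) p) = T' ?t p" for p
        unfolding T'_diff[OF \<phi>(1)[OF h] rt] T'_lin[OF \<phi>(1)[OF f] \<phi>(1)[OF g]] ..
      have "nrm ?t = nrm (\<lambda>p. (\<phi> ?h k p - cut ?h p) + (r *\<^sub>R (cut f p - \<phi> f k p) + (cut g p - \<phi> g k p)))"
        by (rule nrm_cong_norm) (simp add: cut_def algebra_simps)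
      also have "\<dots> \<le> nrm (\<lambda>p. \<phi> ?h k p - cut ?h p) + nrm (\<lambda>p. r *\<^sub>R (cut f p - \<phi> f k p) + (cut g p - \<phi> g k p))"
        by (rule nrm_triangle) measurable
      also have "nrm (\<lambda>p. r *\<^sub>R (cut f p - \<phi> f k p) + (cut g p - \<phi> g k p)) \<le>
          nrm (\<lambda>p. r *\<^sub>R (cut f p - \<phi> f k p)) + nrm (\<lambda>p. cut g p - \<phi> g k p)"
        by (rule nrm_triangle) measurable
      finally have t1: "nrm ?t \<le> nrm (\<lambda>p. \<phi> ?h k p - cut ?h p) + (nrm (\<lambda>p. r *\<^sub>R (cut f p - \<phi> f k p)) + nrm (\<lambda>p. cut g p - \<phi> g k p))"
        by (simp add: add_left_mono)
      also have "\<dots> \<le> ?c + (ennreal \<bar>r\<bar> * ?c + ?c)"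
        unfolding nrm_scaleR nrm_minus_commute[of "cut f"] nrm_minus_commute[of "cut g"]
        using \<phi>(2)[OF f] \<phi>(2)[OF g] \<phi>(2)[OF h] by (intro add_mono mult_left_mono) auto
      finally have t3: "nrm ?t \<le> ?c + (ennreal \<bar>r\<bar> * ?c + ?c)" .
      have t2: "nrm (T' ?t) \<le> K * (?c + (ennreal \<bar>r\<bar> * ?c + ?c))"
        by (rule order_trans[OF T'_bnd[OF tt] mult_left_mono[OF t3]]) simp
      have "nrm (\<lambda>p. E ?h p - (r *\<^sub>R E f p + E g p)) = nrm (\<lambda>p. ?a p + (?b p + (?d p + T' ?t p)))"
        unfolding eT[symmetric] by (rule nrm_cong_norm) (simp add: algebra_simps)
      also have "\<dots> \<le> nrm ?a + nrm (\<lambda>p. ?b p + (?d p + T' ?t p))"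
        by (intro nrm_triangle) measurable
      also have "nrm (\<lambda>p. ?b p + (?d p + T' ?t p)) \<le> nrm ?b + nrm (\<lambda>p. ?d p + T' ?t p)"
        by (intro nrm_triangle) measurable
      also have "nrm (\<lambda>p. ?d p + T' ?t p) \<le> nrm ?d + nrm (T' ?t)"
        by (intro nrm_triangle) measurable
      finally have "nrm (\<lambda>p. E ?h p - (r *\<^sub>R E f p + E g p)) \<le> nrm ?a + (nrm ?b + (nrm ?d + nrm (T' ?t)))"
        by (simp add: add_left_mono)
      also have "\<dots> \<le> K * 2 * 2 * ?c + (ennreal \<bar>r\<bar> * (K * 2 * 2 * ?c) + (K * 2 * 2 * ?c + K * (?c + (ennreal \<bar>r\<bar> * ?c + ?c))))"
        unfolding nrm_scaleR nrm_minus_commute[of _ "E f"] nrm_minus_commute[of _ "E g"]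
        using conv[OF h] conv[OF f] conv[OF g] t2 by (intro add_mono mult_left_mono) auto
      finally show "nrm (\<lambda>p. E ?h p - (r *\<^sub>R E f p + E g p)) \<le>
          (K * 2 * 2 + (ennreal \<bar>r\<bar> * (K * 2 * 2) + (K * 2 * 2 + K * (1 + (ennreal \<bar>r\<bar> + 1))))) * ?c"
        by (simp add: distrib_left distrib_right mult.assoc add.assoc)
    next
      show "K * 2 * 2 + (ennreal \<bar>r\<bar> * (K * 2 * 2) + (K * 2 * 2 + K * (1 + (ennreal \<bar>r\<bar> + 1)))) < \<infinity>"
        using K K2 by (auto simp: ennreal_mult_less_top)
    qed measurable
    then show ?thesis by eventually_elim simp
  qed
  have L_lin: "(\<lambda>p. r * f p + g p) \<in> ?L" if f: "f \<in> ?L" and g: "g \<in> ?L" for f g r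
  proof -
    have e: "cut (\<lambda>p. r * f p + g p) = (\<lambda>p. r *\<^sub>R cut f p + cut g p)" by (auto simp: cut_def algebra_simps)
    note [measurable] = cut_L(1)[OF f] cut_L(1)[OF g]
    have "nrm (\<lambda>p. r *\<^sub>R cut f p + cut g p) \<le> ennreal \<bar>r\<bar> * nrm (cut f) + nrm (cut g)"
      unfolding nrm_scaleR[symmetric] by (rule nrm_triangle) measurable
    also have "\<dots> < \<infinity>" using cut_L(2)[OF f] cut_L(2)[OF g] by (simp add: ennreal_mult_less_top)
    finally have "nrm (cut (\<lambda>p. r * f p + g p)) < \<infinity>" by (simp only: e)
    moreover have "cut (\<lambda>p. r * f p + g p) \<in> borel_measurable borel" unfolding e by measurable
    ultimately show ?thesis
      by (simp add: L2space_def set_borel_measurable_def L2norm_one_eq_nrm cut_def[symmetric])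
  qed
  have test_L: "g \<in> ?L" "cut g = g" if g: "g \<in> test_functions Qdom" for g
    using test_functions_L2space[OF g] by (simp_all add: cut_def)
  have E_test: "AE p in lborel. p \<in> Qdom \<longrightarrow> E g p = T g p" if g: "g \<in> test_functions Qdom" for g
  proof -
    note gL = test_L(1)[OF g]
    note [measurable] = E_meas[OF gL] T'_meas[OF g] T'_meas[OF \<phi>(1)[OF gL]]
    have "AE p in lborel. E g p - T' g p = 0"
    proof (rule AE_of_geometric)
      fix k
      have "nrm (\<lambda>p. E g p - T' g p) \<le> nrm (\<lambda>p. E g p - T' (\<phi> g k) p) + nrm (\<lambda>p. T' (\<phi> g k) p - T' g p)"
        by (intro nrm_triangle_diff) measurable
      also have "\<dots> \<le> K * 2 * 2 * ennreal ((1 / 2) ^ k) + K * ennreal ((1 / 2) ^ k)"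
        using conv[OF gL] order_trans[OF T'_diff_bnd[OF \<phi>(1)[OF gL] g] mult_left_mono[OF \<phi>(2)[OF gL, unfolded test_L(2)[OF g]]]]
        by (intro add_mono) auto
      finally show "nrm (\<lambda>p. E g p - T' g p) \<le> (K * 2 * 2 + K) * ennreal ((1 / 2) ^ k)"
        by (simp add: distrib_right)
    qed (use K K2 in auto)
    then show ?thesis by eventually_elim (auto simp: T'_def)
  qed
  have norm_le: "L2_op_norm E \<le> K"
    unfolding L2_op_norm_def
  proof (rule SUP_least)
    fix f assume f: "f \<in> ?L"
    have "nrm (E f) \<le> K * nrm (cut f)" by (rule E_bnd[OF f])
    then show "L2norm Qdom (\<lambda>_. 1) (E f) / L2norm Qdom (\<lambda>_. 1) f \<le> K"
      using cut_L(2)[OF f] unfolding L2norm_one_eq_nrm E_out cut_def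
      by (intro ennreal_divide_leI) auto
  qed
  have "bounded_extension T E"
    unfolding bounded_extension_def
    using E_L E_lin L_lin E_test norm_le K by (auto intro: le_less_trans)
  then show ?thesis using norm_le by blast
qed

subsection \<open>Upper bound\<close>

text \<open>Lets matrix-valued integrals be computed entrywise, so that the scalar Fubini theorem
  and scalar integration by parts suffice.\<close>

lemma integrable_matrix:
  fixes f :: "'a \<Rightarrow> real^'n::finite^'m::finite"
  assumes "\<And>i j. integrable M (\<lambda>x. f x $ i $ j)"
  shows "integrable M f" "integral\<^sup>L M f $ i $ j = (\<integral>x. f x $ i $ j \<partial>M)"
proof -
  have e: "f = (\<lambda>x. \<Sum>i\<in>UNIV. \<Sum>j\<in>UNIV. f x $ i $ j *\<^sub>R axis i (axis j 1))"
  proof (rule ext, simp add: vec_eq_iff, intro allI)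
    fix x k l
    have "f x $ i $ j * axis i (axis j 1) $ k $ l = (if i = k then (if j = l then f x $ i $ j else 0) else 0)" for i j
      by (auto simp: axis_def)
    then have "(\<Sum>i\<in>UNIV. \<Sum>j\<in>UNIV. f x $ i $ j * axis i (axis j 1) $ k $ l) =
        (\<Sum>i\<in>UNIV. \<Sum>j\<in>UNIV. if i = k then (if j = l then f x $ i $ j else 0) else 0)" by simp
    also have "\<dots> = (\<Sum>i\<in>UNIV. if i = k then (\<Sum>j\<in>UNIV. if j = l then f x $ i $ j else 0) else 0)"
      by (intro sum.cong refl) auto
    finally show "f x $ k $ l = (\<Sum>i\<in>UNIV. \<Sum>j\<in>UNIV. f x $ i $ j * axis i (axis j 1) $ k $ l)" by simp
  qed
  show int: "integrable M f"
    by (subst e) (intro Bochner_Integration.integrable_sum integrable_scaleR_left assms)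
  have "bounded_linear (\<lambda>X::real^'n^'m. X $ i $ j)"
    by (intro bounded_linear_compose[OF bounded_linear_vec_nth bounded_linear_vec_nth])
  from integral_bounded_linear[OF this int]
  show "integral\<^sup>L M f $ i $ j = (\<integral>x. f x $ i $ j \<partial>M)" by simp
qed

lemma bounded_linear_sandwich: "bounded_linear (\<lambda>X::'n::finite mat. R ** X ** R)"
  unfolding linear_conv_bounded_linear[symmetric]
  by (rule linearI)
    (simp_all add: matrix_add_ldistrib matrix_mult_add_rdistrib matrix_scalar_ac scalar_matrix_assoc[symmetric])

lemma hk_hess_even: "hk_hess A \<tau> (- x) = hk_hess A \<tau> x"
  unfolding hk_hess_def hk_even by (simp add: outer_def)

lemma dderiv_zero_open:
  assumes "open S" "x \<in> S" "\<And>y. y \<in> S \<Longrightarrow> f y = 0"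
  shows "dderiv e f x = 0"
  using dderiv_cong[OF assms(1,2), of f "\<lambda>_. 0" e] assms(3) by (simp add: dderiv_def)

text \<open>The square roots of F and the power (s/t)^(\<alpha>/2) in the kernel are precisely the
  conjugation by this division. It turns the unweighted norm of \<open>g\<close> into the weighted
  norm of the result.\<close>

definition unweight :: "real \<Rightarrow> 'n::finite tuple \<Rightarrow> ('n spacetime \<Rightarrow> real) \<Rightarrow> 'n spacetime \<Rightarrow> real" where
  "unweight \<alpha> H g p = 1 / sqrt (tweight \<alpha> (heat_F H) p) * g p"

text \<open>The Hessian of the potential of \<open>f\<close>, with the derivatives on
  \<open>f\<close> because the Hessian of the kernel is not integrable near lag 0. For
  \<open>f\<close> vanishing after time \<open>B\<close> the truncation at lag \<open>B\<close> is
  immaterial at positive times.\<close>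

definition hess_potential :: "'n::finite mat \<Rightarrow> real \<Rightarrow> ('n spacetime \<Rightarrow> real) \<Rightarrow> 'n spacetime \<Rightarrow> 'n mat" where
  "hess_potential A B f p = (\<chi> i j. kconv (hk_st A B) (dderiv2 i j f) p)"

lemma unweight_test_function:
  assumes "heat_tuple H" "g \<in> test_functions Qdom"
  shows "unweight \<alpha> H g \<in> test_functions Qdom"
  unfolding unweight_def[abs_def]
  by (intro test_functions_mult_smooth_on assms open_Qdom smooth_on_sqrt_weight)

lemma kconv_integrable_test:
  assumes "integrable lborel k" "f \<in> test_functions \<Omega>"
  shows "integrable lborel (\<lambda>r. k r * f (p + r))"
proof -
  obtain B where "\<And>x. \<bar>f x\<bar> \<le> B" using test_functions_bounded[OF assms(2)] by blast
  then show ?thesis using kconv_integrable[OF assms(1) test_functions_measurable[OF assms(2)]] by blast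
qed

text \<open>For fixed t > s two integrations by parts in space move the Hessian from the kernel to
  \<open>f\<close>. This has to happen slice by slice, before the time integration, and so uses that
  the spatial integral comes first.\<close>

lemma heat_op_inner_integral:
  fixes a A q :: "'n::finite mat" and \<alpha> :: real
  defines "R \<equiv> matrix_sqrt q"
  assumes H: "heat_tuple (\<theta>, a, A, q)" and g: "g \<in> test_functions Qdom" and s: "0 < s" "s < t"
  defines "f \<equiv> unweight \<alpha> (\<theta>, a, A, q) g"
  shows "(LBINT y. ((s / t) powr (\<alpha> / 2) * sqrt (heat_F (\<theta>, a, A, q) (s, z) / heat_F (\<theta>, a, A, q) (t, y)) *
        (gauss ((2 * (t - s)) *\<^sub>R A) (z - y) / (2 * (t - s))) * g (t, y)) *\<^sub>R
       (R ** ((1 / (2 * (t - s))) *\<^sub>R (matrix_inv A ** outer (z - y) ** matrix_inv A) - matrix_inv A) ** R)) =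
    sqrt (tweight \<alpha> (heat_F (\<theta>, a, A, q)) (s, z)) *\<^sub>R
      (R ** (\<chi> i j. LBINT x. hk A (t - s) x * dderiv2 i j f ((s, z) + (t - s, x))) ** R)"
proof -
  let ?F = "heat_F (\<theta>, a, A, q)" and ?\<tau> = "t - s" and ?w = "tweight \<alpha> (heat_F (\<theta>, a, A, q))"
  have A: "posdef A" using H by (simp add: heat_tuple_def)
  have \<tau>: "?\<tau> > 0" using s by simp
  have f: "f \<in> test_functions UNIV"
    unfolding f_def by (rule test_functions_mono[OF _ unweight_test_function[OF H g]]) simp
  define m where "m x = f (t, z + x) *\<^sub>R hk_hess A ?\<tau> x" for x
  note slice = spacetime_slice_test_function[OF f, where p="(s, z)" and \<tau>="?\<tau>"]
  have st: "(s, z) + (?\<tau>, x) = (t, z + x)" for x by simp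
  have mij: "integrable lborel (\<lambda>x. m x $ i $ j)"
    "(LBINT x. m x $ i $ j) = (LBINT x. hk A ?\<tau> x * dderiv2 i j f ((s, z) + (?\<tau>, x)))" for i j
  proof -
    show "integrable lborel (\<lambda>x. m x $ i $ j)"
      using hk_hess_integration_by_parts(2)[OF A \<tau> slice(1), of i j] by (simp add: m_def mult.commute)
    have d1: "dderiv (axis j 1) (\<lambda>x. f ((s, z) + (?\<tau>, x))) = (\<lambda>x. dderiv (e_space j) f ((s, z) + (?\<tau>, x)))"
      by (intro ext slice(2))
    have d2: "dderiv (axis i 1) (\<lambda>x. dderiv (e_space j) f ((s, z) + (?\<tau>, x))) x =
        dderiv2 i j f ((s, z) + (?\<tau>, x))" for x
      by (rule spacetime_slice_test_function(2)[OF test_functions_dderiv[OF f]])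
    show "(LBINT x. m x $ i $ j) = (LBINT x. hk A ?\<tau> x * dderiv2 i j f ((s, z) + (?\<tau>, x)))"
      using hk_hess_integration_by_parts(1)[OF A \<tau> slice(1), of i j, unfolded d1 d2]
      by (simp add: m_def mult.commute)
  qed
  have m: "integrable lborel m" using mij(1) by (rule integrable_matrix)
  define H0 where "H0 x = sqrt (?w (s, z)) *\<^sub>R (R ** m x ** R)" for x
  have bl: "bounded_linear (\<lambda>X. sqrt (?w (s, z)) *\<^sub>R (R ** X ** R))"
    by (intro bounded_linear_compose[OF bounded_linear_scaleR_right bounded_linear_sandwich])
  have H0: "integrable lborel H0" unfolding H0_def using integrable_bounded_linear[OF bl m] .
  have "((s / t) powr (\<alpha> / 2) * sqrt (?F (s, z) / ?F (t, y)) * (gauss ((2 * ?\<tau>) *\<^sub>R A) (z - y) / (2 * ?\<tau>)) * g (t, y)) *\<^sub>R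
       (R ** ((1 / (2 * ?\<tau>)) *\<^sub>R (matrix_inv A ** outer (z - y) ** matrix_inv A) - matrix_inv A) ** R) = H0 (- z + y)" for y
  proof -
    have Fp: "?F (s, z) > 0" "?F (t, y) > 0" using s by (auto intro!: heat_F_pos[OF H])
    have w: "sqrt (?w (r, x)) = r powr (\<alpha> / 2) * sqrt (?F (r, x))" if "r > 0" for r x
      using that by (simp add: tweight_def real_sqrt_mult powr_half_sqrt[symmetric] powr_powr)
    have t: "t > 0" using s by simp
    \<comment> \<open>The weight at (s, z) does not depend on y and leaves the integral; the weight
      at (t, y) turns \<open>g\<close> into \<open>f\<close>.\<close>
    have c: "(s / t) powr (\<alpha> / 2) * sqrt (?F (s, z) / ?F (t, y)) * (hk A ?\<tau> (z - y) / (2 * ?\<tau>)) * g (t, y) =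
        sqrt (?w (s, z)) * (f (t, y) * (hk A ?\<tau> (z - y) / (2 * ?\<tau>)))"
      unfolding f_def unweight_def w[OF s(1)] w[OF t] using s t Fp
      by (simp add: powr_divide real_sqrt_divide)
    have ev: "hk_hess A ?\<tau> (- z + y) = hk_hess A ?\<tau> (z - y)"
      using hk_hess_even[of A ?\<tau> "z - y"] by simp
    have zy: "z + (- z + y) = y" by simp
    show ?thesis
      unfolding hk_def[symmetric] c H0_def m_def ev zy
      by (simp only: hk_hess_def matrix_scalar_ac scalar_matrix_assoc[symmetric] scaleR_scaleR mult.assoc)
  qed
  then have "(LBINT y. ((s / t) powr (\<alpha> / 2) * sqrt (?F (s, z) / ?F (t, y)) * (gauss ((2 * ?\<tau>) *\<^sub>R A) (z - y) / (2 * ?\<tau>)) * g (t, y)) *\<^sub>R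
       (R ** ((1 / (2 * ?\<tau>)) *\<^sub>R (matrix_inv A ** outer (z - y) ** matrix_inv A) - matrix_inv A) ** R)) =
     (LBINT y. H0 (- z + y))" by (simp only:)
  also have "\<dots> = (LBINT x. H0 x)"
    using borel_measurable_integrable[OF H0] by (intro lborel_translate(1)) simp
  also have "\<dots> = sqrt (?w (s, z)) *\<^sub>R (R ** integral\<^sup>L lborel m ** R)"
    unfolding H0_def by (rule integral_bounded_linear[OF bl m])
  also have "integral\<^sup>L lborel m = (\<chi> i j. LBINT x. hk A ?\<tau> x * dderiv2 i j f ((s, z) + (?\<tau>, x)))"
    using integrable_matrix(2)[OF mij(1)] by (simp only: vec_eq_iff vec_lambda_beta mij(2)) simp
  finally show ?thesis .
qed

text \<open>Once the derivatives fall on \<open>f\<close>, the slice integrals are integrable in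
  time, and Fubini reassembles them into a space-time convolution with the heat kernel.\<close>

theorem heat_op_test_function:
  fixes a A q :: "'n::finite mat"
  assumes H: "heat_tuple (\<theta>, a, A, q)" and g: "g \<in> test_functions Qdom"
    and B: "\<And>s z. s \<ge> B \<Longrightarrow> g (s, z) = 0" and p: "p \<in> Qdom"
  shows "heat_op \<alpha> (\<theta>, a, A, q) g p = sqrt (tweight \<alpha> (heat_F (\<theta>, a, A, q)) p) *\<^sub>R
    (matrix_sqrt q ** hess_potential A B (unweight \<alpha> (\<theta>, a, A, q) g) p ** matrix_sqrt q)"
proof -
  define f where "f = unweight \<alpha> (\<theta>, a, A, q) g"
  let ?R = "matrix_sqrt q" and ?w = "tweight \<alpha> (heat_F (\<theta>, a, A, q))"
  obtain s z where sz: "p = (s, z)" "s > 0" using p by (cases p) auto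
  have A: "posdef A" using H by (simp add: heat_tuple_def)
  have f: "f \<in> test_functions UNIV"
    unfolding f_def by (rule test_functions_mono[OF _ unweight_test_function[OF H g]]) simp
  let ?D = "\<lambda>i j. dderiv2 i j f"
  have D: "?D i j \<in> test_functions UNIV" for i j by (intro test_functions_dderiv f)
  have fz: "f q = 0" if "fst q \<ge> B" for q using B[of "fst q" "snd q"] that by (simp add: f_def unweight_def)
  have o: "open {q::'n spacetime. fst q > B}" by (intro open_Collect_less continuous_intros)
  have Dz: "?D i j q = 0" if "fst q > B" for i j q
    using that fz by (intro dderiv_zero_open[OF o]) auto
  define V where "V \<tau> = (\<chi> i j. LBINT x. hk A \<tau> x * ?D i j (p + (\<tau>, x)))" for \<tau>
  define N where "N \<tau> = indicat_real {0<..} \<tau> *\<^sub>R V \<tau>" for \<tau>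
  have Nij: "N \<tau> $ i $ j = (LBINT x. hk_st A B (\<tau>, x) * ?D i j (p + (\<tau>, x)))" for \<tau> i j
  proof -
    consider "\<tau> \<le> 0" | "0 < \<tau>" "\<tau> \<le> B" | "0 < \<tau>" "B < \<tau>" by linarith
    then show ?thesis
    proof cases
      \<comment> \<open>Beyond the truncation the shifted point lies after time \<open>B\<close>,
        where \<open>f\<close> and hence its derivatives vanish.\<close>
      case 3
      then have "?D i j (p + (\<tau>, x)) = 0" for x using sz by (intro Dz) simp
      then show ?thesis by (simp add: N_def V_def)
    qed (auto simp: N_def V_def hk_st_def)
  qed
  have int: "integrable (lborel \<Otimes>\<^sub>M lborel) (\<lambda>r. hk_st A B r * ?D i j (p + r))" for i j
    using kconv_integrable_test[OF hk_st_integrable[OF A] D] by (simp add: lborel_prod)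
  have Nint: "integrable lborel (\<lambda>\<tau>. N \<tau> $ i $ j)" for i j
    unfolding Nij by (rule lborel_pair.integrable_fst'[OF int])
  have N: "integrable lborel N" using Nint by (rule integrable_matrix)
  have NU: "integral\<^sup>L lborel N = hess_potential A B f p"
  proof -
    have "integral\<^sup>L lborel N $ i $ j = hess_potential A B f p $ i $ j" for i j
    proof -
      have "integral\<^sup>L lborel N $ i $ j = (LBINT \<tau>. \<integral>x. hk_st A B (\<tau>, x) * ?D i j (p + (\<tau>, x)) \<partial>lborel)"
        unfolding integrable_matrix(2)[OF Nint] Nij ..
      also have "\<dots> = kconv (hk_st A B) (?D i j) p"
        using lborel_pair.integral_fst'[OF int[of i j]] by (simp add: kconv_def lborel_prod)
      finally show ?thesis by (simp add: hess_potential_def)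
    qed
    then show ?thesis by (simp add: vec_eq_iff)
  qed
  have bl: "bounded_linear (\<lambda>X. sqrt (?w p) *\<^sub>R (?R ** X ** ?R))"
    by (intro bounded_linear_compose[OF bounded_linear_scaleR_right bounded_linear_sandwich])
  let ?H1 = "\<lambda>\<tau>. sqrt (?w p) *\<^sub>R (?R ** N \<tau> ** ?R)"
  have H1: "integrable lborel ?H1" by (rule integrable_bounded_linear[OF bl N])
  have "heat_op \<alpha> (\<theta>, a, A, q) g p = (LBINT t. ?H1 (- s + t))"
    unfolding heat_op_def set_lebesgue_integral_def sz split_conv
  proof (rule Bochner_Integration.integral_cong[OF refl])
    fix t
    show "indicat_real {s<..} t *\<^sub>R (LBINT y. ((s / t) powr (\<alpha> / 2) * sqrt (heat_F (\<theta>, a, A, q) (s, z) / heat_F (\<theta>, a, A, q) (t, y)) *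
        (gauss ((2 * (t - s)) *\<^sub>R A) (z - y) / (2 * (t - s))) * g (t, y)) *\<^sub>R
       (?R ** ((1 / (2 * (t - s))) *\<^sub>R (matrix_inv A ** outer (z - y) ** matrix_inv A) - matrix_inv A) ** ?R)) =
       sqrt (?w (s, z)) *\<^sub>R (?R ** N (- s + t) ** ?R)"
    proof (cases "s < t")
      case True
      then have "N (- s + t) = (\<chi> i j. LBINT x. hk A (t - s) x * ?D i j ((s, z) + (t - s, x)))"
        by (simp add: N_def V_def sz)
      then show ?thesis
        using True heat_op_inner_integral[OF H g sz(2) True, of \<alpha> z] by (simp add: f_def)
    qed (simp add: N_def linear_0[OF bounded_linear.linear[OF bounded_linear_sandwich]])
  qed
  also have "\<dots> = (LBINT \<tau>. ?H1 \<tau>)"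
    using borel_measurable_integrable[OF H1] by (intro lborel_translate(1)) simp
  also have "\<dots> = sqrt (?w p) *\<^sub>R (?R ** integral\<^sup>L lborel N ** ?R)"
    by (rule integral_bounded_linear[OF bl N])
  finally show ?thesis unfolding NU f_def .
qed

lemma test_function_time_bound:
  fixes g :: "'n::finite spacetime \<Rightarrow> real"
  assumes "g \<in> test_functions \<Omega>"
  obtains B where "B > 0" "\<forall>s z. s \<ge> B \<longrightarrow> g (s, z) = 0"
proof -
  obtain C where C: "compact C" "\<And>x. x \<notin> C \<Longrightarrow> g x = 0" using assms by (metis test_functionsE)
  obtain R where R: "R > 0" "\<And>x. x \<in> C \<Longrightarrow> norm x \<le> R"
    using compact_imp_bounded[OF C(1)] by (auto simp: bounded_pos)
  have "g (s, z) = 0" if "s \<ge> R + 1" for s z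
  proof (rule C(2), rule notI)
    assume "(s, z) \<in> C"
    then have "norm (s, z) \<le> R" by (rule R(2))
    moreover have "\<bar>s\<bar> \<le> norm (s, z)" using norm_fst_le[of s z] by simp
    ultimately show False using that by simp
  qed
  then show ?thesis using that[of "R + 1"] R(1) by simp
qed

lemma kconv_linear:
  assumes "integrable lborel k" "f \<in> test_functions \<Omega>" "h \<in> test_functions \<Omega>"
  shows "kconv k (\<lambda>x. r * f x + h x) p = r * kconv k f p + kconv k h p"
proof -
  have "kconv k (\<lambda>x. r * f x + h x) p = (LBINT x. r * (k x * f (p + x)) + k x * h (p + x))"
    unfolding kconv_def by (rule Bochner_Integration.integral_cong) (auto simp: algebra_simps)
  then show ?thesis
    using kconv_integrable_test[OF assms(1,2)] kconv_integrable_test[OF assms(1,3)]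
    by (simp add: kconv_def)
qed

lemma hess_potential_linear:
  assumes A: "posdef A" and f: "f \<in> test_functions \<Omega>" and h: "h \<in> test_functions \<Omega>"
  shows "hess_potential A B (\<lambda>x. r * f x + h x) p = r *\<^sub>R hess_potential A B f p + hess_potential A B h p"
proof -
  have lin: "dderiv e (\<lambda>x. r * f x + h x) = (\<lambda>x. r * dderiv e f x + dderiv e h x)"
    if "f \<in> test_functions \<Omega>" "h \<in> test_functions \<Omega>" for e and f h :: "_ \<Rightarrow> real"
  proof
    fix x
    have "(f has_derivative (\<lambda>e. dderiv e f x)) (at x)" "(h has_derivative (\<lambda>e. dderiv e h x)) (at x)"
      using that by (auto intro!: has_dderiv smooth_on_differentiable[OF test_functions_smooth])
    from has_derivative_add[OF has_derivative_mult_right[OF this(1), of r] this(2)]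
    show "dderiv e (\<lambda>x. r * f x + h x) x = r * dderiv e f x + dderiv e h x" by (rule dderiv_eq)
  qed
  show ?thesis
    unfolding hess_potential_def lin[OF f h] lin[OF test_functions_dderiv[OF f] test_functions_dderiv[OF h]]
    by (simp add: vec_eq_iff kconv_linear[OF hk_st_integrable[OF A] test_functions_dderiv[OF test_functions_dderiv[OF f]]
          test_functions_dderiv[OF test_functions_dderiv[OF h]]])
qed

lemma heat_op_linear:
  fixes a A q :: "'n::finite mat"
  assumes H: "heat_tuple (\<theta>, a, A, q)" and g: "g \<in> test_functions Qdom" and h: "h \<in> test_functions Qdom" and p: "p \<in> Qdom"
  shows "heat_op \<alpha> (\<theta>, a, A, q) (\<lambda>p. r * g p + h p) p = r *\<^sub>R heat_op \<alpha> (\<theta>, a, A, q) g p + heat_op \<alpha> (\<theta>, a, A, q) h p"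
proof -
  have A: "posdef A" using H by (simp add: heat_tuple_def)
  obtain B1 where "B1 > 0" and B1: "\<forall>s z. s \<ge> B1 \<longrightarrow> g (s, z) = 0" by (rule test_function_time_bound[OF g]) (rule that)
  obtain B2 where "B2 > 0" and B2: "\<forall>s z. s \<ge> B2 \<longrightarrow> h (s, z) = 0" by (rule test_function_time_bound[OF h]) (rule that)
  \<comment> \<open>With a common time bound the same truncated kernel represents the operator on
    both functions and on their combination.\<close>
  define B where "B = max B1 B2"
  have gh: "(\<lambda>p. r * g p + h p) \<in> test_functions Qdom" by (intro test_functions_add test_functions_cmult g h)
  have "unweight \<alpha> (\<theta>, a, A, q) (\<lambda>p. r * g p + h p) = (\<lambda>p. r * unweight \<alpha> (\<theta>, a, A, q) g p + unweight \<alpha> (\<theta>, a, A, q) h p)"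
    by (auto simp: unweight_def algebra_simps add_divide_distrib)
  moreover have "heat_op \<alpha> (\<theta>, a, A, q) k p = sqrt (tweight \<alpha> (heat_F (\<theta>, a, A, q)) p) *\<^sub>R
    (matrix_sqrt q ** hess_potential A B (unweight \<alpha> (\<theta>, a, A, q) k) p ** matrix_sqrt q)"
    if "k \<in> test_functions Qdom" "\<And>s z. s \<ge> B \<Longrightarrow> k (s, z) = 0" for k
    using that p by (intro heat_op_test_function[OF H])
  ultimately show ?thesis
    using B1 B2 g h gh hess_potential_linear[OF A unweight_test_function[OF H g] unweight_test_function[OF H h]]
    by (simp add: B_def linear_add[OF bounded_linear.linear[OF bounded_linear_sandwich]]
        linear_cmul[OF bounded_linear.linear[OF bounded_linear_sandwich]] scaleR_add_right mult.commute)
qed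

lemma hess_potential_continuous:
  assumes "posdef A" "f \<in> test_functions \<Omega>"
  shows "continuous_on S (hess_potential A B f)"
  unfolding hess_potential_def
  by (intro continuous_on_vec_lambda continuous_on_subset[OF smooth_on_continuous[OF smooth_on_kconv[OF hk_st_integrable[OF assms(1)]
    test_functions_dderiv[OF test_functions_dderiv[OF assms(2)]]]]]) auto

lemma heat_op_measurable:
  fixes a A q :: "'n::finite mat"
  assumes H: "heat_tuple (\<theta>, a, A, q)" and g: "g \<in> test_functions Qdom"
  shows "(\<lambda>p. indicat_real Qdom p *\<^sub>R heat_op \<alpha> (\<theta>, a, A, q) g p) \<in> borel_measurable borel"
proof -
  have A: "posdef A" using H by (simp add: heat_tuple_def)
  obtain B where "B > 0" and B: "\<forall>s z. s \<ge> B \<longrightarrow> g (s, z) = 0" by (rule test_function_time_bound[OF g]) (rule that)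
  let ?u = "\<lambda>p. sqrt (tweight \<alpha> (heat_F (\<theta>, a, A, q)) p) *\<^sub>R
    (matrix_sqrt q ** hess_potential A B (unweight \<alpha> (\<theta>, a, A, q) g) p ** matrix_sqrt q)"
  have "continuous_on Qdom ?u"
    by (intro continuous_on_scaleR smooth_on_continuous[OF smooth_on_sqrt_weight(1)[OF H]]
        bounded_linear.continuous_on[OF bounded_linear_sandwich] hess_potential_continuous[OF A unweight_test_function[OF H g]])
  then have "(\<lambda>p. indicat_real Qdom p *\<^sub>R ?u p) \<in> borel_measurable borel"
    by (intro borel_measurable_continuous_on_indicator) (auto intro: borel_open open_Qdom)
  moreover have "indicat_real Qdom p *\<^sub>R ?u p = indicat_real Qdom p *\<^sub>R heat_op \<alpha> (\<theta>, a, A, q) g p" for p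
    using heat_op_test_function[OF H g B[rule_format]] by (cases "p \<in> Qdom") auto
  ultimately show ?thesis by simp
qed

section \<open>Potentials as members of the weighted Sobolev space\<close>

lemma locally_integrable_continuous:
  assumes "continuous_on UNIV u"
  shows "locally_integrable \<Omega> u"
  unfolding locally_integrable_def set_integrable_def
  using borel_integrable_compact[OF _ continuous_on_subset[OF assms]] by auto

lemma weak_deriv_smooth:
  fixes v :: "'x::euclidean_space \<Rightarrow> real"
  assumes v: "smooth_on UNIV v"
  shows "weak_deriv \<Omega> e v (dderiv e v)"
  unfolding weak_deriv_def
proof (intro conjI ballI)
  show "locally_integrable \<Omega> v" "locally_integrable \<Omega> (dderiv e v)"
    using v by (auto intro!: locally_integrable_continuous smooth_on_continuous smooth_on_dderiv)
  fix \<phi> :: "'x \<Rightarrow> real" assume \<phi>: "\<phi> \<in> test_functions \<Omega>"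
  obtain C where C: "compact C" "\<And>x. x \<notin> C \<Longrightarrow> \<phi> x = 0" using \<phi> by (metis test_functionsE)
  have 1: "indicat_real \<Omega> x *\<^sub>R (v x * dderiv e \<phi> x) = dderiv e \<phi> x * v x" for x
    using test_functions_zero[OF test_functions_dderiv[OF \<phi>], of x] by (auto simp: indicator_def)
  have 2: "indicat_real \<Omega> x *\<^sub>R (dderiv e v x * \<phi> x) = \<phi> x * dderiv e v x" for x
    using test_functions_zero[OF \<phi>, of x] by (auto simp: indicator_def)
  have "(LBINT x. \<phi> x * dderiv e v x) = - (LBINT x. dderiv e \<phi> x * v x)"
    by (rule integration_by_parts_dderiv[OF _ _ _ _ C])
      (use smooth_on_differentiable[OF v] smooth_on_differentiable[OF test_functions_smooth[OF \<phi>]]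
        dderiv_continuous[OF v] dderiv_continuous[OF test_functions_smooth[OF \<phi>]] in auto)
  then show "(LINT x:\<Omega>|lborel. v x * dderiv e \<phi> x) = - (LINT x:\<Omega>|lborel. dderiv e v x * \<phi> x)"
    unfolding set_lebesgue_integral_def 1 2 by simp
qed

text \<open>Where \<open>h\<close> at the shifted point is nonzero, the position z and the shift x
  satisfy |z| <= |x| + R. A Gaussian moment of the kernel in x therefore becomes Gaussian decay in z
  with half the exponent.\<close>

lemma kconv_gaussian_decay:
  fixes A :: "'n::finite mat" and h :: "'n spacetime \<Rightarrow> real"
  assumes A: "posdef A" and B: "B > 0" and h: "h \<in> test_functions UNIV"
  shows "\<exists>C \<delta>. C > 0 \<and> \<delta> > 0 \<and> (\<forall>p. \<bar>kconv (hk_st A B) h p\<bar> \<le> C * exp (- \<delta> * (norm (snd p))\<^sup>2))"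
proof -
  obtain \<epsilon> where \<epsilon>: "\<epsilon> > 0" "integrable lborel (\<lambda>r. hk_st A B r * exp (\<epsilon> * (norm (snd r))\<^sup>2))"
    using hk_st_exp_integrable[OF A B] by blast
  obtain b where b: "b > 0" "\<And>x. \<bar>h x\<bar> \<le> b" using test_functions_bounded[OF h] by blast
  obtain R where R: "R > 0" "\<And>\<tau> x. norm x > R \<Longrightarrow> h (0 + (\<tau>, x)) = 0"
    using test_function_translate_bounded[OF h] by blast
  define I where "I = (LBINT r. hk_st A B r * exp (\<epsilon> * (norm (snd r))\<^sup>2))"
  have I: "I \<ge> 0" unfolding I_def using hk_st_nonneg[OF A] by (intro Bochner_Integration.integral_nonneg) auto
  have pw: "norm (hk_st A B r * h (p + r)) \<le> (b * exp (\<epsilon> * R\<^sup>2) * exp (- (\<epsilon> / 2) * (norm (snd p))\<^sup>2)) * (hk_st A B r * exp (\<epsilon> * (norm (snd r))\<^sup>2))"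
    for p r
  proof (cases "norm (snd (p + r)) > R")
    case True
    then have "h (p + r) = 0" using R(2)[of "snd (p + r)" "fst (p + r)"] by (simp only: add_0 prod.collapse)
    then show ?thesis using b(1) hk_st_nonneg[OF A, of B r] by simp
  next
    case False
    have "norm (snd p) \<le> norm (snd r) + R"
      using False norm_triangle_ineq4[of "snd p + snd r" "snd r"] by simp
    then have "(norm (snd p))\<^sup>2 \<le> (norm (snd r) + R)\<^sup>2" by (intro power_mono) auto
    also have "\<dots> \<le> 2 * (norm (snd r))\<^sup>2 + 2 * R\<^sup>2"
      using zero_le_power2[of "norm (snd r) - R"] by (simp add: power2_sum power2_diff)
    finally have "(\<epsilon> / 2) * (norm (snd p))\<^sup>2 \<le> (\<epsilon> / 2) * (2 * (norm (snd r))\<^sup>2 + 2 * R\<^sup>2)"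
      using \<epsilon>(1) by (intro mult_left_mono) auto
    then have "0 \<le> \<epsilon> * R\<^sup>2 + - (\<epsilon> / 2) * (norm (snd p))\<^sup>2 + \<epsilon> * (norm (snd r))\<^sup>2" by (simp add: algebra_simps)
    then have "1 \<le> exp (\<epsilon> * R\<^sup>2 + - (\<epsilon> / 2) * (norm (snd p))\<^sup>2 + \<epsilon> * (norm (snd r))\<^sup>2)" by simp
    then have "b * 1 \<le> b * exp (\<epsilon> * R\<^sup>2 + - (\<epsilon> / 2) * (norm (snd p))\<^sup>2 + \<epsilon> * (norm (snd r))\<^sup>2)"
      using b(1) by (intro mult_left_mono) auto
    then have "\<bar>h (p + r)\<bar> \<le> b * (exp (\<epsilon> * R\<^sup>2) * exp (- (\<epsilon> / 2) * (norm (snd p))\<^sup>2) * exp (\<epsilon> * (norm (snd r))\<^sup>2))"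
      using b(2)[of "p + r"] by (simp only: exp_add mult_1_right)
    from mult_left_mono[OF this hk_st_nonneg[OF A, of B r]]
    show ?thesis using hk_st_nonneg[OF A, of B r] by (simp add: abs_mult mult_ac)
  qed
  have "\<bar>kconv (hk_st A B) h p\<bar> \<le> (b * exp (\<epsilon> * R\<^sup>2) * I + 1) * exp (- (\<epsilon> / 2) * (norm (snd p))\<^sup>2)" for p
  proof -
    have "\<bar>kconv (hk_st A B) h p\<bar> \<le> (LBINT r. norm (hk_st A B r * h (p + r)))"
      unfolding kconv_def real_norm_def[symmetric] by (rule integral_norm_bound)
    also have "\<dots> \<le> (LBINT r. (b * exp (\<epsilon> * R\<^sup>2) * exp (- (\<epsilon> / 2) * (norm (snd p))\<^sup>2)) * (hk_st A B r * exp (\<epsilon> * (norm (snd r))\<^sup>2)))"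
      by (intro integral_mono pw integrable_norm integrable_mult_right \<epsilon> kconv_integrable_test[OF hk_st_integrable[OF A] h])
    also have "\<dots> = (b * exp (\<epsilon> * R\<^sup>2) * I) * exp (- (\<epsilon> / 2) * (norm (snd p))\<^sup>2)" by (simp add: I_def)
    also have "\<dots> \<le> (b * exp (\<epsilon> * R\<^sup>2) * I + 1) * exp (- (\<epsilon> / 2) * (norm (snd p))\<^sup>2)"
      by (intro mult_right_mono) auto
    finally show ?thesis .
  qed
  moreover have "b * exp (\<epsilon> * R\<^sup>2) * I + 1 > 0" using b(1) I by (intro add_nonneg_pos) auto
  ultimately show ?thesis using \<epsilon>(1) by (intro exI[of _ "b * exp (\<epsilon> * R\<^sup>2) * I + 1"] exI[of _ "\<epsilon> / 2"]) auto
qed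

lemma slab_borel: "{c<..<B} \<times> UNIV \<in> sets (borel :: 'n::finite spacetime measure)"
  by (intro borel_open open_Times) auto

text \<open>The square of \<open>v\<close> decays at rate 2 \<delta> and the growth rate of the
  weight is chosen to be \<delta>, which leaves an integrable Gaussian. The time factor is bounded
  by \<open>B powr \<alpha>\<close> on the slab.\<close>

lemma L2space_gaussian_decay:
  fixes v :: "'n::finite spacetime \<Rightarrow> real" and H :: "'n tuple"
  assumes H: "heat_tuple H" and \<alpha>: "\<alpha> \<ge> 0" and c: "0 < c"
    and v: "continuous_on UNIV v" "\<exists>C \<delta>. C > 0 \<and> \<delta> > 0 \<and> (\<forall>p. \<bar>v p\<bar> \<le> C * exp (- \<delta> * (norm (snd p))\<^sup>2))"
  shows "v \<in> L2space ({c<..<B} \<times> UNIV) (tweight \<alpha> (heat_F H))"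
proof -
  obtain \<theta> a A q where H': "H = (\<theta>, a, A, q)" by (cases H)
  obtain C \<delta> where C: "C > 0" "\<delta> > 0" "\<And>p. \<bar>v p\<bar> \<le> C * exp (- \<delta> * (norm (snd p))\<^sup>2)" using v(2) by blast
  obtain D where D: "D > 0" "\<And>p. c \<le> fst p \<Longrightarrow> fst p \<le> B \<Longrightarrow> heat_F H p \<le> D * exp (\<delta> * (norm (snd p))\<^sup>2)"
    using heat_F_bound[OF H[unfolded H'] c C(2), of B] unfolding H' by blast
  let ?w = "tweight \<alpha> (heat_F H)" and ?\<Omega> = "{c<..<B} \<times> UNIV :: 'n spacetime set"
  have bd: "?w p * (v p)\<^sup>2 \<le> (B powr \<alpha> * D * C\<^sup>2) * exp (- \<delta> * (norm (snd p))\<^sup>2)" if p: "p \<in> ?\<Omega>" for p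
  proof -
    have pQ: "p \<in> Qdom" using p c by auto
    have F0: "0 \<le> heat_F H p" using heat_F_pos[OF H[unfolded H'] pQ] H' by simp
    have "?w p = fst p powr \<alpha> * heat_F H p" by (simp add: tweight_def split_beta')
    also have "\<dots> \<le> B powr \<alpha> * (D * exp (\<delta> * (norm (snd p))\<^sup>2))"
      using p c \<alpha> D F0 by (intro mult_mono powr_mono2) auto
    finally have w: "?w p \<le> B powr \<alpha> * (D * exp (\<delta> * (norm (snd p))\<^sup>2))" .
    have "\<bar>v p\<bar>\<^sup>2 \<le> (C * exp (- \<delta> * (norm (snd p))\<^sup>2))\<^sup>2" using C(3) by (intro power_mono) auto
    then have "(v p)\<^sup>2 \<le> C\<^sup>2 * (exp (- \<delta> * (norm (snd p))\<^sup>2) * exp (- \<delta> * (norm (snd p))\<^sup>2))"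
      by (simp only: power_mult_distrib power2_abs power2_eq_square[of "exp _"])
    from mult_mono[OF w this] have "?w p * (v p)\<^sup>2 \<le> (B powr \<alpha> * (D * exp (\<delta> * (norm (snd p))\<^sup>2))) *
        (C\<^sup>2 * (exp (- \<delta> * (norm (snd p))\<^sup>2) * exp (- \<delta> * (norm (snd p))\<^sup>2)))"
      using D(1) by auto
    also have "\<dots> = (B powr \<alpha> * D * C\<^sup>2) * (exp (\<delta> * (norm (snd p))\<^sup>2) * exp (- \<delta> * (norm (snd p))\<^sup>2)) * exp (- \<delta> * (norm (snd p))\<^sup>2)"
      by (simp only: mult_ac)
    also have "exp (\<delta> * (norm (snd p))\<^sup>2) * exp (- \<delta> * (norm (snd p))\<^sup>2) = 1" by (simp add: mult_exp_exp)
    finally show ?thesis by simp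
  qed
  have "integrable (lborel \<Otimes>\<^sub>M lborel) (\<lambda>(s::real, z::real^'n). indicat_real {c<..<B} s * exp (- \<delta> * (norm z)\<^sup>2))"
    using C(2) by (intro integrable_lborel_pair_mult integrable_exp_norm_power2 integrable_real_indicator)
      (cases "c \<le> B"; simp)+
  then have "integrable lborel (\<lambda>p. (B powr \<alpha> * D * C\<^sup>2) * (case p of (s::real, z::real^'n) \<Rightarrow> indicat_real {c<..<B} s * exp (- \<delta> * (norm z)\<^sup>2)))"
    unfolding lborel_prod by (rule integrable_mult_right)
  note int = this
  have "0 \<le> (B powr \<alpha> * D * C\<^sup>2) * (case p of (s::real, z::real^'n) \<Rightarrow> indicat_real {c<..<B} s * exp (- \<delta> * (norm z)\<^sup>2))" for p
    using D(1) by (cases p) simp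
  then have fin: "(\<integral>\<^sup>+p. ennreal ((B powr \<alpha> * D * C\<^sup>2) * (case p of (s::real, z::real^'n) \<Rightarrow> indicat_real {c<..<B} s * exp (- \<delta> * (norm z)\<^sup>2))) \<partial>lborel) < \<infinity>"
    by (subst nn_integral_eq_integral[OF int AE_I2]) auto
  have "(\<integral>\<^sup>+x\<in>?\<Omega>. ennreal (?w x * (norm (v x))\<^sup>2) \<partial>lborel) \<le>
      (\<integral>\<^sup>+p. ennreal ((B powr \<alpha> * D * C\<^sup>2) * (case p of (s::real, z::real^'n) \<Rightarrow> indicat_real {c<..<B} s * exp (- \<delta> * (norm z)\<^sup>2))) \<partial>lborel)"
  proof (rule nn_integral_mono)
    fix p :: "'n spacetime"
    show "ennreal (?w p * (norm (v p))\<^sup>2) * indicator ?\<Omega> p \<le>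
      ennreal ((B powr \<alpha> * D * C\<^sup>2) * (case p of (s::real, z::real^'n) \<Rightarrow> indicat_real {c<..<B} s * exp (- \<delta> * (norm z)\<^sup>2)))"
      using bd[of p] by (cases p) (auto simp: indicator_def ennreal_leI)
  qed
  then have "L2norm ?\<Omega> ?w v < \<infinity>"
    using fin le_less_trans by (auto simp: L2norm_def ennsqrt_less_top_iff)
  moreover have "set_borel_measurable lborel ?\<Omega> v"
    unfolding set_borel_measurable_def using borel_measurable_continuous_onI[OF v(1)]
    by (intro borel_measurable_scaleR borel_measurable_indicator) (auto simp: slab_borel)
  ultimately show ?thesis by (simp add: L2space_def)
qed

lemma L2space_vec:
  fixes f :: "'x::euclidean_space \<Rightarrow> 'b::euclidean_space^'n::finite"
  assumes f: "\<And>i. (\<lambda>x. f x $ i) \<in> L2space \<Omega> w" and \<Omega>: "\<Omega> \<in> sets borel"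
    and w: "\<And>x. x \<in> \<Omega> \<Longrightarrow> 0 \<le> w x" "(\<lambda>x. indicat_real \<Omega> x * w x) \<in> borel_measurable borel"
  shows "f \<in> L2space \<Omega> w"
proof -
  have m [measurable]: "(\<lambda>x. indicat_real \<Omega> x *\<^sub>R f x $ i) \<in> borel_measurable borel" for i
    using f[of i] by (simp add: L2space_def set_borel_measurable_def)
  have e: "(\<lambda>x. indicat_real \<Omega> x *\<^sub>R f x) = (\<lambda>x. \<Sum>i\<in>UNIV. axis i (indicat_real \<Omega> x *\<^sub>R f x $ i))"
  proof
    fix x
    show "indicat_real \<Omega> x *\<^sub>R f x = (\<Sum>i\<in>UNIV. axis i (indicat_real \<Omega> x *\<^sub>R f x $ i))"
      by (simp add: vec_eq_iff axis_def if_distrib[of "\<lambda>v. v $ _"])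
  qed
  have ax: "bounded_linear (axis i :: 'b \<Rightarrow> 'b^'n)" for i
    unfolding linear_conv_bounded_linear[symmetric] by (rule linearI) (auto simp: axis_def vec_eq_iff)
  have fm: "set_borel_measurable lborel \<Omega> f"
    unfolding set_borel_measurable_def e
    by (intro borel_measurable_sum) (use borel_measurable_continuous_onI[OF linear_continuous_on[OF ax]] in measurable)
  have im: "(\<lambda>x. indicat_real \<Omega> x * (w x * (norm (f x $ i))\<^sup>2)) \<in> borel_measurable borel" for i
  proof -
    have "(\<lambda>x. (indicat_real \<Omega> x * w x) * (norm (indicat_real \<Omega> x *\<^sub>R f x $ i))\<^sup>2) \<in> borel_measurable borel"
      using w(2) by measurable
    moreover have "(\<lambda>x. (indicat_real \<Omega> x * w x) * (norm (indicat_real \<Omega> x *\<^sub>R f x $ i))\<^sup>2) = (\<lambda>x. indicat_real \<Omega> x * (w x * (norm (f x $ i))\<^sup>2))"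
      by (auto simp: indicator_def)
    ultimately show ?thesis by simp
  qed
  have "(\<integral>\<^sup>+x\<in>\<Omega>. ennreal (w x * (norm (f x))\<^sup>2) \<partial>lborel) =
      (\<integral>\<^sup>+x. (\<Sum>i\<in>UNIV. ennreal (indicat_real \<Omega> x * (w x * (norm (f x $ i))\<^sup>2))) \<partial>lborel)"
  proof (rule nn_integral_cong)
    fix x
    have "(norm (f x))\<^sup>2 = (\<Sum>i\<in>UNIV. (norm (f x $ i))\<^sup>2)"
      by (simp add: norm_vec_def L2_set_def sum_nonneg)
    then show "ennreal (w x * (norm (f x))\<^sup>2) * indicator \<Omega> x = (\<Sum>i\<in>UNIV. ennreal (indicat_real \<Omega> x * (w x * (norm (f x $ i))\<^sup>2)))"
      using w(1)[of x] by (cases "x \<in> \<Omega>") (auto simp: sum_distrib_left sum_ennreal)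
  qed
  also have "\<dots> = (\<Sum>i\<in>UNIV. \<integral>\<^sup>+x. ennreal (indicat_real \<Omega> x * (w x * (norm (f x $ i))\<^sup>2)) \<partial>lborel)"
    using im by (intro nn_integral_sum) auto
  also have "\<dots> < \<infinity>"
  proof -
    have "(\<integral>\<^sup>+x. ennreal (indicat_real \<Omega> x * (w x * (norm (f x $ i))\<^sup>2)) \<partial>lborel) < \<infinity>" for i
    proof -
      have "(\<integral>\<^sup>+x. ennreal (indicat_real \<Omega> x * (w x * (norm (f x $ i))\<^sup>2)) \<partial>lborel) = (\<integral>\<^sup>+x\<in>\<Omega>. ennreal (w x * (norm (f x $ i))\<^sup>2) \<partial>lborel)"
        by (intro nn_integral_cong) (auto simp: indicator_def)
      then show ?thesis using f[of i] by (simp add: L2space_def L2norm_def ennsqrt_less_top_iff)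
    qed
    then show ?thesis by simp
  qed
  finally show ?thesis using fm by (simp add: L2space_def L2norm_def ennsqrt_less_top_iff)
qed

lemma slab_in_Qdom: "0 \<le> c \<Longrightarrow> {c<..<B} \<times> UNIV \<subseteq> (Qdom :: 'n::finite spacetime set)"
  by auto

lemma tweight_slab_measurable:
  fixes H :: "'n::finite tuple"
  assumes H: "heat_tuple H" and c: "0 \<le> c"
  shows "(\<lambda>x. indicat_real ({c<..<B} \<times> UNIV) x * tweight \<alpha> (heat_F H) x) \<in> borel_measurable borel"
  using borel_measurable_continuous_on_indicator[OF slab_borel
      continuous_on_subset[OF smooth_on_continuous[OF tweight_smooth_on[OF H]] slab_in_Qdom[OF c]]] by simp

lemma frob_inner_sum: "frob_inner C D = (\<Sum>i\<in>UNIV. \<Sum>j\<in>UNIV. C $ i $ j * D $ i $ j)"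
  unfolding frob_inner_def trace_def matrix_matrix_mult_def transpose_def
  by simp (rule sum.swap)

lemma kconv_heat_adj:
  assumes A: "posdef A" and f: "f \<in> test_functions \<Omega>"
  shows "kconv (hk_st A B) (heat_adj A f) p = kconv (hk_st A B) (dderiv e_time f) p + frob_inner A (hess_potential A B f p)"
proof -
  note k = hk_st_integrable[OF A]
  note i1 = kconv_integrable_test[OF k test_functions_dderiv[OF f, of e_time], where p=p]
  note i2 = kconv_integrable_test[OF k test_functions_dderiv[OF test_functions_dderiv[OF f]]]
  have "kconv (hk_st A B) (heat_adj A f) p = (LBINT r. hk_st A B r * dderiv e_time f (p + r) +
      (\<Sum>i\<in>UNIV. \<Sum>j\<in>UNIV. A $ i $ j * (hk_st A B r * dderiv2 i j f (p + r))))"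
    unfolding kconv_def heat_adj_def
    by (rule Bochner_Integration.integral_cong[OF refl]) (simp add: distrib_left sum_distrib_left mult_ac)
  then show ?thesis
    using i1 i2 by (simp add: integral_finite_sum
        frob_inner_sum hess_potential_def kconv_def)
qed

theorem potential_in_W0:
  fixes A :: "'n::finite mat" and H :: "'n tuple"
  assumes H: "heat_tuple H" and A: "posdef A" and \<alpha>: "\<alpha> \<ge> 0" and c: "0 < c" "c < B"
    and f: "f \<in> test_functions UNIV" and fB: "\<And>s z. s \<ge> B \<Longrightarrow> f (s, z) = 0"
  shows "(kconv (hk_st A B) f, kconv (hk_st A B) (dderiv e_time f), \<lambda>p. \<chi> i. kconv (hk_st A B) (dderiv (e_space i) f) p,
    hess_potential A B f) \<in> W0 \<alpha> c B (heat_F H)"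
proof -
  let ?k = "hk_st A B" and ?\<Omega> = "{c<..<B} \<times> UNIV :: 'n spacetime set" and ?w = "tweight \<alpha> (heat_F H)"
  have B: "B > 0" using c by simp
  note k = hk_st_integrable[OF A, of B]
  note d = test_functions_dderiv[OF f]
  note dd = test_functions_dderiv[OF d]
  have sm: "smooth_on UNIV (kconv ?k h)" if "h \<in> test_functions UNIV" for h
    by (rule smooth_on_kconv[OF k that])
  have wd: "weak_deriv ?\<Omega> e (kconv ?k h) (kconv ?k (dderiv e h))" if "h \<in> test_functions UNIV" for h e
    using weak_deriv_smooth[OF sm[OF that], of ?\<Omega> e] by (simp add: kconv_dderiv[OF k that])
  have L2: "kconv ?k h \<in> L2space ?\<Omega> ?w" if "h \<in> test_functions UNIV" for h
    by (rule L2space_gaussian_decay[OF H \<alpha> c(1) smooth_on_continuous[OF sm[OF that]] kconv_gaussian_decay[OF A B that]])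
  have w0: "0 \<le> ?w x" if "x \<in> ?\<Omega>" for x
    using tweight_pos[OF H, of x] that c(1) by (auto intro: less_imp_le)
  note wm = tweight_slab_measurable[OF H less_imp_le[OF c(1)], of B]
  have L2v: "(\<lambda>p. \<chi> i. kconv ?k (dderiv (e_space i) f) p) \<in> L2space ?\<Omega> ?w"
    by (rule L2space_vec[OF _ slab_borel w0 wm]) (simp add: L2[OF d])
  have L2m: "hess_potential A B f \<in> L2space ?\<Omega> ?w"
    by (rule L2space_vec[OF L2space_vec[OF _ slab_borel w0 wm] slab_borel w0 wm])
      (simp add: hess_potential_def L2[OF dd])
  have zero: "kconv ?k f (B, z) = 0" for z
  proof -
    have "?k r * f ((B, z) + r) = 0" for r
      using fB[of "B + fst r" "z + snd r"] by (cases r) (auto simp: hk_st_def)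
    note kz = this
    show ?thesis unfolding kconv_def kz by simp
  qed
  \<comment> \<open>The potential is smooth across s = B and vanishes there, since it looks only
    into the future, where \<open>f\<close> is zero. The constant sequence thus witnesses the trace
    condition.\<close>
  have trace: "has_H1loc_trace c B (kconv ?k f) (kconv ?k (dderiv e_time f)) (\<lambda>p. \<chi> i. kconv ?k (dderiv (e_space i) f) p) (\<lambda>_. 0)"
    unfolding has_H1loc_trace_def Let_def
    by (intro ballI allI impI exI[of _ "\<lambda>_. kconv ?k f"])
      (simp add: smooth_iff_smooth_on sm[OF f] kconv_dderiv[OF k f] zero L2norm_one_eq_nrm)
  show ?thesis
    unfolding W0_def Let_def mem_Collect_eq split_conv
    using wd[OF f] wd[OF d] L2[OF f] L2[OF d] L2v L2m trace
    by (simp add: hess_potential_def)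
qed

lemma hess_potential_zero:
  fixes A :: "'n::finite mat"
  assumes "\<And>s z. s \<ge> B \<Longrightarrow> f (s, z) = 0" "fst p \<ge> B"
  shows "hess_potential A B f p = 0"
proof -
  have o: "open {q::'n spacetime. fst q > B}" by (intro open_Collect_less continuous_intros)
  have fz: "f q = 0" if "fst q \<ge> B" for q using assms(1)[of "fst q" "snd q"] that by simp
  have d: "dderiv (e_space j) f q = 0" if "fst q > B" for j q
    using that fz by (intro dderiv_zero_open[OF o]) auto
  have dd: "dderiv2 i j f q = 0" if "fst q > B" for i j q
    using that d by (rule_tac dderiv_zero_open[OF o]) auto
  have "hk_st A B r * dderiv2 i j f (p + r) = 0" for r i j
    using dd[of "p + r" i j] assms(2) by (cases r) (auto simp: hk_st_def)
  note kz = this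
  show ?thesis unfolding hess_potential_def kconv_def kz by (simp add: vec_eq_iff)
qed

text \<open>On each slab (c, B) the potential of the unweighted \<open>g\<close> competes in
  \<open>k_const\<close>, with P_A of it equal to the unweighted \<open>g\<close> and the operator
  image as weighted Hessian. Letting c tend to 0 with Fatou's lemma covers all times below
  \<open>B\<close>; after \<open>B\<close> the image is zero.\<close>

theorem heat_op_bound:
  fixes H :: "'n::finite tuple"
  assumes H: "heat_tuple H" and \<alpha>: "\<alpha> \<ge> 0" and g: "g \<in> test_functions Qdom"
    and fin: "heat_const \<alpha> H < \<infinity>"
  shows "nrm (\<lambda>p. indicat_real Qdom p *\<^sub>R heat_op \<alpha> H g p) \<le> heat_const \<alpha> H * nrm g"
proof -
  obtain \<theta> a A q where H': "H = (\<theta>, a, A, q)" by (cases H)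
  note H2 = H[unfolded H']
  have A: "posdef A" using H2 by (simp add: heat_tuple_def)
  let ?w = "tweight \<alpha> (heat_F H)" and ?R = "matrix_sqrt q" and ?T = "heat_op \<alpha> H g"
  obtain B where B0: "B > 0" and gB: "\<forall>s z. s \<ge> B \<longrightarrow> g (s, z) = 0" by (rule test_function_time_bound[OF g]) (rule that)
  define f where "f = unweight \<alpha> H g"
  have f: "f \<in> test_functions UNIV"
    unfolding f_def by (rule test_functions_mono[OF _ unweight_test_function[OF H g]]) simp
  have fB: "f (s, z) = 0" if "s \<ge> B" for s z using gB that by (simp add: f_def unweight_def)
  have T: "?T p = sqrt (?w p) *\<^sub>R (?R ** hess_potential A B f p ** ?R)" if "p \<in> Qdom" for p
    using heat_op_test_function[OF H2 g gB[rule_format] that] by (simp add: H' f_def)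
  have slab: "nrm (\<lambda>p. indicat_real ({c<..<B} \<times> UNIV) p *\<^sub>R ?T p) \<le> heat_const \<alpha> H * nrm g" if c: "0 < c" "c < B" for c
  proof -
    let ?\<Omega> = "{c<..<B} \<times> UNIV :: 'n spacetime set"
    have w0: "0 \<le> ?w x" if "x \<in> ?\<Omega>" for x
      using tweight_pos[OF H, of x] that c(1) by (auto intro: less_imp_le)
    let ?us = "kconv (hk_st A B) (dderiv e_time f)" and ?D = "hess_potential A B f"
    have res: "- ?us p - frob_inner A (?D p) = f p" if "p \<in> ?\<Omega>" for p
    proof -
      have "kconv (hk_st A B) (heat_adj A f) p = - f p"
        using that c by (intro heat_potential_identity[OF A f B0 fB]) auto
      then show ?thesis using kconv_heat_adj[OF A f, of B p] by simp
    qed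
    have n2: "L2norm ?\<Omega> ?w (\<lambda>p. - ?us p - frob_inner A (?D p)) \<le> nrm g"
    proof (subst L2norm_eq_nrm, erule w0, rule nrm_mono)
      fix p
      show "norm (indicat_real ?\<Omega> p *\<^sub>R (sqrt (?w p) *\<^sub>R (- ?us p - frob_inner A (?D p)))) \<le> norm (g p)"
      proof (cases "p \<in> ?\<Omega>")
        case True
        then have "p \<in> Qdom" using c(1) by auto
        then have "sqrt (?w p) * f p = g p"
          using tweight_pos[OF H, of p \<alpha>] by (simp add: f_def unweight_def)
        then show ?thesis using True res[OF True] by simp
      qed simp
    qed
    have "L2norm ?\<Omega> ?w (\<lambda>p. ?R ** ?D p ** ?R) / L2norm ?\<Omega> ?w (\<lambda>p. - ?us p - frob_inner A (?D p)) \<le> k_const \<alpha> c B (heat_F H) A q"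
      unfolding k_const_def
      by (rule SUP_upper2[OF potential_in_W0[OF H A \<alpha> c f fB]]) auto
    also have "\<dots> \<le> heat_const \<alpha> H"
      unfolding heat_const_def H' split_conv using c
      by (intro SUP_upper2[of "(c, B)"]) auto
    finally have "L2norm ?\<Omega> ?w (\<lambda>p. ?R ** ?D p ** ?R) \<le> heat_const \<alpha> H * L2norm ?\<Omega> ?w (\<lambda>p. - ?us p - frob_inner A (?D p))"
      by (rule ennreal_divide_leD[OF _ le_less_trans[OF n2 nrm_test_function_finite[OF g]] fin])
    also have "\<dots> \<le> heat_const \<alpha> H * nrm g" by (intro mult_left_mono n2) simp
    also have "L2norm ?\<Omega> ?w (\<lambda>p. ?R ** ?D p ** ?R) = nrm (\<lambda>p. indicat_real ?\<Omega> p *\<^sub>R ?T p)"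
    proof (subst L2norm_eq_nrm, erule w0, rule nrm_cong_norm)
      fix p
      show "norm (indicat_real ?\<Omega> p *\<^sub>R (sqrt (?w p) *\<^sub>R (?R ** ?D p ** ?R))) = norm (indicat_real ?\<Omega> p *\<^sub>R ?T p)"
        using T[of p] c(1) by (cases "p \<in> ?\<Omega>") auto
    qed
    finally show ?thesis .
  qed
  define e where "e n = B / (real n + 2)" for n
  have e: "0 < e n" "e n < B" for n using B0 by (auto simp: e_def field_simps add_pos_nonneg)
  have e0: "e \<longlonglongrightarrow> 0" unfolding e_def by real_asymp
  show ?thesis
  proof (rule nrm_liminf[where f="\<lambda>n p. indicat_real ({e n<..<B} \<times> UNIV) p *\<^sub>R ?T p" and N=0])
    have m: "(\<lambda>p. indicat_real Qdom p *\<^sub>R ?T p) \<in> borel_measurable borel"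
      unfolding H' by (rule heat_op_measurable[OF H2 g])
    show "(\<lambda>p. indicat_real ({e n<..<B} \<times> UNIV) p *\<^sub>R ?T p) \<in> borel_measurable borel" for n
    proof -
      have "(\<lambda>p. indicat_real ({e n<..<B} \<times> UNIV) p *\<^sub>R (indicat_real Qdom p *\<^sub>R ?T p)) \<in> borel_measurable borel"
        by (intro borel_measurable_scaleR m borel_measurable_indicator slab_borel)
      moreover have "indicat_real ({e n<..<B} \<times> UNIV) p *\<^sub>R (indicat_real Qdom p *\<^sub>R ?T p) = indicat_real ({e n<..<B} \<times> UNIV) p *\<^sub>R ?T p" for p
        using e(1)[of n] by (auto simp: indicator_def)
      ultimately show ?thesis by (simp only:)
    qed
    show "nrm (\<lambda>p. indicat_real ({e n<..<B} \<times> UNIV) p *\<^sub>R ?T p) \<le> heat_const \<alpha> H * nrm g" for n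
      by (rule slab[OF e])
    show "AE p in lborel. (\<lambda>n. indicat_real ({e n<..<B} \<times> UNIV) p *\<^sub>R ?T p) \<longlonglongrightarrow> indicat_real Qdom p *\<^sub>R ?T p"
    proof (intro AE_I2)
      fix p :: "'n spacetime"
      consider "fst p \<le> 0" | "0 < fst p" "fst p < B" | "0 < fst p" "fst p \<ge> B" by linarith
      then show "(\<lambda>n. indicat_real ({e n<..<B} \<times> UNIV) p *\<^sub>R ?T p) \<longlonglongrightarrow> indicat_real Qdom p *\<^sub>R ?T p"
      proof cases
        case 1
        then have "indicat_real ({e n<..<B} \<times> UNIV) p = 0" for n using e(1)[of n] by (auto simp: indicator_def)
        moreover have "indicat_real Qdom p = 0" using 1 by (auto simp: indicator_def)
        ultimately show ?thesis by simp
      next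
        case 2
        have "\<forall>\<^sub>F n in sequentially. e n < fst p" using order_tendstoD(2)[OF e0 2(1)] .
        then have "\<forall>\<^sub>F n in sequentially. indicat_real ({e n<..<B} \<times> UNIV) p *\<^sub>R ?T p = indicat_real Qdom p *\<^sub>R ?T p"
          by eventually_elim (use 2 in \<open>cases p; auto simp: indicator_def\<close>)
        then show ?thesis by (rule tendsto_eventually)
      next
        case 3
        then have pQ: "p \<in> Qdom" by (cases p) auto
        have "?T p = 0"
          using T[OF pQ] hess_potential_zero[of B f p A, OF fB 3(2)] by (simp add: linear_0[OF bounded_linear.linear[OF bounded_linear_sandwich]])
        then show ?thesis by simp
      qed
    qed
  qed
qed

theorem op_norm_le_heat_const:
  fixes H :: "'n::finite tuple"
  assumes H: "heat_tuple H" and \<alpha>: "\<alpha> \<ge> 0"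
  shows "op_norm (heat_op \<alpha> H) \<le> heat_const \<alpha> H"
proof (cases "heat_const \<alpha> H < \<infinity>")
  case True
  obtain \<theta> a A q where H': "H = (\<theta>, a, A, q)" by (cases H)
  note H2 = H[unfolded H']
  have "\<exists>E. bounded_extension (heat_op \<alpha> H) E \<and> L2_op_norm E \<le> heat_const \<alpha> H"
    by (rule bounded_extension_exists[OF _ _ heat_op_bound[OF H \<alpha> _ True] True])
      (use heat_op_measurable[OF H2] heat_op_linear[OF H2] in \<open>auto simp: H'\<close>)
  then show ?thesis unfolding op_norm_def by (metis (mono_tags, lifting) INF_lower2 mem_Collect_eq)
next
  case False
  then have "heat_const \<alpha> H = \<infinity>" by (simp add: not_less top_unique)
  then show ?thesis by simp
qed

lemma L2space_indicator_measurable: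
  "f \<in> L2space \<Omega> w \<Longrightarrow> (\<lambda>x. indicat_real \<Omega> x *\<^sub>R f x) \<in> borel_measurable borel"
  by (simp add: L2space_def set_borel_measurable_def)

subsection \<open>Lower bound\<close>

locale W0_element =
  fixes \<theta> :: "(real^'n::finite) measure" and a A q :: "'n mat" and \<alpha> c B :: real
    and u us :: "'n spacetime \<Rightarrow> real" and Du :: "'n spacetime \<Rightarrow> real^'n" and D2u :: "'n spacetime \<Rightarrow> 'n mat"
  assumes heat: "heat_tuple (\<theta>, a, A, q)"
    and c: "0 < c" "c < B"
    and W0: "(u, us, Du, D2u) \<in> W0 \<alpha> c B (heat_F (\<theta>, a, A, q))"
begin

abbreviation w :: "'n spacetime \<Rightarrow> real" where "w \<equiv> tweight \<alpha> (heat_F (\<theta>, a, A, q))"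
abbreviation slab :: "'n spacetime set" where "slab \<equiv> {c<..<B} \<times> UNIV"
text \<open>The functions tested against are products with forward potentials and need not vanish
  near s = B. Integration by parts is therefore required for test functions on this larger set, not
  only on the slab.\<close>

abbreviation upper :: "'n spacetime set" where "upper \<equiv> {c<..} \<times> UNIV"

lemma A_posdef: "posdef A"
  using heat by (simp add: heat_tuple_def)

lemma w_pos: "p \<in> slab \<Longrightarrow> 0 < w p"
  using tweight_pos[OF heat, of p] c by auto

lemma upper_Qdom: "upper \<subseteq> Qdom" and slab_upper: "slab \<subseteq> upper"
  using c by auto

lemma weak_derivs:
  "weak_deriv slab (e_space i) u (\<lambda>p. Du p $ i)"
  "weak_deriv slab (e_space i) (\<lambda>p. Du p $ j) (\<lambda>p. D2u p $ i $ j)"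
  using W0 by (auto simp: W0_def Let_def)

lemma in_L2: "u \<in> L2space slab w" "us \<in> L2space slab w" "Du \<in> L2space slab w" "D2u \<in> L2space slab w"
  using W0 by (auto simp: W0_def Let_def)

lemma trace_zero: "has_H1loc_trace c B u us Du (\<lambda>_. 0)"
  using W0 by (auto simp: W0_def Let_def)

lemma in_L2_component:
  "(\<lambda>p. Du p $ i) \<in> L2space slab w" "(\<lambda>p. D2u p $ i $ j) \<in> L2space slab w"
proof -
  have m: "(\<lambda>p. (indicat_real slab p *\<^sub>R Du p) $ i) \<in> borel_measurable borel"
    "(\<lambda>p. (indicat_real slab p *\<^sub>R D2u p) $ i $ j) \<in> borel_measurable borel"
  proof -
    have "(\<lambda>v. v $ i) \<in> borel_measurable (borel :: (real^'n) measure)" "(\<lambda>M. M $ i $ j) \<in> borel_measurable (borel :: 'n mat measure)"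
      by (auto intro!: borel_measurable_continuous_onI continuous_intros)
    then show "(\<lambda>p. (indicat_real slab p *\<^sub>R Du p) $ i) \<in> borel_measurable borel"
      "(\<lambda>p. (indicat_real slab p *\<^sub>R D2u p) $ i $ j) \<in> borel_measurable borel"
      using measurable_compose[OF L2space_indicator_measurable[OF in_L2(3)]]
        measurable_compose[OF L2space_indicator_measurable[OF in_L2(4)]] by blast+
  qed
  have le: "norm (Du p $ i) \<le> norm (Du p)" "norm (D2u p $ i $ j) \<le> norm (D2u p)" for p
    using Finite_Cartesian_Product.norm_nth_le[of "Du p" i] order_trans[OF Finite_Cartesian_Product.norm_nth_le Finite_Cartesian_Product.norm_nth_le]
    by blast+
  have fin: "L2norm slab w f < \<infinity>" if "L2norm slab w g < \<infinity>" "\<And>p. norm (f p) \<le> norm (g p)"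
    for f :: "'n spacetime \<Rightarrow> real" and g :: "'n spacetime \<Rightarrow> 'b::real_normed_vector"
  proof (rule le_less_trans[OF _ that(1)])
    show "L2norm slab w f \<le> L2norm slab w g"
      unfolding L2norm_def ennsqrt_le_iff
    proof (rule nn_integral_mono)
      fix p
      show "ennreal (w p * (norm (f p))\<^sup>2) * indicator slab p \<le> ennreal (w p * (norm (g p))\<^sup>2) * indicator slab p"
      proof (cases "p \<in> slab")
        case True
        show ?thesis
          using ennreal_leI[OF mult_left_mono[OF power_mono[OF that(2)[of p] norm_ge_zero, of 2] less_imp_le[OF w_pos[OF True]]]]
          by (simp only: indicator_simps(1)[OF True] mult_1_right)
      qed simp
    qed
  qed
  show "(\<lambda>p. Du p $ i) \<in> L2space slab w" "(\<lambda>p. D2u p $ i $ j) \<in> L2space slab w"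
    using m fin[OF _ le(1)] fin[OF _ le(2)] in_L2(3,4) by (auto simp: L2space_def set_borel_measurable_def)
qed

lemma weighted:
  fixes U :: "'n spacetime \<Rightarrow> real"
  assumes "U \<in> L2space slab w"
  shows "(\<lambda>p. indicat_real slab p * (sqrt (w p) * U p)) \<in> borel_measurable borel"
    and "nrm (\<lambda>p. indicat_real slab p * (sqrt (w p) * U p)) < \<infinity>"
proof -
  have "(\<lambda>p. indicat_real slab p *\<^sub>R sqrt (w p)) \<in> borel_measurable borel"
    by (intro borel_measurable_continuous_on_indicator slab_borel
        continuous_on_subset[OF smooth_on_continuous[OF smooth_on_sqrt_weight(1)[OF heat]]])
      (use c in auto)
  from borel_measurable_times[OF this L2space_indicator_measurable[OF assms]]
  have "(\<lambda>p. indicat_real slab p *\<^sub>R sqrt (w p) * (indicat_real slab p *\<^sub>R U p)) \<in> borel_measurable borel" .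
  moreover have "indicat_real slab p *\<^sub>R sqrt (w p) * (indicat_real slab p *\<^sub>R U p) = indicat_real slab p * (sqrt (w p) * U p)" for p
    by (simp add: indicator_def)
  ultimately show "(\<lambda>p. indicat_real slab p * (sqrt (w p) * U p)) \<in> borel_measurable borel" by (simp only:)
  have "L2norm slab w U = nrm (\<lambda>p. indicat_real slab p *\<^sub>R (sqrt (w p) *\<^sub>R U p))"
    by (rule L2norm_eq_nrm) (use w_pos in \<open>auto intro: less_imp_le\<close>)
  then show "nrm (\<lambda>p. indicat_real slab p * (sqrt (w p) * U p)) < \<infinity>"
    using assms by (simp add: L2space_def)
qed

text \<open>Cauchy-Schwarz after the square root of the weight has been moved from one factor to the
  other; \<open>h\<close> divided by it is still a test function.\<close>

lemma slab_integrable: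
  fixes U h :: "'n spacetime \<Rightarrow> real"
  assumes U: "U \<in> L2space slab w" and h: "h \<in> test_functions Qdom"
  shows "integrable lborel (\<lambda>p. indicat_real slab p * (U p * h p))"
proof -
  have t: "unweight \<alpha> (\<theta>, a, A, q) h \<in> test_functions Qdom" by (rule unweight_test_function[OF heat h])
  have "integrable lborel (\<lambda>p. (indicat_real slab p * (sqrt (w p) * U p)) * unweight \<alpha> (\<theta>, a, A, q) h p)"
    by (rule nrm_integrable_mult(1)[OF weighted(1)[OF U] test_functions_measurable[OF t] weighted(2)[OF U] nrm_test_function_finite[OF t]])
  moreover have "(indicat_real slab p * (sqrt (w p) * U p)) * unweight \<alpha> (\<theta>, a, A, q) h p = indicat_real slab p * (U p * h p)" for p
    using w_pos[of p] by (cases "p \<in> slab") (auto simp: unweight_def)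
  ultimately show ?thesis by (simp only:)
qed

lemma upper_test: "h \<in> test_functions upper \<Longrightarrow> h \<in> test_functions Qdom"
  by (rule test_functions_mono[OF upper_Qdom])

text \<open>For space derivatives the trace plays no part: a cutoff depending on time alone commutes
  with them, moves the support of \<eta> into the slab, and disappears in the limit by dominated
  convergence.\<close>

lemma space_integration_by_parts:
  assumes wd: "weak_deriv slab (e_space i) U V" and U: "U \<in> L2space slab w" and V: "V \<in> L2space slab w"
    and \<eta>: "\<eta> \<in> test_functions upper"
  shows "(LBINT p. indicat_real slab p * (U p * dderiv (e_space i) \<eta> p)) =
    - (LBINT p. indicat_real slab p * (V p * \<eta> p))"
proof -
  \<comment> \<open>The argument of the step is 3 - n (B - s), so \<kappa> is 1 when n (B - s) >= 2
    and 0 when n (B - s) <= 1.\<close>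
  define \<kappa> where "\<kappa> n p = smooth_step ((3 - B * real n) + (real n * fst p))" for n and p :: "'n spacetime"
  have blin: "bounded_linear (\<lambda>p::'n spacetime. real n * fst p)" for n
    using bounded_linear_const_mult[OF bounded_linear_fst] .
  have \<kappa>s: "smooth_on UNIV (\<kappa> n)" for n
    unfolding \<kappa>_def[abs_def] by (rule smooth_on_compose_affine[OF open_UNIV blin _ smooth_on_smooth_step]) simp
  have \<kappa>d: "dderiv (e_space i) (\<kappa> n) p = 0" for n p
  proof -
    have "smooth_step differentiable at x" for x using smooth_on_differentiable[OF smooth_on_smooth_step] by simp
    note d = this
    have "dderiv (e_space i) (\<kappa> n) p = dderiv 0 smooth_step ((3 - B * real n) + real n * fst p)"
      unfolding \<kappa>_def[abs_def] using dderiv_eq[OF dderiv_compose_affine[OF blin d], where e="e_space i"] by simp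
    then show ?thesis using linear_0[OF dderiv_linear[OF d]] by simp
  qed
  have \<kappa>1: "\<bar>\<kappa> n p\<bar> \<le> 1" for n p by (simp add: \<kappa>_def abs_of_nonneg smooth_step_bounds)
  have \<kappa>lim: "(\<lambda>n. \<kappa> n p) \<longlonglongrightarrow> 1" if "p \<in> slab" for p
  proof (rule tendsto_eventually)
    have "B - fst p > 0" using that by auto
    then have "\<forall>\<^sub>F n in sequentially. 2 / (B - fst p) \<le> real n"
      using filterlim_real_sequentially by (simp add: filterlim_at_top)
    then show "\<forall>\<^sub>F n in sequentially. \<kappa> n p = 1"
    proof eventually_elim
      fix n assume "2 / (B - fst p) \<le> real n"
      then have "2 \<le> real n * (B - fst p)" using \<open>B - fst p > 0\<close> by (simp add: pos_divide_le_eq)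
      then show "\<kappa> n p = 1" unfolding \<kappa>_def by (intro smooth_step_1) (simp add: algebra_simps)
    qed
  qed
  obtain C where C: "compact C" "C \<subseteq> upper" "\<And>x. x \<notin> C \<Longrightarrow> \<eta> x = 0" "smooth_on UNIV \<eta>"
    using \<eta> by (metis test_functionsE)
  have t: "(\<lambda>p. \<kappa> n p * \<eta> p) \<in> test_functions slab" if n: "n > 0" for n
  proof (rule test_functionsI)
    show "smooth_on UNIV (\<lambda>p. \<kappa> n p * \<eta> p)" by (intro smooth_on_mult \<kappa>s C) simp
    have "closed ({..B - 1 / real n} \<times> (UNIV :: (real^'n) set))" by (intro closed_Times) auto
    then show "compact (C \<inter> ({..B - 1 / real n} \<times> UNIV))" by (intro compact_Int_closed C)
    have "1 / real n > 0" using n by simp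
    show "C \<inter> ({..B - 1 / real n} \<times> UNIV) \<subseteq> slab"
    proof
      fix p assume "p \<in> C \<inter> ({..B - 1 / real n} \<times> UNIV)"
      then have "p \<in> upper" "fst p \<le> B - 1 / real n" using C(2) by auto
      then have "fst p < B" "c < fst p" using \<open>1 / real n > 0\<close> by (linarith, auto)
      then show "p \<in> slab" by (cases p) auto
    qed
    fix p assume p: "p \<notin> C \<inter> ({..B - 1 / real n} \<times> UNIV)"
    show "\<kappa> n p * \<eta> p = 0"
    proof (cases "p \<in> C")
      case True
      then have "fst p > B - 1 / real n" using p by (cases p) auto
      then have "real n * fst p > real n * (B - 1 / real n)" using n by (intro mult_strict_left_mono) auto
      then have "\<kappa> n p = 0" unfolding \<kappa>_def using n by (intro smooth_step_0) (simp add: algebra_simps)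
      then show ?thesis by simp
    qed (simp add: C(3))
  qed
  have eq: "(LBINT p. indicat_real slab p * (U p * (\<kappa> n p * dderiv (e_space i) \<eta> p))) =
      - (LBINT p. indicat_real slab p * (V p * (\<kappa> n p * \<eta> p)))" if "n > 0" for n
  proof -
    have "dderiv (e_space i) (\<lambda>p. \<kappa> n p * \<eta> p) p = \<kappa> n p * dderiv (e_space i) \<eta> p" for p
      by (subst dderiv_mult) (auto simp: \<kappa>d intro: smooth_on_differentiable[OF \<kappa>s] smooth_on_differentiable[OF C(4)])
    moreover have "(LBINT p. indicat_real slab p *\<^sub>R (U p * dderiv (e_space i) (\<lambda>p. \<kappa> n p * \<eta> p) p)) =
        - (LBINT p. indicat_real slab p *\<^sub>R (V p * (\<kappa> n p * \<eta> p)))"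
      using wd t[OF that] unfolding weak_deriv_def set_lebesgue_integral_def by blast
    ultimately show ?thesis by (simp only: real_scaleR_def)
  qed
  have lim: "(\<lambda>n. LBINT p. indicat_real slab p * (G p * (\<kappa> n p * h p))) \<longlonglongrightarrow> (LBINT p. indicat_real slab p * (G p * h p))"
    if G: "G \<in> L2space slab w" and h: "h \<in> test_functions Qdom" for G h
  proof (rule integral_dominated_convergence[where w="\<lambda>p. norm (indicat_real slab p * (G p * h p))"])
    note int = slab_integrable[OF G h]
    show "(\<lambda>p. indicat_real slab p * (G p * h p)) \<in> borel_measurable lborel" using int by auto
    show "integrable lborel (\<lambda>p. norm (indicat_real slab p * (G p * h p)))" using int by (rule integrable_norm)
    have e: "indicat_real slab p * (G p * (\<kappa> n p * h p)) = \<kappa> n p * (indicat_real slab p * (G p * h p))" for n p by simp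
    show "(\<lambda>p. indicat_real slab p * (G p * (\<kappa> n p * h p))) \<in> borel_measurable lborel" for n
    proof -
      have "\<kappa> n \<in> borel_measurable lborel"
        using borel_measurable_continuous_onI[OF smooth_on_continuous[OF \<kappa>s[of n]]] by simp
      from borel_measurable_times[OF this borel_measurable_integrable[OF int]] show ?thesis unfolding e .
    qed
    show "AE p in lborel. norm (indicat_real slab p * (G p * (\<kappa> n p * h p))) \<le> norm (indicat_real slab p * (G p * h p))" for n
      unfolding e using \<kappa>1[of n] by (intro AE_I2) (simp add: abs_mult mult_left_le_one_le)
    show "AE p in lborel. (\<lambda>n. indicat_real slab p * (G p * (\<kappa> n p * h p))) \<longlonglongrightarrow> indicat_real slab p * (G p * h p)"
    proof (intro AE_I2)
      fix p
      show "(\<lambda>n. indicat_real slab p * (G p * (\<kappa> n p * h p))) \<longlonglongrightarrow> indicat_real slab p * (G p * h p)"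
      proof (cases "p \<in> slab")
        case True
        have "(\<lambda>n. \<kappa> n p * (indicat_real slab p * (G p * h p))) \<longlonglongrightarrow> 1 * (indicat_real slab p * (G p * h p))"
          by (intro tendsto_mult tendsto_const \<kappa>lim[OF True])
        then show ?thesis unfolding e by simp
      qed simp
    qed
  qed
  have l1: "(\<lambda>n. LBINT p. indicat_real slab p * (U p * (\<kappa> n p * dderiv (e_space i) \<eta> p))) \<longlonglongrightarrow>
      (LBINT p. indicat_real slab p * (U p * dderiv (e_space i) \<eta> p))"
    by (rule lim[OF U test_functions_dderiv[OF upper_test[OF \<eta>]]])
  have "(\<lambda>n. - (LBINT p. indicat_real slab p * (V p * (\<kappa> n p * \<eta> p)))) \<longlonglongrightarrow>
      - (LBINT p. indicat_real slab p * (V p * \<eta> p))"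
    by (intro tendsto_minus lim[OF V upper_test[OF \<eta>]])
  then have l2: "(\<lambda>n. LBINT p. indicat_real slab p * (U p * (\<kappa> n p * dderiv (e_space i) \<eta> p))) \<longlonglongrightarrow>
      - (LBINT p. indicat_real slab p * (V p * \<eta> p))"
    by (rule Lim_transform_eventually) (use eq in \<open>auto simp: eventually_sequentially intro!: exI[of _ 1]\<close>)
  show ?thesis using LIMSEQ_unique[OF l1 l2] .
qed

end

lemma compact_fst_lower_bound:
  fixes C :: "'n::finite spacetime set"
  assumes "compact C" "C \<subseteq> {c<..} \<times> UNIV" "c < B"
  obtains c' where "c < c'" "c' < B" "\<And>p. p \<in> C \<Longrightarrow> c' < fst p"
proof (cases "C = {}")
  case True
  then show ?thesis using that[of "(c + B) / 2"] assms(3) by simp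
next
  case False
  obtain m where m: "m \<in> C" "\<And>p. p \<in> C \<Longrightarrow> fst m \<le> fst p"
    using continuous_attains_inf[OF assms(1) False, of fst] continuous_on_fst[OF continuous_on_id] by blast
  have "c < fst m" using m(1) assms(2) by auto
  show ?thesis
  proof (rule that[of "(c + min B (fst m)) / 2"])
    fix p assume "p \<in> C"
    then show "(c + min B (fst m)) / 2 < fst p" using m(2)[of p] \<open>c < fst m\<close> min.cobounded2[of B "fst m"] by (simp add: min_def split: if_splits)
  qed (use \<open>c < fst m\<close> assms(3) in \<open>simp_all add: min_def\<close>)
qed

context W0_element
begin

text \<open>Here the zero trace enters. For the smooth approximations the classical formula holds up
  to s = B; its boundary term tends to 0 because their values at s = B tend to 0 in L^2. There is no
  term at the lower end since \<eta> vanishes near s = c.\<close>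

lemma time_integration_by_parts:
  assumes \<eta>: "\<eta> \<in> test_functions upper"
  shows "(LBINT p. indicat_real slab p * (u p * dderiv e_time \<eta> p)) =
    - (LBINT p. indicat_real slab p * (us p * \<eta> p))"
proof -
  obtain C where C: "compact C" "C \<subseteq> upper" "\<And>x. x \<notin> C \<Longrightarrow> \<eta> x = 0" "smooth_on UNIV \<eta>"
    using \<eta> by (metis test_functionsE)
  obtain c' where c': "c < c'" "c' < B" "\<And>p. p \<in> C \<Longrightarrow> c' < fst p"
    using compact_fst_lower_bound[OF C(1,2) c(2)] by blast
  obtain R where R: "R > 0" "\<And>p. p \<in> C \<Longrightarrow> norm (snd p) < R"
  proof -
    obtain b where b: "b > 0" "\<And>p. p \<in> C \<Longrightarrow> norm p \<le> b"
      using compact_imp_bounded[OF C(1)] by (auto simp: bounded_pos)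
    have "norm (snd p) < b + 1" if "p \<in> C" for p
      using b(2)[OF that] norm_snd_le[of "snd p" "fst p"] by simp
    then show ?thesis using that[of "b + 1"] b(1) by simp
  qed
  \<comment> \<open>A cylinder containing the part of the support of \<eta> that lies below time
    \<open>B\<close>; the approximations are taken on it.\<close>
  define Z where "Z = {c'<..<B} \<times> ball (0 :: real^'n) R"
  have "\<exists>\<phi> :: nat \<Rightarrow> 'n spacetime \<Rightarrow> real. let Z = {c'<..<B} \<times> ball 0 R in
        (\<forall>k. smooth (\<phi> k)) \<and>
        (\<lambda>k. L2norm Z (\<lambda>_. 1) (\<lambda>p. \<phi> k p - u p)) \<longlonglongrightarrow> 0 \<and>
        (\<lambda>k. L2norm Z (\<lambda>_. 1) (\<lambda>p. dderiv e_time (\<phi> k) p - us p)) \<longlonglongrightarrow> 0 \<and>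
        (\<forall>i. (\<lambda>k. L2norm Z (\<lambda>_. 1) (\<lambda>p. dderiv (e_space i) (\<phi> k) p - Du p $ i)) \<longlonglongrightarrow> 0) \<and>
        (\<lambda>k. L2norm (ball 0 R) (\<lambda>_. 1) (\<lambda>z. \<phi> k (B, z) - 0)) \<longlonglongrightarrow> 0"
    using trace_zero c'(1,2) R(1) unfolding has_H1loc_trace_def by auto
  then obtain \<phi> :: "nat \<Rightarrow> 'n spacetime \<Rightarrow> real" where \<phi>: "\<And>k. smooth_on UNIV (\<phi> k)"
    "(\<lambda>k. nrm (\<lambda>p. indicat_real Z p * (\<phi> k p - u p))) \<longlonglongrightarrow> 0"
    "(\<lambda>k. nrm (\<lambda>p. indicat_real Z p * (dderiv e_time (\<phi> k) p - us p))) \<longlonglongrightarrow> 0"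
    "(\<lambda>k. nrm (\<lambda>z. indicat_real (ball 0 R) z * \<phi> k (B, z))) \<longlonglongrightarrow> 0"
    unfolding Let_def Z_def[symmetric] smooth_iff_smooth_on L2norm_one_eq_nrm by auto
  have Zs: "Z \<subseteq> slab" using c' by (auto simp: Z_def)
  have Zm [measurable]: "Z \<in> sets borel" unfolding Z_def by (intro borel_open open_Times) auto
  have dt: "dderiv e_time \<eta> \<in> test_functions upper" by (rule test_functions_dderiv[OF \<eta>])
  have dz: "dderiv e_time \<eta> p = 0" if "p \<notin> C" for p
    by (rule dderiv_zero_open[of "- C"]) (use that C(3) compact_imp_closed[OF C(1)] in auto)
  have meas [measurable]: "\<eta> \<in> borel_measurable borel" "dderiv e_time \<eta> \<in> borel_measurable borel"
    using test_functions_measurable[OF \<eta>] test_functions_measurable[OF dt] by auto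
  have cutm: "(\<lambda>p. indicat_real Z p * (f p - U p)) \<in> borel_measurable borel"
    if f: "f \<in> borel_measurable borel" and U: "U \<in> L2space slab w" for f U
  proof -
    have "(\<lambda>p. indicat_real Z p * (f p - indicat_real slab p *\<^sub>R U p)) \<in> borel_measurable borel"
      using f L2space_indicator_measurable[OF U] by measurable
    moreover have "indicat_real Z p * (f p - indicat_real slab p *\<^sub>R U p) = indicat_real Z p * (f p - U p)" for p
      using Zs by (auto simp: indicator_def)
    ultimately show ?thesis by (simp only:)
  qed
  have ZC: "indicat_real slab p = indicat_real Z p" if "p \<in> C" for p
    using c'(3)[OF that] R(2)[OF that] c' by (cases p) (auto simp: indicator_def Z_def)
  have phim: "\<phi> k \<in> borel_measurable borel" "dderiv e_time (\<phi> k) \<in> borel_measurable borel" for k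
    using smooth_on_continuous[OF \<phi>(1)] dderiv_continuous[OF \<phi>(1)] borel_measurable_continuous_onI by blast+
  let ?d = "\<lambda>k p. indicat_real Z p * (\<phi> k p - u p)" and ?e = "\<lambda>k p. indicat_real Z p * (dderiv e_time (\<phi> k) p - us p)"
  note ld = tendsto_integral_mult_0[OF cutm[OF phim(1) in_L2(1)] meas(2) nrm_test_function_finite[OF dt] \<phi>(2)]
  note le = tendsto_integral_mult_0[OF cutm[OF phim(2) in_L2(2)] meas(1) nrm_test_function_finite[OF \<eta>] \<phi>(3)]
  \<comment> \<open>The integrand is the time derivative of \<phi> k \<eta>. Hence
    \<open>I k\<close> is a pure boundary term, while its limit is the quantity \<open>J\<close>
    that has to vanish.\<close>
  define I where "I k = (LBINT p. indicat_real Z p * (\<phi> k p * dderiv e_time \<eta> p + dderiv e_time (\<phi> k) p * \<eta> p))" for k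
  note i1 = slab_integrable[OF in_L2(1) upper_test[OF dt]] and i2 = slab_integrable[OF in_L2(2) upper_test[OF \<eta>]]
  define J where "J = (LBINT p. indicat_real slab p * (u p * dderiv e_time \<eta> p)) + (LBINT p. indicat_real slab p * (us p * \<eta> p))"
  have "\<forall>\<^sub>F k in sequentially. I k = J + ((LBINT p. ?d k p * dderiv e_time \<eta> p) + (LBINT p. ?e k p * \<eta> p))"
    using ld(2) le(2)
  proof eventually_elim
    fix k assume i3: "integrable lborel (\<lambda>p. ?d k p * dderiv e_time \<eta> p)" and i4: "integrable lborel (\<lambda>p. ?e k p * \<eta> p)"
    have "indicat_real Z p * (\<phi> k p * dderiv e_time \<eta> p + dderiv e_time (\<phi> k) p * \<eta> p) =
       (indicat_real slab p * (u p * dderiv e_time \<eta> p) + indicat_real slab p * (us p * \<eta> p)) +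
       (?d k p * dderiv e_time \<eta> p + ?e k p * \<eta> p)" for p
    proof (cases "p \<in> C")
      case True
      then show ?thesis unfolding ZC[OF True] by (simp add: algebra_simps)
    qed (simp add: dz C(3))
    then show "I k = J + ((LBINT p. ?d k p * dderiv e_time \<eta> p) + (LBINT p. ?e k p * \<eta> p))"
      unfolding I_def J_def using i1 i2 i3 i4 by (simp only: Bochner_Integration.integral_add Bochner_Integration.integrable_add)
  qed
  moreover have "(\<lambda>k. J + ((LBINT p. ?d k p * dderiv e_time \<eta> p) + (LBINT p. ?e k p * \<eta> p))) \<longlonglongrightarrow> J + (0 + 0)"
    by (intro tendsto_add tendsto_const ld(1) le(1))
  ultimately have IJ: "I \<longlonglongrightarrow> J"
    by (subst (asm) add_0_right, subst (asm) add_0_right)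
      (rule Lim_transform_eventually, assumption, auto elim: eventually_mono)
  have Ik: "I k = (LBINT z. (indicat_real (ball 0 R) z * \<phi> k (B, z)) * \<eta> (B, z))" for k
  proof -
    let ?\<zeta> = "\<lambda>p. \<phi> k p * \<eta> p"
    have d\<zeta>: "dderiv e_time ?\<zeta> p = \<phi> k p * dderiv e_time \<eta> p + dderiv e_time (\<phi> k) p * \<eta> p" for p
      by (rule dderiv_mult) (auto intro: smooth_on_differentiable[OF \<phi>(1)] smooth_on_differentiable[OF C(4)])
    have s\<zeta>: "smooth_on UNIV ?\<zeta>" by (intro smooth_on_mult \<phi> C) simp
    have "(LBINT p. indicat_real ({c'..B} \<times> UNIV) p * dderiv e_time ?\<zeta> p) = (LBINT z. ?\<zeta> (B, z) - ?\<zeta> (c', z))"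
    proof (rule slab_integral_time_derivative(1))
      show "c' \<le> B" using c' by simp
      show "((\<lambda>s. ?\<zeta> (s, z)) has_real_derivative dderiv e_time ?\<zeta> (s, z)) (at s within {c'..B})" for s z
        using spacetime_time_derivative[of ?\<zeta> 0 s z, OF smooth_on_differentiable[OF s\<zeta>]]
        by (simp add: has_field_derivative_at_within)
      show "continuous_on ({c'..B} \<times> UNIV) (dderiv e_time ?\<zeta>)"
        by (rule continuous_on_subset[OF dderiv_continuous[OF s\<zeta>]]) simp
      show "dderiv e_time ?\<zeta> (s, z) = 0" if "z \<notin> cball 0 R" for s z
      proof -
        have "(s, z) \<notin> C" using that R(2)[of "(s, z)"] by auto
        then show ?thesis by (simp add: d\<zeta> dz C(3))
      qed
    qed
    moreover have "(LBINT z. ?\<zeta> (B, z) - ?\<zeta> (c', z)) = (LBINT z. (indicat_real (ball 0 R) z * \<phi> k (B, z)) * \<eta> (B, z))"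
    proof (rule Bochner_Integration.integral_cong[OF refl])
      fix z
      have "\<eta> (c', z) = 0" using c'(3)[of "(c', z)"] C(3) by auto
      moreover have "\<eta> (B, z) = 0" if "z \<notin> ball 0 R" using R(2)[of "(B, z)"] C(3)[of "(B, z)"] that by auto
      ultimately show "?\<zeta> (B, z) - ?\<zeta> (c', z) = (indicat_real (ball 0 R) z * \<phi> k (B, z)) * \<eta> (B, z)"
        by (auto simp: indicator_def)
    qed
    moreover have "(LBINT p. indicat_real ({c'..B} \<times> UNIV) p * dderiv e_time ?\<zeta> p) = I k"
      unfolding I_def
    proof (rule integral_cong_AE)
      have [measurable]: "{c'..B} \<times> UNIV \<in> sets (borel :: 'n spacetime measure)" by (intro borel_closed closed_Times) auto
      have [measurable]: "dderiv e_time ?\<zeta> \<in> borel_measurable borel"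
        by (rule borel_measurable_continuous_onI[OF dderiv_continuous[OF s\<zeta>]])
      note [measurable] = phim
      show "(\<lambda>p. indicat_real ({c'..B} \<times> UNIV) p * dderiv e_time ?\<zeta> p) \<in> borel_measurable lborel" by measurable
      show "(\<lambda>p. indicat_real Z p * (\<phi> k p * dderiv e_time \<eta> p + dderiv e_time (\<phi> k) p * \<eta> p)) \<in> borel_measurable lborel" by measurable
      \<comment> \<open>The closed time interval of the boundary formula and the open one in
        \<open>Z\<close> differ by the null set s = B.\<close>
      have "AE p in lborel \<Otimes>\<^sub>M (lborel :: (real^'n) measure). fst p \<noteq> B"
      proof (rule lborel_pair.AE_pair_measure)
        show "{x \<in> space (lborel \<Otimes>\<^sub>M lborel). fst x \<noteq> B} \<in> sets (lborel \<Otimes>\<^sub>M lborel)" by measurable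
        show "AE x in lborel. AE y in lborel. fst (x, y) \<noteq> B"
          using AE_lborel_singleton[of B] by eventually_elim simp
      qed
      then have "AE p in (lborel :: 'n spacetime measure). fst p \<noteq> B" unfolding lborel_prod .
      then show "AE p in lborel. indicat_real ({c'..B} \<times> UNIV) p * dderiv e_time ?\<zeta> p =
        indicat_real Z p * (\<phi> k p * dderiv e_time \<eta> p + dderiv e_time (\<phi> k) p * \<eta> p)"
      proof eventually_elim
        fix p :: "'n spacetime" assume B: "fst p \<noteq> B"
        show "indicat_real ({c'..B} \<times> UNIV) p * dderiv e_time ?\<zeta> p =
          indicat_real Z p * (\<phi> k p * dderiv e_time \<eta> p + dderiv e_time (\<phi> k) p * \<eta> p)"
        proof (cases "p \<in> C")
          case True
          then show ?thesis using B c'(3)[OF True] R(2)[OF True] by (cases p) (auto simp: d\<zeta> indicator_def Z_def)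
        qed (simp add: d\<zeta> dz C(3))
      qed
    qed
    ultimately show ?thesis by simp
  qed
  have I0: "(\<lambda>k. LBINT z. (indicat_real (ball 0 R) z * \<phi> k (B, z)) * \<eta> (B, z)) \<longlonglongrightarrow> 0"
  proof (rule tendsto_integral_mult_0(1)[OF _ _ _ \<phi>(4)])
    have e: "\<eta> (B, z) = \<eta> (0 + (B, z))" for z by simp
    have t: "(\<lambda>z. \<eta> (B, z)) \<in> test_functions UNIV"
      unfolding e by (rule spacetime_slice_test_function(1)[OF test_functions_mono[OF _ \<eta>]]) simp
    show "(\<lambda>z. \<eta> (B, z)) \<in> borel_measurable borel" by (rule test_functions_measurable[OF t])
    show "nrm (\<lambda>z. \<eta> (B, z)) < \<infinity>" by (rule nrm_test_function_finite[OF t])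
    have "continuous_on UNIV (\<lambda>z. \<phi> k (B, z))" for k
      by (rule continuous_on_compose2[OF smooth_on_continuous[OF \<phi>(1)]]) (auto intro!: continuous_intros)
    from borel_measurable_continuous_onI[OF this]
    show "(\<lambda>z. indicat_real (ball 0 R) z * \<phi> k (B, z)) \<in> borel_measurable borel" for k
      by (intro borel_measurable_times borel_measurable_indicator borel_open open_ball)
  qed
  have "I \<longlonglongrightarrow> 0" using I0 by (simp only: Ik[symmetric])
  then have "J = 0" using IJ LIMSEQ_unique by blast
  then show ?thesis by (simp add: J_def)
qed

text \<open>The argument is written as a constant plus a linear map so that the lemmas on affine
  composition apply.\<close>

definition cutoff :: "real \<Rightarrow> 'n spacetime \<Rightarrow> real" where
  "cutoff \<rho> p = ball_cutoff 0 1 (0 + (1 / \<rho>) *\<^sub>R snd p)"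

lemma cutoff_linear: "bounded_linear (\<lambda>p::'n spacetime. (1 / \<rho>) *\<^sub>R snd p)"
  by (intro bounded_linear_compose[OF bounded_linear_scaleR_right bounded_linear_snd])

lemma cutoff_smooth: "smooth_on UNIV (cutoff \<rho>)"
  unfolding cutoff_def[abs_def]
  by (rule smooth_on_compose_affine[OF open_UNIV cutoff_linear _ smooth_on_ball_cutoff]) simp

lemma cutoff_1: "\<rho> > 0 \<Longrightarrow> norm (snd p) \<le> \<rho> \<Longrightarrow> cutoff \<rho> p = 1"
  unfolding cutoff_def by (intro ball_cutoff_1) (auto simp: field_simps)

lemma cutoff_0: "\<rho> > 0 \<Longrightarrow> 2 * \<rho> \<le> norm (snd p) \<Longrightarrow> cutoff \<rho> p = 0"
  unfolding cutoff_def by (intro ball_cutoff_0) (auto simp: field_simps)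

lemma cutoff_bounds: "\<bar>cutoff \<rho> p\<bar> \<le> 1"
  unfolding cutoff_def using ball_cutoff_bounds[of 0 1 "0 + (1 / \<rho>) *\<^sub>R snd p"] by linarith

lemma unit_cutoff_test: "ball_cutoff (0 :: real^'n) 1 \<in> test_functions UNIV"
  by (rule test_functionsI[OF smooth_on_ball_cutoff, of "cball 0 2"]) (auto intro: ball_cutoff_0)

lemma cutoff_dderiv:
  "dderiv (e_space j) (cutoff \<rho>) p = (1 / \<rho>) * dderiv (axis j 1) (ball_cutoff 0 1) (0 + (1 / \<rho>) *\<^sub>R snd p)"
  "dderiv2 i j (cutoff \<rho>) p =
    (1 / \<rho>) * ((1 / \<rho>) * dderiv (axis i 1) (dderiv (axis j 1) (ball_cutoff 0 1)) (0 + (1 / \<rho>) *\<^sub>R snd p))"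
proof -
  have d: "dderiv (0, e) (\<lambda>p. f (0 + (1 / \<rho>) *\<^sub>R snd p)) p = (1 / \<rho>) * dderiv e f (0 + (1 / \<rho>) *\<^sub>R snd p)"
    if f: "smooth_on UNIV f" for f :: "real^'n \<Rightarrow> real" and e and p :: "'n spacetime"
  proof -
    have df: "f differentiable at x" for x using smooth_on_differentiable[OF f] by simp
    have "dderiv (0, e) (\<lambda>p. f (0 + (1 / \<rho>) *\<^sub>R snd p)) p = dderiv ((1 / \<rho>) *\<^sub>R e) f (0 + (1 / \<rho>) *\<^sub>R snd p)"
      using dderiv_eq[OF dderiv_compose_affine[OF cutoff_linear[of \<rho>] df, where b=0 and x=p], of "(0, e)"] by (simp only: snd_conv)
    also have "\<dots> = (1 / \<rho>) * dderiv e f (0 + (1 / \<rho>) *\<^sub>R snd p)"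
      using linear_cmul[OF dderiv_linear[OF df], of "1 / \<rho>" e] by simp
    finally show ?thesis .
  qed
  have s: "smooth_on UNIV (ball_cutoff (0 :: real^'n) 1)" by (rule smooth_on_ball_cutoff)
  have 1: "dderiv (e_space j) (cutoff \<rho>) = (\<lambda>p. (1 / \<rho>) * dderiv (axis j 1) (ball_cutoff 0 1) (0 + (1 / \<rho>) *\<^sub>R snd p))"
    unfolding cutoff_def[abs_def] by (rule ext) (rule d[OF s])
  then show "dderiv (e_space j) (cutoff \<rho>) p = (1 / \<rho>) * dderiv (axis j 1) (ball_cutoff 0 1) (0 + (1 / \<rho>) *\<^sub>R snd p)"
    by (rule fun_cong)
  have s2: "smooth_on UNIV (\<lambda>p::'n spacetime. dderiv (axis j 1) (ball_cutoff 0 1) (0 + (1 / \<rho>) *\<^sub>R snd p))"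
    by (rule smooth_on_compose_affine[OF open_UNIV cutoff_linear _ smooth_on_dderiv[OF s]]) simp
  show "dderiv2 i j (cutoff \<rho>) p =
    (1 / \<rho>) * ((1 / \<rho>) * dderiv (axis i 1) (dderiv (axis j 1) (ball_cutoff 0 1)) (0 + (1 / \<rho>) *\<^sub>R snd p))"
    unfolding 1
    by (subst dderiv_cmult[OF smooth_on_differentiable[OF s2]], simp, subst d[OF smooth_on_dderiv[OF s]], rule refl)
qed

text \<open>By scaling, with derivatives of the unit cutoff bounded by compactness. The second
  derivatives are even of order 1/\<rho>^2; for \<rho> >= 1 this is weakened so that one bound
  serves both orders.\<close>

lemma cutoff_dderiv_bounded:
  obtains K where "K > 0" "\<And>\<rho> j p. \<rho> \<ge> 1 \<Longrightarrow> \<bar>dderiv (e_space j) (cutoff \<rho>) p\<bar> \<le> K / \<rho>"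
    "\<And>\<rho> i j p. \<rho> \<ge> 1 \<Longrightarrow> \<bar>dderiv2 i j (cutoff \<rho>) p\<bar> \<le> K / \<rho>"
proof -
  have "\<exists>K>0. \<forall>x. \<bar>dderiv (axis j 1) (ball_cutoff (0::real^'n) 1) x\<bar> \<le> K" for j
    using test_functions_bounded[OF test_functions_dderiv[OF unit_cutoff_test]] by metis
  then obtain K1 where K1: "\<And>j. K1 j > 0" "\<And>j x. \<bar>dderiv (axis j 1) (ball_cutoff (0::real^'n) 1) x\<bar> \<le> K1 j" by metis
  have "\<exists>K>0. \<forall>x. \<bar>dderiv (axis i 1) (dderiv (axis j 1) (ball_cutoff (0::real^'n) 1)) x\<bar> \<le> K" for i j
    using test_functions_bounded[OF test_functions_dderiv[OF test_functions_dderiv[OF unit_cutoff_test]]] by metis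
  then obtain K2 where K2: "\<And>i j. K2 i j > 0" "\<And>i j x. \<bar>dderiv (axis i 1) (dderiv (axis j 1) (ball_cutoff (0::real^'n) 1)) x\<bar> \<le> K2 i j" by metis
  define K where "K = (\<Sum>j\<in>UNIV. K1 j) + (\<Sum>i\<in>UNIV. \<Sum>j\<in>UNIV. K2 i j)"
  have "0 < (\<Sum>j\<in>UNIV. K1 j)" "0 \<le> (\<Sum>i\<in>UNIV. \<Sum>j\<in>UNIV. K2 i j)"
    by (intro sum_pos sum_nonneg less_imp_le[OF K2(1)] K1(1); simp)+
  moreover have "K1 j \<le> (\<Sum>j\<in>UNIV. K1 j)" for j
    using K1(1) by (intro member_le_sum) (auto intro: less_imp_le)
  moreover have "K2 i j \<le> (\<Sum>i\<in>UNIV. \<Sum>j\<in>UNIV. K2 i j)" for i j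
  proof -
    have "K2 i j \<le> (\<Sum>j\<in>UNIV. K2 i j)" using K2(1) by (intro member_le_sum) (auto intro: less_imp_le)
    also have "\<dots> \<le> (\<Sum>i\<in>UNIV. \<Sum>j\<in>UNIV. K2 i j)"
      using K2(1) by (intro member_le_sum[of i UNIV "\<lambda>i. \<Sum>j\<in>UNIV. K2 i j"]) (auto intro: sum_nonneg less_imp_le[OF K2(1)])
    finally show ?thesis .
  qed
  ultimately have K: "K1 j \<le> K" "K2 i j \<le> K" "K > 0" for i j
    unfolding K_def by (auto intro: add_increasing2 add_increasing[OF less_imp_le] add_pos_nonneg)
  show ?thesis
  proof (rule that[OF K(3)])
    fix \<rho> :: real and i j :: 'n and p :: "'n spacetime" assume \<rho>: "\<rho> \<ge> 1"
    have "\<bar>dderiv (e_space j) (cutoff \<rho>) p\<bar> = (1 / \<rho>) * \<bar>dderiv (axis j 1) (ball_cutoff 0 1) (0 + (1 / \<rho>) *\<^sub>R snd p)\<bar>"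
      unfolding cutoff_dderiv(1) abs_mult using \<rho> by simp
    also have "\<dots> \<le> (1 / \<rho>) * K" using \<rho> by (intro mult_left_mono order_trans[OF K1(2) K(1)]) auto
    finally show "\<bar>dderiv (e_space j) (cutoff \<rho>) p\<bar> \<le> K / \<rho>" by simp
    have "\<bar>dderiv2 i j (cutoff \<rho>) p\<bar> =
        (1 / \<rho>) * ((1 / \<rho>) * \<bar>dderiv (axis i 1) (dderiv (axis j 1) (ball_cutoff 0 1)) (0 + (1 / \<rho>) *\<^sub>R snd p)\<bar>)"
      unfolding cutoff_dderiv(2) abs_mult using \<rho> by simp
    also have "\<dots> \<le> (1 / \<rho>) * (1 * K)" using \<rho> K(3)
      by (intro mult_left_mono mult_mono order_trans[OF K2(2) K(2)]) auto
    finally show "\<bar>dderiv2 i j (cutoff \<rho>) p\<bar> \<le> K / \<rho>" by simp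
  qed
qed

end

section \<open>Weak lower semicontinuity and forward heat potentials\<close>

lemma nrm_eq_inner:
  fixes g :: "'x::euclidean_space \<Rightarrow> 'b::euclidean_space"
  assumes "g \<in> borel_measurable borel" "nrm g < \<infinity>"
  shows "(nrm g)\<^sup>2 = ennreal (LBINT x. g x \<bullet> g x)"
proof -
  have "(\<integral>\<^sup>+x. ennreal ((norm (g x))\<^sup>2) \<partial>lborel) < \<infinity>"
    using assms(2) by (simp add: nrm_def ennsqrt_less_top_iff)
  then have "integrable lborel (\<lambda>x. (norm (g x))\<^sup>2)"
    using assms(1) by (intro integrableI_nonneg) auto
  then show ?thesis unfolding nrm_power2
    by (subst nn_integral_eq_integral) (auto simp: power2_norm_eq_inner)
qed

lemma inner_integral_nrm:
  fixes f g :: "'x::euclidean_space \<Rightarrow> 'b::euclidean_space"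
  assumes [measurable]: "f \<in> borel_measurable borel" "g \<in> borel_measurable borel"
    and fin: "nrm f < \<infinity>" "nrm g < \<infinity>"
  shows "integrable lborel (\<lambda>x. f x \<bullet> g x)"
    and "ennreal \<bar>\<integral>x. f x \<bullet> g x \<partial>lborel\<bar> \<le> nrm f * nrm g"
proof -
  have i: "integrable lborel (\<lambda>x. norm (f x) * norm (g x))"
    by (rule nrm_integrable_mult(1)) (use fin in \<open>auto simp: nrm_norm\<close>)
  show j: "integrable lborel (\<lambda>x. f x \<bullet> g x)"
    by (rule Bochner_Integration.integrable_bound[OF i]) (auto simp: Cauchy_Schwarz_ineq2)
  have "\<bar>\<integral>x. f x \<bullet> g x \<partial>lborel\<bar> \<le> (LBINT x. \<bar>f x \<bullet> g x\<bar>)" by (rule integral_abs_bound)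
  also have "\<dots> \<le> (LBINT x. norm (f x) * norm (g x))"
    by (intro integral_mono i integrable_abs j Cauchy_Schwarz_ineq2)
  finally have "ennreal \<bar>\<integral>x. f x \<bullet> g x \<partial>lborel\<bar> \<le> ennreal \<bar>\<integral>x. norm (f x) * norm (g x) \<partial>lborel\<bar>"
    by (intro ennreal_leI) linarith
  also have "\<dots> \<le> nrm (\<lambda>x. norm (f x)) * nrm (\<lambda>x. norm (g x))"
    by (rule nrm_integrable_mult(2)) (use fin in \<open>auto simp: nrm_norm\<close>)
  finally show "ennreal \<bar>\<integral>x. f x \<bullet> g x \<partial>lborel\<bar> \<le> nrm f * nrm g" by (simp add: nrm_norm)
qed

text \<open>Test functions \<Phi> k approximating \<open>g\<close> in L^2 are paired with the f n.
  Letting n tend to infinity bounds the pairing of \<open>g\<close> with \<Phi> k by K times the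
  norm of \<Phi> k; letting k tend to infinity gives (nrm g)^2 <= K nrm g, and dividing by the norm
  finishes.\<close>

lemma nrm_weak_lower_semicontinuous:
  fixes f :: "nat \<Rightarrow> 'x::euclidean_space \<Rightarrow> 'b::euclidean_space"
  assumes \<Omega>: "open \<Omega>"
    and m [measurable]: "\<And>n. f n \<in> borel_measurable borel" "g \<in> borel_measurable borel"
    and g0: "\<And>x. x \<notin> \<Omega> \<Longrightarrow> g x = 0" and fin: "\<And>n. nrm (f n) < \<infinity>" "nrm g < \<infinity>"
    and weak: "\<And>b \<omega>. b \<in> Basis \<Longrightarrow> \<omega> \<in> test_functions \<Omega> \<Longrightarrow>
      (\<lambda>n. LBINT x. (f n x \<bullet> b) * \<omega> x) \<longlonglongrightarrow> (LBINT x. (g x \<bullet> b) * \<omega> x)"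
    and bound: "\<And>n. nrm (f n) \<le> C n" "C \<longlonglongrightarrow> K" "K < \<infinity>"
  shows "nrm g \<le> K"
proof -
  have comp: "nrm (\<lambda>x. h x \<bullet> b) \<le> nrm h" if "b \<in> Basis" for h :: "'x \<Rightarrow> 'b" and b
    using that by (intro nrm_mono) (simp add: norm_nth_le Basis_le_norm)
  have "\<exists>\<phi>. \<forall>k. \<phi> k \<in> test_functions \<Omega> \<and> nrm (\<lambda>x. \<phi> k x - g x \<bullet> b) < ennreal ((1 / 2) ^ k)" if b: "b \<in> Basis" for b
  proof -
    have f': "nrm (\<lambda>x. g x \<bullet> b) < \<infinity>" using comp[OF b] fin(2) by (rule le_less_trans)
    have m': "(\<lambda>x. g x \<bullet> b) \<in> borel_measurable borel" by measurable
    have z': "g x \<bullet> b = 0" if "x \<notin> \<Omega>" for x using g0[OF that] by simp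
    show ?thesis
    proof (rule test_functions_dense_sequence[OF \<Omega> m' f' z'])
      fix \<phi> assume "\<And>k. \<phi> k \<in> test_functions \<Omega>" "\<And>k. nrm (\<lambda>x. \<phi> k x - g x \<bullet> b) < ennreal ((1 / 2) ^ k)"
      then show ?thesis by (intro exI[of _ \<phi>]) simp
    qed
  qed
  then obtain \<phi> where \<phi>: "\<And>b k. b \<in> Basis \<Longrightarrow> \<phi> b k \<in> test_functions \<Omega>"
    "\<And>b k. b \<in> Basis \<Longrightarrow> nrm (\<lambda>x. \<phi> b k x - g x \<bullet> b) < ennreal ((1 / 2) ^ k)" by metis
  have \<phi>m [measurable]: "b \<in> Basis \<Longrightarrow> \<phi> b k \<in> borel_measurable borel" for b k by (rule test_functions_measurable[OF \<phi>(1)])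
  define \<Phi> where "\<Phi> k x = (\<Sum>b\<in>Basis. \<phi> b k x *\<^sub>R b)" for k x
  have \<Phi>m [measurable]: "\<Phi> k \<in> borel_measurable borel" for k
    unfolding \<Phi>_def[abs_def] by (intro borel_measurable_sum borel_measurable_scaleR \<phi>m) auto
  have nd: "nrm (\<lambda>x. \<Phi> k x - g x) \<le> ennreal (real DIM('b)) * ennreal ((1 / 2) ^ k)" for k
  proof -
    have "\<Phi> k x - g x = (\<Sum>b\<in>Basis. (\<phi> b k x - g x \<bullet> b) *\<^sub>R b)" for x
      by (simp add: \<Phi>_def scaleR_diff_left sum_subtractf euclidean_representation)
    then have "nrm (\<lambda>x. \<Phi> k x - g x) = nrm (\<lambda>x. \<Sum>b\<in>Basis. (\<phi> b k x - g x \<bullet> b) *\<^sub>R b)" by (simp only:)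
    also have "\<dots> \<le> (\<Sum>b\<in>Basis. nrm (\<lambda>x. (\<phi> b k x - g x \<bullet> b) *\<^sub>R b))"
      by (rule nrm_sum) (auto intro!: borel_measurable_scaleR borel_measurable_diff \<phi>m)
    also have "\<dots> \<le> (\<Sum>b\<in>(Basis::'b set). ennreal ((1 / 2) ^ k))"
    proof (rule sum_mono)
      fix b :: 'b assume b: "b \<in> Basis"
      have "nrm (\<lambda>x. (\<phi> b k x - g x \<bullet> b) *\<^sub>R b) = nrm (\<lambda>x. \<phi> b k x - g x \<bullet> b)"
        using b by (intro nrm_cong_norm) simp
      then show "nrm (\<lambda>x. (\<phi> b k x - g x \<bullet> b) *\<^sub>R b) \<le> ennreal ((1 / 2) ^ k)" using \<phi>(2)[OF b] by (simp add: less_imp_le)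
    qed
    also have "\<dots> = ennreal (real DIM('b)) * ennreal ((1 / 2) ^ k)" by (simp add: ennreal_of_nat_eq_real_of_nat)
    finally show ?thesis .
  qed
  have \<Phi>fin: "nrm (\<Phi> k) < \<infinity>" and \<Phi>le: "nrm (\<Phi> k) \<le> nrm (\<lambda>x. \<Phi> k x - g x) + nrm g" for k
  proof -
    have "nrm (\<lambda>x. (\<Phi> k x - g x) + g x) \<le> nrm (\<lambda>x. \<Phi> k x - g x) + nrm g"
      by (rule nrm_triangle) measurable
    then show le: "nrm (\<Phi> k) \<le> nrm (\<lambda>x. \<Phi> k x - g x) + nrm g" by simp
    have "nrm (\<lambda>x. \<Phi> k x - g x) < \<infinity>" using nd[of k] by (rule le_less_trans) (simp add: ennreal_mult_less_top)
    then have "nrm (\<lambda>x. \<Phi> k x - g x) + nrm g < \<infinity>" using fin(2) by simp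
    then show "nrm (\<Phi> k) < \<infinity>" by (rule le_less_trans[OF le])
  qed
  have expand: "(LBINT x. h x \<bullet> \<Phi> k x) = (\<Sum>b\<in>Basis. LBINT x. (h x \<bullet> b) * \<phi> b k x)"
    if h: "h \<in> borel_measurable borel" "nrm h < \<infinity>" for h :: "'x \<Rightarrow> 'b" and k
  proof -
    have i: "integrable lborel (\<lambda>x. (h x \<bullet> b) * \<phi> b k x)" if b: "b \<in> Basis" for b
      using h(1) le_less_trans[OF comp[OF b] h(2)] nrm_test_function_finite[OF \<phi>(1)[OF b]] \<phi>m[OF b]
      by (intro nrm_integrable_mult(1)) auto
    show ?thesis unfolding \<Phi>_def inner_sum_right inner_scaleR_right
      by (subst Bochner_Integration.integral_sum) (auto simp: mult.commute i)
  qed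
  have le: "ennreal \<bar>\<integral>x. g x \<bullet> \<Phi> k x \<partial>lborel\<bar> \<le> K * nrm (\<Phi> k)" for k
  proof (rule LIMSEQ_le)
    have "(\<lambda>n. \<Sum>b\<in>Basis. LBINT x. (f n x \<bullet> b) * \<phi> b k x) \<longlonglongrightarrow> (\<Sum>b\<in>Basis. LBINT x. (g x \<bullet> b) * \<phi> b k x)"
      by (intro tendsto_sum weak \<phi>(1))
    then have "(\<lambda>n. LBINT x. f n x \<bullet> \<Phi> k x) \<longlonglongrightarrow> (LBINT x. g x \<bullet> \<Phi> k x)"
      by (simp only: expand[OF m(1) fin(1)] expand[OF m(2) fin(2)])
    then show "(\<lambda>n. ennreal \<bar>\<integral>x. f n x \<bullet> \<Phi> k x \<partial>lborel\<bar>) \<longlonglongrightarrow> ennreal \<bar>\<integral>x. g x \<bullet> \<Phi> k x \<partial>lborel\<bar>"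
      by (intro tendsto_ennrealI tendsto_rabs)
    show "(\<lambda>n. C n * nrm (\<Phi> k)) \<longlonglongrightarrow> K * nrm (\<Phi> k)"
      using bound(3) \<Phi>fin[of k] by (intro tendsto_mult_ennreal tendsto_const bound(2)) auto
    have "ennreal \<bar>\<integral>x. f n x \<bullet> \<Phi> k x \<partial>lborel\<bar> \<le> C n * nrm (\<Phi> k)" for n
      by (rule order_trans[OF inner_integral_nrm(2)[OF m(1) \<Phi>m fin(1) \<Phi>fin] mult_right_mono[OF bound(1)]]) simp
    then show "\<exists>N. \<forall>n\<ge>N. ennreal \<bar>\<integral>x. f n x \<bullet> \<Phi> k x \<partial>lborel\<bar> \<le> C n * nrm (\<Phi> k)" by blast
  qed
  have fle: "(nrm g)\<^sup>2 \<le> K * nrm g"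
  proof (rule ennreal_le_of_geometric)
    fix k
    let ?d = "\<lambda>x. \<Phi> k x - g x" and ?c = "ennreal (real DIM('b)) * ennreal ((1 / 2) ^ k)"
    have dm: "?d \<in> borel_measurable borel" by measurable
    have dfin: "nrm ?d < \<infinity>" using nd[of k] by (rule le_less_trans) (simp add: ennreal_mult_less_top)
    have "(LBINT x. g x \<bullet> \<Phi> k x) - (LBINT x. g x \<bullet> g x) = (LBINT x. g x \<bullet> ?d x)"
      unfolding inner_diff_right
      by (rule Bochner_Integration.integral_diff[symmetric]) (intro inner_integral_nrm(1) m \<Phi>m fin \<Phi>fin)+
    then have "ennreal (LBINT x. g x \<bullet> g x) \<le> ennreal (\<bar>LBINT x. g x \<bullet> \<Phi> k x\<bar> + \<bar>LBINT x. g x \<bullet> ?d x\<bar>)"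
      by (intro ennreal_leI) linarith
    also have "\<dots> \<le> K * nrm (\<Phi> k) + nrm g * nrm ?d"
      by (subst ennreal_plus) (auto intro!: add_mono le inner_integral_nrm(2)[OF m(2) dm fin(2) dfin])
    also have "\<dots> \<le> K * (?c + nrm g) + nrm g * ?c"
      by (intro add_mono mult_left_mono order_trans[OF \<Phi>le] nd order_refl) auto
    finally show "(nrm g)\<^sup>2 \<le> K * nrm g + (K + nrm g) * ennreal (real DIM('b)) * ennreal ((1 / 2) ^ k)"
      by (simp add: nrm_eq_inner[OF m(2) fin(2)] distrib_left distrib_right ac_simps)
  qed (use bound(3) fin(2) in \<open>simp add: ennreal_mult_less_top\<close>)
  show ?thesis
  proof (cases "nrm g = 0")
    case False
    have "nrm g * nrm g / nrm g \<le> K"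
      using fle fin(2) by (intro ennreal_divide_leI) (simp_all add: power2_eq_square)
    then show ?thesis using False fin(2) by (simp add: ennreal_mult_divide_eq)
  qed simp
qed

lemma dderiv_reflect:
  fixes f :: "'x::euclidean_space \<Rightarrow> real"
  assumes f: "smooth_on UNIV f"
  shows "dderiv e (\<lambda>p. f (- p)) p = - dderiv e f (- p)"
proof -
  have d: "f differentiable at x" for x using smooth_on_differentiable[OF f] by simp
  have "dderiv e (\<lambda>p. f (0 + - p)) p = dderiv (- e) f (0 + - p)"
    by (rule dderiv_eq[OF dderiv_compose_affine[OF bounded_linear_minus[OF bounded_linear_ident] d]])
  then show ?thesis using linear_neg[OF dderiv_linear[OF d, of "- p"]] by simp
qed

lemma test_functions_reflect:
  assumes "f \<in> test_functions \<Omega>"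
  shows "(\<lambda>p. f (- p)) \<in> test_functions UNIV"
proof -
  obtain C where C: "compact C" "\<And>x. x \<notin> C \<Longrightarrow> f x = 0" "smooth_on UNIV f" using assms by (metis test_functionsE)
  have "smooth_on UNIV (\<lambda>p. f (0 + - p))"
    by (rule smooth_on_compose_affine[OF open_UNIV bounded_linear_minus[OF bounded_linear_ident] _ C(3)]) simp
  then show ?thesis
    by (intro test_functionsI[of _ "uminus ` C"] compact_negations C) (auto simp: C(2) image_iff equation_minus_iff)
qed

lemma kconv_reflect: "kconv (\<lambda>r. k (- r)) f p = kconv k (\<lambda>q. f (- q)) (- p)"
  if "k \<in> borel_measurable borel" "f \<in> borel_measurable borel" for k f :: "'x::euclidean_space \<Rightarrow> real"
proof -
  have "(\<lambda>r. k r * f (p - r)) \<in> borel_measurable borel" using that by measurable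
  from lborel_reflect(1)[OF this] show ?thesis by (simp add: kconv_def add.commute)
qed

text \<open>Reflecting space-time exchanges the two directions of time: first derivatives change
  sign, second ones do not. So \<open>heat_potential_identity\<close> for the reflected function is
  the claim.\<close>

lemma backward_heat_identity:
  fixes A :: "'n::finite mat"
  assumes A: "posdef A" and M: "M > 0" and f: "f \<in> test_functions \<Omega>"
    and z: "\<And>s z. s \<le> fst p - M \<Longrightarrow> f (s, z) = 0"
  shows "dderiv e_time (kconv (\<lambda>r. hk_st A M (- r)) f) p -
    (\<Sum>i\<in>UNIV. \<Sum>j\<in>UNIV. A $ i $ j * dderiv (e_space i) (dderiv (e_space j) (kconv (\<lambda>r. hk_st A M (- r)) f)) p) = f p"
proof -
  let ?k = "\<lambda>r. hk_st A M (- r)" and ?f = "\<lambda>p. f (- p)"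
  note km = hk_st_measurable[OF A, of M]
  have k: "integrable lborel ?k" using lborel_reflect(2)[OF km] hk_st_integrable[OF A] by simp
  have sm: "smooth_on UNIV h" if "h \<in> test_functions \<Omega>" for h using test_functions_smooth[OF that] .
  note d = test_functions_dderiv[OF f]
  note dd = test_functions_dderiv[OF d]
  define \<Phi> where "\<Phi> q = - dderiv e_time f q + (\<Sum>i\<in>UNIV. \<Sum>j\<in>UNIV. A $ i $ j * dderiv2 i j f q)" for q
  have "dderiv e ?f = (\<lambda>q. (- 1) * dderiv e f (- q))" for e by (rule ext) (simp add: dderiv_reflect[OF sm[OF f]])
  note d1 = this
  have "dderiv e' (\<lambda>q. (- 1) * dderiv e f (- q)) q = dderiv e' (dderiv e f) (- q)" for e e' q
  proof -
    have "(\<lambda>q. dderiv e f (- q)) differentiable at q"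
      by (rule smooth_on_differentiable[OF test_functions_smooth[OF test_functions_reflect[OF d]]]) simp
    then show ?thesis using dderiv_cmult[of "\<lambda>q. dderiv e f (- q)" q e' "- 1"] unfolding dderiv_reflect[OF sm[OF d]] by linarith
  qed
  note d2 = this
  have "heat_adj A ?f = (\<lambda>q. \<Phi> (- q))"
    unfolding heat_adj_def[abs_def] \<Phi>_def d1 d2 by simp
  then have "kconv (hk_st A M) (\<lambda>q. \<Phi> (- q)) (- p) = - f p"
    using heat_potential_identity[OF A test_functions_reflect[OF f] M, of "- p"] z[of "- _" "- _"]
    by (auto simp: minus_le_iff)
  moreover have "\<Phi> \<in> borel_measurable borel"
    unfolding \<Phi>_def[abs_def] by (intro borel_measurable_add borel_measurable_uminus borel_measurable_sum
        borel_measurable_times borel_measurable_const test_functions_measurable[OF d] test_functions_measurable[OF dd])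
  ultimately have 1: "kconv ?k \<Phi> p = - f p" using kconv_reflect[OF km, of \<Phi> p] by simp
  note i1 = kconv_integrable_test[OF k d[of e_time], where p=p]
  note i2 = kconv_integrable_test[OF k dd]
  have "kconv ?k \<Phi> p = (LBINT r. - (?k r * dderiv e_time f (p + r)) +
      (\<Sum>i\<in>UNIV. \<Sum>j\<in>UNIV. A $ i $ j * (?k r * dderiv2 i j f (p + r))))"
    unfolding kconv_def \<Phi>_def
    by (rule Bochner_Integration.integral_cong[OF refl]) (simp add: distrib_left right_diff_distrib sum_distrib_left mult_ac)
  also have "\<dots> = - kconv ?k (dderiv e_time f) p +
      (\<Sum>i\<in>UNIV. \<Sum>j\<in>UNIV. A $ i $ j * kconv ?k (dderiv2 i j f) p)"
    using i1 i2 by (simp add: integral_finite_sum kconv_def)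
  finally show ?thesis using 1 by (simp add: kconv_dderiv[OF k f] kconv_dderiv[OF k d])
qed

context W0_element
begin

text \<open>The adjoint of the backward potential: \<open>bpot \<Psi>\<close> solves \<open>v\<^sub>s - A : D\<^sup>2v = \<Psi>\<close> on the slab with
  zero data at \<open>s = c\<close>.\<close>

definition bpot :: "('n spacetime \<Rightarrow> real) \<Rightarrow> 'n spacetime \<Rightarrow> real" where
  "bpot \<Psi> = kconv (\<lambda>r. hk_st A B (- r)) \<Psi>"

lemma bk_integrable: "integrable lborel (\<lambda>r. hk_st A B (- r))"
  using lborel_reflect(2)[OF hk_st_measurable[OF A_posdef]] hk_st_integrable[OF A_posdef] by simp

lemma bpot_smooth: "\<Psi> \<in> test_functions \<Omega> \<Longrightarrow> smooth_on UNIV (bpot \<Psi>)"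
  unfolding bpot_def by (rule smooth_on_kconv[OF bk_integrable])

text \<open>Time lags lie in (0, B] and \<Psi> lives at times between some c' > c and B, so the
  forward potential is zero outside times c' to 2 B. In space it spreads everywhere, and compactness
  there is supplied by \<open>Y\<close>.\<close>

lemma bpot_times_test:
  assumes \<Psi>: "\<Psi> \<in> test_functions slab" and Y: "smooth_on UNIV Y" "\<And>p. 2 * \<rho> < norm (snd p) \<Longrightarrow> Y p = 0"
  shows "(\<lambda>p. Y p * bpot \<Psi> p) \<in> test_functions upper"
proof -
  obtain C where C: "compact C" "C \<subseteq> slab" "\<And>x. x \<notin> C \<Longrightarrow> \<Psi> x = 0" using \<Psi> by (metis test_functionsE)
  obtain c' where c': "c < c'" "\<And>p. p \<in> C \<Longrightarrow> c' < fst p"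
    using compact_fst_lower_bound[OF C(1) order_trans[OF C(2) slab_upper] c(2)] by blast
  have z: "bpot \<Psi> p = 0" if "fst p \<le> c' \<or> 2 * B \<le> fst p" for p
  proof -
    have "hk_st A B (- r) * \<Psi> (p + r) = 0" for r
    proof (cases "p + r \<in> C")
      case True
      then have "p + r \<in> slab" using C(2) by blast
      then have "c' < fst p + fst r" "fst p + fst r < B" using c'(2)[OF True] unfolding mem_Times_iff by auto
      then show ?thesis using that by (cases r) (auto simp: hk_st_def)
    qed (simp add: C(3))
    note kz = this
    show ?thesis unfolding bpot_def kconv_def kz by simp
  qed
  show ?thesis
  proof (rule test_functionsI)
    show "smooth_on UNIV (\<lambda>p. Y p * bpot \<Psi> p)" by (intro smooth_on_mult Y bpot_smooth[OF \<Psi>]) simp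
    show "compact ({c'..2 * B} \<times> cball (0 :: real^'n) (2 * \<rho>))" by (intro compact_Times) auto
    show "{c'..2 * B} \<times> cball 0 (2 * \<rho>) \<subseteq> upper" using c' by auto
    fix p assume "p \<notin> {c'..2 * B} \<times> cball (0 :: real^'n) (2 * \<rho>)"
    then have "fst p \<le> c' \<or> 2 * B \<le> fst p \<or> 2 * \<rho> < norm (snd p)" unfolding mem_Times_iff by auto
    then show "Y p * bpot \<Psi> p = 0" using z[of p] Y(2)[of p] by auto
  qed
qed

lemma cutoff_dderiv_0: "\<rho> > 0 \<Longrightarrow> 2 * \<rho> < norm (snd p) \<Longrightarrow> dderiv e (cutoff \<rho>) p = 0"
  and cutoff_dderiv2_0: "\<rho> > 0 \<Longrightarrow> 2 * \<rho> < norm (snd p) \<Longrightarrow> dderiv e' (dderiv e (cutoff \<rho>)) p = 0"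
proof -
  have o: "open {p::'n spacetime. 2 * \<rho> < norm (snd p)}" by (intro open_Collect_less continuous_intros)
  show 1: "dderiv e (cutoff \<rho>) p = 0" if "\<rho> > 0" "2 * \<rho> < norm (snd p)" for p e
    by (rule dderiv_zero_open[OF o]) (use that in \<open>auto intro: cutoff_0\<close>)
  show "dderiv e' (dderiv e (cutoff \<rho>)) p = 0" if "\<rho> > 0" "2 * \<rho> < norm (snd p)"
    by (rule dderiv_zero_open[OF o]) (use that 1 in auto)
qed

lemma cutoff_dderiv_time: "dderiv e_time (cutoff \<rho>) p = 0"
proof -
  have d: "ball_cutoff (0::real^'n) 1 differentiable at x" for x
    using smooth_on_differentiable[OF smooth_on_ball_cutoff] by simp
  have "dderiv e_time (cutoff \<rho>) p = dderiv ((1 / \<rho>) *\<^sub>R snd (e_time :: 'n spacetime)) (ball_cutoff 0 1) (0 + (1 / \<rho>) *\<^sub>R snd p)"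
    unfolding cutoff_def[abs_def] by (rule dderiv_eq[OF dderiv_compose_affine[OF cutoff_linear d]])
  then show ?thesis using linear_0[OF dderiv_linear[OF d]] by simp
qed

definition resid :: "'n spacetime \<Rightarrow> real" where
  "resid p = - us p - frob_inner A (D2u p)"

text \<open>This is \<open>P\<^sub>A\<close> applied to the product of the cutoff and \<open>u\<close>: all error terms carry a derivative of
  the cutoff.\<close>

definition cut_resid :: "real \<Rightarrow> 'n spacetime \<Rightarrow> real" where
  "cut_resid \<rho> p = cutoff \<rho> p * resid p - (\<Sum>k\<in>UNIV. \<Sum>l\<in>UNIV. A $ k $ l *
     (dderiv (e_space l) (cutoff \<rho>) p * Du p $ k + dderiv (e_space k) (cutoff \<rho>) p * Du p $ l +
      dderiv2 l k (cutoff \<rho>) p * u p))"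

text \<open>The Hessian is moved from \<open>u\<close> to \<psi>; the resulting second derivative of
  \<psi> is the operator d/ds - A : D^2 applied to its forward potential, and the derivatives are
  then moved back to \<open>u\<close>. As the potential is not compactly supported in space, the
  cutoff is inserted before the second move, which is why \<open>cut_resid\<close> appears instead
  of P_A u.\<close>

lemma duality_identity:
  assumes \<psi>: "\<psi> \<in> test_functions ({c<..<B} \<times> ball 0 R)" and \<rho>: "\<rho> > 0" "R \<le> \<rho>"
  shows "(LBINT p. indicat_real slab p * (D2u p $ i $ j * \<psi> p)) =
    (LBINT p. indicat_real slab p * (cut_resid \<rho> p * bpot (dderiv2 j i \<psi>) p))"
proof -
  define \<Psi> where "\<Psi> = dderiv2 j i \<psi>"
  define v where "v = bpot \<Psi>"
  let ?X = "cutoff \<rho>" and ?D = "\<lambda>k. dderiv (e_space k)"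
  let ?I = "\<lambda>U h. LBINT p. indicat_real slab p * (U p * h p)"
  have sub: "{c<..<B} \<times> ball 0 R \<subseteq> slab" "{c<..<B} \<times> ball 0 R \<subseteq> upper" by auto
  have \<psi>u: "\<psi> \<in> test_functions upper" by (rule test_functions_mono[OF sub(2) \<psi>])
  have \<Psi>0: "\<Psi> \<in> test_functions ({c<..<B} \<times> ball 0 R)" unfolding \<Psi>_def by (intro test_functions_dderiv \<psi>)
  have \<Psi>: "\<Psi> \<in> test_functions slab" by (rule test_functions_mono[OF sub(1) \<Psi>0])
  note L2u = in_L2(1,2) in_L2_component
  have Xs: "smooth_on UNIV ?X" by (rule cutoff_smooth)
  have vs: "smooth_on UNIV v" unfolding v_def by (rule bpot_smooth[OF \<Psi>])
  have df: "h differentiable at p" if "smooth_on UNIV h" for h and p :: "'n spacetime"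
    using smooth_on_differentiable[OF that] by simp
  have T: "(\<lambda>p. Y p * v p) \<in> test_functions upper"
    if "smooth_on UNIV Y" "\<And>p. 2 * \<rho> < norm (snd p) \<Longrightarrow> Y p = 0" for Y
    unfolding v_def by (rule bpot_times_test[OF \<Psi> that])
  \<comment> \<open>The product rule expresses the cutoff times the second derivatives of v through
    derivatives of \<eta>, \<theta>' and the undifferentiated \<xi>. All three are test functions on
    \<open>upper\<close>, so each derivative can be passed to \<open>u\<close>.\<close>
  define \<eta> where "\<eta> = (\<lambda>p. ?X p * v p)"
  define \<theta>' where "\<theta>' = (\<lambda>k p. ?D k ?X p * v p)"
  define \<xi> where "\<xi> = (\<lambda>l k p. ?D l (?D k ?X) p * v p)"
  have \<eta>: "\<eta> \<in> test_functions upper" unfolding \<eta>_def by (intro T Xs cutoff_0) (use \<rho> in auto)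
  have \<theta>': "\<theta>' k \<in> test_functions upper" for k unfolding \<theta>'_def by (intro T smooth_on_dderiv Xs cutoff_dderiv_0 \<rho>)
  have \<xi>: "\<xi> l k \<in> test_functions upper" for l k unfolding \<xi>_def by (intro T smooth_on_dderiv Xs cutoff_dderiv2_0 \<rho>)
  have D\<eta>: "dderiv e \<eta> p = ?X p * dderiv e v p + dderiv e ?X p * v p" for e p
    unfolding \<eta>_def by (rule dderiv_mult[OF df[OF Xs] df[OF vs]])
  have DD\<eta>: "?D k (?D l \<eta>) p = ?X p * ?D k (?D l v) p + ?D k ?X p * ?D l v p + ?D k (\<theta>' l) p" for k l p
  proof -
    have "?D l \<eta> = (\<lambda>p. ?X p * ?D l v p + \<theta>' l p)" by (rule ext) (simp add: D\<eta> \<theta>'_def)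
    then have "?D k (?D l \<eta>) p = ?D k (\<lambda>p. ?X p * ?D l v p) p + ?D k (\<theta>' l) p"
      by (simp only:) (intro dderiv_add df smooth_on_mult Xs smooth_on_dderiv vs open_UNIV test_functions_smooth[OF \<theta>'])
    then show ?thesis by (simp only: dderiv_mult[OF df[OF Xs] df[OF smooth_on_dderiv[OF vs]]])
  qed
  have D\<theta>: "?D l (\<theta>' k) p = ?D k ?X p * ?D l v p + \<xi> l k p" for k l p
    unfolding \<theta>'_def \<xi>_def by (rule dderiv_mult[OF df[OF smooth_on_dderiv[OF Xs]] df[OF vs]])
  have pw: "indicat_real slab p * (u p * \<Psi> p) = indicat_real slab p * (u p * dderiv e_time \<eta> p) -
     (\<Sum>k\<in>UNIV. \<Sum>l\<in>UNIV. A $ k $ l * (indicat_real slab p * (u p * ?D k (?D l \<eta>) p) - indicat_real slab p * (u p * ?D k (\<theta>' l) p)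
       - indicat_real slab p * (u p * ?D l (\<theta>' k) p) + indicat_real slab p * (u p * \<xi> l k p)))" for p
  proof (cases "p \<in> slab")
    case True
    \<comment> \<open>The cutoff equals 1 on the support of \<Psi>, since R <= \<rho>; inserting it
      changes nothing on the left-hand side.\<close>
    have "?X p * \<Psi> p = \<Psi> p"
    proof (cases "p \<in> {c<..<B} \<times> ball 0 R")
      case True
      then have "norm (snd p) \<le> \<rho>" using \<rho>(2) by auto
      then show ?thesis using cutoff_1[OF \<rho>(1)] by simp
    qed (simp add: test_functions_zero[OF \<Psi>0])
    moreover have "dderiv e_time v p - (\<Sum>k\<in>UNIV. \<Sum>l\<in>UNIV. A $ k $ l * ?D k (?D l v) p) = \<Psi> p"
      unfolding v_def bpot_def
    proof (rule backward_heat_identity[OF A_posdef _ \<Psi>])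
      show "B > 0" using c by simp
      show "\<Psi> (s, z) = 0" if "s \<le> fst p - B" for s z
        by (rule test_functions_zero[OF \<Psi>]) (use that True c(1) in auto)
    qed
    ultimately have "\<Psi> p = ?X p * (dderiv e_time v p - (\<Sum>k\<in>UNIV. \<Sum>l\<in>UNIV. A $ k $ l * ?D k (?D l v) p))" by simp
    also have "\<dots> = dderiv e_time \<eta> p - (\<Sum>k\<in>UNIV. \<Sum>l\<in>UNIV. A $ k $ l * (?X p * ?D k (?D l v) p))"
      by (simp add: D\<eta> cutoff_dderiv_time right_diff_distrib sum_distrib_left mult.left_commute)
    also have "\<dots> = dderiv e_time \<eta> p - (\<Sum>k\<in>UNIV. \<Sum>l\<in>UNIV. A $ k $ l * (?D k (?D l \<eta>) p - ?D k (\<theta>' l) p - ?D l (\<theta>' k) p + \<xi> l k p))"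
      by (simp add: DD\<eta> D\<theta>[of _ _ p, unfolded \<xi>_def] \<xi>_def)
    finally have \<Psi>eq: "\<Psi> p = \<dots>" .
    show ?thesis unfolding indicator_simps(1)[OF True] mult_1_left \<Psi>eq
      by (simp add: right_diff_distrib sum_distrib_left distrib_left mult_ac)
  qed simp
  have int: "integrable lborel (\<lambda>p. indicat_real slab p * (U p * h p))" if "U \<in> L2space slab w" "h \<in> test_functions upper" for U h
    by (rule slab_integrable[OF that(1) upper_test[OF that(2)]])
  note i = int[OF L2u(1) test_functions_dderiv[OF \<eta>]] int[OF L2u(1) test_functions_dderiv[OF test_functions_dderiv[OF \<eta>]]]
    int[OF L2u(1) test_functions_dderiv[OF \<theta>']] int[OF L2u(1) \<xi>]
  have ex: "?I u \<Psi> = ?I u (dderiv e_time \<eta>) - (\<Sum>k\<in>UNIV. \<Sum>l\<in>UNIV. A $ k $ l *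
      (?I u (?D k (?D l \<eta>)) - ?I u (?D k (\<theta>' l)) - ?I u (?D l (\<theta>' k)) + ?I u (\<xi> l k)))"
    unfolding pw using i by (simp add: integral_finite_sum)
  have ibp1: "?I u (?D k h) = - ?I (\<lambda>p. Du p $ k) h" if "h \<in> test_functions upper" for k h
    by (rule space_integration_by_parts[OF weak_derivs(1) L2u(1) L2u(3) that])
  have ibp2: "?I (\<lambda>p. Du p $ k) (?D l h) = - ?I (\<lambda>p. D2u p $ l $ k) h" if "h \<in> test_functions upper" for k l h
    by (rule space_integration_by_parts[OF weak_derivs(2) L2u(3) L2u(4) that])
  \<comment> \<open>The outer weak derivative, of index i, is transferred first, which explains the
    order of indices in \<open>dderiv2 j i\<close>.\<close>
  have lhs: "?I (\<lambda>p. D2u p $ i $ j) \<psi> = ?I u \<Psi>"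
    unfolding \<Psi>_def ibp1[OF test_functions_dderiv[OF \<psi>u]] ibp2[OF \<psi>u] by simp
  have "?I u \<Psi> = - ?I us \<eta> - (\<Sum>k\<in>UNIV. \<Sum>l\<in>UNIV. A $ k $ l *
      (?I (\<lambda>p. D2u p $ l $ k) \<eta> + ?I (\<lambda>p. Du p $ k) (\<theta>' l) + ?I (\<lambda>p. Du p $ l) (\<theta>' k) + ?I u (\<xi> l k)))"
    unfolding ex time_integration_by_parts[OF \<eta>] ibp1[OF test_functions_dderiv[OF \<eta>]] ibp1[OF \<theta>'] ibp2[OF \<eta>] by simp
  also have "\<dots> = (LBINT p. - (indicat_real slab p * (us p * \<eta> p)) - (\<Sum>k\<in>UNIV. \<Sum>l\<in>UNIV. A $ k $ l *
      (indicat_real slab p * (D2u p $ l $ k * \<eta> p) + indicat_real slab p * (Du p $ k * \<theta>' l p) +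
       indicat_real slab p * (Du p $ l * \<theta>' k p) + indicat_real slab p * (u p * \<xi> l k p))))"
    using int[OF L2u(2) \<eta>] int[OF L2u(4) \<eta>] int[OF L2u(3) \<theta>'] int[OF L2u(1) \<xi>]
    by (simp add: integral_finite_sum)
  also have "\<dots> = ?I (cut_resid \<rho>) v"
  proof (rule Bochner_Integration.integral_cong[OF refl])
    fix p
    \<comment> \<open>Integration by parts produced the entries of \<open>D2u\<close> with
      interchanged indices; the symmetry of \<open>A\<close> accounts for this in the
      contraction.\<close>
    have fr: "frob_inner A (D2u p) = (\<Sum>k\<in>UNIV. \<Sum>l\<in>UNIV. A $ k $ l * D2u p $ l $ k)"
    proof -
      have "symmetric_mat A" using A_posdef by (simp add: posdef_def)
      note sy = symmetric_mat_entry[OF this]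
      show ?thesis unfolding frob_inner_sum by (subst sum.swap) (intro sum.cong refl, subst sy, rule refl)
    qed
    have e: "cut_resid \<rho> p = - (?X p * us p) - (\<Sum>k\<in>UNIV. \<Sum>l\<in>UNIV. A $ k $ l *
       (D2u p $ l $ k * ?X p + Du p $ k * ?D l ?X p + Du p $ l * ?D k ?X p + u p * ?D l (?D k ?X) p))"
      unfolding cut_resid_def resid_def fr by (simp add: right_diff_distrib sum_distrib_left distrib_left mult_ac sum.distrib)
    show "- (indicat_real slab p * (us p * \<eta> p)) - (\<Sum>k\<in>UNIV. \<Sum>l\<in>UNIV. A $ k $ l *
      (indicat_real slab p * (D2u p $ l $ k * \<eta> p) + indicat_real slab p * (Du p $ k * \<theta>' l p) +
       indicat_real slab p * (Du p $ l * \<theta>' k p) + indicat_real slab p * (u p * \<xi> l k p))) =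
      indicat_real slab p * (cut_resid \<rho> p * v p)"
      unfolding e \<eta>_def \<theta>'_def \<xi>_def
      by (simp add: left_diff_distrib right_diff_distrib sum_distrib_left sum_distrib_right distrib_left distrib_right mult_ac sum.distrib)
  qed
  finally show ?thesis unfolding lhs by (simp only: v_def \<Psi>_def)
qed

text \<open>The counterpart of \<open>duality_identity\<close> for the potential of a test function.
  Both right-hand sides pair a source with the same forward potential, so convergence of the sources
  implies weak convergence of the Hessians.\<close>

lemma potential_duality:
  assumes f: "f \<in> test_functions \<Omega>" and \<psi>: "\<psi> \<in> test_functions \<Omega>'"
  shows "(LBINT p. hess_potential A B f p $ i $ j * \<psi> p) =
    (LBINT p. f p * bpot (dderiv2 j i \<psi>) p)"
proof -
  let ?D = "\<lambda>k. dderiv (e_space k)" and ?v = "kconv (\<lambda>r. hk_st A B (- r))"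
  note d = test_functions_dderiv[OF f]
  have sm: "smooth_on UNIV (?v h)" if "h \<in> test_functions \<Omega>'" for h by (rule smooth_on_kconv[OF bk_integrable that])
  have ibp: "(LBINT p. ?D k g p * ?v h p) = - (LBINT p. g p * ?v (?D k h) p)"
    if g: "g \<in> test_functions \<Omega>" and h: "h \<in> test_functions \<Omega>'" for g h k
  proof -
    obtain C where C: "compact C" "\<And>x. x \<notin> C \<Longrightarrow> g x = 0" using g by (metis test_functionsE)
    have "(LBINT p. g p * ?D k (?v h) p) = - (LBINT p. ?D k g p * ?v h p)"
      by (rule integration_by_parts_dderiv[OF _ _ _ _ C])
        (use smooth_on_differentiable[OF sm[OF h]] smooth_on_differentiable[OF test_functions_smooth[OF g]]
          dderiv_continuous[OF sm[OF h]] dderiv_continuous[OF test_functions_smooth[OF g]] in auto)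
    then show ?thesis by (simp add: kconv_dderiv[OF bk_integrable h])
  qed
  have "(LBINT p. hess_potential A B f p $ i $ j * \<psi> p) = (LBINT p. ?D i (?D j f) p * ?v \<psi> p)"
    unfolding hess_potential_def by (simp add: kconv_adjoint[OF hk_st_integrable[OF A_posdef] test_functions_dderiv[OF d] \<psi>])
  then show ?thesis
    by (simp add: ibp[OF d \<psi>] ibp[OF f test_functions_dderiv[OF \<psi>]] bpot_def)
qed

end

section \<open>Cut-off residuals and the bound for the Hessian\<close>

definition l2 :: "('x::euclidean_space \<Rightarrow> real) \<Rightarrow> bool" where
  "l2 f \<longleftrightarrow> f \<in> borel_measurable borel \<and> nrm f < \<infinity>"

lemma l2_add:
  assumes "l2 f" "l2 g"
  shows "l2 (\<lambda>x. f x + g x)"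
proof -
  have m: "f \<in> borel_measurable borel" "g \<in> borel_measurable borel" using assms by (auto simp: l2_def)
  have "nrm (\<lambda>x. f x + g x) \<le> nrm f + nrm g" using m by (intro nrm_triangle) auto
  also have "\<dots> < \<infinity>" using assms by (simp add: l2_def)
  finally show ?thesis using m by (simp add: l2_def)
qed

lemma l2_cmult: "l2 f \<Longrightarrow> l2 (\<lambda>x. c * f x)"
  using nrm_scaleR[of c f] by (auto simp: l2_def ennreal_mult_less_top)

lemma l2_abs: "l2 f \<Longrightarrow> l2 (\<lambda>x. \<bar>f x\<bar>)"
  using nrm_norm[of f] by (auto simp: l2_def)

lemma l2_sum: "(\<And>i. i \<in> I \<Longrightarrow> l2 (f i)) \<Longrightarrow> l2 (\<lambda>x. \<Sum>i\<in>I. f i x)"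
proof (induction I rule: infinite_finite_induct)
  case (insert i I)
  then show ?case using l2_add[of "f i" "\<lambda>x. \<Sum>i\<in>I. f i x"] by simp
qed (auto simp: l2_def)

lemma nrm_bounded_mult:
  fixes f Y :: "'x::euclidean_space \<Rightarrow> real"
  assumes "\<And>x. \<bar>Y x\<bar> \<le> K"
  shows "nrm (\<lambda>x. Y x * f x) \<le> ennreal K * nrm f"
proof -
  have K: "0 \<le> K" using assms[of undefined] by linarith
  have "nrm (\<lambda>x. Y x * f x) \<le> nrm (\<lambda>x. K *\<^sub>R f x)"
    by (rule nrm_mono) (use K in \<open>simp add: abs_mult mult_right_mono assms\<close>)
  then show ?thesis using K by (simp only: nrm_scaleR abs_of_nonneg)
qed

lemma matrix_Basis_cases:
  assumes "b \<in> (Basis :: 'n::finite mat set)"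
  obtains l m where "\<And>X. X \<bullet> b = X $ l $ m"
  using assms by (auto simp: Basis_vec_def inner_axis)

lemma sandwich_entry:
  fixes R X :: "'n::finite mat"
  shows "(R ** X ** R) $ l $ m = (\<Sum>i\<in>UNIV. \<Sum>j\<in>UNIV. R $ l $ i * R $ j $ m * X $ i $ j)"
  unfolding matrix_matrix_mult_def
  by (simp add: sum_distrib_right) (subst sum.swap, simp add: mult_ac)

context W0_element
begin

abbreviation wt :: "('n spacetime \<Rightarrow> real) \<Rightarrow> 'n spacetime \<Rightarrow> real" where
  "wt U \<equiv> \<lambda>p. indicat_real slab p * (sqrt (w p) * U p)"

lemma wt_l2: "U \<in> L2space slab w \<Longrightarrow> l2 (wt U)"
  using weighted by (simp add: l2_def)

lemma wt_resid_l2: "l2 (wt resid)"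
proof -
  have e: "wt resid p = (- 1) * wt us p + (- 1) * (\<Sum>k\<in>UNIV. \<Sum>l\<in>UNIV. A $ k $ l * wt (\<lambda>p. D2u p $ k $ l) p)" for p
    by (simp add: resid_def frob_inner_sum right_diff_distrib sum_distrib_left sum_negf mult_ac)
  show ?thesis unfolding e by (intro l2_add l2_cmult l2_sum wt_l2 in_L2 in_L2_component)
qed

text \<open>Every error term has a derivative of the cutoff, of size K / \<rho>, times
  \<open>u\<close> or an entry of \<open>Du\<close>. Since these lie in the weighted space, the
  errors are bounded by 1/\<rho> times a number \<open>M\<close> that does not depend on
  \<rho>.\<close>

lemma cut_resid_bound:
  obtains M where "M < \<infinity>" "\<And>\<rho>. \<rho> \<ge> 1 \<Longrightarrow> nrm (wt (cut_resid \<rho>)) \<le> nrm (wt resid) + ennreal (1 / \<rho>) * M"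
    "\<And>\<rho>. \<rho> \<ge> 1 \<Longrightarrow> l2 (wt (cut_resid \<rho>))"
proof -
  obtain K where K: "K > 0" "\<And>\<rho> j p. \<rho> \<ge> 1 \<Longrightarrow> \<bar>dderiv (e_space j) (cutoff \<rho>) p\<bar> \<le> K / \<rho>"
    "\<And>\<rho> i j p. \<rho> \<ge> 1 \<Longrightarrow> \<bar>dderiv2 i j (cutoff \<rho>) p\<bar> \<le> K / \<rho>"
    by (rule cutoff_dderiv_bounded) (rule that)
  let ?D = "\<lambda>k. wt (\<lambda>p. Du p $ k)"
  define S where "S p = (\<Sum>k\<in>UNIV. \<Sum>l\<in>UNIV. \<bar>A $ k $ l\<bar> * ((\<bar>?D k p\<bar> + \<bar>?D l p\<bar>) + \<bar>wt u p\<bar>))" for p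
  have S: "l2 S" unfolding S_def[abs_def] by (intro l2_add l2_cmult l2_sum l2_abs wt_l2 in_L2 in_L2_component)
  define M where "M = ennreal K * nrm S"
  have M: "M < \<infinity>" using S by (simp add: M_def l2_def ennreal_mult_less_top)
  have est: "nrm (wt (cut_resid \<rho>)) \<le> nrm (wt resid) + ennreal (1 / \<rho>) * M \<and> l2 (wt (cut_resid \<rho>))" if \<rho>: "\<rho> \<ge> 1" for \<rho>
  proof -
    let ?X = "cutoff \<rho>"
    define E where "E p = (\<Sum>k\<in>UNIV. \<Sum>l\<in>UNIV. A $ k $ l * ((dderiv (e_space l) ?X p * ?D k p + dderiv (e_space k) ?X p * ?D l p) +
      dderiv2 l k ?X p * wt u p))" for p
    have e: "wt (cut_resid \<rho>) p = ?X p * wt resid p + - E p" for p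
      unfolding cut_resid_def E_def
      by (simp add: right_diff_distrib sum_distrib_left distrib_left mult_ac)
    have bd: "norm (E p) \<le> norm ((K / \<rho>) *\<^sub>R S p)" for p
    proof -
      have t: "\<bar>A $ k $ l * ((dderiv (e_space l) ?X p * ?D k p + dderiv (e_space k) ?X p * ?D l p) +
          dderiv2 l k ?X p * wt u p)\<bar> \<le> K / \<rho> * (\<bar>A $ k $ l\<bar> * ((\<bar>?D k p\<bar> + \<bar>?D l p\<bar>) + \<bar>wt u p\<bar>))" for k l
      proof -
        have m: "\<bar>y * x\<bar> \<le> K / \<rho> * \<bar>x\<bar>" if "\<bar>y\<bar> \<le> K / \<rho>" for x y
          unfolding abs_mult by (rule mult_right_mono[OF that]) simp
        have "\<bar>(dderiv (e_space l) ?X p * ?D k p + dderiv (e_space k) ?X p * ?D l p) +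
          dderiv2 l k ?X p * wt u p\<bar> \<le> (K / \<rho> * \<bar>?D k p\<bar> + K / \<rho> * \<bar>?D l p\<bar>) + K / \<rho> * \<bar>wt u p\<bar>"
          by (intro order_trans[OF abs_triangle_ineq] add_mono m K \<rho>)
        from mult_left_mono[OF this abs_ge_zero[of "A $ k $ l"]] show ?thesis
          unfolding abs_mult[of "A $ k $ l"] by (simp only: distrib_left mult.left_commute)
      qed
      have "\<bar>E p\<bar> \<le> (\<Sum>k\<in>UNIV. \<Sum>l\<in>UNIV. K / \<rho> * (\<bar>A $ k $ l\<bar> * ((\<bar>?D k p\<bar> + \<bar>?D l p\<bar>) + \<bar>wt u p\<bar>)))"
        unfolding E_def by (intro order_trans[OF sum_abs] sum_mono t)
      also have "\<dots> = (K / \<rho>) * S p" by (simp only: S_def sum_distrib_left)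
      also have "\<dots> \<le> \<bar>(K / \<rho>) * S p\<bar>" by (rule abs_ge_self)
      finally show ?thesis by simp
    qed
    have mX: "?X \<in> borel_measurable borel" "dderiv d ?X \<in> borel_measurable borel" "dderiv d' (dderiv d ?X) \<in> borel_measurable borel" for d d'
      by (intro borel_measurable_continuous_onI smooth_on_continuous smooth_on_dderiv cutoff_smooth)+
    have mE: "E \<in> borel_measurable borel"
      unfolding E_def[abs_def]
      by (intro borel_measurable_sum borel_measurable_times borel_measurable_add borel_measurable_const mX weighted(1)[OF in_L2(1)] weighted(1)[OF in_L2_component(1)])
    have mR: "(\<lambda>p. ?X p * wt resid p) \<in> borel_measurable borel"
      by (rule borel_measurable_times[OF mX(1) conjunct1[OF wt_resid_l2[unfolded l2_def]]])
    have "nrm (wt (cut_resid \<rho>)) = nrm (\<lambda>p. ?X p * wt resid p + - E p)" by (simp only: e)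
    also have "\<dots> \<le> nrm (\<lambda>p. ?X p * wt resid p) + nrm (\<lambda>p. - E p)"
      by (rule nrm_triangle) (use mR mE in measurable)
    also have "\<dots> \<le> ennreal 1 * nrm (wt resid) + nrm (\<lambda>p. (K / \<rho>) *\<^sub>R S p)"
      unfolding nrm_minus by (intro add_mono nrm_bounded_mult cutoff_bounds nrm_mono bd)
    also have "\<dots> = nrm (wt resid) + ennreal (1 / \<rho>) * M"
    proof -
      have "ennreal \<bar>K / \<rho>\<bar> = ennreal (1 / \<rho>) * ennreal K"
        using K(1) \<rho> by (subst ennreal_mult[symmetric]) auto
      then show ?thesis unfolding nrm_scaleR M_def by (simp add: mult.assoc)
    qed
    finally have le: "nrm (wt (cut_resid \<rho>)) \<le> nrm (wt resid) + ennreal (1 / \<rho>) * M" .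
    also have "\<dots> < \<infinity>" using M wt_resid_l2 by (simp add: l2_def ennreal_mult_less_top)
    finally have "nrm (wt (cut_resid \<rho>)) < \<infinity>" .
    moreover have "wt (cut_resid \<rho>) \<in> borel_measurable borel"
      unfolding e by (intro borel_measurable_add mR borel_measurable_uminus mE)
    ultimately show ?thesis using le by (simp add: l2_def)
  qed
  show ?thesis by (rule that[OF M]) (use est in blast)+
qed

abbreviation hess_q :: "'n spacetime \<Rightarrow> 'n mat" where
  "hess_q p \<equiv> matrix_sqrt q ** D2u p ** matrix_sqrt q"

abbreviation wt_hess :: "'n spacetime \<Rightarrow> 'n mat" where
  "wt_hess p \<equiv> indicat_real slab p *\<^sub>R (sqrt (w p) *\<^sub>R hess_q p)"

lemma hess_q_measurable: "wt_hess \<in> borel_measurable borel"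
  and hess_q_nrm: "nrm wt_hess < \<infinity>"
proof -
  let ?L = "\<lambda>X. matrix_sqrt q ** X ** matrix_sqrt q"
  have L: "bounded_linear ?L" by (rule bounded_linear_sandwich)
  note Lin = bounded_linear.linear[OF L]
  have s: "(\<lambda>p. indicat_real slab p *\<^sub>R sqrt (w p)) \<in> borel_measurable borel"
    by (intro borel_measurable_continuous_on_indicator slab_borel
        continuous_on_subset[OF smooth_on_continuous[OF smooth_on_sqrt_weight(1)[OF heat]]])
      (use c in auto)
  have "(\<lambda>p. (indicat_real slab p *\<^sub>R sqrt (w p)) *\<^sub>R ?L (indicat_real slab p *\<^sub>R D2u p)) \<in> borel_measurable borel"
    by (intro borel_measurable_scaleR s measurable_compose[OF L2space_indicator_measurable[OF in_L2(4)]]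
        borel_measurable_continuous_onI linear_continuous_on L)
  moreover have "(indicat_real slab p *\<^sub>R sqrt (w p)) *\<^sub>R ?L (indicat_real slab p *\<^sub>R D2u p) = wt_hess p" for p
    unfolding linear_cmul[OF Lin] by (simp add: indicator_def)
  ultimately show "wt_hess \<in> borel_measurable borel" by (simp only:)
  obtain K where K: "K > 0" "\<And>X. norm (?L X) \<le> norm X * K" using bounded_linear.pos_bounded[OF L] by blast
  have "nrm wt_hess \<le> nrm (\<lambda>p. K *\<^sub>R (indicat_real slab p *\<^sub>R (sqrt (w p) *\<^sub>R D2u p)))"
  proof (rule nrm_mono)
    fix p
    show "norm (wt_hess p) \<le> norm (K *\<^sub>R (indicat_real slab p *\<^sub>R (sqrt (w p) *\<^sub>R D2u p)))"
    proof (cases "p \<in> slab")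
      case True
      have "sqrt (w p) * norm (hess_q p) \<le> sqrt (w p) * (norm (D2u p) * K)"
        by (intro mult_left_mono K) (use w_pos[OF True] in auto)
      then show ?thesis using True w_pos[OF True] K(1) by (simp add: mult_ac)
    qed simp
  qed
  also have "\<dots> = ennreal \<bar>K\<bar> * L2norm slab w D2u"
    unfolding nrm_scaleR by (subst L2norm_eq_nrm) (use w_pos in \<open>auto intro: less_imp_le\<close>)
  also have "\<dots> < \<infinity>" using in_L2(4) by (simp add: L2space_def ennreal_mult_less_top)
  finally show "nrm wt_hess < \<infinity>" .
qed

text \<open>The weighted cut-off residual is approximated in L^2 by test functions \<phi> n, whose
  images under the operator are bounded by N times their norms. By the two duality formulas these
  images converge weakly on the smaller cylinder to the weighted Hessian of \<open>u\<close>, and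
  the bound passes to the weak limit. Uniqueness for the heat equation is never invoked.\<close>

lemma local_hessian_bound:
  assumes N: "N < \<infinity>" and Nb: "\<And>g. g \<in> test_functions Qdom \<Longrightarrow>
      nrm (\<lambda>p. indicat_real Qdom p *\<^sub>R heat_op \<alpha> (\<theta>, a, A, q) g p) \<le> N * nrm g"
    and \<rho>: "\<rho> \<ge> 1" "R \<le> \<rho>"
  shows "nrm (\<lambda>p. indicat_real ({c<..<B} \<times> ball 0 R) p *\<^sub>R (sqrt (w p) *\<^sub>R hess_q p)) \<le> N * nrm (wt (cut_resid \<rho>))"
proof -
  \<comment> \<open>The radius of \<open>?V\<close> exceeds 2 \<rho>, beyond which the cutoff and
    its derivatives vanish, so the open set \<open>?V\<close> carries the residual on the slab. On
    \<open>?O\<close> the cutoff is 1.\<close>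
  let ?O = "{c<..<B} \<times> ball (0 :: real^'n) R" and ?V = "{c<..<B} \<times> ball (0 :: real^'n) (2 * \<rho> + 1)"
  let ?H = "(\<theta>, a, A, q)" and ?g = "wt (cut_resid \<rho>)" and ?R = "matrix_sqrt q"
  have \<rho>0: "\<rho> > 0" using \<rho> by simp
  have l2g: "l2 ?g" by (rule cut_resid_bound) (use \<rho> in blast)
  then have gm: "?g \<in> borel_measurable borel" and gfin: "nrm ?g < \<infinity>" by (auto simp: l2_def)
  have open': "open ?O" "open ?V" by (intro open_Times open_ball open_greaterThanLessThan)+
  have Ob: "?O \<in> sets borel" "?V \<in> sets borel" using open' by auto
  have sub: "?O \<subseteq> slab" "?V \<subseteq> slab" "?O \<subseteq> Qdom" "?V \<subseteq> Qdom" using c by auto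
  have cr0: "cut_resid \<rho> p = 0" if "p \<in> slab" "p \<notin> ?V" for p
  proof -
    have "2 * \<rho> < norm (snd p)" using that unfolding mem_Times_iff by auto
    then show ?thesis by (simp add: cut_resid_def cutoff_0 cutoff_dderiv_0 cutoff_dderiv2_0 \<rho>0)
  qed
  have g0: "?g p = 0" if "p \<notin> ?V" for p using cr0[OF _ that] by (cases "p \<in> slab") simp_all
  obtain \<phi> where \<phi>: "\<And>n. \<phi> n \<in> test_functions ?V" "\<And>n. nrm (\<lambda>x. \<phi> n x - ?g x) < ennreal ((1 / 2) ^ n)"
    by (rule test_functions_dense_sequence[OF open'(2) gm gfin]) (rule g0, assumption, rule that)
  have \<phi>Q: "\<phi> n \<in> test_functions Qdom" for n by (rule test_functions_mono[OF sub(4) \<phi>(1)])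
  have \<phi>m: "\<phi> n \<in> borel_measurable borel" for n by (rule test_functions_measurable[OF \<phi>(1)])
  have \<phi>B: "\<phi> n (s, z) = 0" if "s \<ge> B" for n s z
    by (rule test_functions_zero[OF \<phi>(1)]) (use that in auto)
  define f where "f n = unweight \<alpha> ?H (\<phi> n)" for n
  have f: "f n \<in> test_functions Qdom" for n unfolding f_def by (rule unweight_test_function[OF heat \<phi>Q])
  have T: "heat_op \<alpha> ?H (\<phi> n) p = sqrt (w p) *\<^sub>R (?R ** hess_potential A B (f n) p ** ?R)" if "p \<in> Qdom" for n p
    unfolding f_def by (rule heat_op_test_function[OF heat \<phi>Q \<phi>B that])
  have d0: "(\<lambda>n. nrm (\<lambda>x. \<phi> n x - ?g x)) \<longlonglongrightarrow> 0"
    by (rule tendsto_0_geometric) (rule less_imp_le[OF \<phi>(2)])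
  define F where "F n p = indicat_real ?O p *\<^sub>R heat_op \<alpha> ?H (\<phi> n) p" for n p
  have Fm: "F n \<in> borel_measurable borel" for n
  proof -
    have "(\<lambda>p. indicat_real ?O p *\<^sub>R (indicat_real Qdom p *\<^sub>R heat_op \<alpha> ?H (\<phi> n) p)) \<in> borel_measurable borel"
      by (intro borel_measurable_scaleR heat_op_measurable[OF heat \<phi>Q] borel_measurable_indicator Ob)
    moreover have "indicat_real ?O p *\<^sub>R (indicat_real Qdom p *\<^sub>R heat_op \<alpha> ?H (\<phi> n) p) = F n p" for p
      using sub(3) unfolding F_def by (auto simp: indicator_def)
    ultimately show ?thesis by (simp only: F_def[abs_def])
  qed
  have F1: "nrm (F n) \<le> N * nrm (\<phi> n)" for n
  proof (rule order_trans[OF nrm_mono Nb[OF \<phi>Q]])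
    fix p show "norm (F n p) \<le> norm (indicat_real Qdom p *\<^sub>R heat_op \<alpha> ?H (\<phi> n) p)"
      using sub(3) unfolding F_def by (cases "p \<in> ?O") (auto simp: indicator_def)
  qed
  have F2: "nrm (F n) \<le> N * (nrm (\<lambda>x. \<phi> n x - ?g x) + nrm ?g)" for n
  proof -
    have "nrm (\<lambda>x. (\<phi> n x - ?g x) + ?g x) \<le> nrm (\<lambda>x. \<phi> n x - ?g x) + nrm ?g"
      by (rule nrm_triangle) (use \<phi>m gm in measurable)
    then have "nrm (\<phi> n) \<le> nrm (\<lambda>x. \<phi> n x - ?g x) + nrm ?g" by simp
    from order_trans[OF F1 mult_left_mono[OF this]] show ?thesis by simp
  qed
  have Ffin: "nrm (F n) < \<infinity>" for n
    by (rule le_less_trans[OF F1]) (use N nrm_test_function_finite[OF \<phi>Q] in \<open>simp add: ennreal_mult_less_top\<close>)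
  define G where "G p = indicat_real ?O p *\<^sub>R (sqrt (w p) *\<^sub>R hess_q p)" for p
  have GO: "G p = indicat_real ?O p *\<^sub>R wt_hess p" for p
    using sub(1) unfolding G_def by (auto simp: indicator_def)
  have Gm: "G \<in> borel_measurable borel"
    unfolding GO[abs_def] by (intro borel_measurable_scaleR hess_q_measurable borel_measurable_indicator Ob)
  have Gfin: "nrm G < \<infinity>"
    by (rule le_less_trans[OF nrm_mono hess_q_nrm]) (simp add: GO indicator_def)
  have "nrm G \<le> N * (0 + nrm ?g)"
  proof (rule nrm_weak_lower_semicontinuous[OF open'(1) Fm Gm _ Ffin Gfin _ F2])
    show "G x = 0" if "x \<notin> ?O" for x using that by (simp add: G_def)
    show "(\<lambda>n. N * (nrm (\<lambda>x. \<phi> n x - ?g x) + nrm ?g)) \<longlonglongrightarrow> N * (0 + nrm ?g)"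
      using N gfin by (intro tendsto_mult_ennreal tendsto_add tendsto_const d0) auto
    show "N * (0 + nrm ?g) < \<infinity>" using N gfin by (simp add: ennreal_mult_less_top)
    fix b :: "'n mat" and \<omega> assume b: "b \<in> Basis" and \<omega>: "\<omega> \<in> test_functions ?O"
    obtain l m where lm: "\<And>X. X \<bullet> b = X $ l $ m" by (rule matrix_Basis_cases[OF b]) (rule that)
    \<comment> \<open>The weight is absorbed into the test function, which makes the pairings
      unweighted and fit for the duality formulas.\<close>
    define \<psi> where "\<psi> p = sqrt (w p) * \<omega> p" for p
    have \<psi>: "\<psi> \<in> test_functions ?O"
      unfolding \<psi>_def[abs_def]
      by (rule test_functions_mult_smooth_on[OF \<omega> open'(1) smooth_on_subset[OF smooth_on_sqrt_weight(1)[OF heat]]]) (use sub open' in auto)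
    have o0: "\<omega> p = 0" "\<psi> p = 0" if "p \<notin> ?O" for p
      using test_functions_zero[OF \<omega> that] test_functions_zero[OF \<psi> that] by auto
    let ?v = "\<lambda>i j. bpot (dderiv2 j i \<psi>)"
    have FE: "(F n p \<bullet> b) * \<omega> p = (\<Sum>i\<in>UNIV. \<Sum>j\<in>UNIV. ?R $ l $ i * ?R $ j $ m * (hess_potential A B (f n) p $ i $ j * \<psi> p))" for n p
    proof (cases "p \<in> ?O")
      case True
      then have pQ: "p \<in> Qdom" using sub(3) by blast
      show ?thesis unfolding lm F_def T[OF pQ] indicator_simps(1)[OF True] \<psi>_def
        by (simp add: sandwich_entry sum_distrib_left sum_distrib_right mult_ac)
    qed (simp add: o0)
    have GE: "(G p \<bullet> b) * \<omega> p = (\<Sum>i\<in>UNIV. \<Sum>j\<in>UNIV. ?R $ l $ i * ?R $ j $ m * (indicat_real slab p * (D2u p $ i $ j * \<psi> p)))" for p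
    proof (cases "p \<in> ?O")
      case True
      then have pS: "p \<in> slab" using sub(1) by blast
      show ?thesis unfolding lm G_def indicator_simps(1)[OF True] indicator_simps(1)[OF pS] \<psi>_def
        by (simp add: sandwich_entry sum_distrib_left sum_distrib_right mult_ac)
    qed (simp add: o0)
    have iF: "integrable lborel (\<lambda>p. hess_potential A B (f n) p $ i $ j * \<psi> p)" for n i j
    proof -
      have "smooth_on UNIV (kconv (hk_st A B) (dderiv2 i j (f n)))"
        by (rule smooth_on_kconv[OF hk_st_integrable[OF A_posdef] test_functions_dderiv[OF test_functions_dderiv[OF f]]])
      then have "(\<lambda>p. kconv (hk_st A B) (dderiv2 i j (f n)) p * \<psi> p) \<in> test_functions UNIV"
        using test_functions_mono[OF _ \<psi>, of UNIV] by (intro test_functions_mult_smooth_on) auto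
      then show ?thesis unfolding hess_potential_def by (simp add: test_functions_integrable)
    qed
    have iG: "integrable lborel (\<lambda>p. indicat_real slab p * (D2u p $ i $ j * \<psi> p))" for i j
      by (rule slab_integrable[OF in_L2_component(2) test_functions_mono[OF sub(3) \<psi>]])
    have lim: "(\<lambda>n. LBINT p. hess_potential A B (f n) p $ i $ j * \<psi> p) \<longlonglongrightarrow>
        (LBINT p. indicat_real slab p * (D2u p $ i $ j * \<psi> p))" for i j
    proof -
      \<comment> \<open>The dual function with the weight moved onto it: \<phi> n times
        \<open>h\<close> is \<open>f n\<close> times the forward potential. Restricting to the
        bounded set \<open>?V\<close>, whose times stay above c > 0, makes \<open>h\<close> square
        integrable.\<close>
      define h where "h p = indicat_real ?V p * (1 / sqrt (w p) * ?v i j p)" for p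
      have vs: "smooth_on UNIV (?v i j)"
        by (rule bpot_smooth[OF test_functions_dderiv[OF test_functions_dderiv[OF \<psi>]]])
      have hc: "continuous_on Qdom (\<lambda>p. 1 / sqrt (w p) * ?v i j p)"
        by (intro continuous_on_mult smooth_on_continuous[OF smooth_on_sqrt_weight(2)[OF heat]]
            continuous_on_subset[OF smooth_on_continuous[OF vs]]) auto
      have "(\<lambda>p. indicat_real ?V p *\<^sub>R (1 / sqrt (w p) * ?v i j p)) \<in> borel_measurable borel"
        by (intro borel_measurable_continuous_on_indicator Ob continuous_on_subset[OF hc] sub)
      then have hm: "h \<in> borel_measurable borel" by (simp add: h_def[abs_def])
      have hfin: "nrm h < \<infinity>"
        unfolding h_def[abs_def]
      proof (rule nrm_continuous_compact)
        show "compact ({c..B} \<times> cball (0 :: real^'n) (2 * \<rho> + 1))" by (intro compact_Times) auto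
        show "continuous_on ({c..B} \<times> cball 0 (2 * \<rho> + 1)) (\<lambda>p. 1 / sqrt (w p) * ?v i j p)"
          by (rule continuous_on_subset[OF hc]) (use c in auto)
        show "?V \<subseteq> {c..B} \<times> cball 0 (2 * \<rho> + 1)" by auto
      qed
      have "(\<lambda>n. LBINT p. \<phi> n p * h p) \<longlonglongrightarrow> (LBINT p. ?g p * h p)"
        by (rule tendsto_integral_mult_nrm[OF \<phi>m gm hm nrm_test_function_finite[OF \<phi>(1)] gfin hfin d0])
      moreover have "(LBINT p. \<phi> n p * h p) = (LBINT p. hess_potential A B (f n) p $ i $ j * \<psi> p)" for n
      proof -
        have "\<phi> n p * h p = f n p * ?v i j p" for p
          using test_functions_zero[OF \<phi>(1), of p n] by (cases "p \<in> ?V") (simp_all add: h_def f_def unweight_def)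
        then show ?thesis unfolding potential_duality[OF f \<psi>] by (simp only:)
      qed
      moreover have "(LBINT p. ?g p * h p) = (LBINT p. indicat_real slab p * (D2u p $ i $ j * \<psi> p))"
      proof -
        have "?g p * h p = indicat_real slab p * (cut_resid \<rho> p * ?v i j p)" for p
        proof (cases "p \<in> ?V")
          case True
          then have pS: "p \<in> slab" using sub(2) by blast
          show ?thesis unfolding h_def indicator_simps(1)[OF True] indicator_simps(1)[OF pS] using w_pos[OF pS] by simp
        next
          case False
          then show ?thesis using cr0[OF _ False] g0[OF False] by (cases "p \<in> slab") simp_all
        qed
        then show ?thesis unfolding duality_identity[OF \<psi> \<rho>0 \<rho>(2)] by (simp only:)
      qed
      ultimately show ?thesis by (simp only:)
    qed
    have "(LBINT p. (F n p \<bullet> b) * \<omega> p) = (\<Sum>i\<in>UNIV. \<Sum>j\<in>UNIV. ?R $ l $ i * ?R $ j $ m * (LBINT p. hess_potential A B (f n) p $ i $ j * \<psi> p))" for n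
      unfolding FE using iF by (simp add: integral_finite_sum)
    moreover have "(LBINT p. (G p \<bullet> b) * \<omega> p) = (\<Sum>i\<in>UNIV. \<Sum>j\<in>UNIV. ?R $ l $ i * ?R $ j $ m * (LBINT p. indicat_real slab p * (D2u p $ i $ j * \<psi> p)))"
      unfolding GE using iG by (simp add: integral_finite_sum)
    moreover have "(\<lambda>n. \<Sum>i\<in>UNIV. \<Sum>j\<in>UNIV. ?R $ l $ i * ?R $ j $ m * (LBINT p. hess_potential A B (f n) p $ i $ j * \<psi> p)) \<longlonglongrightarrow>
        (\<Sum>i\<in>UNIV. \<Sum>j\<in>UNIV. ?R $ l $ i * ?R $ j $ m * (LBINT p. indicat_real slab p * (D2u p $ i $ j * \<psi> p)))"
      by (intro tendsto_sum tendsto_mult tendsto_const lim)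
    ultimately show "(\<lambda>n. LBINT p. (F n p \<bullet> b) * \<omega> p) \<longlonglongrightarrow> (LBINT p. (G p \<bullet> b) * \<omega> p)" by (simp only:)
  qed
  then show ?thesis by (simp add: G_def[abs_def])
qed

text \<open>Two limits in turn: on a fixed ball the cutoff radius tends to infinity and removes the
  error term; then the balls exhaust space and Fatou's lemma gives the global bound.\<close>

lemma hessian_quotient_bound:
  assumes N: "N < \<infinity>" and Nb: "\<And>g. g \<in> test_functions Qdom \<Longrightarrow>
      nrm (\<lambda>p. indicat_real Qdom p *\<^sub>R heat_op \<alpha> (\<theta>, a, A, q) g p) \<le> N * nrm g"
  shows "L2norm slab w hess_q / L2norm slab w (\<lambda>p. - us p - frob_inner A (D2u p)) \<le> N"
proof -
  have w0: "0 \<le> w p" if "p \<in> slab" for p using w_pos[OF that] by simp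
  have e1: "L2norm slab w hess_q = nrm wt_hess"
    by (rule L2norm_eq_nrm) (erule w0)
  have "L2norm slab w (\<lambda>p. - us p - frob_inner A (D2u p)) = nrm (\<lambda>p. indicat_real slab p *\<^sub>R (sqrt (w p) *\<^sub>R (- us p - frob_inner A (D2u p))))"
    by (rule L2norm_eq_nrm) (erule w0)
  also have "\<dots> = nrm (wt resid)" by (simp only: resid_def real_scaleR_def)
  finally have e2: "L2norm slab w (\<lambda>p. - us p - frob_inner A (D2u p)) = nrm (wt resid)" .
  obtain M where M: "M < \<infinity>" "\<And>\<rho>. \<rho> \<ge> 1 \<Longrightarrow> nrm (wt (cut_resid \<rho>)) \<le> nrm (wt resid) + ennreal (1 / \<rho>) * M"
    by (rule cut_resid_bound) (rule that)
  have rfin: "nrm (wt resid) < \<infinity>" using wt_resid_l2 by (simp add: l2_def)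
  have loc: "nrm (\<lambda>p. indicat_real ({c<..<B} \<times> ball 0 (real k)) p *\<^sub>R (sqrt (w p) *\<^sub>R hess_q p)) \<le> N * nrm (wt resid)" for k :: nat
  proof -
    have "nrm (\<lambda>p. indicat_real ({c<..<B} \<times> ball 0 (real k)) p *\<^sub>R (sqrt (w p) *\<^sub>R hess_q p)) \<le>
        N * (nrm (wt resid) + ennreal (1 / (1 + real k + real n)) * M)" for n
      \<comment> \<open>The radius 1 + k + n is at least 1 and at least the radius k of the ball,
        and it tends to infinity with n.\<close>
      by (rule order_trans[OF local_hessian_bound[OF N Nb, of "1 + real k + real n"] mult_left_mono[OF M(2)]]) auto
    moreover have "(\<lambda>n. N * (nrm (wt resid) + ennreal (1 / (1 + real k + real n)) * M)) \<longlonglongrightarrow> N * (nrm (wt resid) + ennreal 0 * M)"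
    proof -
      have "(\<lambda>n. 1 / (1 + real k + real n)) \<longlonglongrightarrow> 0" by real_asymp
      then have "(\<lambda>n. ennreal (1 / (1 + real k + real n))) \<longlonglongrightarrow> ennreal 0" by (intro tendsto_ennrealI)
      then show ?thesis using N M(1) rfin
        by (intro tendsto_mult_ennreal tendsto_add tendsto_const) auto
    qed
    ultimately have "nrm (\<lambda>p. indicat_real ({c<..<B} \<times> ball 0 (real k)) p *\<^sub>R (sqrt (w p) *\<^sub>R hess_q p)) \<le> N * (nrm (wt resid) + ennreal 0 * M)"
      by (intro LIMSEQ_le_const) auto
    then show ?thesis by simp
  qed
  have "nrm wt_hess \<le> N * nrm (wt resid)"
  proof (rule nrm_liminf[OF _ _ loc])
    fix k :: nat
    let ?O = "{c<..<B} \<times> ball (0 :: real^'n) (real k)"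
    have "(\<lambda>p. indicat_real ?O p *\<^sub>R wt_hess p) \<in> borel_measurable borel"
      by (intro borel_measurable_scaleR hess_q_measurable borel_measurable_indicator borel_open open_Times) auto
    moreover have "indicat_real ?O p *\<^sub>R wt_hess p = indicat_real ?O p *\<^sub>R (sqrt (w p) *\<^sub>R hess_q p)" for p
      by (auto simp: indicator_def)
    ultimately show "(\<lambda>p. indicat_real ?O p *\<^sub>R (sqrt (w p) *\<^sub>R hess_q p)) \<in> borel_measurable borel" by (simp only:)
  next
    show "AE p in lborel. (\<lambda>k. indicat_real ({c<..<B} \<times> ball (0 :: real^'n) (real k)) p *\<^sub>R (sqrt (w p) *\<^sub>R hess_q p)) \<longlonglongrightarrow>
      wt_hess p"
    proof (intro AE_I2 tendsto_eventually)
      fix p :: "'n spacetime"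
      have "\<forall>\<^sub>F k in sequentially. norm (snd p) < real k"
        using filterlim_at_top_dense[THEN iffD1, OF filterlim_real_sequentially] by blast
      then show "\<forall>\<^sub>F k in sequentially. indicat_real ({c<..<B} \<times> ball (0 :: real^'n) (real k)) p *\<^sub>R (sqrt (w p) *\<^sub>R hess_q p) =
          wt_hess p"
        by eventually_elim (auto simp: indicator_def)
    qed
  qed
  then show ?thesis unfolding e1 e2 by (rule ennreal_divide_leI) (rule rfin)
qed

end

text \<open>Any bounded extension supplies the bound for test functions, which is what
  \<open>hessian_quotient_bound\<close> asks for. Without a bounded extension the infimum is
  \<infinity>, and the claim is trivial.\<close>

theorem heat_const_le_op_norm:
  fixes H :: "'n::finite tuple"
  assumes H: "heat_tuple H"
  shows "heat_const \<alpha> H \<le> op_norm (heat_op \<alpha> H)"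
  unfolding op_norm_def
proof (rule INF_greatest)
  fix E assume "E \<in> {E. bounded_extension (heat_op \<alpha> H) E}"
  then have E: "bounded_extension (heat_op \<alpha> H) E" by simp
  define N where "N = L2_op_norm E"
  have N: "N < \<infinity>" using E by (simp add: bounded_extension_def N_def)
  have Nb: "nrm (\<lambda>p. indicat_real Qdom p *\<^sub>R heat_op \<alpha> H g p) \<le> N * nrm g" if g: "g \<in> test_functions Qdom" for g
  proof -
    have ge: "L2norm Qdom (\<lambda>_. 1) g = nrm g"
      unfolding L2norm_one_eq_nrm test_functions_L2space(2)[OF g] ..
    have "L2norm Qdom (\<lambda>_. 1) (E g) / L2norm Qdom (\<lambda>_. 1) g \<le> N"
      unfolding N_def L2_op_norm_def by (rule SUP_upper[OF test_functions_L2space(1)[OF g]])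
    then have "L2norm Qdom (\<lambda>_. 1) (E g) \<le> N * nrm g"
      unfolding ge by (rule ennreal_divide_leD[OF _ nrm_test_function_finite[OF g] N])
    also have "L2norm Qdom (\<lambda>_. 1) (E g) = nrm (\<lambda>p. indicat_real Qdom p *\<^sub>R heat_op \<alpha> H g p)"
      unfolding L2norm_one_eq_nrm
    proof (rule nrm_cong_AE)
      have "AE p in lborel. p \<in> Qdom \<longrightarrow> E g p = heat_op \<alpha> H g p" using E g by (simp add: bounded_extension_def)
      then show "AE p in lborel. indicat_real Qdom p *\<^sub>R E g p = indicat_real Qdom p *\<^sub>R heat_op \<alpha> H g p"
        by eventually_elim (auto simp: indicator_def)
    qed
    finally show ?thesis .
  qed
  obtain \<theta> a A q where H': "H = (\<theta>, a, A, q)" by (cases H)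
  have "heat_const \<alpha> (\<theta>, a, A, q) \<le> N"
    unfolding heat_const_def split_conv
  proof (rule SUP_least, clarify)
    fix c B :: real assume cB: "0 < c" "c < B"
    show "k_const \<alpha> c B (heat_F (\<theta>, a, A, q)) A q \<le> N"
      unfolding k_const_def
    proof (rule SUP_least, clarify)
      fix u us Du D2u assume "(u, us, Du, D2u) \<in> W0 \<alpha> c B (heat_F (\<theta>, a, A, q))"
      then interpret W0_element \<theta> a A q \<alpha> c B u us Du D2u
        using H cB by unfold_locales (simp_all add: H')
      show "L2norm slab w hess_q / L2norm slab w (\<lambda>p. - us p - frob_inner A (D2u p)) \<le> N"
        by (rule hessian_quotient_bound[OF N Nb[unfolded H']])
    qed
  qed
  then show "heat_const \<alpha> H \<le> L2_op_norm E" by (simp add: H' N_def)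
qed

subsection \<open>Tangent tuples\<close>

lemma posdef_of_loewner:
  fixes M :: "'n::finite mat"
  assumes "symmetric_mat M" "l > 0" "l *\<^sub>R mat 1 \<preceq>\<^sub>L M"
  shows "posdef M"
proof -
  have "0 < \<xi> \<bullet> (M *v \<xi>)" if "\<xi> \<noteq> 0" for \<xi>
  proof -
    have "0 < l * (\<xi> \<bullet> \<xi>)" using that assms(2) by simp
    also have "l * (\<xi> \<bullet> \<xi>) = \<xi> \<bullet> ((l *\<^sub>R mat 1) *v \<xi>)"
      by (simp add: scaleR_matrix_vector_assoc[symmetric])
    also have "\<dots> \<le> \<xi> \<bullet> (M *v \<xi>)" using assms(3) by (simp add: loewner_le_def)
    finally show ?thesis .
  qed
  then show ?thesis using assms(1) by (simp add: posdef_def)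
qed

lemma doubling_iterate:
  fixes \<mu> :: "(real^'n::finite) measure"
  assumes "\<And>r. r > 0 \<Longrightarrow> measure \<mu> (ball y (2 * r)) \<le> C * measure \<mu> (ball y r)" "C \<ge> 0" "r > 0"
  shows "measure \<mu> (ball y (2 ^ k * r)) \<le> C ^ k * measure \<mu> (ball y r)"
proof (induction k)
  case (Suc k)
  have "measure \<mu> (ball y (2 ^ Suc k * r)) \<le> C * measure \<mu> (ball y (2 ^ k * r))"
    using assms(1)[of "2 ^ k * r"] assms(3) by (simp add: mult.assoc)
  also have "\<dots> \<le> C * (C ^ k * measure \<mu> (ball y r))" by (intro mult_left_mono Suc assms(2))
  finally show ?case by (simp add: mult.assoc)
qed simp

text \<open>The normalisation gives the unit ball mass 1, and scaling turns the doubling condition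
  at x into polynomial growth. The bounds do not depend on x or r, and this uniformity is what the
  limit measure inherits.\<close>

lemma blowup_ball:
  fixes \<mu> :: "(real^'n::finite) measure"
  assumes \<mu>: "prob_space \<mu>" "sets \<mu> = sets borel" and x: "x \<in> msupport \<mu>" and r: "r > 0"
    and C: "\<And>r. r > 0 \<Longrightarrow> measure \<mu> (ball x (2 * r)) \<le> C * measure \<mu> (ball x r)" "C \<ge> 0"
  shows "emeasure (blowup \<mu> x r) (ball 0 1) = 1"
    and "emeasure (blowup \<mu> x r) (ball 0 (2 ^ k)) \<le> ennreal (C ^ k)"
proof -
  interpret prob_space \<mu> by fact
  have im: "(\<lambda>z. x + r *\<^sub>R z) ` ball 0 \<rho> = ball x (\<rho> * r)" for \<rho>
  proof -
    have "(\<lambda>z. x + r *\<^sub>R z) ` ball 0 \<rho> = (+) x ` ((*\<^sub>R) r ` ball 0 \<rho>)" by (simp add: image_image)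
    also have "\<dots> = ball x (\<rho> * r)" using r by (simp add: ball_scale ball_translation[symmetric] mult.commute)
    finally show ?thesis .
  qed
  have pos: "0 < emeasure \<mu> (ball x r)" using x r by (simp add: msupport_def)
  have e: "emeasure (blowup \<mu> x r) (ball 0 \<rho>) = emeasure \<mu> (ball x (\<rho> * r)) / emeasure \<mu> (ball x r)" for \<rho>
    by (subst emeasure_blowup[OF \<mu>(2) r]) (simp_all add: im)
  show "emeasure (blowup \<mu> x r) (ball 0 1) = 1"
    unfolding e mult_1_left using pos emeasure_finite[of "ball x r"]
    by (intro ennreal_divide_self) (auto simp: less_top[symmetric])
  have "emeasure \<mu> (ball x (2 ^ k * r)) \<le> ennreal (C ^ k) * emeasure \<mu> (ball x r)"
    unfolding emeasure_eq_measure using doubling_iterate[OF C r] C(2)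
    by (subst ennreal_mult[symmetric]) (auto intro!: ennreal_leI)
  then show "emeasure (blowup \<mu> x r) (ball 0 (2 ^ k)) \<le> ennreal (C ^ k)"
    unfolding e by (intro ennreal_divide_leI) (auto simp: emeasure_eq_measure)
qed

text \<open>Vague convergence tests continuous functions only, so masses of balls are compared
  through cutoffs, at the price of doubling the radius.\<close>

lemma cutoff_integral_bounds:
  fixes \<theta> :: "(real^'n::finite) measure"
  assumes \<theta>: "sets \<theta> = sets borel" and r: "r > 0" and fin: "emeasure \<theta> (ball 0 (2 * r)) < \<infinity>"
  shows "measure \<theta> (ball 0 r) \<le> integral\<^sup>L \<theta> (ball_cutoff 0 r)"
    and "integral\<^sup>L \<theta> (ball_cutoff 0 r) \<le> measure \<theta> (ball 0 (2 * r))"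
proof -
  have m: "ball_cutoff 0 r \<in> borel_measurable \<theta>"
    unfolding measurable_cong_sets[OF \<theta> refl]
    by (intro borel_measurable_continuous_onI smooth_on_continuous[OF smooth_on_ball_cutoff])
  have s: "ball 0 \<rho> \<in> sets \<theta>" for \<rho> unfolding \<theta> by simp
  have i2: "integrable \<theta> (indicat_real (ball 0 (2 * r)))"
    using fin s by (intro integrable_real_indicator)
  have le1: "indicat_real (ball 0 r) x \<le> ball_cutoff 0 r x" for x
    using ball_cutoff_1[of r x 0] ball_cutoff_bounds[of 0 r x] r by (auto simp: indicator_def)
  have le2: "ball_cutoff 0 r x \<le> indicat_real (ball 0 (2 * r)) x" for x
    using ball_cutoff_0[of r x 0] ball_cutoff_bounds[of 0 r x] r by (auto simp: indicator_def)
  have i: "integrable \<theta> (ball_cutoff 0 r)"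
    by (rule Bochner_Integration.integrable_bound[OF i2 m])
      (auto simp: abs_of_nonneg ball_cutoff_bounds(1) le2)
  have "emeasure \<theta> (ball 0 r) \<le> emeasure \<theta> (ball 0 (2 * r))"
    using r s by (intro emeasure_mono) auto
  then have i1: "integrable \<theta> (indicat_real (ball 0 r))"
    using fin s by (intro integrable_real_indicator le_less_trans[OF _ fin])
  have sp: "space \<theta> = UNIV" using sets_eq_imp_space_eq[OF \<theta>] by simp
  show "measure \<theta> (ball 0 r) \<le> integral\<^sup>L \<theta> (ball_cutoff 0 r)"
    using integral_mono[OF i1 i le1] by (simp add: sp)
  show "integral\<^sup>L \<theta> (ball_cutoff 0 r) \<le> measure \<theta> (ball 0 (2 * r))"
    using integral_mono[OF i i2 le2] by (simp add: sp)
qed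

text \<open>Dyadic shells: where 2^k <= |z| < 2^(k+1) the Gaussian is at most exp (-c 4^k), and the
  mass of the larger ball grows only geometrically in k. The unit ball is treated
  separately.\<close>

lemma gaussian_integral_finite:
  fixes \<theta> :: "(real^'n::finite) measure"
  assumes \<theta>: "sets \<theta> = sets borel" and C: "C \<ge> 1" and c: "c > 0"
    and growth: "\<And>k. emeasure \<theta> (ball 0 (2 ^ k)) \<le> ennreal (C ^ Suc k)"
  shows "(\<integral>\<^sup>+z. ennreal (exp (- c * (norm z)\<^sup>2)) \<partial>\<theta>) < \<infinity>"
proof -
  let ?t = "\<lambda>k z. ennreal (exp (- c * 4 ^ k)) * indicator (ball 0 (2 ^ Suc k)) z"
  have s: "ball 0 \<rho> \<in> sets \<theta>" for \<rho> unfolding \<theta> by simp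
  have pw: "ennreal (exp (- c * (norm z)\<^sup>2)) \<le> indicator (ball 0 1) z + (\<Sum>k. ?t k z)" for z
  proof (cases "norm z < 1")
    case True
    have "ennreal (exp (- c * (norm z)\<^sup>2)) \<le> ennreal 1" using c by (intro ennreal_leI) simp
    then show ?thesis using True by (intro add_increasing2) auto
  next
    case False
    obtain n :: nat where "norm z < 2 ^ n" using real_arch_pow[of 2 "norm z"] by auto
    then have ex: "\<exists>n::nat. norm z < 2 ^ n" by blast
    define n where "n = (LEAST n::nat. norm z < 2 ^ n)"
    have n: "norm z < 2 ^ n" unfolding n_def by (rule LeastI_ex[OF ex])
    then obtain k where k: "n = Suc k" using False by (cases n) auto
    have "\<not> norm z < 2 ^ k" using not_less_Least[of k "\<lambda>n. norm z < 2 ^ n"] k by (simp add: n_def)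
    then have "(2 ^ k)\<^sup>2 \<le> (norm z)\<^sup>2" by (intro power_mono) auto
    then have "4 ^ k \<le> (norm z)\<^sup>2" by (simp add: power2_eq_square power_mult_distrib[symmetric])
    then have "exp (- c * (norm z)\<^sup>2) \<le> exp (- c * 4 ^ k)" using c by simp
    then have "ennreal (exp (- c * (norm z)\<^sup>2)) \<le> ?t k z" using n k by (simp add: ennreal_leI)
    also have "\<dots> = (\<Sum>k\<in>{k}. ?t k z)" by (simp only: sum.insert finite.emptyI empty_iff not_False_eq_True sum.empty add_0_right)
    also have "\<dots> \<le> (\<Sum>k. ?t k z)" by (intro sum_le_suminf summableI) auto
    finally show ?thesis by (rule add_increasing[rotated]) simp
  qed
  have sm: "summable (\<lambda>k. exp (- c * 4 ^ k) * C ^ k)"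
  proof -
    \<comment> \<open>The quotient of consecutive terms is C exp (-3 c 4^k), because 4^(k+1) - 4^k =
      3 * 4^k.\<close>
    have "(\<lambda>k::nat. C * exp (- (3 * c) * 4 ^ k)) \<longlonglongrightarrow> C * 0"
    proof (intro tendsto_mult tendsto_const)
      show "(\<lambda>k::nat. exp (- (3 * c) * 4 ^ k)) \<longlonglongrightarrow> 0" using c by real_asymp
    qed
    then have "\<forall>\<^sub>F k in sequentially. C * exp (- (3 * c) * 4 ^ k) < 1 / 2"
      by (intro order_tendstoD(2)[of _ "C * 0"]) auto
    then obtain K where K: "\<And>k. k \<ge> K \<Longrightarrow> C * exp (- (3 * c) * 4 ^ k) < 1 / 2"
      unfolding eventually_sequentially by blast
    show ?thesis
    proof (rule summable_ratio_test[of "1 / 2" K])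
      fix k assume k: "k \<ge> K"
      have "exp (- c * 4 ^ Suc k) * C ^ Suc k = (C * exp (- (3 * c) * 4 ^ k)) * (exp (- c * 4 ^ k) * C ^ k)"
      proof -
        have "exp (- c * 4 ^ Suc k) = exp (- (3 * c) * 4 ^ k) * exp (- c * 4 ^ k)"
          unfolding exp_add[symmetric] by (simp add: algebra_simps)
        then show ?thesis by simp
      qed
      also have "\<dots> \<le> 1 / 2 * (exp (- c * 4 ^ k) * C ^ k)"
        using K[OF k] C by (intro mult_right_mono) auto
      finally show "norm (exp (- c * 4 ^ Suc k) * C ^ Suc k) \<le> 1 / 2 * norm (exp (- c * 4 ^ k) * C ^ k)"
        using C by simp
    qed simp
  qed
  have "(\<integral>\<^sup>+z. ennreal (exp (- c * (norm z)\<^sup>2)) \<partial>\<theta>) \<le> (\<integral>\<^sup>+z. indicator (ball 0 1) z + (\<Sum>k. ?t k z) \<partial>\<theta>)"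
    by (intro nn_integral_mono pw)
  also have "\<dots> = emeasure \<theta> (ball 0 (2 ^ 0)) + (\<Sum>k. ennreal (exp (- c * 4 ^ k)) * emeasure \<theta> (ball 0 (2 ^ Suc k)))"
    using s by (simp add: nn_integral_add nn_integral_suminf nn_integral_cmult_indicator borel_measurable_suminf)
  \<comment> \<open>The growth bound at radius 2^(k+1) has exponent k + 2, whence the factor C^2 in
    front of the summable terms.\<close>
  also have "\<dots> \<le> ennreal (C ^ Suc 0) + (\<Sum>k. ennreal (C\<^sup>2 * (exp (- c * 4 ^ k) * C ^ k)))"
  proof (intro add_mono growth suminf_le summableI)
    fix k
    have "ennreal (exp (- c * 4 ^ k)) * emeasure \<theta> (ball 0 (2 ^ Suc k)) \<le> ennreal (exp (- c * 4 ^ k)) * ennreal (C ^ Suc (Suc k))"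
      by (intro mult_left_mono growth) simp
    also have "\<dots> = ennreal (C\<^sup>2 * (exp (- c * 4 ^ k) * C ^ k))"
      using C by (subst ennreal_mult[symmetric]) (auto simp: power2_eq_square mult_ac)
    finally show "ennreal (exp (- c * 4 ^ k)) * emeasure \<theta> (ball 0 (2 ^ Suc k)) \<le> ennreal (C\<^sup>2 * (exp (- c * 4 ^ k) * C ^ k))" .
  qed
  also have "\<dots> < \<infinity>"
  proof -
    have "(\<Sum>k. ennreal (C\<^sup>2 * (exp (- c * 4 ^ k) * C ^ k))) \<noteq> top"
      using C by (intro ennreal_suminf_neq_top summable_mult sm) auto
    then show ?thesis by (simp add: less_top)
  qed
  finally show ?thesis .
qed

text \<open>The integrals of cutoffs over the blow-ups are at least 1 at unit radius and at most
  C^(k+1) at radius 2^k. Both bounds pass to the vague limit; the first excludes the zero measure,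
  the second gives the growth that makes Gaussians integrable.\<close>

lemma tangent_measure_properties:
  fixes \<mu> \<theta> :: "(real^'n::finite) measure"
  assumes \<mu>: "\<mu> \<in> class_D" and \<theta>: "radon \<theta>" and xs: "\<And>j. xs j \<in> msupport \<mu>" and rs: "\<And>j. 0 < rs j"
    and lim: "vague_conv (\<lambda>j. blowup \<mu> (xs j) (rs j)) \<theta>"
  shows "emeasure \<theta> UNIV \<noteq> 0"
    and "c > 0 \<Longrightarrow> (\<integral>\<^sup>+z. ennreal (exp (- c * (norm z)\<^sup>2)) \<partial>\<theta>) < \<infinity>"
proof -
  have \<mu>': "prob_space \<mu>" "sets \<mu> = sets borel" using \<mu> by (auto simp: class_D_def)
  obtain C0 where C0: "\<And>y r. y \<in> msupport \<mu> \<Longrightarrow> r > 0 \<Longrightarrow> measure \<mu> (ball y (2 * r)) \<le> C0 * measure \<mu> (ball y r)"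
    using \<mu> unfolding class_D_def by blast
  \<comment> \<open>Enlarging the doubling constant to at least 1 makes it nonnegative, as the
    iterated estimate and the growth bounds require.\<close>
  define C where "C = max C0 1"
  have C1: "C \<ge> 1" by (simp add: C_def)
  have C: "measure \<mu> (ball y (2 * r)) \<le> C * measure \<mu> (ball y r)" if "y \<in> msupport \<mu>" "r > 0" for y r
    by (rule order_trans[OF C0[OF that] mult_right_mono]) (simp_all add: C_def)
  let ?\<theta> = "\<lambda>j. blowup \<mu> (xs j) (rs j)"
  have b1: "emeasure (?\<theta> j) (ball 0 1) = 1" and b2: "emeasure (?\<theta> j) (ball 0 (2 ^ k)) \<le> ennreal (C ^ k)" for j k
    by (rule blowup_ball[OF \<mu>' xs rs C[OF xs]]; use C1 in simp)+
  have sj: "sets (?\<theta> j) = sets borel" for j by (simp add: blowup_def)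
  have s\<theta>: "sets \<theta> = sets borel" using \<theta> by (simp add: radon_def)
  have fin\<theta>: "emeasure \<theta> (ball 0 \<rho>) < \<infinity>" for \<rho>
  proof -
    have "emeasure \<theta> (ball 0 \<rho>) \<le> emeasure \<theta> (cball 0 \<rho>)" by (intro emeasure_mono) (auto simp: s\<theta>)
    also have "\<dots> < \<infinity>" using \<theta> by (simp add: radon_def)
    finally show ?thesis .
  qed
  have conv: "(\<lambda>j. integral\<^sup>L (?\<theta> j) (ball_cutoff 0 (2 ^ k))) \<longlonglongrightarrow> integral\<^sup>L \<theta> (ball_cutoff 0 (2 ^ k))" for k
  proof -
    have "continuous_on UNIV (ball_cutoff (0 :: real^'n) (2 ^ k))" by (rule smooth_on_continuous[OF smooth_on_ball_cutoff])
    moreover have "{x. ball_cutoff (0 :: real^'n) (2 ^ k) x \<noteq> 0} \<subseteq> cball 0 (2 * 2 ^ k)"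
      using ball_cutoff_0[of "2 ^ k" _ "0 :: real^'n"] by (force simp: not_le)
    then have "compact (closure {x. ball_cutoff (0 :: real^'n) (2 ^ k) x \<noteq> 0})"
      by (meson bounded_subset bounded_cball compact_closure)
    ultimately show ?thesis using lim unfolding vague_conv_def by blast
  qed
  have f: "emeasure (?\<theta> j) (ball 0 (2 * 2 ^ k)) < \<infinity>" for j k
    using b2[of j "Suc k"] by (simp add: le_less_trans)
  have up: "integral\<^sup>L (?\<theta> j) (ball_cutoff 0 (2 ^ k)) \<le> C ^ Suc k" for j k
  proof -
    have "integral\<^sup>L (?\<theta> j) (ball_cutoff 0 (2 ^ k)) \<le> measure (?\<theta> j) (ball 0 (2 * 2 ^ k))"
      by (rule cutoff_integral_bounds(2)[OF sj _ f]) simp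
    also have "\<dots> \<le> C ^ Suc k"
      using enn2real_mono[OF b2[of j "Suc k"]] C1 by (simp add: measure_def)
    finally show ?thesis .
  qed
  have grow: "emeasure \<theta> (ball 0 (2 ^ k)) \<le> ennreal (C ^ Suc k)" for k
  proof -
    have "measure \<theta> (ball 0 (2 ^ k)) \<le> integral\<^sup>L \<theta> (ball_cutoff 0 (2 ^ k))"
      by (rule cutoff_integral_bounds(1)[OF s\<theta> _ fin\<theta>]) simp
    also have "\<dots> \<le> C ^ Suc k" by (rule LIMSEQ_le_const2[OF conv]) (use up in blast)
    finally show ?thesis
      using fin\<theta>[of "2 ^ k"] by (subst emeasure_eq_ennreal_measure) (auto intro: ennreal_leI)
  qed
  show "(\<integral>\<^sup>+z. ennreal (exp (- c * (norm z)\<^sup>2)) \<partial>\<theta>) < \<infinity>" if "c > 0"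
    by (rule gaussian_integral_finite[OF s\<theta> C1 that grow])
  show "emeasure \<theta> UNIV \<noteq> 0"
  proof
    assume z: "emeasure \<theta> UNIV = 0"
    have l1: "measure (?\<theta> j) (ball 0 1) \<le> integral\<^sup>L (?\<theta> j) (ball_cutoff 0 1)" for j
      by (rule cutoff_integral_bounds(1)[OF sj]) (use f[of j 0] in simp_all)
    have "1 \<le> integral\<^sup>L (?\<theta> j) (ball_cutoff 0 1)" for j
      using l1[of j] b1[of j] by (simp add: measure_def)
    then have "1 \<le> integral\<^sup>L \<theta> (ball_cutoff 0 1)"
      using conv[of 0] by (intro LIMSEQ_le_const) auto
    also have "integral\<^sup>L \<theta> (ball_cutoff 0 1) \<le> measure \<theta> (ball 0 (2 * 1))"
      by (rule cutoff_integral_bounds(2)[OF s\<theta> _ fin\<theta>]) simp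
    also have "\<dots> = 0"
      using emeasure_mono[of "ball 0 (2 * 1)" UNIV \<theta>] z by (simp add: s\<theta> measure_def)
    finally show False by simp
  qed
qed

text \<open>The matrices are evaluated at time 0, which lies in {0..T}, so the uniform lower bounds
  there make them positive definite.\<close>

lemma tangent_heat_tuple:
  fixes \<mu> :: "(real^'n::finite) measure"
  assumes T: "T > 0" and co: "coefficient_assumptions T a b A q" and \<mu>: "\<mu> \<in> class_D"
    and H: "H \<in> tangent_tuples a A q \<mu>"
  shows "heat_tuple H"
proof -
  obtain \<theta> x xs rs where H': "H = (\<theta>, a 0 x, A 0 x, q 0 x)" "radon \<theta>" "\<And>j. xs j \<in> msupport \<mu>" "\<And>j. 0 < rs j"
    "vague_conv (\<lambda>j. blowup \<mu> (xs j) (rs j)) \<theta>"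
    using H unfolding tangent_tuples_def by blast
  have t0: "0 \<in> {0..T}" using T by simp
  have pd: "posdef (M 0 x)"
    if l: "\<exists>l>0. \<exists>U>0. \<forall>t\<in>{0..T}. \<forall>x. l *\<^sub>R mat 1 \<preceq>\<^sub>L M t x \<and> M t x \<preceq>\<^sub>L U *\<^sub>R mat 1" and sy: "symmetric_mat (M 0 x)"
    for M :: "real \<Rightarrow> real^'n \<Rightarrow> 'n mat"
  proof -
    obtain l where "l > 0" "l *\<^sub>R mat 1 \<preceq>\<^sub>L M 0 x" using l t0 by meson
    then show ?thesis by (intro posdef_of_loewner[OF sy])
  qed
  have "symmetric_mat (a 0 x)" "symmetric_mat (A 0 x)" "symmetric_mat (q 0 x)"
    using co t0 unfolding coefficient_assumptions_def by (elim conjE, simp)+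
  note sym = this
  have "posdef (a 0 x)" using co unfolding coefficient_assumptions_def by (elim conjE) (rule pd[of a, OF _ sym(1)])
  moreover have "posdef (A 0 x)" using co unfolding coefficient_assumptions_def by (elim conjE) (rule pd[of A, OF _ sym(2)])
  moreover have "posdef (q 0 x)" using co unfolding coefficient_assumptions_def by (elim conjE) (rule pd[of q, OF _ sym(3)])
  ultimately show ?thesis
    using tangent_measure_properties[OF \<mu> H'(2-5)] H'(1,2) by (simp add: heat_tuple_def)
qed

theorem proposition4p1:
  fixes T \<alpha> :: real
    and a A q :: "real \<Rightarrow> real^'n::finite \<Rightarrow> real^'n^'n"
    and b :: "real \<Rightarrow> real^'n \<Rightarrow> real^'n"
    and \<mu> :: "(real^'n) measure"
  assumes "T > 0"
    and "coefficient_assumptions T a b A q"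
    and "\<alpha> \<ge> 0"
    and "\<mu> \<in> class_D"
  shows "K_init \<alpha> a A q \<mu> = (SUP H\<in>tangent_tuples a A q \<mu>. op_norm (heat_op \<alpha> H)) \<and>
    (\<forall>H :: 'n tuple. heat_tuple H \<longrightarrow> op_norm (heat_op \<alpha> H) = heat_const \<alpha> H)"
proof -
  have eq: "op_norm (heat_op \<alpha> H) = heat_const \<alpha> H" if "heat_tuple H" for H :: "'n tuple"
    by (rule antisym[OF op_norm_le_heat_const[OF that assms(3)] heat_const_le_op_norm[OF that]])
  show ?thesis
    unfolding K_init_def using eq tangent_heat_tuple[OF assms(1,2,4)]
    by (intro conjI SUP_cong) simp_all
qed

end
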